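(* Let $d\geq 2$. If $f\in BMO(\mathbb R^d)$ satisfies $\lim_{t\to\infty}t^{\frac1d}\mu(t,\bar{d} f)=0$, then $f$ is constant (almost everywhere). (Here $\bar{d} f$ denotes the quantum derivative of $f$ defined in the context.)
   Context: Notation: $\bar{d} f$ is the single symbol for the quantum derivative. Let $N:=2^{[d/2]}$ ($[\cdot]$ = integer part) and fix Hermitian $N\times N$ matrices $\gamma_1,\ldots,\gamma_d$ with $\gamma_j\gamma_k+\gamma_k\gamma_j=2\delta_{j,k}$ for all $1\le j,k\le d$. With $D_j=-i\partial_j$, define on $\mathbb C^N\otimes L_2(\mathbb R^d)$ the bounded operator $$\mathrm{sgn}\,\mathcal D:=\sum_{j=1}^d\gamma_j\otimes\frac{D_j}{\sqrt{D_1^2+\cdots+D_d^2}},$$ where $D_j/\sqrt{D_1^2+\cdots+D_d^2}$ is the Fourier multiplier with symbol $\xi_j/|\xi|$. For a measurable complex-valued function $f$ on $\mathbb R^d$ let $M_f$ be pointwise multiplication by $f$ and set $\bar{d} f:=i[\mathrm{sgn}\,\mathcal D,1\otimes M_f]$. For $f\in BMO(\mathbb R^d)$ this (initially defined on, e.g., bounded compactly supported functions) extends to a bounded operator on $\mathbb C^N\otimes L_2(\mathbb R^d)$ (Coifman–Rochberg–Weiss), also denoted $\bar{d} f$. $BMO(\mathbb R^d)$ is the set of $f\in L_{1,\mathrm{loc}}(\mathbb R^d)$ with $\sup_{a\in\mathbb R^d,r>0}|B_r(a)|^{-1}\int_{B_r(a)}\big|f(x)-|B_r(a)|^{-1}\int_{B_r(a)}f(y)\,dy\big|\,dx<\infty$,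 with $B_r(a)=\{x:|x-a|<r\}$. For a bounded operator $T$ on a complex separable Hilbert space and $t>0$, $\mu(t,T)=\inf\{\|T-R\|:\ \mathrm{rank}(R)\leq t\}$ (operator norm). *)

theory Defs
  imports "HOL-Analysis.Analysis"
begin

section \<open>The Hilbert space of square-integrable functions\<close>

definition square_integrable :: "('a::euclidean_space \<Rightarrow> 'b::euclidean_space) \<Rightarrow> bool" where
  "square_integrable f \<longleftrightarrow>
     f \<in> borel_measurable lebesgue \<and> integrable lebesgue (\<lambda>x. (norm (f x))\<^sup>2)"

lemma square_integrable_0: "square_integrable (\<lambda>x. 0)"
  by (simp add: square_integrable_def)

lemma square_integrable_scaleR:
  "square_integrable f \<Longrightarrow> square_integrable (\<lambda>x. c *\<^sub>R f x)"
  by (auto simp: square_integrable_def power_mult_distrib)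

lemma square_integrable_add:
  assumes "square_integrable f" "square_integrable g"
  shows "square_integrable (\<lambda>x. f x + g x)"
proof -
  have [measurable]: "f \<in> borel_measurable lebesgue" "g \<in> borel_measurable lebesgue"
    using assms by (auto simp: square_integrable_def)
  have le: "(norm (f x + g x))\<^sup>2 \<le> 2 * (norm (f x))\<^sup>2 + 2 * (norm (g x))\<^sup>2" for x
  proof -
    have "(norm (f x + g x))\<^sup>2 \<le> (norm (f x) + norm (g x))\<^sup>2"
      by (simp add: norm_triangle_ineq power_mono)
    also have "\<dots> \<le> 2 * (norm (f x))\<^sup>2 + 2 * (norm (g x))\<^sup>2"
      using zero_le_power2[of "norm (f x) - norm (g x)"]
      by (simp add: power2_eq_square algebra_simps)
    finally show ?thesis .
  qed
  have "integrable lebesgue (\<lambda>x. (norm (f x + g x))\<^sup>2)"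
  proof (rule Bochner_Integration.integrable_bound)
    show "integrable lebesgue (\<lambda>x. 2 * (norm (f x))\<^sup>2 + 2 * (norm (g x))\<^sup>2)"
      using assms by (auto simp: square_integrable_def)
    show "(\<lambda>x. (norm (f x + g x))\<^sup>2) \<in> borel_measurable lebesgue"
      by measurable
    show "AE x in lebesgue. norm ((norm (f x + g x))\<^sup>2)
            \<le> norm (2 * (norm (f x))\<^sup>2 + 2 * (norm (g x))\<^sup>2)"
      using le by (intro AE_I2) (simp add: order.trans[OF le])
  qed
  then show ?thesis
    by (simp add: square_integrable_def)
qed

lemma square_integrable_uminus:
  "square_integrable f \<Longrightarrow> square_integrable (\<lambda>x. - f x)"
  by (auto simp: square_integrable_def)

lemma square_integrable_diff:
  "square_integrable f \<Longrightarrow> square_integrable g \<Longrightarrow> square_integrable (\<lambda>x. f x - g x)"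
  using square_integrable_add[of f "\<lambda>x. - g x"] by (simp add: square_integrable_uminus)

lemma integrable_inner_square_integrable:
  assumes "square_integrable f" "square_integrable g"
  shows "integrable lebesgue (\<lambda>x. f x \<bullet> g x)"
proof -
  have eq: "f x \<bullet> g x = ((norm (f x + g x))\<^sup>2 - (norm (f x))\<^sup>2 - (norm (g x))\<^sup>2) / 2" for x
    by (rule dot_norm)
  show ?thesis
    unfolding eq using assms square_integrable_add[OF assms]
    by (intro integrable_divide_zero Bochner_Integration.integrable_diff)
       (auto simp: square_integrable_def)
qed

quotient_type (overloaded) ('a, 'b) L2 =
  "'a::euclidean_space \<Rightarrow> 'b::euclidean_space" / partial:
  "\<lambda>f g. square_integrable f \<and> square_integrable g \<and> (AE x in lebesgue. f x = g x)"
proof (rule part_equivpI)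
  show "\<exists>f::'a \<Rightarrow> 'b. square_integrable f \<and> square_integrable f \<and> (AE x in lebesgue. f x = f x)"
    using square_integrable_0 by auto
  show "symp (\<lambda>f g::'a \<Rightarrow> 'b. square_integrable f \<and> square_integrable g \<and>
          (AE x in lebesgue. f x = g x))"
    by (auto simp: symp_def elim: eventually_mono)
  show "transp (\<lambda>f g::'a \<Rightarrow> 'b. square_integrable f \<and> square_integrable g \<and>
          (AE x in lebesgue. f x = g x))"
    by (auto simp: transp_def elim: eventually_elim2)
qed

instantiation L2 :: (euclidean_space, euclidean_space) real_inner
begin

lift_definition zero_L2 :: "('a, 'b) L2" is "\<lambda>x. 0"
  by (simp add: square_integrable_0)

lift_definition plus_L2 :: "('a, 'b) L2 \<Rightarrow> ('a, 'b) L2 \<Rightarrow> ('a, 'b) L2"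
  is "\<lambda>f g x. f x + g x"
  by (auto simp: square_integrable_add elim: eventually_elim2)

lift_definition minus_L2 :: "('a, 'b) L2 \<Rightarrow> ('a, 'b) L2 \<Rightarrow> ('a, 'b) L2"
  is "\<lambda>f g x. f x - g x"
  by (auto simp: square_integrable_diff elim: eventually_elim2)

lift_definition uminus_L2 :: "('a, 'b) L2 \<Rightarrow> ('a, 'b) L2"
  is "\<lambda>f x. - f x"
  by (auto simp: square_integrable_uminus elim: eventually_mono)

lift_definition scaleR_L2 :: "real \<Rightarrow> ('a, 'b) L2 \<Rightarrow> ('a, 'b) L2"
  is "\<lambda>c f x. c *\<^sub>R f x"
  by (auto simp: square_integrable_scaleR elim: eventually_mono)

lift_definition inner_L2 :: "('a, 'b) L2 \<Rightarrow> ('a, 'b) L2 \<Rightarrow> real"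
  is "\<lambda>f g. LINT x|lebesgue. f x \<bullet> g x"
proof -
  fix f f' g g' :: "'a \<Rightarrow> 'b"
  assume f: "square_integrable f \<and> square_integrable f' \<and> (AE x in lebesgue. f x = f' x)"
    and g: "square_integrable g \<and> square_integrable g' \<and> (AE x in lebesgue. g x = g' x)"
  have "AE x in lebesgue. f x \<bullet> g x = f' x \<bullet> g' x"
    using f g by (auto elim: eventually_elim2)
  then show "(LINT x|lebesgue. f x \<bullet> g x) = (LINT x|lebesgue. f' x \<bullet> g' x)"
    using f g by (intro integral_cong_AE borel_measurable_inner) (auto simp: square_integrable_def)
qed

definition norm_L2 :: "('a, 'b) L2 \<Rightarrow> real" where
  "norm_L2 u = sqrt (u \<bullet> u)"

definition dist_L2 :: "('a, 'b) L2 \<Rightarrow> ('a, 'b) L2 \<Rightarrow> real" where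
  "dist_L2 u v = norm (u - v)"

definition sgn_L2 :: "('a, 'b) L2 \<Rightarrow> ('a, 'b) L2" where
  "sgn_L2 u = inverse (norm u) *\<^sub>R u"

definition uniformity_L2 :: "(('a, 'b) L2 \<times> ('a, 'b) L2) filter" where
  "uniformity_L2 = (INF e\<in>{0 <..}. principal {(u, v). dist u v < e})"

definition open_L2 :: "('a, 'b) L2 set \<Rightarrow> bool" where
  "open_L2 U = (\<forall>u\<in>U. eventually (\<lambda>(u', v). u' = u \<longrightarrow> v \<in> U) uniformity)"

instance
proof
  fix u v w :: "('a, 'b) L2" and a b :: real
  show "u + v + w = u + (v + w)"
    by transfer (auto simp: add.assoc square_integrable_add)
  show "u + v = v + u"
    by transfer (auto simp: add.commute square_integrable_add)
  show "0 + u = u"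
    by transfer auto
  show "- u + u = 0"
    by transfer (auto simp: square_integrable_0)
  show "u - v = u + - v"
    by transfer (auto simp: square_integrable_diff)
  show "a *\<^sub>R (u + v) = a *\<^sub>R u + a *\<^sub>R v"
    by transfer (auto simp: scaleR_add_right square_integrable_add square_integrable_scaleR)
  show "(a + b) *\<^sub>R u = a *\<^sub>R u + b *\<^sub>R u"
    by transfer (auto simp: scaleR_add_left square_integrable_add square_integrable_scaleR)
  show "a *\<^sub>R b *\<^sub>R u = (a * b) *\<^sub>R u"
    by transfer (auto simp: square_integrable_scaleR)
  show "1 *\<^sub>R u = u"
    by transfer auto
  show "dist u v = norm (u - v)"
    by (rule dist_L2_def)
  show "sgn u = inverse (norm u) *\<^sub>R u"
    by (simp add: sgn_L2_def)
  show "(uniformity :: (('a, 'b) L2 \<times> ('a, 'b) L2) filter)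
          = (INF e\<in>{0 <..}. principal {(u, v). dist u v < e})"
    by (rule uniformity_L2_def)
  show "open U = (\<forall>u\<in>U. \<forall>\<^sub>F (u', v) in uniformity. u' = u \<longrightarrow> v \<in> U)"
    for U :: "('a, 'b) L2 set"
    by (rule open_L2_def)
  show "u \<bullet> v = v \<bullet> u"
    by transfer (simp add: inner_commute)
  show "(u + v) \<bullet> w = u \<bullet> w + v \<bullet> w"
    by transfer (simp add: inner_add_left integrable_inner_square_integrable)
  show "(a *\<^sub>R u) \<bullet> v = a * (u \<bullet> v)"
    by transfer simp
  show "0 \<le> u \<bullet> u"
    by transfer simp
  show "(u \<bullet> u = 0) = (u = 0)"
  proof transfer
    fix f :: "'a \<Rightarrow> 'b"
    assume f: "square_integrable f \<and> square_integrable f \<and> (AE x in lebesgue. f x = f x)"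
    have "((LINT x|lebesgue. f x \<bullet> f x) = 0) = (AE x in lebesgue. f x \<bullet> f x = 0)"
      using f by (intro integral_nonneg_eq_0_iff_AE integrable_inner_square_integrable) auto
    then show "((LINT x|lebesgue. f x \<bullet> f x) = 0) =
        (square_integrable f \<and> square_integrable (\<lambda>x. 0::'b) \<and> (AE x in lebesgue. f x = 0))"
      using f by (simp add: square_integrable_0)
  qed
  show "norm u = sqrt (u \<bullet> u)"
    by (rule norm_L2_def)
qed

end


section \<open>Operators on \<open>\<complex>\<^sup>N \<otimes> L\<^sub>2\<close> and their singular values\<close>

text \<open>\<open>\<complex>\<^sup>N \<otimes> L\<^sub>2(\<real>\<^sup>d)\<close> is identified with \<open>L\<^sub>2(\<real>\<^sup>d; \<complex>\<^sup>N)\<close>, the type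
  \<open>(real^'d, complex^'n) L2\<close>; the real inner product above is the real part of the complex one
  and induces the same norm.\<close>

lemma norm_vector_smult_complex:
  fixes v :: "complex^'n"
  shows "norm (c *s v) = norm c * norm v"
  by (simp add: norm_vec_def norm_mult L2_set_right_distrib)

lemma borel_measurable_vector_smult:
  fixes g :: "'a::euclidean_space \<Rightarrow> complex^'n"
  assumes "g \<in> borel_measurable lebesgue"
  shows "(\<lambda>x. c *s g x) \<in> borel_measurable lebesgue"
proof -
  have "continuous_on UNIV (\<lambda>v::complex^'n. c *s v)"
    unfolding vector_scalar_mult_def by (intro continuous_intros)
  then show ?thesis
    using assms borel_measurable_continuous_on by blast
qed

lemma square_integrable_smult:
  fixes g :: "'a::euclidean_space \<Rightarrow> complex^'n"
  shows "square_integrable g \<Longrightarrow> square_integrable (\<lambda>x. c *s g x)"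
  by (auto simp: square_integrable_def norm_vector_smult_complex power_mult_distrib
      intro: borel_measurable_vector_smult)

lift_definition cscale_L2 ::
    "complex \<Rightarrow> ('a::euclidean_space, complex^'n) L2 \<Rightarrow> ('a, complex^'n) L2"
    (infixr "*\<^sub>C" 75)
  is "\<lambda>c f x. c *s f x"
  by (auto simp: square_integrable_smult elim: eventually_mono)

interpretation cL2: vector_space
  "cscale_L2 :: complex \<Rightarrow> ('a::euclidean_space, complex^'n) L2 \<Rightarrow> ('a, complex^'n) L2"
proof
  fix a b :: complex and u v :: "('a, complex^'n) L2"
  show "a *\<^sub>C (u + v) = a *\<^sub>C u + a *\<^sub>C v"
    by transfer (auto simp: vector_add_ldistrib square_integrable_add square_integrable_smult)
  show "(a + b) *\<^sub>C u = a *\<^sub>C u + b *\<^sub>C u"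
    by transfer (auto simp: vector_sadd_rdistrib square_integrable_add square_integrable_smult)
  show "a *\<^sub>C b *\<^sub>C u = (a * b) *\<^sub>C u"
    by transfer (auto simp: vector_smult_assoc square_integrable_smult)
  show "1 *\<^sub>C u = u"
    by transfer auto
qed

definition bounded_clinear ::
    "(('a::euclidean_space, complex^'n) L2 \<Rightarrow> ('a, complex^'n) L2) \<Rightarrow> bool" where
  "bounded_clinear T \<longleftrightarrow> bounded_linear T \<and> (\<forall>c u. T (c *\<^sub>C u) = c *\<^sub>C T u)"

definition rank_le ::
    "(('a::euclidean_space, complex^'n) L2 \<Rightarrow> ('a, complex^'n) L2) \<Rightarrow> real \<Rightarrow> bool" where
  "rank_le R t \<longleftrightarrow> (\<exists>S. finite S \<and> real (card S) \<le> t \<and> range R \<subseteq> cL2.span S)"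

definition singular_value ::
    "real \<Rightarrow> (('a::euclidean_space, complex^'n) L2 \<Rightarrow> ('a, complex^'n) L2) \<Rightarrow> real" where
  "singular_value t T = Inf {onorm (\<lambda>u. T u - R u) | R. bounded_clinear R \<and> rank_le R t}"


section \<open>Fourier multipliers\<close>

text \<open>The Fourier--Plancherel transform, with kernel \<open>(2\<pi>)\<^bsup>-d/2\<^esup> e\<^bsup>-i x\<cdot>\<xi>\<^esup>\<close> (so that
  \<open>-i \<partial>\<^sub>j\<close> has symbol \<open>\<xi>\<^sub>j\<close>), is the \<open>L\<^sub>2\<close>-limit of the transforms of the truncations
  to balls. By Plancherel's theorem the limit exists and the transform is a bijection
  of \<open>L\<^sub>2\<close>.\<close>

definition fourier_L2 :: "('a::euclidean_space, complex) L2 \<Rightarrow> ('a, complex) L2" where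
  "fourier_L2 u =
     Lim at_top (\<lambda>r::real. abs_L2 (\<lambda>\<xi>. of_real ((2 * pi) powr (- real DIM('a) / 2)) *
       (LINT x:cball 0 r|lebesgue. cis (- (x \<bullet> \<xi>)) * rep_L2 u x)))"

definition fourier_multiplier ::
    "('a::euclidean_space \<Rightarrow> complex) \<Rightarrow> ('a, complex) L2 \<Rightarrow> ('a, complex) L2" where
  "fourier_multiplier m u = inv fourier_L2 (abs_L2 (\<lambda>\<xi>. m \<xi> * rep_L2 (fourier_L2 u) \<xi>))"


section \<open>The quantum derivative\<close>

definition gamma_matrices :: "('d::finite \<Rightarrow> complex^'n^'n) \<Rightarrow> bool" where
  "gamma_matrices \<gamma> \<longleftrightarrow>
     (\<forall>j. (\<chi> k l. cnj (\<gamma> j $ l $ k)) = \<gamma> j) \<and>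
     (\<forall>j k. \<gamma> j ** \<gamma> k + \<gamma> k ** \<gamma> j = mat (if j = k then 2 else 0))"

text \<open>\<open>A \<otimes> B\<close> applies \<open>B\<close> to each of the \<open>N\<close> components and then the matrix \<open>A\<close> pointwise.\<close>

definition tensor_op ::
    "complex^'n^'n \<Rightarrow> (('a::euclidean_space, complex) L2 \<Rightarrow> ('a, complex) L2) \<Rightarrow>
     ('a, complex^'n) L2 \<Rightarrow> ('a, complex^'n) L2" where
  "tensor_op A B u =
     abs_L2 (\<lambda>x. A *v (\<chi> k. rep_L2 (B (abs_L2 (\<lambda>y. rep_L2 u y $ k))) x))"

definition sgn_dirac ::
    "('d::finite \<Rightarrow> complex^'n^'n) \<Rightarrow> (real^'d, complex^'n) L2 \<Rightarrow> (real^'d, complex^'n) L2" where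
  "sgn_dirac \<gamma> u =
     (\<Sum>j\<in>UNIV. tensor_op (\<gamma> j) (fourier_multiplier (\<lambda>\<xi>. of_real (\<xi> $ j / norm \<xi>))) u)"

definition ball_average ::
    "('a::euclidean_space \<Rightarrow> 'b::{banach,second_countable_topology}) \<Rightarrow> 'a \<Rightarrow> real \<Rightarrow> 'b" where
  "ball_average f a r = (LINT x:ball a r|lebesgue. f x) /\<^sub>R measure lebesgue (ball a r)"

definition BMO :: "('a::euclidean_space \<Rightarrow> complex) set" where
  "BMO = {f. (\<forall>K. compact K \<longrightarrow> f absolutely_integrable_on K) \<and>
     bdd_above {ball_average (\<lambda>x. norm (f x - ball_average f a r)) a r | a r. r > 0}}"

text \<open>\<open>T\<close> is the quantum derivative of \<open>f\<close>: the bounded operator that agrees with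
  \<open>i [sgn D, 1 \<otimes> M\<^sub>f]\<close> on bounded compactly supported functions \<open>g\<close>. As these are dense there
  is at most one such \<open>T\<close>; for \<open>f \<in> BMO\<close> there is one by Coifman--Rochberg--Weiss.
  For such \<open>f\<close> the function \<open>f g\<close> is in \<open>L\<^sub>2\<close> by the John--Nirenberg inequality, so that
  \<open>abs_L2\<close> is applied to square-integrable functions only.\<close>

definition is_quantum_derivative ::
    "('d::finite \<Rightarrow> complex^'n^'n) \<Rightarrow> (real^'d \<Rightarrow> complex) \<Rightarrow>
     ((real^'d, complex^'n) L2 \<Rightarrow> (real^'d, complex^'n) L2) \<Rightarrow> bool" where
  "is_quantum_derivative \<gamma> f T \<longleftrightarrow> bounded_clinear T \<and>
     (\<forall>g. g \<in> borel_measurable lebesgue \<and> bounded (range g) \<and> compact (closure {x. g x \<noteq> 0}) \<longrightarrow>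
        (AE x in lebesgue. rep_L2 (T (abs_L2 g)) x =
           \<i> *s (rep_L2 (sgn_dirac \<gamma> (abs_L2 (\<lambda>y. f y *s g y))) x
                  - f x *s rep_L2 (sgn_dirac \<gamma> (abs_L2 g)) x)))"

end

theory Submission
  imports Defs "HOL-Probability.Probability" "HOL-Real_Asymp.Real_Asymp"
begin

text \<open>Let \<open>R\<^sub>l\<close> be the self-adjoint operator with symbol \<open>\<xi>\<^sub>l / norm \<xi>\<close>. For a cube \<open>Q\<close>, taking the trace
  over the spinor index in \<open>\<langle>df (\<chi>\<^sub>Q \<gamma>\<^sub>l e\<^sub>p), \<chi>\<^sub>Q e\<^sub>p\<rangle>\<close> leaves, up to a constant, the pairing of \<open>f\<close> with
  \<open>\<chi>\<^sub>Q Im (R\<^sub>l \<chi>\<^sub>Q)\<close>; after rescaling this is a local mean of \<open>f\<close> against a fixed kernel \<open>\<rho>\<^sub>l\<close> supported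
  in the unit cube. The normalised indicators of the \<open>O(n\<^sup>d)\<close> cubes of mesh \<open>1/n\<close> in a bounded region
  are orthonormal, and \<open>\<mu>(t, df) = o(t\<^bsup>-1/d\<^esup>)\<close> makes the sum of the pairings with \<open>df\<close> over them
  \<open>o(n\<^bsup>d-1\<^esup>)\<close>. Averaging over translates of the lattice, the local means of \<open>f\<close> at scale \<open>1/n\<close> are
  \<open>o(1/n)\<close> in \<open>L\<^sub>1\<close> on bounded sets. The kernel \<open>\<rho>\<^sub>l\<close> has mean zero, hence in the limit the weak
  derivative of \<open>f\<close> along the first moment of \<open>\<rho>\<^sub>l\<close> vanishes; these moments span by a positivity
  argument, so the weak gradient of \<open>f\<close> is zero.

  The pairings need \<open>f \<in> L\<^sub>2\<close> locally. Instead of the John--Nirenberg inequality, this uses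
  that \<open>df\<close> and \<open>R\<^sub>l\<close> map into \<open>L\<^sub>2\<close>: if \<open>f\<close> is bounded on \<open>A\<close>, then \<open>f R\<^sub>l \<chi>\<^sub>A\<close> is in \<open>L\<^sub>2\<close>, and
  \<open>R\<^sub>l \<chi>\<^sub>A\<close> is bounded away from zero on a ball to the side of \<open>A\<close>.\<close>

section \<open>Square-integrable functions\<close>

text \<open>The exponents meet at the scale \<open>1 / n\<close>. By Taylor expansion, a mean-zero
  kernel dilated to this scale sees \<open>1 / n\<close> times a directional derivative, so local
  means of size \<open>o(1 / n)\<close> leave room for no gradient. On the operator side, about
  \<open>n^d\<close> singular values of size \<open>o(k^(-1/d))\<close> add up to
  \<open>o(n^(d-1))\<close>, and shared among \<open>n^d\<close> cubes this is again
  \<open>o(1 / n)\<close> per cube on average. The pairing with a normalised cube contributes no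
  further power of \<open>n\<close>, because the symbol of \<open>R_l\<close> is homogeneous of
  degree zero. The trace works because \<open>\<gamma>_j \<gamma>_l\<close> has trace zero for
  \<open>j \<noteq> l\<close>, which isolates one Riesz transform. The imaginary part comes from
  self-adjointness: after moving \<open>R_l\<close> across the pairing, one term of the commutator
  contains \<open>R_l \<chi>_Q\<close> and the other its complex conjugate. All inner products are
  real, so the argument treats the real functions \<open>Re (cnj z * f)\<close> with
  \<open>norm z = 1\<close>; the values \<open>1\<close> and \<open>\<i>\<close> of \<open>z\<close>
  recover \<open>f\<close>.\<close>

lemma square_integrable_rep_L2: "square_integrable (rep_L2 u)"
  using Quotient3_rep_reflp[OF Quotient3_L2, of u] by simp

lemma abs_rep_L2 [simp]: "abs_L2 (rep_L2 u) = u"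
  by (rule Quotient3_abs_rep[OF Quotient3_L2])

lemma rep_abs_L2:
  assumes "square_integrable g"
  shows "AE x in lebesgue. rep_L2 (abs_L2 g) x = g x"
  using Quotient3_rep_abs[OF Quotient3_L2, of g] assms by simp

lemma abs_L2_cong:
  assumes "square_integrable f" "square_integrable g" "AE x in lebesgue. f x = g x"
  shows "abs_L2 f = abs_L2 g"
  using Quotient3_rel_abs[OF Quotient3_L2, of f g] assms by simp

text \<open>Borel counterpart of \<open>square_integrable\<close>. Fubini and affine substitution
  are carried out for \<open>lborel\<close>, whose products are again Lebesgue-Borel measures
  (\<open>lborel_prod\<close>); classes in \<open>L2\<close> are handled through representatives of
  this kind.\<close>

definition sq_int :: "('a::euclidean_space \<Rightarrow> 'b::euclidean_space) \<Rightarrow> bool" where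
  "sq_int g \<longleftrightarrow> g \<in> borel_measurable borel \<and> integrable lborel (\<lambda>x. (norm (g x))\<^sup>2)"

lemma sq_int_measurable [measurable_dest]: "sq_int g \<Longrightarrow> g \<in> borel_measurable borel"
  by (simp add: sq_int_def)

lemma sq_int_imp_square_integrable:
  assumes "sq_int g"
  shows "square_integrable g"
proof -
  have [measurable]: "g \<in> borel_measurable borel"
    using assms by (simp add: sq_int_def)
  show ?thesis
    using assms unfolding sq_int_def square_integrable_def
    by (subst integrable_completion) (auto intro: measurable_completion)
qed

text \<open>Each coordinate is a real function measurable for the completion, hence agrees almost
  everywhere with a Borel function. The finitely many exceptional sets are merged and the vector is
  reassembled over \<open>Basis\<close>.\<close>

lemma lebesgue_measurable_ex_borel:
  fixes f :: "'a::euclidean_space \<Rightarrow> 'b::euclidean_space"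
  assumes "f \<in> borel_measurable lebesgue"
  shows "\<exists>g\<in>borel_measurable borel. AE x in lebesgue. f x = g x"
proof -
  have "\<exists>g\<in>borel_measurable lborel. AE x in lborel. f x \<bullet> b = g x" for b
    by (rule completion_ex_borel_measurable_real) (use assms in measurable)
  then obtain g where g: "\<And>b. g b \<in> borel_measurable borel" "\<And>b. AE x in lborel. f x \<bullet> b = g b x"
    by (metis measurable_lborel2)
  have "AE x in lborel. \<forall>b\<in>Basis. f x \<bullet> b = g b x"
    using g(2) by (simp add: AE_finite_all)
  then have "AE x in lebesgue. f x = (\<Sum>b\<in>Basis. g b x *\<^sub>R b)"
  proof (intro AE_completion, eventually_elim)
    fix x assume *: "\<forall>b\<in>Basis. f x \<bullet> b = g b x"
    have "f x = (\<Sum>b\<in>Basis. (f x \<bullet> b) *\<^sub>R b)" by (simp add: euclidean_representation)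
    also have "\<dots> = (\<Sum>b\<in>Basis. g b x *\<^sub>R b)" using * by simp
    finally show "f x = (\<Sum>b\<in>Basis. g b x *\<^sub>R b)" .
  qed
  moreover have "(\<lambda>x. \<Sum>b\<in>Basis. g b x *\<^sub>R b) \<in> borel_measurable borel"
    using g(1) by (intro borel_measurable_sum borel_measurable_scaleR borel_measurable_const)
  ultimately show ?thesis by (intro bexI)
qed

lemma sq_intI_AE:
  assumes "square_integrable f" "g \<in> borel_measurable borel" "AE x in lebesgue. f x = g x"
  shows "sq_int g"
proof -
  have [measurable]: "f \<in> borel_measurable lebesgue" "g \<in> borel_measurable lebesgue"
    using assms by (auto simp: square_integrable_def intro: measurable_completion)
  have "integrable lebesgue (\<lambda>x. (norm (f x))\<^sup>2)"
    using assms by (simp add: square_integrable_def)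
  moreover have "AE x in lebesgue. (norm (f x))\<^sup>2 = (norm (g x))\<^sup>2"
    using assms(3) by (auto elim: eventually_mono)
  ultimately have "integrable lebesgue (\<lambda>x. (norm (g x))\<^sup>2)"
    by (subst (asm) integrable_cong_AE) auto
  then show ?thesis
    using assms(2) unfolding sq_int_def by (subst (asm) integrable_completion) auto
qed

lemma L2_ex_sq_int:
  obtains g where "sq_int g" "u = abs_L2 g"
proof -
  obtain g where g: "g \<in> borel_measurable borel" "AE x in lebesgue. rep_L2 u x = g x"
    using lebesgue_measurable_ex_borel square_integrable_rep_L2[of u]
    unfolding square_integrable_def by blast
  have "sq_int g"
    using square_integrable_rep_L2 g by (rule sq_intI_AE)
  moreover have "u = abs_L2 g"
    using abs_L2_cong[OF square_integrable_rep_L2 sq_int_imp_square_integrable[OF \<open>sq_int g\<close>] g(2)]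
    by simp
  ultimately show ?thesis using that by blast
qed

lemma rep_abs_sq_int: "sq_int g \<Longrightarrow> AE x in lborel. rep_L2 (abs_L2 g) x = g x"
  using rep_abs_L2[OF sq_int_imp_square_integrable] by (metis AE_completion_iff)

lemma abs_L2_add:
  "square_integrable f \<Longrightarrow> square_integrable g \<Longrightarrow> abs_L2 f + abs_L2 g = abs_L2 (\<lambda>x. f x + g x)"
  by (intro plus_L2.abs_eq) auto

lemma abs_L2_diff:
  "square_integrable f \<Longrightarrow> square_integrable g \<Longrightarrow> abs_L2 f - abs_L2 g = abs_L2 (\<lambda>x. f x - g x)"
  by (intro minus_L2.abs_eq) auto

lemma abs_L2_scaleR:
  "square_integrable f \<Longrightarrow> c *\<^sub>R abs_L2 f = abs_L2 (\<lambda>x. c *\<^sub>R f x)"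
  by (intro scaleR_L2.abs_eq) auto

lemma abs_L2_inner:
  "square_integrable f \<Longrightarrow> square_integrable g \<Longrightarrow>
    abs_L2 f \<bullet> abs_L2 g = (LINT x|lebesgue. f x \<bullet> g x)"
  by (intro inner_L2.abs_eq) auto

lemma sq_int_inner:
  assumes "sq_int f" "sq_int g"
  shows "abs_L2 f \<bullet> abs_L2 g = (LINT x|lborel. f x \<bullet> g x)"
    and "integrable lborel (\<lambda>x. f x \<bullet> g x)"
proof -
  have [measurable]: "f \<in> borel_measurable borel" "g \<in> borel_measurable borel"
    using assms by (auto simp: sq_int_def)
  note sq = assms[THEN sq_int_imp_square_integrable]
  show "abs_L2 f \<bullet> abs_L2 g = (LINT x|lborel. f x \<bullet> g x)"
    using abs_L2_inner[OF sq] by (simp add: integral_completion)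
  show "integrable lborel (\<lambda>x. f x \<bullet> g x)"
    using integrable_inner_square_integrable[OF sq] by (simp add: integrable_completion)
qed

lemma sq_int_norm:
  assumes "sq_int f"
  shows "(norm (abs_L2 f))\<^sup>2 = (LINT x|lborel. (norm (f x))\<^sup>2)"
  using sq_int_inner(1)[OF assms assms] by (simp add: power2_norm_eq_inner)

lemma sq_int_0 [simp]: "sq_int (\<lambda>x. 0)"
  by (simp add: sq_int_def)

lemma sq_int_AE_imp:
  assumes "sq_int f" "g \<in> borel_measurable borel" "AE x in lborel. f x = g x"
  shows "sq_int g"
  using sq_intI_AE[OF sq_int_imp_square_integrable[OF assms(1)] assms(2)] assms(3)
  by (simp add: AE_completion_iff)

section \<open>Membership in L2 by domination and by bounded support\<close>

lemma sq_int_bound: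
  assumes "sq_int f" "g \<in> borel_measurable borel" "AE x in lborel. norm (g x) \<le> C * norm (f x)"
  shows "sq_int g"
  unfolding sq_int_def
proof
  have [measurable]: "f \<in> borel_measurable borel" using assms by (simp add: sq_int_def)
  note [measurable] = assms(2)
  show "integrable lborel (\<lambda>x. (norm (g x))\<^sup>2)"
  proof (rule Bochner_Integration.integrable_bound)
    show "integrable lborel (\<lambda>x. C\<^sup>2 * (norm (f x))\<^sup>2)"
      using assms by (simp add: sq_int_def)
    show "AE x in lborel. norm ((norm (g x))\<^sup>2) \<le> norm (C\<^sup>2 * (norm (f x))\<^sup>2)"
      using assms(3)
    proof eventually_elim
      case (elim x)
      then have "(norm (g x))\<^sup>2 \<le> (C * norm (f x))\<^sup>2"
        by (intro power_mono) auto
      then show ?case by (simp add: power_mult_distrib)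
    qed
  qed measurable
qed (use assms in simp)

lemma sq_int_add:
  assumes "sq_int f" "sq_int g"
  shows "sq_int (\<lambda>x. f x + g x)"
proof (rule sq_intI_AE)
  show "square_integrable (\<lambda>x. f x + g x)"
    using assms by (intro square_integrable_add sq_int_imp_square_integrable)
  show "(\<lambda>x. f x + g x) \<in> borel_measurable borel"
    using assms by (auto simp: sq_int_def)
qed simp

lemma sq_int_diff:
  assumes "sq_int f" "sq_int g"
  shows "sq_int (\<lambda>x. f x - g x)"
proof (rule sq_intI_AE)
  show "square_integrable (\<lambda>x. f x - g x)"
    using assms by (intro square_integrable_diff sq_int_imp_square_integrable)
  show "(\<lambda>x. f x - g x) \<in> borel_measurable borel"
    using assms by (auto simp: sq_int_def)
qed simp

lemma sq_int_scaleR: "sq_int f \<Longrightarrow> sq_int (\<lambda>x. c *\<^sub>R f x)"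
  by (rule sq_int_bound[where C="\<bar>c\<bar>"]) (auto simp: sq_int_def)

lemma sq_int_mult_bounded:
  fixes f m :: "'a::euclidean_space \<Rightarrow> complex"
  assumes "sq_int f" "m \<in> borel_measurable borel" "\<And>x. norm (m x) \<le> C"
  shows "sq_int (\<lambda>x. m x * f x)"
proof (rule sq_int_bound[OF assms(1), where C=C])
  show "(\<lambda>x. m x * f x) \<in> borel_measurable borel"
    using sq_int_measurable[OF assms(1)] assms(2) by measurable
  show "AE x in lborel. norm (m x * f x) \<le> C * norm (f x)"
    using assms(3) by (intro AE_I2) (simp add: norm_mult mult_right_mono)
qed

lemma sq_int_restrict:
  assumes "sq_int f" "A \<in> sets borel"
  shows "sq_int (\<lambda>x. indicator A x *\<^sub>R f x)"
proof (rule sq_int_bound[OF assms(1), where C=1])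
  show "(\<lambda>x. indicator A x *\<^sub>R f x) \<in> borel_measurable borel"
    using sq_int_measurable[OF assms(1)] assms(2) by measurable
  show "AE x in lborel. norm (indicator A x *\<^sub>R f x) \<le> 1 * norm (f x)"
    by (intro AE_I2) (simp add: indicator_def)
qed

lemma sq_int_bounded_support:
  assumes "g \<in> borel_measurable borel" "\<And>x. norm (g x) \<le> C" "\<And>x. g x \<noteq> 0 \<Longrightarrow> norm x \<le> r"
  shows "sq_int g"
proof -
  obtain b :: 'b where b: "b \<in> Basis" using nonempty_Basis by blast
  have "sq_int (\<lambda>x::'a. indicator (cball 0 r) x *\<^sub>R b)"
  proof -
    have "integrable lborel (indicator (cball (0::'a) r) :: 'a \<Rightarrow> real)"
      using emeasure_compact_finite[OF compact_cball, of 0 r] by (intro integrable_real_indicator) auto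
    moreover have "(\<lambda>x::'a. (norm (indicator (cball 0 r) x *\<^sub>R b))\<^sup>2) = indicator (cball 0 r)"
      using b by (auto simp: indicator_def fun_eq_iff)
    ultimately show ?thesis by (simp add: sq_int_def)
  qed
  moreover have "norm (g x) \<le> C * norm (indicator (cball 0 r) x *\<^sub>R b)" for x
    using assms(2)[of x] assms(3)[of x] b by (cases "g x = 0") (auto simp: indicator_def)
  ultimately show ?thesis
    using assms(1) by (auto intro: sq_int_bound[where C=C and f="\<lambda>x. indicator (cball 0 r) x *\<^sub>R b"])
qed

text \<open>Pointwise \<open>norm (f x) \<le> 1 + (norm (f x))^2\<close>, so \<open>f\<close> is
  dominated by the indicator of the ball plus an integrable square. This is what makes the Fourier
  integrals of truncations absolutely convergent.\<close>

lemma sq_int_bounded_support_integrable: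
  fixes f :: "'a::euclidean_space \<Rightarrow> 'b::euclidean_space"
  assumes "sq_int f" "\<And>x. f x \<noteq> 0 \<Longrightarrow> norm x \<le> r"
  shows "integrable lborel f"
proof (rule Bochner_Integration.integrable_bound)
  show "integrable lborel (\<lambda>x. indicator (cball 0 r) x + (norm (f x))\<^sup>2 :: real)"
    using assms emeasure_compact_finite[OF compact_cball, of "0::'a" r]
    by (intro Bochner_Integration.integrable_add integrable_real_indicator) (auto simp: sq_int_def)
  show "f \<in> borel_measurable lborel" using assms by (simp add: sq_int_def)
  have "norm (f x) \<le> 1 + (norm (f x))\<^sup>2" for x
    using zero_le_power2[of "norm (f x) - 1/2"] zero_le_power2[of "norm (f x)"]
    by (simp add: power2_eq_square algebra_simps) 
  moreover have "f x = 0" if "\<not> norm x \<le> r" for x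
    using assms(2) that by blast
  ultimately show "AE x in lborel. norm (f x) \<le> norm (indicator (cball 0 r) x + (norm (f x))\<^sup>2 :: real)"
    by (intro AE_I2) (simp add: indicator_def)
qed

text \<open>Tonelli over the coordinates reduces the integral to a power of the one-dimensional
  Gaussian integral. The function serves as the weight in \<open>L2_complete\<close>.\<close>

lemma integrable_gaussian_euclidean:
  "integrable lborel (\<lambda>x::'a::euclidean_space. exp (- (norm x)\<^sup>2))"
proof -
  have 1: "integrable lborel (\<lambda>x::real. exp (- x\<^sup>2))"
    using has_bochner_integral_even_function[OF gaussian_moment_0] by (auto simp: has_bochner_integral_iff)
  have "(\<integral>\<^sup>+(x::'a). (\<Prod>b\<in>Basis. ennreal (exp (- (x \<bullet> b)\<^sup>2))) \<partial>lborel)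
      = (\<Prod>b\<in>(Basis::'a set). (\<integral>\<^sup>+x. ennreal (exp (- x\<^sup>2)) \<partial>lborel))"
    by (rule nn_integral_lborel_prod) auto
  also have "\<dots> < \<infinity>"
    using 1 by (simp add: integrable_iff_bounded power_less_top_ennreal)
  also have "(\<lambda>x::'a. \<Prod>b\<in>Basis. ennreal (exp (- (x \<bullet> b)\<^sup>2))) = (\<lambda>x. ennreal (exp (- (norm x)\<^sup>2)))"
  proof
    fix x :: 'a
    have "(norm x)\<^sup>2 = (\<Sum>b\<in>Basis. (x \<bullet> b)\<^sup>2)"
      by (simp add: power2_norm_eq_inner) (subst euclidean_inner, simp add: power2_eq_square)
    then show "(\<Prod>b\<in>Basis. ennreal (exp (- (x \<bullet> b)\<^sup>2))) = ennreal (exp (- (norm x)\<^sup>2))"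
      by (simp add: prod_ennreal exp_sum sum_negf[symmetric])
  qed
  finally show ?thesis by (auto simp: integrable_iff_bounded)
qed

section \<open>Cauchy-Schwarz, Fatou and dominated convergence in L2\<close>

lemma sq_int_norm_fun: "sq_int f \<Longrightarrow> sq_int (\<lambda>x. norm (f x))"
  by (auto simp: sq_int_def)

lemma norm_abs_L2_norm_fun:
  assumes "sq_int f"
  shows "norm (abs_L2 (\<lambda>x. norm (f x))) = norm (abs_L2 f)"
proof -
  have "(norm (abs_L2 (\<lambda>x. norm (f x))))\<^sup>2 = (norm (abs_L2 f))\<^sup>2"
    using sq_int_norm[OF assms] sq_int_norm[OF sq_int_norm_fun[OF assms]] by simp
  then show ?thesis by simp
qed

text \<open>The Hilbert space inequality is applied to the pointwise norms, not to \<open>f\<close>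
  and \<open>g\<close> themselves, so that the two functions may take values in different spaces;
  \<open>L2_complete\<close> pairs a scalar weight with a vector-valued function.\<close>

lemma L2_Cauchy_Schwarz:
  assumes "sq_int f" "sq_int g"
  shows "integrable lborel (\<lambda>x. norm (f x) * norm (g x))"
    and "(LINT x|lborel. norm (f x) * norm (g x)) \<le> norm (abs_L2 f) * norm (abs_L2 g)"
proof -
  note sq = sq_int_norm_fun[OF assms(1)] sq_int_norm_fun[OF assms(2)]
  show "integrable lborel (\<lambda>x. norm (f x) * norm (g x))"
    using sq_int_inner(2)[OF sq] by simp
  have "(LINT x|lborel. norm (f x) * norm (g x)) = abs_L2 (\<lambda>x. norm (f x)) \<bullet> abs_L2 (\<lambda>x. norm (g x))"
    using sq_int_inner(1)[OF sq] by simp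
  also have "\<dots> \<le> norm (abs_L2 (\<lambda>x. norm (f x))) * norm (abs_L2 (\<lambda>x. norm (g x)))"
    by (rule norm_cauchy_schwarz)
  finally show "(LINT x|lborel. norm (f x) * norm (g x)) \<le> norm (abs_L2 f) * norm (abs_L2 g)"
    by (simp add: norm_abs_L2_norm_fun assms)
qed

text \<open>Fatou's lemma for the squared norms. It produces square integrability of the limit
  together with the norm bound, from almost everywhere convergence and no dominating
  function.\<close>

lemma L2_Fatou:
  assumes "\<And>i. sq_int (h i)" "k \<in> borel_measurable borel"
    and "AE x in lborel. (\<lambda>i. h i x) \<longlonglongrightarrow> k x"
    and "\<And>i. norm (abs_L2 (h i)) \<le> C"
  shows "sq_int k" "norm (abs_L2 k) \<le> C"
proof -
  have [measurable]: "h i \<in> borel_measurable borel" for i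
    using assms(1) by (rule sq_int_measurable)
  note [measurable] = assms(2)
  have C: "0 \<le> C" using assms(4)[of 0] norm_ge_zero order_trans by blast
  have h: "(\<integral>\<^sup>+x. ennreal ((norm (h i x))\<^sup>2) \<partial>lborel) \<le> ennreal (C\<^sup>2)" for i
  proof -
    have "(\<integral>\<^sup>+x. ennreal ((norm (h i x))\<^sup>2) \<partial>lborel) = ennreal ((norm (abs_L2 (h i)))\<^sup>2)"
      using assms(1)[of i] by (simp add: nn_integral_eq_integral sq_int_def sq_int_norm[OF assms(1)])
    then show ?thesis using assms(4)[of i] by (simp add: power_mono ennreal_leI)
  qed
  have "(\<integral>\<^sup>+x. ennreal ((norm (k x))\<^sup>2) \<partial>lborel)
      = (\<integral>\<^sup>+x. liminf (\<lambda>i. ennreal ((norm (h i x))\<^sup>2)) \<partial>lborel)"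
  proof (rule nn_integral_cong_AE)
    show "AE x in lborel. ennreal ((norm (k x))\<^sup>2) = liminf (\<lambda>i. ennreal ((norm (h i x))\<^sup>2))"
      using assms(3)
    proof eventually_elim
      case (elim x)
      then have "(\<lambda>i. (norm (h i x))\<^sup>2) \<longlonglongrightarrow> (norm (k x))\<^sup>2"
        by (intro tendsto_intros)
      then have "(\<lambda>i. ennreal ((norm (h i x))\<^sup>2)) \<longlonglongrightarrow> ennreal ((norm (k x))\<^sup>2)"
        by (intro tendsto_ennrealI)
      then show ?case by (intro lim_imp_Liminf[symmetric]) auto
    qed
  qed
  also have "\<dots> \<le> liminf (\<lambda>i. \<integral>\<^sup>+x. ennreal ((norm (h i x))\<^sup>2) \<partial>lborel)"
    by (rule nn_integral_liminf) measurable
  also have "\<dots> \<le> liminf (\<lambda>i::nat. ennreal (C\<^sup>2))"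
    by (rule Liminf_mono) (simp add: h)
  also have "\<dots> = ennreal (C\<^sup>2)" by (simp add: Liminf_const)
  finally have *: "(\<integral>\<^sup>+x. ennreal ((norm (k x))\<^sup>2) \<partial>lborel) \<le> ennreal (C\<^sup>2)" .
  then have int: "integrable lborel (\<lambda>x. (norm (k x))\<^sup>2)"
    unfolding integrable_iff_bounded by (auto simp: le_less_trans)
  then show k: "sq_int k" by (simp add: sq_int_def)
  have "ennreal ((norm (abs_L2 k))\<^sup>2) = (\<integral>\<^sup>+x. ennreal ((norm (k x))\<^sup>2) \<partial>lborel)"
    unfolding sq_int_norm[OF k] by (rule nn_integral_eq_integral[OF int, symmetric]) simp
  from ord_eq_le_trans[OF this *] have "(norm (abs_L2 k))\<^sup>2 \<le> C\<^sup>2"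
    by (subst (asm) ennreal_le_iff) auto
  then show "norm (abs_L2 k) \<le> C"
    using C by (rule power2_le_imp_le)
qed

lemma L2_dominated_convergence:
  assumes "sq_int G" "\<And>i. h i \<in> borel_measurable borel" "k \<in> borel_measurable borel"
    and lim: "AE x in lborel. (\<lambda>i. h i x) \<longlonglongrightarrow> k x"
    and dom: "\<And>i x. norm (h i x) \<le> norm (G x)"
  shows "\<And>i. sq_int (h i)" "sq_int k" "(\<lambda>i. abs_L2 (h i)) \<longlonglongrightarrow> abs_L2 k"
proof -
  note [measurable] = assms(2,3) sq_int_measurable[OF assms(1)]
  show h: "sq_int (h i)" for i
    by (rule sq_int_bound[OF assms(1,2), where C=1]) (simp add: dom)
  have kd: "AE x in lborel. norm (k x) \<le> norm (G x)"
    using lim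
  proof eventually_elim
    case (elim x)
    then show ?case using dom by (intro LIMSEQ_le_const2[OF tendsto_norm[OF elim]]) auto
  qed
  show k: "sq_int k"
    by (rule sq_int_bound[OF assms(1,3), where C=1]) (use kd in simp)
  have "(\<lambda>i. LINT x|lborel. (norm (h i x - k x))\<^sup>2) \<longlonglongrightarrow> (LINT x::'a|lborel. 0)"
  proof (rule integral_dominated_convergence)
    show "integrable lborel (\<lambda>x. 4 * (norm (G x))\<^sup>2)"
      using assms(1) by (simp add: sq_int_def)
    show "AE x in lborel. (\<lambda>i. (norm (h i x - k x))\<^sup>2) \<longlonglongrightarrow> 0"
      using lim
    proof eventually_elim
      case (elim x)
      then have "(\<lambda>i. (norm (h i x - k x))\<^sup>2) \<longlonglongrightarrow> (norm (k x - k x))\<^sup>2"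
        by (intro tendsto_intros)
      then show ?case by simp
    qed
    show "AE x in lborel. norm ((norm (h i x - k x))\<^sup>2) \<le> 4 * (norm (G x))\<^sup>2" for i
      using kd
    proof eventually_elim
      case (elim x)
      then have "norm (h i x - k x) \<le> 2 * norm (G x)"
        using dom[of i x] norm_triangle_ineq4[of "h i x" "k x"] by linarith
      then have "(norm (h i x - k x))\<^sup>2 \<le> (2 * norm (G x))\<^sup>2"
        by (intro power_mono) auto
      then show ?case by (simp add: power_mult_distrib)
    qed
  qed measurable
  also have "(LINT x::'a|lborel. 0::real) = 0" by simp
  finally have "(\<lambda>i. (norm (abs_L2 (h i) - abs_L2 k))\<^sup>2) \<longlonglongrightarrow> 0"
    using h k by (simp add: abs_L2_diff sq_int_imp_square_integrable sq_int_norm sq_int_diff)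
  then have "(\<lambda>i. sqrt ((norm (abs_L2 (h i) - abs_L2 k))\<^sup>2)) \<longlonglongrightarrow> sqrt 0"
    by (intro tendsto_real_sqrt)
  then have "(\<lambda>i. norm (abs_L2 (h i) - abs_L2 k)) \<longlonglongrightarrow> 0" by simp
  then show "(\<lambda>i. abs_L2 (h i)) \<longlonglongrightarrow> abs_L2 k"
    by (simp add: LIM_zero_iff tendsto_norm_zero_iff)
qed

text \<open>Multiplication by a Gaussian maps \<open>L\<^sub>2\<close>-Cauchy sequences to \<open>L\<^sub>1\<close>-Cauchy sequences,
  which have almost everywhere convergent subsequences.\<close>

lemma L2_complete:
  fixes X :: "nat \<Rightarrow> ('a::euclidean_space, 'b::euclidean_space) L2"
  assumes "Cauchy X"
  shows "convergent X"
proof -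
  have "\<forall>n. \<exists>g. sq_int g \<and> X n = abs_L2 g" by (meson L2_ex_sq_int)
  then obtain g where g: "\<And>n. sq_int (g n)" "\<And>n. X n = abs_L2 (g n)" by metis
  have [measurable]: "g n \<in> borel_measurable borel" for n
    using g(1) by (rule sq_int_measurable)
  define w :: "'a \<Rightarrow> real" where "w x = exp (- (norm x)\<^sup>2)" for x
  have w: "sq_int w"
    unfolding sq_int_def
  proof
    show "integrable lborel (\<lambda>x. (norm (w x))\<^sup>2)"
    proof (rule Bochner_Integration.integrable_bound[OF integrable_gaussian_euclidean])
      show "AE x in lborel. norm ((norm (w x))\<^sup>2) \<le> norm (exp (- (norm x)\<^sup>2))"
        by (intro AE_I2) (simp add: w_def power2_eq_square mult_le_cancel_left1)
    qed (simp add: w_def[abs_def])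
  qed (simp add: w_def[abs_def])
  have [measurable]: "w \<in> borel_measurable borel" using w by (rule sq_int_measurable)
  have s_le: "(LINT x|lborel. norm (w x *\<^sub>R g i x - w x *\<^sub>R g j x)) \<le> norm (abs_L2 w) * norm (X i - X j)" for i j
  proof -
    have "(LINT x|lborel. norm (w x *\<^sub>R g i x - w x *\<^sub>R g j x))
        = (LINT x|lborel. norm (w x) * norm (g i x - g j x))"
      by (simp add: scaleR_diff_right[symmetric])
    also have "\<dots> \<le> norm (abs_L2 w) * norm (abs_L2 (\<lambda>x. g i x - g j x))"
      by (intro L2_Cauchy_Schwarz w sq_int_diff g)
    finally show ?thesis using g by (simp add: abs_L2_diff sq_int_imp_square_integrable)
  qed
  obtain r where r: "strict_mono r" "AE x in lborel. Cauchy (\<lambda>i. w x *\<^sub>R g (r i) x)"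
  proof (rule cauchy_L1_AE_cauchy_subseq[of lborel "\<lambda>n x. w x *\<^sub>R g n x"])
    show "integrable lborel (\<lambda>x. w x *\<^sub>R g n x)" for n
      using L2_Cauchy_Schwarz(1)[OF w g(1)[of n]]
      by (subst integrable_norm_iff[symmetric]) (auto simp: abs_mult)
    fix e :: real assume "e > 0"
    define c where "c = norm (abs_L2 w) + 1"
    have c: "c > 0" "norm (abs_L2 w) \<le> c" unfolding c_def by (auto intro: add_nonneg_pos)
    then obtain N where N: "\<And>i j. i \<ge> N \<Longrightarrow> j \<ge> N \<Longrightarrow> norm (X i - X j) < e / c"
      using assms \<open>e > 0\<close> unfolding Cauchy_def dist_norm by (meson divide_pos_pos)
    have "(LINT x|lborel. norm (w x *\<^sub>R g i x - w x *\<^sub>R g j x)) < e" if "i \<ge> N" "j \<ge> N" for i j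
    proof -
      have "norm (abs_L2 w) * norm (X i - X j) \<le> c * norm (X i - X j)"
        using c by (intro mult_right_mono) auto
      also have "\<dots> < e" using N[OF that] c by (simp add: field_simps)
      finally show ?thesis using s_le[of i j] by linarith
    qed
    then show "\<exists>N. \<forall>i\<ge>N. \<forall>j\<ge>N. (LINT x|lborel. norm (w x *\<^sub>R g i x - w x *\<^sub>R g j x)) < e" by blast
  qed blast
  define L where "L x = lim (\<lambda>i. g (r i) x)" for x
  have [measurable]: "L \<in> borel_measurable borel" unfolding L_def by measurable
  have lim: "AE x in lborel. (\<lambda>i. g (r i) x) \<longlonglongrightarrow> L x"
    using r(2)
  proof eventually_elim
    case (elim x)
    then have "convergent (\<lambda>i. w x *\<^sub>R g (r i) x)" by (simp add: Cauchy_convergent_iff)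
    then obtain l where "(\<lambda>i. w x *\<^sub>R g (r i) x) \<longlonglongrightarrow> l" by (auto simp: convergent_def)
    then have "(\<lambda>i. inverse (w x) *\<^sub>R w x *\<^sub>R g (r i) x) \<longlonglongrightarrow> inverse (w x) *\<^sub>R l"
      by (intro tendsto_intros)
    then have "(\<lambda>i. g (r i) x) \<longlonglongrightarrow> inverse (w x) *\<^sub>R l" by (simp add: w_def)
    then show ?case unfolding L_def using limI by metis
  qed
  \<comment> \<open>Fatou along the subsequence carries the Cauchy bound to the limit in one index.
    The shift by \<open>N\<close> ensures \<open>r (i + N) \<ge> N\<close>, since a strictly
    increasing \<open>r\<close> satisfies \<open>n \<le> r n\<close>.\<close>
  have close: "sq_int (\<lambda>x. L x - g m x) \<and> norm (abs_L2 (\<lambda>x. L x - g m x)) \<le> e"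
    if N: "\<forall>i\<ge>N. \<forall>j\<ge>N. norm (X i - X j) \<le> e" and "m \<ge> N" for e N m
  proof -
    have 1: "sq_int (\<lambda>x. g (r (i + N)) x - g m x)" for i
      by (intro sq_int_diff g)
    have 2: "AE x in lborel. (\<lambda>i. g (r (i + N)) x - g m x) \<longlonglongrightarrow> L x - g m x"
      using lim
    proof eventually_elim
      case (elim x)
      from LIMSEQ_ignore_initial_segment[OF this, of N] show ?case by (intro tendsto_intros)
    qed
    have 3: "norm (abs_L2 (\<lambda>x. g (r (i + N)) x - g m x)) \<le> e" for i
    proof -
      have "r (i + N) \<ge> N" using seq_suble[OF r(1), of "i + N"] by linarith
      then have "norm (X (r (i + N)) - X m) \<le> e" using N \<open>m \<ge> N\<close> by blast
      then show ?thesis using g by (simp add: abs_L2_diff sq_int_imp_square_integrable)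
    qed
    show ?thesis using L2_Fatou[OF 1 _ 2 3] by simp
  qed
  have ex: "\<exists>N. \<forall>i\<ge>N. \<forall>j\<ge>N. norm (X i - X j) \<le> e" if "e > 0" for e
    using assms that unfolding Cauchy_def dist_norm by (meson less_imp_le)
  have L: "sq_int L"
  proof -
    obtain N where "\<forall>i\<ge>N. \<forall>j\<ge>N. norm (X i - X j) \<le> 1" using ex[of 1] by auto
    then have "sq_int (\<lambda>x. L x - g N x)" using close by blast
    from sq_int_add[OF this g(1)[of N]] show ?thesis by simp
  qed
  have "X \<longlonglongrightarrow> abs_L2 L"
  proof (rule LIMSEQ_I)
    fix e :: real assume "e > 0"
    then obtain N where N: "\<forall>i\<ge>N. \<forall>j\<ge>N. norm (X i - X j) \<le> e / 2" using ex[of "e / 2"] by auto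
    have "norm (X m - abs_L2 L) < e" if "m \<ge> N" for m
    proof -
      have "norm (abs_L2 (\<lambda>x. L x - g m x)) \<le> e / 2" using close[OF N that] by blast
      then have "norm (abs_L2 L - X m) \<le> e / 2"
        using L g by (simp add: abs_L2_diff sq_int_imp_square_integrable)
      then show ?thesis using \<open>e > 0\<close> by (simp add: norm_minus_commute)
    qed
    then show "\<exists>N. \<forall>m\<ge>N. norm (X m - abs_L2 L) < e" by blast
  qed
  then show ?thesis by (auto simp: convergent_def)
qed

text \<open>With a constant function \<open>m\<close> this is multiplication by a complex scalar,
  which \<open>cscale_L2\<close> provides only for functions with values in
  \<open>complex^'n\<close>.\<close>

definition mult_L2 :: "('a::euclidean_space \<Rightarrow> complex) \<Rightarrow> ('a, complex) L2 \<Rightarrow> ('a, complex) L2" where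
  "mult_L2 m u = abs_L2 (\<lambda>x. m x * rep_L2 u x)"

definition bounded_borel :: "('a::euclidean_space \<Rightarrow> complex) \<Rightarrow> bool" where
  "bounded_borel m \<longleftrightarrow> m \<in> borel_measurable borel \<and> (\<exists>C. \<forall>x. norm (m x) \<le> C)"

lemma bounded_borel_const [simp]: "bounded_borel (\<lambda>x. c)"
  by (auto simp: bounded_borel_def)

lemma sq_int_bounded_borel_mult: "bounded_borel m \<Longrightarrow> sq_int f \<Longrightarrow> sq_int (\<lambda>x. m x * f x)"
  unfolding bounded_borel_def using sq_int_mult_bounded by blast

text \<open>Measurability of \<open>h\<close> comes from completeness of \<open>lebesgue\<close>: a
  set that differs from a measurable one by a null set is measurable. It is needed for functions
  assembled from the arbitrary representatives \<open>rep_L2\<close>.\<close>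

lemma square_integrable_cong_AE:
  assumes "sq_int f" "AE x in lebesgue. h x = f x"
  shows "square_integrable h"
proof -
  have f: "square_integrable f" using assms(1) by (rule sq_int_imp_square_integrable)
  have [measurable]: "f \<in> borel_measurable lebesgue" using f by (simp add: square_integrable_def)
  have h [measurable]: "h \<in> borel_measurable lebesgue"
  proof (rule measurableI)
    fix A :: "'b set" assume A: "A \<in> sets borel"
    have "f -` A \<inter> space lebesgue \<in> sets lebesgue"
      using A by measurable
    moreover have "AE x in lebesgue. x \<in> f -` A \<inter> space lebesgue \<longleftrightarrow> x \<in> h -` A \<inter> space lebesgue"
      using assms(2) by eventually_elim simp
    ultimately show "h -` A \<inter> space lebesgue \<in> sets lebesgue"
      using completion.in_sets_AE by blast
  qed simp
  have "integrable lebesgue (\<lambda>x. (norm (h x))\<^sup>2) \<longleftrightarrow> integrable lebesgue (\<lambda>x. (norm (f x))\<^sup>2)"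
    by (rule integrable_cong_AE) (use assms(2) in \<open>auto elim: eventually_mono\<close>)
  then show ?thesis using f h by (simp add: square_integrable_def)
qed

lemma abs_L2_cong_sq_int:
  assumes "sq_int f" "AE x in lebesgue. h x = f x"
  shows "abs_L2 h = abs_L2 f"
  using assms by (intro abs_L2_cong square_integrable_cong_AE sq_int_imp_square_integrable)

lemma mult_L2_abs:
  assumes "bounded_borel m" "sq_int g"
  shows "mult_L2 m (abs_L2 g) = abs_L2 (\<lambda>x. m x * g x)"
  unfolding mult_L2_def
  by (rule abs_L2_cong_sq_int[OF sq_int_bounded_borel_mult[OF assms]])
     (use rep_abs_L2[OF sq_int_imp_square_integrable[OF assms(2)]] in \<open>auto elim: eventually_mono\<close>)

lemma mult_L2_add: "bounded_borel m \<Longrightarrow> mult_L2 m (u + v) = mult_L2 m u + mult_L2 m v"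
  by (rule L2_ex_sq_int[of u], rule L2_ex_sq_int[of v])
     (simp add: abs_L2_add mult_L2_abs sq_int_add sq_int_bounded_borel_mult sq_int_imp_square_integrable
       distrib_left)

lemma mult_L2_mult_L2: 
  assumes "bounded_borel m" "bounded_borel n"
  shows "mult_L2 m (mult_L2 n u) = mult_L2 (\<lambda>x. m x * n x) u"
proof -
  obtain C D where "\<forall>x. norm (m x) \<le> C" "\<forall>x. norm (n x) \<le> D"
    using assms by (auto simp: bounded_borel_def)
  then have "\<forall>x. norm (m x * n x) \<le> C * D"
    by (auto simp: norm_mult intro!: mult_mono intro: order_trans[OF norm_ge_zero])
  then have "bounded_borel (\<lambda>x. m x * n x)"
    using assms unfolding bounded_borel_def by (intro conjI borel_measurable_times) auto
  then show ?thesis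
    by (rule_tac L2_ex_sq_int[of u])
       (simp add: mult_L2_abs sq_int_bounded_borel_mult assms mult.assoc)
qed

lemma norm_mult_L2_le:
  assumes "m \<in> borel_measurable borel" "\<And>x. norm (m x) \<le> C"
  shows "norm (mult_L2 m u) \<le> C * norm u"
proof -
  obtain g where g: "sq_int g" "u = abs_L2 g" by (rule L2_ex_sq_int)
  have m: "bounded_borel m" using assms by (auto simp: bounded_borel_def)
  have C: "0 \<le> C" using assms(2) norm_ge_zero order_trans by blast
  have "(norm (mult_L2 m u))\<^sup>2 = (LINT x|lborel. (norm (m x * g x))\<^sup>2)"
    using g m by (simp add: mult_L2_abs sq_int_norm sq_int_bounded_borel_mult)
  also have "\<dots> \<le> (LINT x|lborel. C\<^sup>2 * (norm (g x))\<^sup>2)"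
  proof (rule integral_mono)
    show "integrable lborel (\<lambda>x. (norm (m x * g x))\<^sup>2)"
      using sq_int_bounded_borel_mult[OF m g(1)] by (simp add: sq_int_def)
    show "integrable lborel (\<lambda>x. C\<^sup>2 * (norm (g x))\<^sup>2)" using g by (simp add: sq_int_def)
    show "(norm (m x * g x))\<^sup>2 \<le> C\<^sup>2 * (norm (g x))\<^sup>2" for x
      unfolding norm_mult power_mult_distrib using assms(2) by (intro mult_right_mono power_mono) auto
  qed
  also have "\<dots> = (C * norm u)\<^sup>2" using g by (simp add: sq_int_norm power_mult_distrib)
  finally show ?thesis by (rule power2_le_imp_le) (use C in simp)
qed

lemma inner_mult_L2_real:
  assumes "bounded_borel (\<lambda>x. of_real (m x))"
  shows "mult_L2 (\<lambda>x. of_real (m x)) u \<bullet> v = u \<bullet> mult_L2 (\<lambda>x. of_real (m x)) v"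
proof -
  obtain g h where "sq_int g" "u = abs_L2 g" "sq_int h" "v = abs_L2 h" by (metis L2_ex_sq_int)
  then show ?thesis
    using sq_int_bounded_borel_mult[OF assms]
    by (simp add: mult_L2_abs assms sq_int_inner inner_complex_def algebra_simps)
qed

lift_definition cnj_L2 :: "('a::euclidean_space, complex) L2 \<Rightarrow> ('a, complex) L2"
  is "\<lambda>f x. cnj (f x)"
  by (auto simp: square_integrable_def elim: eventually_mono
      intro!: borel_measurable_continuous_on[of cnj] continuous_intros)

lemma sq_int_cnj: "sq_int g \<Longrightarrow> sq_int (\<lambda>x. cnj (g x))"
  by (auto simp: sq_int_def intro!: borel_measurable_continuous_on[of cnj] continuous_intros)

lemma cnj_L2_abs: "sq_int g \<Longrightarrow> cnj_L2 (abs_L2 g) = abs_L2 (\<lambda>x. cnj (g x))"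
  by (intro cnj_L2.abs_eq) (simp add: sq_int_imp_square_integrable)

lemma cnj_L2_cnj_L2 [simp]: "cnj_L2 (cnj_L2 u) = u"
  by (rule L2_ex_sq_int[of u]) (simp add: cnj_L2_abs sq_int_cnj)

lemma norm_cnj_L2 [simp]: "norm (cnj_L2 u) = norm u"
proof -
  obtain g where g: "sq_int g" "u = abs_L2 g" by (rule L2_ex_sq_int)
  then have "(norm (cnj_L2 u))\<^sup>2 = (norm u)\<^sup>2" by (simp add: cnj_L2_abs sq_int_norm sq_int_cnj)
  then show ?thesis by simp
qed

section \<open>Gaussian integrals\<close>

text \<open>\<open>lborel_eq\<close> presents Lebesgue measure as the image of a product measure
  indexed by \<open>Basis\<close>, so integrability and the integral factorise by the theorems on
  finite products.\<close>

lemma integrable_lborel_prod: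
  fixes f :: "'a::euclidean_space \<Rightarrow> real \<Rightarrow> complex"
  assumes "\<And>b. b \<in> Basis \<Longrightarrow> integrable lborel (f b)"
  shows "integrable lborel (\<lambda>x::'a. \<Prod>b\<in>Basis. f b (x \<bullet> b))"
    and "(LINT x::'a|lborel. (\<Prod>b\<in>Basis. f b (x \<bullet> b))) = (\<Prod>b\<in>Basis. LINT t|lborel. f b t)"
proof -
  interpret product_sigma_finite "\<lambda>_::'a. lborel :: real measure"
    by standard
  have m [measurable]: "\<And>b. b \<in> Basis \<Longrightarrow> f b \<in> borel_measurable borel"
    using assms by (auto dest: borel_measurable_integrable)
  have meas: "(\<lambda>x::'a. \<Prod>b\<in>Basis. f b (x \<bullet> b)) \<in> borel_measurable borel"
    by measurable
  have T: "(\<lambda>f. \<Sum>b\<in>Basis. f b *\<^sub>R b) \<in> (\<Pi>\<^sub>M b\<in>(Basis::'a set). lborel) \<rightarrow>\<^sub>M borel"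
    by measurable
  have eq: "(\<Prod>b\<in>Basis. f b ((\<Sum>i\<in>Basis. x i *\<^sub>R i) \<bullet> b)) = (\<Prod>b\<in>Basis. f b (x b))" for x :: "'a \<Rightarrow> real"
    by (intro prod.cong) auto
  show "integrable lborel (\<lambda>x::'a. \<Prod>b\<in>Basis. f b (x \<bullet> b))"
    by (subst lborel_eq, subst integrable_distr_eq[OF T meas], simp only: eq)
       (intro product_integrable_prod assms finite_Basis)
  show "(LINT x::'a|lborel. (\<Prod>b\<in>Basis. f b (x \<bullet> b))) = (\<Prod>b\<in>Basis. LINT t|lborel. f b t)"
    by (subst lborel_eq, subst integral_distr[OF T meas], simp only: eq)
       (intro product_integral_prod assms finite_Basis)
qed

lemma integrable_exp_quadratic:
  assumes "t > 0"
  shows "integrable lborel (\<lambda>x::real. exp (- t * x\<^sup>2))" "integrable lborel (\<lambda>x::real. x * exp (- t * x\<^sup>2))"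
proof -
  have s: "sqrt t \<noteq> 0" using assms by simp
  have "integrable lborel (\<lambda>x::real. exp (- x\<^sup>2))"
    using has_bochner_integral_even_function[OF gaussian_moment_0] by (auto simp: has_bochner_integral_iff)
  from lborel_integrable_real_affine[OF this s, of 0]
  show "integrable lborel (\<lambda>x::real. exp (- t * x\<^sup>2))" using assms by (simp add: power_mult_distrib)
  have "integrable lborel (\<lambda>x::real. exp (- x\<^sup>2) * x ^ 1)"
    using has_bochner_integral_odd_function[OF gaussian_moment_odd_pos[of 0]]
    by (auto simp: has_bochner_integral_iff)
  from lborel_integrable_real_affine[OF this s, of 0]
  have "integrable lborel (\<lambda>x::real. (exp (- t * x\<^sup>2) * (sqrt t * x)) / sqrt t)"
    using assms by (intro integrable_divide_zero) (simp add: power_mult_distrib)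
  then show "integrable lborel (\<lambda>x::real. x * exp (- t * x\<^sup>2))"
    using assms by (simp add: mult.commute)
qed

lemma integrable_mult_cis:
  assumes "integrable lborel (f :: real \<Rightarrow> real)"
  shows "integrable lborel (\<lambda>x. of_real (f x) * cis (z * x))"
proof (rule Bochner_Integration.integrable_bound[OF assms])
  have [measurable]: "f \<in> borel_measurable borel" using assms by simp
  have [measurable]: "(\<lambda>x. cis (z * x)) \<in> borel_measurable borel"
    by (intro borel_measurable_continuous_onI continuous_intros)
  show "(\<lambda>x. of_real (f x) * cis (z * x)) \<in> borel_measurable lborel" by measurable
qed (simp add: norm_mult)

text \<open>This is the characteristic function of the standard normal distribution, dilated by
  \<open>r = sqrt (2 * t)\<close> so that the exponent \<open>x^2 / 2\<close> of the density becomes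
  \<open>t * x^2\<close>.\<close>

lemma integral_gaussian_cis:
  assumes "t > 0"
  shows "(LINT x|lborel. of_real (exp (- t * x\<^sup>2)) * cis (- (z * x)))
    = of_real (sqrt (pi / t) * exp (- z\<^sup>2 / (4 * t)))"
proof -
  define r where "r = sqrt (2 * t)"
  have r: "r > 0" "r\<^sup>2 = 2 * t" using assms by (auto simp: r_def)
  have "of_real (exp (- (z / r)\<^sup>2 / 2)) = char std_normal_distribution (- (z / r))"
    by (simp add: char_std_normal_distribution)
  also have "\<dots> = (LINT x|lborel. std_normal_density x *\<^sub>R cis (- (z / r) * x))"
    unfolding char_def by (subst integral_density) (auto simp: normal_density_nonneg cis_conv_exp mult_ac)
  also have "\<dots> = \<bar>r\<bar> *\<^sub>R (LINT x|lborel. std_normal_density (0 + r * x) *\<^sub>R cis (- (z / r) * (0 + r * x)))"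
    using r by (intro lborel_integral_real_affine) simp
  also have "\<dots> = \<bar>r\<bar> *\<^sub>R (LINT x|lborel. of_real (1 / sqrt (2 * pi)) * (of_real (exp (- t * x\<^sup>2)) * cis (- (z * x))))"
    using r by (simp add: std_normal_density_def power_mult_distrib scaleR_conv_of_real mult_ac)
  also have "\<dots> = of_real (r / sqrt (2 * pi)) * (LINT x|lborel. of_real (exp (- t * x\<^sup>2)) * cis (- (z * x)))"
    using r by (subst integral_mult_right_zero) (simp add: scaleR_conv_of_real)
  finally have *: "of_real (exp (- (z / r)\<^sup>2 / 2))
      = of_real (r / sqrt (2 * pi)) * (LINT x|lborel. of_real (exp (- t * x\<^sup>2)) * cis (- (z * x)))" .
  have "of_real (sqrt (2 * pi) / r) * of_real (exp (- (z / r)\<^sup>2 / 2))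
      = (LINT x|lborel. of_real (exp (- t * x\<^sup>2)) * cis (- (z * x)))"
    unfolding * using r by (simp add: field_simps)
  moreover have "sqrt (2 * pi) / r = sqrt (pi / t)"
    using assms by (simp add: r_def real_sqrt_divide[symmetric])
  moreover have "- (z / r)\<^sup>2 / 2 = - z\<^sup>2 / (4 * t)"
    using r by (simp add: power_divide)
  ultimately show ?thesis by (metis of_real_mult)
qed

lemma tendsto_exp_neg_square:
  assumes "t > 0"
  shows "((\<lambda>x::real. exp (- t * x\<^sup>2)) \<longlongrightarrow> 0) at_top" "((\<lambda>x::real. exp (- t * x\<^sup>2)) \<longlongrightarrow> 0) at_bot"
  using assms by real_asymp+

text \<open>The function \<open>F\<close> vanishes at both infinities, so its derivative
  \<open>f\<close> has integral zero. The two terms of \<open>f\<close> are a multiple of the wanted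
  moment and a multiple of the Gaussian integral already known.\<close>

lemma integral_gaussian_cis_moment:
  assumes "t > 0"
  shows "(LINT x|lborel. of_real (x * exp (- t * x\<^sup>2)) * cis (- (z * x)))
    = - \<i> * of_real (z / (2 * t)) * of_real (sqrt (pi / t) * exp (- z\<^sup>2 / (4 * t)))"
proof -
  define F where "F x = of_real (exp (- t * x\<^sup>2)) * cis (- (z * x))" for x
  define f where "f x = of_real (-2 * t) * (of_real (x * exp (- t * x\<^sup>2)) * cis (- (z * x))) - \<i> * of_real z * F x" for x
  have cis_der: "((\<lambda>x. cis (- (z * x))) has_vector_derivative (- \<i> * of_real z * cis (- (z * x)))) (at x)" for x
  proof -
    have "((\<lambda>x. exp (\<i> * (of_real (- z) * of_real x))) has_vector_derivative
        (of_real (- z) * \<i> * exp (\<i> * (of_real (- z) * of_real x)))) (at x)"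
      by (rule has_vector_derivative_real_field) (auto intro!: derivative_eq_intros)
    then show ?thesis by (simp add: cis_conv_exp mult_ac)
  qed
  have exp_der: "((\<lambda>x. of_real (exp (- t * x\<^sup>2)) :: complex) has_vector_derivative of_real (- t * (2 * x) * exp (- t * x\<^sup>2))) (at x)" for x
    by (intro has_vector_derivative_of_real) (auto intro!: derivative_eq_intros simp: has_real_derivative_iff_has_vector_derivative[symmetric])
  have der: "(F has_vector_derivative f x) (at x)" for x
    unfolding F_def[abs_def] f_def
    by (rule has_vector_derivative_eq_rhs[OF has_vector_derivative_mult[OF exp_der cis_der]])
       (simp add: F_def algebra_simps)
  have cont: "isCont f x" for x
    unfolding f_def F_def
    by (intro continuous_intros has_vector_derivative_continuous[OF cis_der])
  note int = integrable_exp_quadratic[OF assms, THEN integrable_mult_cis, of "- z"]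
  have intf: "integrable lborel f"
    unfolding f_def[abs_def] F_def using int by simp
  have "(LBINT x=-\<infinity>..\<infinity>. f x) = 0 - 0"
  proof (rule interval_integral_FTC_integrable)
    show "set_integrable lborel (einterval (-\<infinity>) \<infinity>) f"
      using intf by (simp add: set_integrable_def)
    have n: "norm (F x) = exp (- t * x\<^sup>2)" for x by (simp add: F_def norm_mult)
    have "(F \<longlongrightarrow> 0) at_top" "(F \<longlongrightarrow> 0) at_bot"
      by (rule tendsto_norm_zero_cancel, simp only: n tendsto_exp_neg_square[OF assms])+
    then show "((F \<circ> real_of_ereal) \<longlongrightarrow> 0) (at_right (-\<infinity>))" "((F \<circ> real_of_ereal) \<longlongrightarrow> 0) (at_left \<infinity>)"
      by (simp_all add: ereal_tendsto_simps)
  qed (use der cont in auto)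
  then have zero: "(LINT x|lborel. f x) = 0"
    by (simp add: interval_integral_to_infinity_eq interval_lebesgue_integral_def set_lebesgue_integral_def)
  have eq: "(LINT x|lborel. f x) = of_real (-2 * t) * (LINT x|lborel. of_real (x * exp (- t * x\<^sup>2)) * cis (- (z * x)))
      - \<i> * of_real z * (LINT x|lborel. F x)"
    unfolding f_def F_def using int
    by (subst Bochner_Integration.integral_diff) simp_all
  have arith: "of_real (2 * t) * I = - \<i> * of_real z * G"
    if "0 = of_real (-2 * t) * I - \<i> * of_real z * G" for I G :: complex
  proof -
    have "of_real (2 * t) * I = - \<i> * of_real z * G - (of_real (-2 * t) * I - \<i> * of_real z * G)"
      by simp
    also have "of_real (-2 * t) * I - \<i> * of_real z * G = 0" using that by simp
    finally show ?thesis by simp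
  qed
  have "of_real (2 * t) * (LINT x|lborel. of_real (x * exp (- t * x\<^sup>2)) * cis (- (z * x)))
      = - \<i> * of_real z * of_real (sqrt (pi / t) * exp (- z\<^sup>2 / (4 * t)))"
    by (rule arith[OF eq[unfolded zero F_def integral_gaussian_cis[OF assms]]])
  then show ?thesis using assms by (simp add: field_simps)
qed

text \<open>The integral of \<open>\<xi> \<mapsto> exp (- t * (norm \<xi>)\<^sup>2) * cis (\<xi> \<bullet> z)\<close>.\<close>

definition heat :: "real \<Rightarrow> 'a::euclidean_space \<Rightarrow> real" where
  "heat t z = sqrt (pi / t) ^ DIM('a) * exp (- (norm z)\<^sup>2 / (4 * t))"

lemma norm_square_Basis: "(norm (x::'a::euclidean_space))\<^sup>2 = (\<Sum>b\<in>Basis. (x \<bullet> b)\<^sup>2)"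
  by (simp add: power2_norm_eq_inner) (subst euclidean_inner, simp add: power2_eq_square)

lemma exp_norm_square_Basis: "exp (c * (norm (x::'a::euclidean_space))\<^sup>2) = (\<Prod>b\<in>Basis. exp (c * (x \<bullet> b)\<^sup>2))"
  by (simp add: norm_square_Basis exp_sum sum_distrib_left)

lemma cis_sum: "finite A \<Longrightarrow> cis (\<Sum>b\<in>A. f b) = (\<Prod>b\<in>A. cis (f b))"
  by (induction rule: finite_induct) (auto simp: cis_mult[symmetric])

lemma cis_inner_Basis: "cis (- (z \<bullet> x)) = (\<Prod>b\<in>Basis. cis (- ((z \<bullet> b) * (x \<bullet> b))))"
  for x :: "'a::euclidean_space"
  by (subst euclidean_inner) (simp add: sum_negf[symmetric] cis_sum)

lemma heat_Basis: "of_real (heat t z) = (\<Prod>b\<in>Basis. of_real (sqrt (pi / t) * exp (- (z \<bullet> b)\<^sup>2 / (4 * t))) :: complex)"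
  for z :: "'a::euclidean_space"
proof -
  have "heat t z = sqrt (pi / t) ^ DIM('a) * exp (- (1 / (4 * t)) * (norm z)\<^sup>2)"
    by (simp add: heat_def)
  also have "\<dots> = (\<Prod>b\<in>Basis. sqrt (pi / t) * exp (- (z \<bullet> b)\<^sup>2 / (4 * t)))"
    unfolding exp_norm_square_Basis prod.distrib by simp
  finally show ?thesis by simp
qed

lemma gaussian_fourier_euclidean:
  fixes z :: "'a::euclidean_space"
  assumes "t > 0"
  shows "integrable lborel (\<lambda>x::'a. of_real (exp (- t * (norm x)\<^sup>2)) * cis (- (z \<bullet> x)))"
    and "(LINT x|lborel. of_real (exp (- t * (norm x)\<^sup>2)) * cis (- (z \<bullet> x))) = of_real (heat t z)"
proof -
  have *: "of_real (exp (- t * (norm x)\<^sup>2)) * cis (- (z \<bullet> x))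
    = (\<Prod>b\<in>Basis. of_real (exp (- t * (x \<bullet> b)\<^sup>2)) * cis (- ((z \<bullet> b) * (x \<bullet> b))))" for x :: 'a
    unfolding exp_norm_square_Basis cis_inner_Basis prod.distrib by simp
  have i: "integrable lborel (\<lambda>s. of_real (exp (- t * s\<^sup>2)) * cis (- ((z \<bullet> b) * s)))" for b
    using integrable_mult_cis[OF integrable_exp_quadratic(1)[OF assms], of "- (z \<bullet> b)"] by simp
  show "integrable lborel (\<lambda>x::'a. of_real (exp (- t * (norm x)\<^sup>2)) * cis (- (z \<bullet> x)))"
    unfolding * by (rule integrable_lborel_prod(1)[OF i])
  show "(LINT x|lborel. of_real (exp (- t * (norm x)\<^sup>2)) * cis (- (z \<bullet> x))) = of_real (heat t z)"
    unfolding * integrable_lborel_prod(2)[OF i] integral_gaussian_cis[OF assms] heat_Basis ..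
qed

text \<open>The integrand still factorises: only the coordinate \<open>b0\<close> carries the extra
  linear factor, so its one-dimensional integral is a first moment while all others are plain
  Gaussian integrals.\<close>

lemma gaussian_fourier_moment_Basis:
  fixes z :: "'a::euclidean_space"
  assumes "t > 0" and b0: "b0 \<in> Basis"
  shows "integrable lborel (\<lambda>x::'a. of_real ((b0 \<bullet> x) * exp (- t * (norm x)\<^sup>2)) * cis (- (z \<bullet> x)))"
    and "(LINT x|lborel. of_real ((b0 \<bullet> x) * exp (- t * (norm x)\<^sup>2)) * cis (- (z \<bullet> x)))
      = - \<i> * of_real ((b0 \<bullet> z) / (2 * t) * heat t z)"
proof -
  have d: "(\<Prod>b\<in>Basis. if b = b0 then (g b :: complex) else 1) = g b0" for g
    using b0 by simp
  define h where "h b s = (if b = b0 then of_real (s * exp (- t * s\<^sup>2)) * cis (- ((z \<bullet> b) * s))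
    else of_real (exp (- t * s\<^sup>2)) * cis (- ((z \<bullet> b) * s)))" for b s
  have *: "of_real ((b0 \<bullet> x) * exp (- t * (norm x)\<^sup>2)) * cis (- (z \<bullet> x)) = (\<Prod>b\<in>Basis. h b (x \<bullet> b))" for x :: 'a
  proof -
    have "(\<Prod>b\<in>Basis. h b (x \<bullet> b)) = (\<Prod>b\<in>Basis. (if b = b0 then of_real (x \<bullet> b) else 1) *
      (of_real (exp (- t * (x \<bullet> b)\<^sup>2)) * cis (- ((z \<bullet> b) * (x \<bullet> b)))))"
      by (intro prod.cong) (auto simp: h_def)
    also have "\<dots> = of_real (x \<bullet> b0) * (of_real (exp (- t * (norm x)\<^sup>2)) * cis (- (z \<bullet> x)))"
      unfolding exp_norm_square_Basis cis_inner_Basis prod.distrib d by simp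
    finally show ?thesis by (simp add: inner_commute)
  qed
  have i: "integrable lborel (h b)" for b
    using integrable_exp_quadratic[OF assms(1), THEN integrable_mult_cis, of "- (z \<bullet> b)"]
    by (cases "b = b0") (simp_all add: h_def[abs_def])
  show "integrable lborel (\<lambda>x::'a. of_real ((b0 \<bullet> x) * exp (- t * (norm x)\<^sup>2)) * cis (- (z \<bullet> x)))"
    unfolding * by (rule integrable_lborel_prod(1)[OF i])
  have "(LINT x|lborel. of_real ((b0 \<bullet> x) * exp (- t * (norm x)\<^sup>2)) * cis (- (z \<bullet> x)))
      = (\<Prod>b\<in>Basis. LINT s|lborel. h b s)"
    unfolding * by (rule integrable_lborel_prod(2)[OF i])
  also have "\<dots> = (\<Prod>b\<in>Basis. (if b = b0 then - \<i> * of_real ((z \<bullet> b) / (2 * t)) else 1) *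
      of_real (sqrt (pi / t) * exp (- (z \<bullet> b)\<^sup>2 / (4 * t))))"
  proof (intro prod.cong refl)
    fix b :: 'a assume "b \<in> Basis"
    show "(LINT s|lborel. h b s) = (if b = b0 then - \<i> * of_real ((z \<bullet> b) / (2 * t)) else 1) *
      of_real (sqrt (pi / t) * exp (- (z \<bullet> b)\<^sup>2 / (4 * t)))"
    proof (cases "b = b0")
      case True
      then have "h b = (\<lambda>s. of_real (s * exp (- t * s\<^sup>2)) * cis (- ((z \<bullet> b) * s)))"
        by (simp add: h_def fun_eq_iff)
      then show ?thesis
        using True integral_gaussian_cis_moment[OF assms(1), of "z \<bullet> b"] by (simp only: if_True refl)
    next
      case False
      then have "h b = (\<lambda>s. of_real (exp (- t * s\<^sup>2)) * cis (- ((z \<bullet> b) * s)))"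
        by (simp add: h_def fun_eq_iff)
      then show ?thesis
        using False integral_gaussian_cis[OF assms(1), of "z \<bullet> b"] by (simp only: if_False mult_1)
    qed
  qed
  also have "\<dots> = - \<i> * of_real ((z \<bullet> b0) / (2 * t)) * of_real (heat t z)"
    unfolding prod.distrib d heat_Basis ..
  finally show "(LINT x|lborel. of_real ((b0 \<bullet> x) * exp (- t * (norm x)\<^sup>2)) * cis (- (z \<bullet> x)))
      = - \<i> * of_real ((b0 \<bullet> z) / (2 * t) * heat t z)"
    by (simp add: inner_commute)
qed

lemma gaussian_fourier_moment:
  fixes z c :: "'a::euclidean_space"
  assumes "t > 0"
  shows "integrable lborel (\<lambda>x::'a. of_real ((c \<bullet> x) * exp (- t * (norm x)\<^sup>2)) * cis (- (z \<bullet> x)))"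
    and "(LINT x|lborel. of_real ((c \<bullet> x) * exp (- t * (norm x)\<^sup>2)) * cis (- (z \<bullet> x)))
      = - \<i> * of_real ((c \<bullet> z) / (2 * t) * heat t z)"
proof -
  have c: "c \<bullet> x = (\<Sum>b\<in>Basis. (c \<bullet> b) * (b \<bullet> x))" for x
    by (subst euclidean_inner) (simp add: inner_commute)
  have *: "of_real ((c \<bullet> x) * exp (- t * (norm x)\<^sup>2)) * cis (- (z \<bullet> x))
    = (\<Sum>b\<in>Basis. of_real (c \<bullet> b) * (of_real ((b \<bullet> x) * exp (- t * (norm x)\<^sup>2)) * cis (- (z \<bullet> x))))" for x
    unfolding c[of x] by (simp add: sum_distrib_right sum_distrib_left mult_ac)
  note i = gaussian_fourier_moment_Basis[OF assms]
  show "integrable lborel (\<lambda>x::'a. of_real ((c \<bullet> x) * exp (- t * (norm x)\<^sup>2)) * cis (- (z \<bullet> x)))"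
    unfolding * by (intro Bochner_Integration.integrable_sum integrable_mult_right i(1))
  have "(LINT x|lborel. of_real ((c \<bullet> x) * exp (- t * (norm x)\<^sup>2)) * cis (- (z \<bullet> x)))
    = (\<Sum>b\<in>Basis. of_real (c \<bullet> b) * (LINT x|lborel. of_real ((b \<bullet> x) * exp (- t * (norm x)\<^sup>2)) * cis (- (z \<bullet> x))))"
    unfolding *
    by (subst Bochner_Integration.integral_sum, rule integrable_mult_right[OF i(1)], assumption,
        subst integral_mult_right_zero, rule refl)
  also have "\<dots> = (\<Sum>b\<in>Basis. of_real (c \<bullet> b) * (- \<i> * of_real ((b \<bullet> z) / (2 * t) * heat t z)))"
    by (intro sum.cong refl) (simp only: i(2))
  also have "\<dots> = (\<Sum>b\<in>Basis. - \<i> * of_real (heat t z / (2 * t)) * of_real ((c \<bullet> b) * (b \<bullet> z)))"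
  proof (intro sum.cong refl)
    fix b :: 'a assume "b \<in> Basis"
    have "(c \<bullet> b) * ((b \<bullet> z) / (2 * t) * heat t z) = heat t z / (2 * t) * ((c \<bullet> b) * (b \<bullet> z))"
      by simp
    from arg_cong[OF this, of "\<lambda>r. - \<i> * of_real r"]
    show "of_real (c \<bullet> b) * (- \<i> * of_real ((b \<bullet> z) / (2 * t) * heat t z))
      = - \<i> * of_real (heat t z / (2 * t)) * of_real ((c \<bullet> b) * (b \<bullet> z))"
      by (simp only: of_real_mult mult_ac)
  qed
  also have "\<dots> = - \<i> * of_real (heat t z / (2 * t)) * of_real (c \<bullet> z)"
    unfolding sum_distrib_left[symmetric] of_real_sum[symmetric] c[of z] ..
  also have "\<dots> = - \<i> * of_real ((c \<bullet> z) / (2 * t) * heat t z)"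
    by simp
  finally show "(LINT x|lborel. of_real ((c \<bullet> x) * exp (- t * (norm x)\<^sup>2)) * cis (- (z \<bullet> x)))
      = - \<i> * of_real ((c \<bullet> z) / (2 * t) * heat t z)" .
qed

section \<open>Plancherel's theorem\<close>

lemma lborel_affine_integral:
  fixes f :: "'a::euclidean_space \<Rightarrow> 'b::{banach, second_countable_topology}"
  assumes [measurable]: "f \<in> borel_measurable borel" and c: "c \<noteq> 0"
  shows "(LINT x|lborel. f x) = (\<bar>c\<bar> ^ DIM('a)) *\<^sub>R (LINT x|lborel. f (t + c *\<^sub>R x))"
    and "integrable lborel (\<lambda>x. f (t + c *\<^sub>R x)) \<longleftrightarrow> integrable lborel f"
proof -
  have T [measurable]: "(\<lambda>x::'a. t + c *\<^sub>R x) \<in> lborel \<rightarrow>\<^sub>M borel" by measurable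
  show "(LINT x|lborel. f x) = (\<bar>c\<bar> ^ DIM('a)) *\<^sub>R (LINT x|lborel. f (t + c *\<^sub>R x))"
    by (subst lborel_affine[OF c, of t])
       (simp add: integral_density integral_distr[OF T])
  have "integrable lborel f \<longleftrightarrow> integrable lborel (\<lambda>x. (\<bar>c\<bar> ^ DIM('a)) *\<^sub>R f (t + c *\<^sub>R x))"
    by (subst lborel_affine[OF c, of t])
       (simp add: integrable_density integrable_distr_eq[OF T])
  then show "integrable lborel (\<lambda>x. f (t + c *\<^sub>R x)) \<longleftrightarrow> integrable lborel f"
    using c integrable_scaleR_right[of "inverse (\<bar>c\<bar> ^ DIM('a))" lborel "\<lambda>x. (\<bar>c\<bar> ^ DIM('a)) *\<^sub>R f (t + c *\<^sub>R x)"]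
    by auto
qed

lemma integrable_pair_product:
  fixes f :: "'a::euclidean_space \<Rightarrow> 'c::{real_normed_algebra,banach,second_countable_topology}"
    and g :: "'b::euclidean_space \<Rightarrow> 'c"
  assumes "integrable lborel f" "integrable lborel g"
  shows "integrable (lborel \<Otimes>\<^sub>M lborel) (\<lambda>(x, y). norm (f x) * norm (g y))"
proof -
  have [measurable]: "f \<in> borel_measurable borel" "g \<in> borel_measurable borel"
    using assms by (auto dest: borel_measurable_integrable)
  show ?thesis
  proof (rule lborel_pair.Fubini_integrable)
    show "integrable lborel (\<lambda>x. LINT y|lborel. norm (case (x, y) of (x, y) \<Rightarrow> norm (f x) * norm (g y)))"
      using assms by (simp add: abs_mult)
    show "AE x in lborel. integrable lborel (\<lambda>y. case (x, y) of (x, y) \<Rightarrow> norm (f x) * norm (g y))"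
      using assms by simp
  qed measurable
qed

lemma measurable_cis_inner [measurable]:
  assumes "f \<in> M \<rightarrow>\<^sub>M (borel :: 'a::euclidean_space measure)" "g \<in> M \<rightarrow>\<^sub>M borel"
  shows "(\<lambda>x. cis (- (f x \<bullet> g x))) \<in> borel_measurable M"
proof -
  have "(\<lambda>x::real. cis (- x)) \<in> borel_measurable borel"
    by (intro borel_measurable_continuous_onI continuous_intros)
  then show ?thesis
    using borel_measurable_inner[OF assms] by (rule measurable_compose_rev)
qed

lemma borel_measurable_cnj [measurable (raw)]:
  "f \<in> borel_measurable M \<Longrightarrow> (\<lambda>x. cnj (f x)) \<in> borel_measurable M"
  by (rule borel_measurable_continuous_on[of cnj]) (intro continuous_intros)

text \<open>The Fourier integral as an ordinary function, with the normalisation of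
  \<open>fourier_L2\<close>. The two agree on square-integrable functions of bounded support
  (\<open>fourier_L2_bounded_support\<close>).\<close>

definition ft :: "('a::euclidean_space \<Rightarrow> complex) \<Rightarrow> 'a \<Rightarrow> complex" where
  "ft u \<xi> = of_real ((2 * pi) powr (- real DIM('a) / 2)) * (LINT x|lborel. cis (- (x \<bullet> \<xi>)) * u x)"

lemma borel_measurable_ft [measurable]:
  assumes [measurable]: "u \<in> borel_measurable borel"
  shows "ft u \<in> borel_measurable borel"
proof -
  have "(\<lambda>\<xi>. LINT x|lborel. cis (- (x \<bullet> \<xi>)) * u x) \<in> borel_measurable borel"
    by measurable
  then show ?thesis unfolding ft_def[abs_def] by measurable
qed

lemma integrable_cis_mult:
  assumes "integrable lborel (u :: 'a::euclidean_space \<Rightarrow> complex)"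
  shows "integrable lborel (\<lambda>x. cis (- (x \<bullet> \<xi>)) * u x)"
proof (rule Bochner_Integration.integrable_bound[OF assms])
  have [measurable]: "u \<in> borel_measurable borel" using assms by (auto dest: borel_measurable_integrable)
  show "(\<lambda>x. cis (- (x \<bullet> \<xi>)) * u x) \<in> borel_measurable lborel" by measurable
qed (simp add: norm_mult)

text \<open>Fubini: both transforms are written out and the integral over \<xi> is done innermost.
  For Gaussian weights \<open>g\<close> that inner integral is explicit; the plain Gaussian leads to
  Plancherel's theorem and the Gaussian times a linear factor to the Riesz transforms.\<close>

lemma ft_weighted:
  fixes u v :: "'a::euclidean_space \<Rightarrow> complex"
  assumes u: "integrable lborel u" and v: "integrable lborel v" and g: "integrable lborel g"
  shows "(LINT \<xi>|lborel. g \<xi> * (ft u \<xi> * cnj (ft v \<xi>)))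
    = of_real ((2 * pi) powr (- real DIM('a))) * (LINT p|(lborel \<Otimes>\<^sub>M lborel).
        u (fst p) * cnj (v (snd p)) * (LINT \<xi>|lborel. g \<xi> * cis (- ((fst p - snd p) \<bullet> \<xi>))))"
proof -
  have [measurable]: "u \<in> borel_measurable borel" "v \<in> borel_measurable borel" "g \<in> borel_measurable borel"
    using assms by (auto dest: borel_measurable_integrable)
  define H where "H \<xi> p = g \<xi> * (u (fst p) * cnj (v (snd p)) * cis (- ((fst p - snd p) \<bullet> \<xi>)))"
    for \<xi> and p :: "'a \<times> 'a"
  have uv: "integrable (lborel :: ('a \<times> 'a) measure) (\<lambda>(x, y). norm (u x) * norm (v y))"
    using integrable_pair_product[OF u v] by (simp only: lborel_prod)
  have "integrable (lborel \<Otimes>\<^sub>M lborel) (\<lambda>(\<xi>, p). norm (g \<xi>) * norm (of_real (case p of (x, y) \<Rightarrow> norm (u x) * norm (v y)) :: complex))"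
    by (rule integrable_pair_product[OF g]) (use uv in simp)
  note dom = this
  have [measurable]:
      "(\<lambda>q::'a \<times> 'a \<times> 'a. fst (snd q)) \<in> borel_measurable (lborel \<Otimes>\<^sub>M lborel)"
      "(\<lambda>q::'a \<times> 'a \<times> 'a. snd (snd q)) \<in> borel_measurable (lborel \<Otimes>\<^sub>M lborel)"
    unfolding lborel_prod by (auto intro!: borel_measurable_continuous_onI continuous_intros)
  have H: "integrable (lborel \<Otimes>\<^sub>M lborel) (case_prod H)"
  proof (rule Bochner_Integration.integrable_bound[OF dom])
    show "case_prod H \<in> borel_measurable (lborel \<Otimes>\<^sub>M lborel)"
      unfolding H_def[abs_def] case_prod_unfold by measurable
    show "AE x in lborel \<Otimes>\<^sub>M lborel. norm (case_prod H x) \<le>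
        norm (case x of (\<xi>, p) \<Rightarrow> norm (g \<xi>) * norm (of_real (case p of (x, y) \<Rightarrow> norm (u x) * norm (v y)) :: complex))"
      by (intro AE_I2) (auto simp: H_def norm_mult abs_mult split: prod.split)
  qed
  define C where "C = (2 * pi) powr (- real DIM('a) / 2)"
  have C: "C * C = (2 * pi) powr (- real DIM('a))"
    unfolding C_def by (simp add: powr_add[symmetric])
  have inner: "(LINT p|lborel. H \<xi> p) = g \<xi> * ((LINT x|lborel. cis (- (x \<bullet> \<xi>)) * u x) * cnj (LINT x|lborel. cis (- (x \<bullet> \<xi>)) * v x))" for \<xi>
  proof -
    define a where "a x = cis (- (x \<bullet> \<xi>)) * u x" for x
    define b where "b x = cnj (cis (- (x \<bullet> \<xi>)) * v x)" for x
    have a: "integrable lborel a"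
      unfolding a_def[abs_def] by (rule integrable_cis_mult[OF u])
    have b: "integrable lborel b"
      unfolding b_def[abs_def] by (rule integrable_cnj[OF integrable_cis_mult[OF v]])
    have [measurable]: "a \<in> borel_measurable borel" "b \<in> borel_measurable borel"
      using a b by (auto dest: borel_measurable_integrable)
    have ab: "integrable (lborel \<Otimes>\<^sub>M lborel) (\<lambda>(x, y). a x * b y)"
      by (rule Bochner_Integration.integrable_bound[OF integrable_pair_product[OF a b]])
         (auto simp: norm_mult)
    have "(LINT p|lborel. H \<xi> p) = (LINT p|lborel. g \<xi> * (case p of (x, y) \<Rightarrow> a x * b y))"
      by (intro Bochner_Integration.integral_cong)
         (auto simp: H_def a_def b_def cis_cnj cis_mult algebra_simps inner_diff_left split: prod.split)
    also have "\<dots> = g \<xi> * (LINT p|(lborel \<Otimes>\<^sub>M lborel). (case p of (x, y) \<Rightarrow> a x * b y))"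
      by (simp add: lborel_prod)
    also have "(LINT p|(lborel \<Otimes>\<^sub>M lborel). (case p of (x, y) \<Rightarrow> a x * b y)) = (LINT x|lborel. LINT y|lborel. a x * b y)"
      using lborel_pair.integral_fst[of "\<lambda>x y. a x * b y"] ab by simp
    also have "\<dots> = (LINT x|lborel. a x) * (LINT y|lborel. b y)"
      by simp
    also have "(LINT y|lborel. b y) = cnj (LINT x|lborel. cis (- (x \<bullet> \<xi>)) * v x)"
      unfolding b_def by (rule integral_bounded_linear'[OF bounded_linear_cnj bounded_linear_cnj]) simp
    finally show ?thesis unfolding a_def .
  qed
  have "(LINT \<xi>|lborel. g \<xi> * (ft u \<xi> * cnj (ft v \<xi>))) = (LINT \<xi>|lborel. of_real (C * C) * (LINT p|lborel. H \<xi> p))"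
    unfolding inner ft_def C_def[symmetric] by (intro Bochner_Integration.integral_cong) (auto simp: mult_ac)
  also have "\<dots> = of_real (C * C) * (LINT \<xi>|lborel. LINT p|lborel. H \<xi> p)"
    by simp
  also have "(LINT \<xi>|lborel. LINT p|lborel. H \<xi> p) = (LINT p|lborel. LINT \<xi>|lborel. H \<xi> p)"
    by (rule lborel_pair.Fubini_integral[OF H, symmetric])
  also have "\<dots> = (LINT p|lborel. u (fst p) * cnj (v (snd p)) * (LINT \<xi>|lborel. g \<xi> * cis (- ((fst p - snd p) \<bullet> \<xi>))))"
  proof (intro Bochner_Integration.integral_cong refl)
    fix p :: "'a \<times> 'a"
    have "(LINT \<xi>|lborel. H \<xi> p) = (LINT \<xi>|lborel. (u (fst p) * cnj (v (snd p))) * (g \<xi> * cis (- ((fst p - snd p) \<bullet> \<xi>))))"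
      unfolding H_def by (intro Bochner_Integration.integral_cong) (auto simp: mult_ac)
    then show "(LINT \<xi>|lborel. H \<xi> p) = u (fst p) * cnj (v (snd p)) * (LINT \<xi>|lborel. g \<xi> * cis (- ((fst p - snd p) \<bullet> \<xi>)))"
      by simp
  qed
  finally show ?thesis unfolding C lborel_prod .
qed

section \<open>Translations in L2 and approximation by continuous functions\<close>

lemma sq_int_translate:
  assumes "sq_int u"
  shows "sq_int (\<lambda>x. u (x - h))" "norm (abs_L2 (\<lambda>x. u (x - h))) = norm (abs_L2 u)"
proof -
  have [measurable]: "u \<in> borel_measurable borel" using assms by (rule sq_int_measurable)
  have m: "(\<lambda>x. (norm (u x))\<^sup>2) \<in> borel_measurable borel" by measurable
  note aff = lborel_affine_integral[OF m, of 1 "- h"]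
  show s: "sq_int (\<lambda>x. u (x - h))"
    using aff(2) assms unfolding sq_int_def by (simp add: algebra_simps)
  have "(norm (abs_L2 (\<lambda>x. u (x - h))))\<^sup>2 = (norm (abs_L2 u))\<^sup>2"
    using aff(1) by (simp add: sq_int_norm s assms algebra_simps)
  then show "norm (abs_L2 (\<lambda>x. u (x - h))) = norm (abs_L2 u)" by simp
qed

text \<open>Measurability yields continuous functions \<open>g n\<close> that converge to
  \<open>u\<close> off a null set, with no control on size or support. Each is cut off in space and
  in size, which changes nothing in the limit and creates a common dominating function.\<close>

lemma L2_continuous_approx_bounded:
  fixes u :: "'a::euclidean_space \<Rightarrow> 'b::euclidean_space"
  assumes [measurable]: "u \<in> borel_measurable borel" and bd: "\<And>x. norm (u x) \<le> M" and "M > 0"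
    and supp: "\<And>x. u x \<noteq> 0 \<Longrightarrow> norm x \<le> R" and "e > 0"
  shows "\<exists>w. continuous_on UNIV w \<and> (\<forall>x. norm (w x) \<le> M) \<and> (\<forall>x. w x \<noteq> 0 \<longrightarrow> norm x \<le> R + 1) \<and>
    norm (abs_L2 u - abs_L2 w) < e"
proof -
  have "u measurable_on UNIV"
    by (rule lebesgue_measurable_imp_measurable_on)
       (use assms(1) in \<open>auto intro: measurable_completion simp: lebesgue_on_UNIV_eq\<close>)
  then obtain N g where N: "negligible N" and g: "\<And>n. continuous_on UNIV (g n)"
      and lim: "\<And>x. x \<notin> N \<Longrightarrow> (\<lambda>n. g n x) \<longlonglongrightarrow> u x"
    unfolding measurable_on_def by auto
  \<comment> \<open>The cut-off equals 1 where \<open>norm x \<le> R\<close> and 0 where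
    \<open>norm x \<ge> R + 1\<close>. In the next definition, division by
    \<open>max 1 (norm (g n x) / M)\<close> projects radially onto the ball of radius
    \<open>M\<close> and preserves continuity.\<close>
  define \<eta> :: "'a \<Rightarrow> real" where "\<eta> x = max 0 (min 1 (R + 1 - norm x))" for x
  define w where "w n x = (\<eta> x / max 1 (norm (g n x) / M)) *\<^sub>R g n x" for n x
  have mx: "max 1 (r / M) > 0" for r :: real by (simp add: less_max_iff_disj)
  have w_cont: "continuous_on UNIV (w n)" for n
    unfolding w_def[abs_def] \<eta>_def
    by (intro continuous_intros g) (use mx \<open>M > 0\<close> in \<open>auto simp: less_imp_neq[THEN not_sym]\<close>)
  then have [measurable]: "w n \<in> borel_measurable borel" for n
    by (rule borel_measurable_continuous_onI)
  have w_bd: "norm (w n x) \<le> M" for n x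
  proof -
    have "norm (w n x) = \<eta> x * (norm (g n x) / max 1 (norm (g n x) / M))"
      using mx[of "norm (g n x)"] by (simp add: w_def \<eta>_def)
    also have "\<dots> \<le> 1 * M"
    proof (rule mult_mono)
      have "norm (g n x) = M * (norm (g n x) / M)" using \<open>M > 0\<close> by simp
      also have "\<dots> \<le> M * max 1 (norm (g n x) / M)" using \<open>M > 0\<close> by (intro mult_left_mono) auto
      finally show "norm (g n x) / max 1 (norm (g n x) / M) \<le> M"
        using mx[of "norm (g n x)"] by (simp add: pos_divide_le_eq)
    qed (auto simp: \<eta>_def)
    finally show ?thesis by simp
  qed
  have w_supp: "w n x \<noteq> 0 \<Longrightarrow> norm x \<le> R + 1" for n x
    by (cases "norm x \<le> R + 1") (auto simp: w_def \<eta>_def)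
  have AE: "AE x in lborel. (\<lambda>n. w n x) \<longlonglongrightarrow> u x"
  proof -
    have "AE x in lebesgue. x \<notin> N"
      using N by (simp add: negligible_iff_null_sets AE_not_in)
    then have "AE x in lborel. x \<notin> N" by (simp add: AE_completion_iff)
    then show ?thesis
    proof eventually_elim
      case (elim x)
      have nz: "max 1 (norm (u x) / M) \<noteq> 0" using mx[of "norm (u x)"] by linarith
      have "(\<lambda>n. w n x) \<longlonglongrightarrow> (\<eta> x / max 1 (norm (u x) / M)) *\<^sub>R u x"
        unfolding w_def by (intro tendsto_intros lim elim nz) (use \<open>M > 0\<close> in auto)
      moreover have "(\<eta> x / max 1 (norm (u x) / M)) *\<^sub>R u x = u x"
      proof (cases "u x = 0")
        case False
        then have "\<eta> x = 1" using supp[of x] by (simp add: \<eta>_def)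
        moreover have "max 1 (norm (u x) / M) = 1" using bd[of x] \<open>M > 0\<close> by (simp add: max_def)
        ultimately show ?thesis by simp
      qed simp
      ultimately show ?case by simp
    qed
  qed
  obtain b :: 'b where b: "b \<in> Basis" using nonempty_Basis by blast
  define G where "G x = indicator (cball 0 (R + 1)) x *\<^sub>R (M *\<^sub>R b)" for x :: 'a
  have G: "sq_int G"
    by (rule sq_int_bounded_support[where C=M and r="R+1"])
       (use b \<open>M > 0\<close> in \<open>auto simp: G_def[abs_def] indicator_def split: if_splits\<close>)
  have dom: "norm (w n x) \<le> norm (G x)" for n x
    using w_bd[of n x] w_supp[of n x] b \<open>M > 0\<close> by (cases "w n x = 0") (auto simp: G_def)
  note L = L2_dominated_convergence[OF G _ _ AE dom]
  have "(\<lambda>n. abs_L2 (w n)) \<longlonglongrightarrow> abs_L2 u" by (rule L(3)) measurable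
  then obtain n where "norm (abs_L2 (w n) - abs_L2 u) < e"
    using LIMSEQ_D[OF _ \<open>e > 0\<close>] by blast
  then show ?thesis using w_cont w_bd w_supp by (metis norm_minus_commute)
qed

lemma L2_continuous_approx:
  fixes u :: "'a::euclidean_space \<Rightarrow> 'b::euclidean_space"
  assumes u: "sq_int u" and "e > 0"
  shows "\<exists>w M R. continuous_on UNIV w \<and> (\<forall>x. norm (w x) \<le> M) \<and> (\<forall>x. w x \<noteq> 0 \<longrightarrow> norm x \<le> R) \<and>
    norm (abs_L2 u - abs_L2 w) < e"
proof -
  note [measurable] = sq_int_measurable[OF u]
  define v where "v n x = (if norm x \<le> real n \<and> norm (u x) \<le> real n then u x else 0)" for n x
  have vm [measurable]: "v n \<in> borel_measurable borel" for n
    unfolding v_def[abs_def] by measurable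
  have AE: "AE x in lborel. (\<lambda>n. v n x) \<longlonglongrightarrow> u x"
  proof (rule AE_I2)
    fix x
    obtain n0 where n0: "max (norm x) (norm (u x)) \<le> real n0" using real_arch_simple by blast
    have "v n x = u x" if "n \<ge> n0" for n
      using n0 that by (auto simp: v_def)
    then show "(\<lambda>n. v n x) \<longlonglongrightarrow> u x"
      by (intro tendsto_eventually) (auto simp: eventually_sequentially)
  qed
  have lim: "(\<lambda>n. abs_L2 (v n)) \<longlonglongrightarrow> abs_L2 u"
    by (rule L2_dominated_convergence(3)[OF u _ _ AE]) (measurable, auto simp: v_def)
  obtain n where n: "norm (abs_L2 (v n) - abs_L2 u) < e / 2"
    using LIMSEQ_D[OF lim half_gt_zero[OF \<open>e > 0\<close>]] by blast
  \<comment> \<open>The bound \<open>real n + 1\<close> makes \<open>M\<close> positive even for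
    \<open>n = 0\<close>; in the support it is the widening by 1 that the cut-off causes.\<close>
  obtain w where w: "continuous_on UNIV w" "\<forall>x. norm (w x) \<le> real n + 1" "\<forall>x. w x \<noteq> 0 \<longrightarrow> norm x \<le> real n + 1"
      "norm (abs_L2 (v n) - abs_L2 w) < e / 2"
  proof -
    have "norm (v n x) \<le> real n + 1" for x by (auto simp: v_def)
    moreover have "norm x \<le> real n" if "v n x \<noteq> 0" for x
      using that unfolding v_def by presburger
    ultimately show thesis
      using L2_continuous_approx_bounded[OF vm[of n] _ _ _ half_gt_zero[OF \<open>e > 0\<close>], of "real n + 1" "real n"] that
      by (metis add_nonneg_pos of_nat_0_le_iff zero_less_one)
  qed
  have "norm (abs_L2 u - abs_L2 w) < e"
    using norm_triangle_ineq[of "abs_L2 u - abs_L2 (v n)" "abs_L2 (v n) - abs_L2 w"] n w(4)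
    by (simp add: norm_minus_commute)
  then show ?thesis using w by blast
qed

text \<open>A three-term estimate around a continuous \<open>w\<close> of bounded support.
  Translation is an isometry, so the outer terms are equally small; the middle one tends to zero by
  dominated convergence, once the shifts have norm below 1.\<close>

lemma L2_translation_continuous:
  fixes u :: "'a::euclidean_space \<Rightarrow> 'b::euclidean_space"
  assumes u: "sq_int u" and h: "h \<longlonglongrightarrow> 0"
  shows "(\<lambda>n. abs_L2 (\<lambda>x. u (x - h n))) \<longlonglongrightarrow> abs_L2 u"
proof (rule LIMSEQ_I)
  fix e :: real assume "e > 0"
  obtain w M R where w: "continuous_on UNIV w" "\<And>x. norm (w x) \<le> M" "\<And>x. w x \<noteq> 0 \<Longrightarrow> norm x \<le> R"
      "norm (abs_L2 u - abs_L2 w) < e / 3"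
    using L2_continuous_approx[OF u, of "e / 3"] \<open>e > 0\<close> by auto
  have [measurable]: "w \<in> borel_measurable borel" using w(1) by (rule borel_measurable_continuous_onI)
  have sw: "sq_int w" by (rule sq_int_bounded_support[OF _ w(2,3)]) measurable
  obtain N where N: "\<And>n. n \<ge> N \<Longrightarrow> norm (h n) < 1" using LIMSEQ_D[OF h, of 1] by auto
  obtain b :: 'b where b: "b \<in> Basis" using nonempty_Basis by blast
  define G where "G x = indicator (cball 0 (R + 1)) x *\<^sub>R (M *\<^sub>R b)" for x :: 'a
  have M: "0 \<le> M" using w(2) norm_ge_zero order_trans by blast
  have G: "sq_int G"
    by (rule sq_int_bounded_support[where C=M and r="R+1"])
       (use b M in \<open>auto simp: G_def[abs_def] indicator_def split: if_splits\<close>)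
  have lim: "(\<lambda>n. abs_L2 (\<lambda>x. w (x - h (n + N)))) \<longlonglongrightarrow> abs_L2 w"
  proof (rule L2_dominated_convergence(3)[OF G])
    show "AE x in lborel. (\<lambda>n. w (x - h (n + N))) \<longlonglongrightarrow> w x"
    proof (rule AE_I2)
      fix x
      have "(\<lambda>n. x - h (n + N)) \<longlonglongrightarrow> x - 0"
        by (intro tendsto_intros LIMSEQ_ignore_initial_segment h)
      then have "(\<lambda>n. w (x - h (n + N))) \<longlonglongrightarrow> w (x - 0)"
        using w(1) by (intro continuous_on_tendsto_compose[OF w(1)]) auto
      then show "(\<lambda>n. w (x - h (n + N))) \<longlonglongrightarrow> w x" by simp
    qed
    show "norm (w (x - h (n + N))) \<le> norm (G x)" for n x
    proof (cases "w (x - h (n + N)) = 0")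
      case False
      then have "norm (x - h (n + N)) \<le> R" by (rule w(3))
      then have "norm x \<le> R + 1"
        using norm_triangle_sub[of x "h (n + N)"] N[of "n + N"] by auto
      then show ?thesis using w(2)[of "x - h (n + N)"] b M by (simp add: G_def)
    qed simp
  qed measurable
  from LIMSEQ_D[OF LIMSEQ_offset[of "\<lambda>n. abs_L2 (\<lambda>x. w (x - h n))" N, OF lim], of "e / 3"] \<open>e > 0\<close>
  obtain n0 where n0: "\<And>n. n \<ge> n0 \<Longrightarrow> norm (abs_L2 (\<lambda>x. w (x - h n)) - abs_L2 w) < e / 3"
    by auto
  have "norm (abs_L2 (\<lambda>x. u (x - h n)) - abs_L2 u) < e" if "n \<ge> n0" for n
  proof -
    have "abs_L2 (\<lambda>x. u (x - h n)) - abs_L2 (\<lambda>x. w (x - h n)) = abs_L2 (\<lambda>x. u (x - h n) - w (x - h n))"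
      by (intro abs_L2_diff sq_int_imp_square_integrable sq_int_translate u sw)
    moreover have "norm \<dots> = norm (abs_L2 u - abs_L2 w)"
      using sq_int_translate(2)[OF sq_int_diff[OF u sw]] u sw
      by (simp add: abs_L2_diff sq_int_imp_square_integrable)
    ultimately have 1: "norm (abs_L2 (\<lambda>x. u (x - h n)) - abs_L2 (\<lambda>x. w (x - h n))) < e / 3"
      using w(4) by simp
    let ?a = "abs_L2 (\<lambda>x. u (x - h n)) - abs_L2 (\<lambda>x. w (x - h n))"
      and ?b = "abs_L2 (\<lambda>x. w (x - h n)) - abs_L2 w" and ?c = "abs_L2 w - abs_L2 u"
    have "abs_L2 (\<lambda>x. u (x - h n)) - abs_L2 u = ?a + ?b + ?c" by simp
    moreover have "norm (?a + ?b + ?c) \<le> norm ?a + norm ?b + norm ?c"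
      using norm_triangle_ineq[of "?a + ?b" ?c] norm_triangle_ineq[of ?a ?b] by linarith
    ultimately have "norm (abs_L2 (\<lambda>x. u (x - h n)) - abs_L2 u) \<le> norm ?a + norm ?b + norm ?c"
      by simp
    then show ?thesis using 1 n0[OF that] w(4) norm_minus_commute[of "abs_L2 w" "abs_L2 u"] by linarith
  qed
  then show "\<exists>no. \<forall>n\<ge>no. norm (abs_L2 (\<lambda>x. u (x - h n)) - abs_L2 u) < e" by blast
qed

section \<open>Plancherel's identity on functions of bounded support\<close>

lemma ft_bounded:
  assumes "integrable lborel (u :: 'a::euclidean_space \<Rightarrow> complex)"
  shows "norm (ft u \<xi>) \<le> (2 * pi) powr (- real DIM('a) / 2) * (LINT x|lborel. norm (u x))"
proof -
  have "norm (LINT x|lborel. cis (- (x \<bullet> \<xi>)) * u x) \<le> (LINT x|lborel. norm (cis (- (x \<bullet> \<xi>)) * u x))"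
    by (rule integral_norm_bound)
  also have "\<dots> = (LINT x|lborel. norm (u x))" by (simp add: norm_mult)
  finally show ?thesis unfolding ft_def by (simp add: norm_mult mult_left_mono)
qed

lemma heat_nonneg: "0 \<le> t \<Longrightarrow> 0 \<le> heat t z"
  by (simp add: heat_def)

text \<open>The Gaussian damping makes every integral absolutely convergent. Writing
  \<open>y = x - s *\<^sub>R w\<close> in the double integral of \<open>ft_weighted\<close> turns
  the Gaussian into the fixed probability density \<open>k\<close>, so the damped energy is an
  average of the autocorrelation of \<open>u\<close> over the shifts \<open>s *\<^sub>R w\<close>,
  which shrink with \<open>s\<close>.\<close>

lemma plancherel_weighted:
  fixes u :: "'a::euclidean_space \<Rightarrow> complex"
  assumes u: "sq_int u" and supp: "\<And>x. u x \<noteq> 0 \<Longrightarrow> norm x \<le> R" and s: "s > 0"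
  defines "k \<equiv> \<lambda>w::'a. (2 * pi) powr (- real DIM('a)) * (sqrt pi ^ DIM('a) * exp (- (1 / 4) * (norm w)\<^sup>2))"
  shows "integrable lborel (\<lambda>\<xi>. exp (- s\<^sup>2 * (norm \<xi>)\<^sup>2) * (norm (ft u \<xi>))\<^sup>2)"
    and "(LINT \<xi>|lborel. exp (- s\<^sup>2 * (norm \<xi>)\<^sup>2) * (norm (ft u \<xi>))\<^sup>2)
      = (LINT w|lborel. k w * (LINT x|lborel. u x \<bullet> u (x - s *\<^sub>R w)))"
    and "integrable lborel k" "(LINT w|lborel. k w) = 1"
proof -
  have s2: "s\<^sup>2 > 0" using s by simp
  have [measurable]: "u \<in> borel_measurable borel" using u by (rule sq_int_measurable)
  have iu: "integrable lborel u" by (rule sq_int_bounded_support_integrable[OF u supp])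
  have gi: "integrable lborel (\<lambda>\<xi>::'a. of_real (exp (- t * (norm \<xi>)\<^sup>2)) :: complex)" if "t > 0" for t
    using gaussian_fourier_euclidean(1)[OF that, of 0] by simp
  then have gr: "integrable lborel (\<lambda>\<xi>::'a. exp (- t * (norm \<xi>)\<^sup>2))" if "t > 0" for t
    using complex_of_real_integrable_eq that by blast
  define B where "B = (2 * pi) powr (- real DIM('a) / 2) * (LINT x|lborel. norm (u x))"
  show int1: "integrable lborel (\<lambda>\<xi>. exp (- s\<^sup>2 * (norm \<xi>)\<^sup>2) * (norm (ft u \<xi>))\<^sup>2)"
  proof (rule Bochner_Integration.integrable_bound)
    show "integrable lborel (\<lambda>\<xi>::'a. B\<^sup>2 * exp (- s\<^sup>2 * (norm \<xi>)\<^sup>2))"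
      using gr[OF s2] by simp
    show "AE \<xi> in lborel. norm (exp (- s\<^sup>2 * (norm \<xi>)\<^sup>2) * (norm (ft u \<xi>))\<^sup>2) \<le> norm (B\<^sup>2 * exp (- s\<^sup>2 * (norm \<xi>)\<^sup>2))"
    proof (rule AE_I2)
      fix \<xi>
      have "(norm (ft u \<xi>))\<^sup>2 \<le> B\<^sup>2" unfolding B_def by (intro power_mono ft_bounded iu) auto
      then show "norm (exp (- s\<^sup>2 * (norm \<xi>)\<^sup>2) * (norm (ft u \<xi>))\<^sup>2) \<le> norm (B\<^sup>2 * exp (- s\<^sup>2 * (norm \<xi>)\<^sup>2))"
        by simp
    qed
  qed measurable
  \<comment> \<open>The Jacobian \<open>s ^ DIM('a)\<close> compensates the factor
    \<open>sqrt (pi / s\<^sup>2) ^ DIM('a)\<close> of the heat kernel; this is why \<open>k\<close>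
    does not depend on \<open>s\<close>.\<close>
  have k_def': "k w = (2 * pi) powr (- real DIM('a)) * (s ^ DIM('a) * heat (s\<^sup>2) (s *\<^sub>R w))" for w
  proof -
    have "s * sqrt (pi / s\<^sup>2) = sqrt pi" using s by (simp add: real_sqrt_divide)
    then have "s ^ DIM('a) * sqrt (pi / s\<^sup>2) ^ DIM('a) = sqrt pi ^ DIM('a)"
      by (simp only: power_mult_distrib[symmetric])
    then show ?thesis using s by (simp add: k_def heat_def power_mult_distrib)
  qed
  show ki: "integrable lborel k"
    unfolding k_def using gr[of "1 / 4"] by simp
  show "(LINT w|lborel. k w) = 1"
  proof -
    have "complex_of_real (LINT w::'a|lborel. exp (- (1 / 4) * (norm w)\<^sup>2)) = of_real (heat (1 / 4) (0 :: 'a))"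
      using gaussian_fourier_euclidean(2)[of "1 / 4" "0 :: 'a"] by simp
    then have "(LINT w::'a|lborel. exp (- (1 / 4) * (norm w)\<^sup>2)) = sqrt (4 * pi) ^ DIM('a)"
      unfolding of_real_eq_iff by (simp add: heat_def mult.commute)
    then have "(LINT w|lborel. k w) = (2 * pi) powr (- real DIM('a)) * (sqrt pi ^ DIM('a) * sqrt (4 * pi) ^ DIM('a))"
      unfolding k_def by simp
    also have "sqrt pi ^ DIM('a) * sqrt (4 * pi) ^ DIM('a) = (sqrt pi * sqrt (4 * pi)) ^ DIM('a)"
      by (simp only: power_mult_distrib)
    also have "sqrt pi * sqrt (4 * pi) = 2 * pi" by (simp add: real_sqrt_mult)
    also have "(2 * pi) ^ DIM('a) = (2 * pi) powr (real DIM('a))" by (simp add: powr_realpow)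
    finally show ?thesis by (simp add: powr_add[symmetric])
  qed
  have [measurable]: "k \<in> borel_measurable borel" using ki by auto
  define F where "F w x = of_real (k w) * (u x * cnj (u (x - s *\<^sub>R w)))" for w x
  have Fm: "(\<lambda>(w, x). F w x) \<in> borel_measurable (lborel \<Otimes>\<^sub>M lborel)"
    unfolding F_def[abs_def] by measurable
  have k_nn: "0 \<le> k w" for w by (simp add: k_def)
  have F_norm: "integrable lborel (\<lambda>x. norm (F w x))" "(LINT x|lborel. norm (F w x)) \<le> k w * (norm (abs_L2 u))\<^sup>2" for w
  proof -
    have *: "norm (F w x) = k w * (norm (u x) * norm (u (x - s *\<^sub>R w)))" for x
      using k_nn by (simp add: F_def norm_mult)
    note t = sq_int_translate[OF u, of "s *\<^sub>R w"]
    show "integrable lborel (\<lambda>x. norm (F w x))"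
      unfolding * using L2_Cauchy_Schwarz(1)[OF u t(1)] by simp
    have "(LINT x|lborel. norm (F w x)) = k w * (LINT x|lborel. norm (u x) * norm (u (x - s *\<^sub>R w)))"
      unfolding * by simp
    also have "\<dots> \<le> k w * (norm (abs_L2 u) * norm (abs_L2 (\<lambda>x. u (x - s *\<^sub>R w))))"
      by (intro mult_left_mono L2_Cauchy_Schwarz u t k_nn)
    finally show "(LINT x|lborel. norm (F w x)) \<le> k w * (norm (abs_L2 u))\<^sup>2"
      by (simp add: t(2) power2_eq_square)
  qed
  have F: "integrable (lborel \<Otimes>\<^sub>M lborel) (\<lambda>(w, x). F w x)"
  proof (rule lborel_pair.Fubini_integrable[OF Fm])
    show "integrable lborel (\<lambda>w. LINT x|lborel. norm (case (w, x) of (w, x) \<Rightarrow> F w x))"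
    proof (rule Bochner_Integration.integrable_bound)
      show "integrable lborel (\<lambda>w. k w * (norm (abs_L2 u))\<^sup>2)" using ki by simp
      show "(\<lambda>w. LINT x|lborel. norm (case (w, x) of (w, x) \<Rightarrow> F w x)) \<in> borel_measurable lborel"
        using Fm by measurable
      show "AE w in lborel. norm (LINT x|lborel. norm (case (w, x) of (w, x) \<Rightarrow> F w x)) \<le> norm (k w * (norm (abs_L2 u))\<^sup>2)"
        using F_norm(2) k_nn by (intro AE_I2) (simp add: abs_of_nonneg integral_nonneg)
    qed
    show "AE w in lborel. integrable lborel (\<lambda>x. case (w, x) of (w, x) \<Rightarrow> F w x)"
    proof (intro AE_I2)
      fix w :: 'a
      have "F w \<in> borel_measurable borel" unfolding F_def[abs_def] by measurable
      then show "integrable lborel (\<lambda>x. case (w, x) of (w, x) \<Rightarrow> F w x)"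
        using F_norm(1)[of w] integrable_norm_iff[of "F w" lborel] by simp
    qed
  qed
  define P where "P x y = u x * cnj (u y) * of_real (heat (s\<^sup>2) (x - y))" for x y
  have P: "integrable (lborel \<Otimes>\<^sub>M lborel) (\<lambda>(x, y). P x y)"
  proof (rule Bochner_Integration.integrable_bound)
    show "integrable (lborel \<Otimes>\<^sub>M lborel) (\<lambda>p. sqrt (pi / s\<^sup>2) ^ DIM('a) * (case p of (x, y) \<Rightarrow> norm (u x) * norm (u y)))"
      using integrable_pair_product[OF iu iu] by simp
    show "(\<lambda>(x, y). P x y) \<in> borel_measurable (lborel \<Otimes>\<^sub>M lborel)"
      unfolding P_def[abs_def] heat_def by measurable
    have "heat (s\<^sup>2) z \<le> sqrt (pi / s\<^sup>2) ^ DIM('a)" for z :: 'a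
      unfolding heat_def by (rule mult_left_le) auto
    then have "norm (u x) * norm (u y) * heat (s\<^sup>2) (x - y) \<le> norm (u x) * norm (u y) * sqrt (pi / s\<^sup>2) ^ DIM('a)" for x y
      by (intro mult_left_mono) auto
    moreover have "norm (P x y) = norm (u x) * norm (u y) * heat (s\<^sup>2) (x - y)" for x y
      using s by (simp add: P_def norm_mult heat_nonneg)
    ultimately show "AE p in lborel \<Otimes>\<^sub>M lborel. norm (case p of (x, y) \<Rightarrow> P x y)
        \<le> norm (sqrt (pi / s\<^sup>2) ^ DIM('a) * (case p of (x, y) \<Rightarrow> norm (u x) * norm (u y)))"
      by (intro AE_I2) (auto simp: abs_mult mult_ac)
  qed
  have sub: "of_real ((2 * pi) powr (- real DIM('a))) * (LINT y|lborel. P x y) = (LINT w|lborel. F w x)" for x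
  proof -
    have [measurable]: "P x \<in> borel_measurable borel" unfolding P_def[abs_def] heat_def by measurable
    have "(LINT y|lborel. P x y) = (s ^ DIM('a)) *\<^sub>R (LINT w|lborel. P x (x + (- s) *\<^sub>R w))"
      using lborel_affine_integral(1)[of "P x" "- s" x] s by simp
    also have "of_real ((2 * pi) powr (- real DIM('a))) * \<dots>
        = (LINT w|lborel. of_real ((2 * pi) powr (- real DIM('a)) * s ^ DIM('a)) * P x (x + (- s) *\<^sub>R w))"
      by (simp add: scaleR_conv_of_real)
    also have "\<dots> = (LINT w|lborel. F w x)"
      by (intro Bochner_Integration.integral_cong) (simp_all add: F_def P_def k_def' mult_ac)
    finally show ?thesis .
  qed
  have "complex_of_real (LINT \<xi>|lborel. exp (- s\<^sup>2 * (norm \<xi>)\<^sup>2) * (norm (ft u \<xi>))\<^sup>2)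
      = (LINT \<xi>|lborel. of_real (exp (- s\<^sup>2 * (norm \<xi>)\<^sup>2)) * (ft u \<xi> * cnj (ft u \<xi>)))"
    unfolding integral_complex_of_real[symmetric]
    by (intro Bochner_Integration.integral_cong) (simp_all add: complex_norm_square[symmetric])
  also have "\<dots> = of_real ((2 * pi) powr (- real DIM('a))) * (LINT p|(lborel \<Otimes>\<^sub>M lborel). (case p of (x, y) \<Rightarrow> P x y))"
    unfolding ft_weighted[OF iu iu gi[OF s2]] gaussian_fourier_euclidean(2)[OF s2]
    by (simp add: P_def case_prod_unfold)
  also have "(LINT p|(lborel \<Otimes>\<^sub>M lborel). (case p of (x, y) \<Rightarrow> P x y)) = (LINT x|lborel. LINT y|lborel. P x y)"
    by (rule lborel_pair.integral_fst[OF P, symmetric])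
  also have "of_real ((2 * pi) powr (- real DIM('a))) * \<dots>
      = (LINT x|lborel. of_real ((2 * pi) powr (- real DIM('a))) * (LINT y|lborel. P x y))"
    by simp
  also have "\<dots> = (LINT x|lborel. LINT w|lborel. F w x)"
    unfolding sub ..
  also have "\<dots> = (LINT w|lborel. LINT x|lborel. F w x)"
    by (rule lborel_pair.Fubini_integral[OF F])
  also have "\<dots> = (LINT w|lborel. of_real (k w) * (LINT x|lborel. u x * cnj (u (x - s *\<^sub>R w))))"
    unfolding F_def by simp
  finally have eq: "complex_of_real (LINT \<xi>|lborel. exp (- s\<^sup>2 * (norm \<xi>)\<^sup>2) * (norm (ft u \<xi>))\<^sup>2)
      = (LINT w|lborel. of_real (k w) * (LINT x|lborel. u x * cnj (u (x - s *\<^sub>R w))))" .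
  have iw: "integrable lborel (\<lambda>w. of_real (k w) * (LINT x|lborel. u x * cnj (u (x - s *\<^sub>R w))))"
    using lborel_pair.integrable_fst[OF F] unfolding F_def by simp
  have "(LINT \<xi>|lborel. exp (- s\<^sup>2 * (norm \<xi>)\<^sup>2) * (norm (ft u \<xi>))\<^sup>2)
    = Re (LINT w|lborel. of_real (k w) * (LINT x|lborel. u x * cnj (u (x - s *\<^sub>R w))))"
    unfolding eq[symmetric] by simp
  also have "\<dots> = (LINT w|lborel. Re (of_real (k w) * (LINT x|lborel. u x * cnj (u (x - s *\<^sub>R w)))))"
    by (rule integral_Re[OF iw, symmetric])
  also have "\<dots> = (LINT w|lborel. k w * (LINT x|lborel. u x \<bullet> u (x - s *\<^sub>R w)))"
  proof (intro Bochner_Integration.integral_cong refl)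
    fix w :: 'a
    have "integrable lborel (\<lambda>x. norm (u x * cnj (u (x - s *\<^sub>R w))))"
      using L2_Cauchy_Schwarz(1)[OF u sq_int_translate(1)[OF u, of "s *\<^sub>R w"]] by (simp add: norm_mult)
    then have "integrable lborel (\<lambda>x. u x * cnj (u (x - s *\<^sub>R w)))"
      by (subst (asm) integrable_norm_iff) measurable
    then have "Re (LINT x|lborel. u x * cnj (u (x - s *\<^sub>R w))) = (LINT x|lborel. u x \<bullet> u (x - s *\<^sub>R w))"
      by (simp add: integral_Re[symmetric] inner_complex_def)
    then show "Re (of_real (k w) * (LINT x|lborel. u x * cnj (u (x - s *\<^sub>R w)))) = k w * (LINT x|lborel. u x \<bullet> u (x - s *\<^sub>R w))"
      by simp
  qed
  finally show "(LINT \<xi>|lborel. exp (- s\<^sup>2 * (norm \<xi>)\<^sup>2) * (norm (ft u \<xi>))\<^sup>2)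
      = (LINT w|lborel. k w * (LINT x|lborel. u x \<bullet> u (x - s *\<^sub>R w)))" .
qed

text \<open>In \<open>plancherel_weighted\<close> let \<open>s\<close> tend to zero through
  \<open>1 / (n + 1)\<close>. The averages of the autocorrelation tend to its value at 0 by
  continuity of translations. On the Fourier side the integrands increase, and monotone convergence
  gives the square integrability of \<open>ft u\<close> together with its norm.\<close>

lemma plancherel_bounded_support:
  fixes u :: "'a::euclidean_space \<Rightarrow> complex"
  assumes u: "sq_int u" and supp: "\<And>x. u x \<noteq> 0 \<Longrightarrow> norm x \<le> R"
  shows "sq_int (ft u)" "norm (abs_L2 (ft u)) = norm (abs_L2 u)"
proof -
  have [measurable]: "u \<in> borel_measurable borel" using u by (rule sq_int_measurable)
  define k where "k = (\<lambda>w::'a. (2 * pi) powr (- real DIM('a)) * (sqrt pi ^ DIM('a) * exp (- (1 / 4) * (norm w)\<^sup>2)))"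
  define s where "s n = inverse (real (Suc n))" for n
  have s: "s n > 0" for n by (simp add: s_def)
  have slim: "s \<longlonglongrightarrow> 0" unfolding s_def by (rule LIMSEQ_inverse_real_of_nat)
  note W = plancherel_weighted[OF u supp s, folded k_def]
  have k_nn: "0 \<le> k w" for w by (simp add: k_def)
  have [measurable]: "k \<in> borel_measurable borel" unfolding k_def by measurable
  define c where "c h = (LINT x|lborel. u x \<bullet> u (x - h))" for h
  have c_eq: "c h = abs_L2 u \<bullet> abs_L2 (\<lambda>x. u (x - h))" for h
    unfolding c_def by (rule sq_int_inner(1)[OF u sq_int_translate(1)[OF u], symmetric])
  have [measurable]: "c \<in> borel_measurable borel" unfolding c_def[abs_def] by measurable
  have c_le: "\<bar>c h\<bar> \<le> (norm (abs_L2 u))\<^sup>2" for h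
    using Cauchy_Schwarz_ineq2[of "abs_L2 u" "abs_L2 (\<lambda>x. u (x - h))"]
    by (simp add: c_eq sq_int_translate(2)[OF u] power2_eq_square)
  have "(\<lambda>n. LINT w|lborel. k w * c (s n *\<^sub>R w)) \<longlonglongrightarrow> (LINT w|lborel. k w * (norm (abs_L2 u))\<^sup>2)"
  proof (rule integral_dominated_convergence)
    show "integrable lborel (\<lambda>w. k w * (norm (abs_L2 u))\<^sup>2)" using W(3) by simp
    show "AE w in lborel. (\<lambda>n. k w * c (s n *\<^sub>R w)) \<longlonglongrightarrow> k w * (norm (abs_L2 u))\<^sup>2"
    proof (rule AE_I2)
      fix w :: 'a
      have "(\<lambda>n. s n *\<^sub>R w) \<longlonglongrightarrow> 0 *\<^sub>R w" by (intro tendsto_intros slim)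
      then have "(\<lambda>n. abs_L2 (\<lambda>x. u (x - s n *\<^sub>R w))) \<longlonglongrightarrow> abs_L2 u"
        by (intro L2_translation_continuous[OF u]) simp
      then have "(\<lambda>n. c (s n *\<^sub>R w)) \<longlonglongrightarrow> abs_L2 u \<bullet> abs_L2 u"
        unfolding c_eq by (intro tendsto_intros)
      then show "(\<lambda>n. k w * c (s n *\<^sub>R w)) \<longlonglongrightarrow> k w * (norm (abs_L2 u))\<^sup>2"
        unfolding power2_norm_eq_inner by (intro tendsto_intros)
    qed
    show "AE w in lborel. norm (k w * c (s n *\<^sub>R w)) \<le> k w * (norm (abs_L2 u))\<^sup>2" for n
      using c_le k_nn by (intro AE_I2) (simp add: abs_mult mult_left_mono)
  qed measurable
  also have "(LINT w|lborel. k w * (norm (abs_L2 u))\<^sup>2) = (norm (abs_L2 u))\<^sup>2"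
    using W(4) by simp
  finally have lim: "(\<lambda>n. LINT w|lborel. k w * c (s n *\<^sub>R w)) \<longlonglongrightarrow> (norm (abs_L2 u))\<^sup>2" .
  have W2: "(LINT w|lborel. k w * c (s n *\<^sub>R w)) = (LINT \<xi>|lborel. exp (- (s n)\<^sup>2 * (norm \<xi>)\<^sup>2) * (norm (ft u \<xi>))\<^sup>2)" for n
    unfolding c_def k_def by (rule plancherel_weighted(2)[OF u supp s, symmetric])
  from lim have lim: "(\<lambda>n. LINT \<xi>|lborel. exp (- (s n)\<^sup>2 * (norm \<xi>)\<^sup>2) * (norm (ft u \<xi>))\<^sup>2) \<longlonglongrightarrow> (norm (abs_L2 u))\<^sup>2"
    by (simp only: W2)
  have mono: "mono (\<lambda>n. exp (- (s n)\<^sup>2 * (norm \<xi>)\<^sup>2) * (norm (ft u \<xi>))\<^sup>2)" for \<xi> :: 'a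
  proof (rule monoI)
    fix m n :: nat assume "m \<le> n"
    then have "s n \<le> s m" unfolding s_def by (intro le_imp_inverse_le) auto
    then have "(s n)\<^sup>2 \<le> (s m)\<^sup>2" using s[of n] by (intro power_mono) auto
    then have "exp (- (s m)\<^sup>2 * (norm \<xi>)\<^sup>2) \<le> exp (- (s n)\<^sup>2 * (norm \<xi>)\<^sup>2)"
      by (simp add: mult_right_mono)
    then show "exp (- (s m)\<^sup>2 * (norm \<xi>)\<^sup>2) * (norm (ft u \<xi>))\<^sup>2 \<le> exp (- (s n)\<^sup>2 * (norm \<xi>)\<^sup>2) * (norm (ft u \<xi>))\<^sup>2"
      by (intro mult_right_mono) auto
  qed
  have plim: "(\<lambda>n. exp (- (s n)\<^sup>2 * (norm \<xi>)\<^sup>2) * (norm (ft u \<xi>))\<^sup>2) \<longlonglongrightarrow> (norm (ft u \<xi>))\<^sup>2" for \<xi> :: 'a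
  proof -
    have "(\<lambda>n. exp (- (s n)\<^sup>2 * (norm \<xi>)\<^sup>2) * (norm (ft u \<xi>))\<^sup>2) \<longlonglongrightarrow> exp (- 0\<^sup>2 * (norm \<xi>)\<^sup>2) * (norm (ft u \<xi>))\<^sup>2"
      by (intro tendsto_intros slim)
    then show ?thesis by simp
  qed
  have m: "(\<lambda>\<xi>. (norm (ft u \<xi>))\<^sup>2) \<in> borel_measurable lborel" by measurable
  have I: "integrable lborel (\<lambda>\<xi>. (norm (ft u \<xi>))\<^sup>2)" "(LINT \<xi>|lborel. (norm (ft u \<xi>))\<^sup>2) = (norm (abs_L2 u))\<^sup>2"
    by (rule integral_monotone_convergence_nonneg[OF W(1) _ _ _ lim m]; use mono plim in simp)+
  show sq: "sq_int (ft u)" using I(1) by (simp add: sq_int_def)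
  show "norm (abs_L2 (ft u)) = norm (abs_L2 u)"
    using I(2) sq_int_norm[OF sq] by simp
qed

section \<open>Extension of the transform from truncations to all of L2\<close>

definition trunc :: "real \<Rightarrow> ('a::euclidean_space \<Rightarrow> complex) \<Rightarrow> 'a \<Rightarrow> complex" where
  "trunc r g x = indicator (cball 0 r) x *\<^sub>R g x"

lemma sq_int_trunc: "sq_int g \<Longrightarrow> sq_int (trunc r g)"
  unfolding trunc_def[abs_def] by (rule sq_int_restrict) auto

lemma trunc_support: "trunc r g x \<noteq> 0 \<Longrightarrow> norm x \<le> r"
  by (auto simp: trunc_def indicator_def split: if_splits)

lemma integrable_trunc: "sq_int g \<Longrightarrow> integrable lborel (trunc r g)"
  by (rule sq_int_bounded_support_integrable[OF sq_int_trunc trunc_support])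

lemma trunc_eq: "(\<And>x. g x \<noteq> 0 \<Longrightarrow> norm x \<le> R) \<Longrightarrow> R \<le> r \<Longrightarrow> trunc r g = g"
  by (force simp: trunc_def fun_eq_iff indicator_def)

lemma trunc_tendsto:
  assumes g: "sq_int g" and r: "filterlim r at_top sequentially"
  shows "(\<lambda>n. abs_L2 (trunc (r n) g)) \<longlonglongrightarrow> abs_L2 g"
proof (rule L2_dominated_convergence(3)[OF g])
  show "trunc (r n) g \<in> borel_measurable borel" for n
    using sq_int_trunc[OF g] by (rule sq_int_measurable)
  show "g \<in> borel_measurable borel" using g by (rule sq_int_measurable)
  show "AE x in lborel. (\<lambda>n. trunc (r n) g x) \<longlonglongrightarrow> g x"
  proof (rule AE_I2)
    fix x :: 'a
    have "eventually (\<lambda>n. norm x \<le> r n) sequentially"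
      using r by (simp add: filterlim_at_top)
    then have "eventually (\<lambda>n. trunc (r n) g x = g x) sequentially"
      by eventually_elim (simp add: trunc_def)
    then show "(\<lambda>n. trunc (r n) g x) \<longlonglongrightarrow> g x" by (rule tendsto_eventually)
  qed
  show "norm (trunc (r n) g x) \<le> norm (g x)" for n x
    by (simp add: trunc_def indicator_def)
qed

lemma ft_diff:
  assumes "integrable lborel u" "integrable lborel v"
  shows "ft (\<lambda>x. u x - v x) \<xi> = ft u \<xi> - ft v \<xi>"
  unfolding ft_def right_diff_distrib[symmetric]
  by (subst Bochner_Integration.integral_diff[symmetric, OF assms[THEN integrable_cis_mult]])
     (simp add: algebra_simps)

lemma ft_add:
  assumes "integrable lborel u" "integrable lborel v"
  shows "ft (\<lambda>x. u x + v x) \<xi> = ft u \<xi> + ft v \<xi>"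
  unfolding ft_def distrib_left[symmetric]
  by (subst Bochner_Integration.integral_add[symmetric, OF assms[THEN integrable_cis_mult]])
     (simp add: algebra_simps)

lemma ft_cmult: "ft (\<lambda>x. c * u x) \<xi> = c * ft u \<xi>"
proof -
  have "(LINT x|lborel. cis (- (x \<bullet> \<xi>)) * (c * u x)) = (LINT x|lborel. c * (cis (- (x \<bullet> \<xi>)) * u x))"
    by (intro Bochner_Integration.integral_cong) (auto simp: mult_ac)
  then show ?thesis by (simp add: ft_def mult_ac)
qed

text \<open>The difference of two truncations again has bounded support, so the isometry applies to
  it. Convergence of the truncations themselves thereby becomes the Cauchy property of their
  transforms.\<close>

lemma dist_ft_trunc:
  assumes "sq_int g"
  shows "norm (abs_L2 (ft (trunc r g)) - abs_L2 (ft (trunc q g))) = norm (abs_L2 (trunc r g) - abs_L2 (trunc q g))"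
proof -
  note P = plancherel_bounded_support
  have d: "sq_int (\<lambda>x. trunc r g x - trunc q g x)" by (intro sq_int_diff sq_int_trunc assms)
  have supp: "norm x \<le> max r q" if "trunc r g x - trunc q g x \<noteq> 0" for x
    using that trunc_support[of r g x] trunc_support[of q g x] by fastforce
  have "abs_L2 (ft (trunc r g)) - abs_L2 (ft (trunc q g)) = abs_L2 (\<lambda>\<xi>. ft (trunc r g) \<xi> - ft (trunc q g) \<xi>)"
    by (intro abs_L2_diff sq_int_imp_square_integrable P(1)[OF sq_int_trunc[OF assms] trunc_support])
  also have "(\<lambda>\<xi>. ft (trunc r g) \<xi> - ft (trunc q g) \<xi>) = ft (\<lambda>x. trunc r g x - trunc q g x)"
    using ft_diff[OF integrable_trunc[OF assms] integrable_trunc[OF assms]] by (simp add: fun_eq_iff)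
  also have "norm (abs_L2 (ft (\<lambda>x. trunc r g x - trunc q g x))) = norm (abs_L2 (\<lambda>x. trunc r g x - trunc q g x))"
    by (rule P(2)[OF d supp])
  also have "abs_L2 (\<lambda>x. trunc r g x - trunc q g x) = abs_L2 (trunc r g) - abs_L2 (trunc q g)"
    by (intro abs_L2_diff[symmetric] sq_int_imp_square_integrable sq_int_trunc assms)
  finally show ?thesis .
qed

text \<open>The definition integrates the arbitrary Lebesgue measurable \<open>rep_L2\<close>; an
  integral does not see the choice of representative, so a Borel function may take its
  place.\<close>

lemma fourier_L2_eq_Lim:
  assumes g: "sq_int g"
  shows "fourier_L2 (abs_L2 g) = Lim at_top (\<lambda>r. abs_L2 (ft (trunc r g)))"
proof -
  have "(LINT x:cball 0 r|lebesgue. cis (- (x \<bullet> \<xi>)) * rep_L2 (abs_L2 g) x) = (LINT x|lborel. cis (- (x \<bullet> \<xi>)) * trunc r g x)"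
    for r and \<xi> :: 'a
  proof -
    have [measurable]: "g \<in> borel_measurable borel" using g by (rule sq_int_measurable)
    have [measurable]: "trunc r g \<in> borel_measurable borel" using sq_int_trunc[OF g] by (rule sq_int_measurable)
    have [measurable]: "rep_L2 (abs_L2 g) \<in> borel_measurable lebesgue"
      using square_integrable_rep_L2 by (auto simp: square_integrable_def)
    have m: "(\<lambda>x. cis (- (x \<bullet> \<xi>)) * trunc r g x) \<in> borel_measurable lborel" by measurable
    have c: "(\<lambda>x. cis (- (x \<bullet> \<xi>))) \<in> borel_measurable lebesgue"
      by (rule measurable_completion) measurable
    have i: "(indicator (cball 0 r) :: 'a \<Rightarrow> real) \<in> borel_measurable lebesgue"
      by (rule measurable_completion) (simp add: borel_measurable_indicator)
    have "(LINT x:cball 0 r|lebesgue. cis (- (x \<bullet> \<xi>)) * rep_L2 (abs_L2 g) x) = (LINT x|lebesgue. cis (- (x \<bullet> \<xi>)) * trunc r g x)"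
      unfolding set_lebesgue_integral_def
    proof (rule integral_cong_AE)
      show "AE x in lebesgue. indicator (cball 0 r) x *\<^sub>R (cis (- (x \<bullet> \<xi>)) * rep_L2 (abs_L2 g) x) = cis (- (x \<bullet> \<xi>)) * trunc r g x"
        using rep_abs_L2[OF sq_int_imp_square_integrable[OF g]] by eventually_elim (simp add: trunc_def)
      show "(\<lambda>x. cis (- (x \<bullet> \<xi>)) * trunc r g x) \<in> borel_measurable lebesgue"
        by (rule measurable_completion[OF m])
      show "(\<lambda>x. indicator (cball 0 r) x *\<^sub>R (cis (- (x \<bullet> \<xi>)) * rep_L2 (abs_L2 g) x)) \<in> borel_measurable lebesgue"
        by (intro borel_measurable_scaleR borel_measurable_times i c) measurable
    qed
    then show ?thesis using integral_completion[OF m] by simp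
  qed
  then show ?thesis unfolding fourier_L2_def ft_def[abs_def] by simp
qed

text \<open>Completeness gives a limit along the integers. Any other sequence of radii has the same
  limit, since the truncations at the two radii approach each other in norm. Only with existence of
  the limit does \<open>Lim\<close> in the definition acquire its meaning.\<close>

lemma fourier_L2_tendsto:
  assumes g: "sq_int g"
  shows "((\<lambda>r. abs_L2 (ft (trunc r g))) \<longlongrightarrow> fourier_L2 (abs_L2 g)) at_top"
proof -
  define X where "X n = abs_L2 (ft (trunc (real n) g))" for n
  have lim: "(\<lambda>n. abs_L2 (trunc (real n) g)) \<longlonglongrightarrow> abs_L2 g"
    by (rule trunc_tendsto[OF g filterlim_real_sequentially])
  then have "Cauchy (\<lambda>n. abs_L2 (trunc (real n) g))" by (rule LIMSEQ_imp_Cauchy)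
  then have "Cauchy X"
    unfolding Cauchy_def X_def dist_norm dist_ft_trunc[OF g] .
  then obtain L where L: "X \<longlonglongrightarrow> L" using L2_complete by (auto simp: convergent_def)
  have "((\<lambda>r. abs_L2 (ft (trunc r g))) \<longlongrightarrow> L) at_top"
  proof (rule tendsto_at_topI_sequentially)
    fix r :: "nat \<Rightarrow> real" assume r: "filterlim r at_top sequentially"
    have "(\<lambda>n. abs_L2 (trunc (r n) g) - abs_L2 (trunc (real n) g)) \<longlonglongrightarrow> abs_L2 g - abs_L2 g"
      by (intro tendsto_diff trunc_tendsto[OF g r] lim)
    then have "(\<lambda>n. norm (abs_L2 (trunc (r n) g) - abs_L2 (trunc (real n) g))) \<longlonglongrightarrow> 0"
      by (intro tendsto_norm_zero) simp
    then have "(\<lambda>n. norm (abs_L2 (ft (trunc (r n) g)) - X n)) \<longlonglongrightarrow> 0"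
      unfolding X_def dist_ft_trunc[OF g] .
    then have "(\<lambda>n. abs_L2 (ft (trunc (r n) g)) - X n) \<longlonglongrightarrow> 0"
      by (rule tendsto_norm_zero_cancel)
    from tendsto_add[OF this L] show "(\<lambda>n. abs_L2 (ft (trunc (r n) g))) \<longlonglongrightarrow> L" by simp
  qed
  moreover from this have "fourier_L2 (abs_L2 g) = L"
    unfolding fourier_L2_eq_Lim[OF g] by (intro tendsto_Lim) auto
  ultimately show ?thesis by simp
qed

lemma fourier_L2_tendsto_seq:
  assumes g: "sq_int g"
  shows "(\<lambda>n. abs_L2 (ft (trunc (real n) g))) \<longlonglongrightarrow> fourier_L2 (abs_L2 g)"
  using fourier_L2_tendsto[OF g] filterlim_real_sequentially by (rule filterlim_compose)

lemma fourier_L2_bounded_support: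
  assumes g: "sq_int g" and supp: "\<And>x. g x \<noteq> 0 \<Longrightarrow> norm x \<le> R"
  shows "fourier_L2 (abs_L2 g) = abs_L2 (ft g)"
proof -
  have "eventually (\<lambda>r. abs_L2 (ft (trunc r g)) = abs_L2 (ft g)) at_top"
    using eventually_ge_at_top[of R] by eventually_elim (simp add: trunc_eq[OF supp])
  then have "((\<lambda>r. abs_L2 (ft (trunc r g))) \<longlongrightarrow> abs_L2 (ft g)) at_top" by (rule tendsto_eventually)
  then show ?thesis
    using fourier_L2_tendsto[OF g] by (intro tendsto_unique[OF _ fourier_L2_tendsto[OF g]]) auto
qed

lemma norm_fourier_L2 [simp]: "norm (fourier_L2 u) = norm u"
proof -
  obtain g where g: "sq_int g" "u = abs_L2 g" by (rule L2_ex_sq_int)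
  have "(\<lambda>n. norm (abs_L2 (ft (trunc (real n) g)))) \<longlonglongrightarrow> norm (fourier_L2 u)"
    unfolding g(2) by (intro tendsto_norm fourier_L2_tendsto_seq g)
  moreover have "norm (abs_L2 (ft (trunc r g))) = norm (abs_L2 (trunc r g))" for r
    by (rule plancherel_bounded_support(2)[OF sq_int_trunc[OF g(1)] trunc_support])
  moreover have "(\<lambda>n. norm (abs_L2 (trunc (real n) g))) \<longlonglongrightarrow> norm u"
    unfolding g(2) by (intro tendsto_norm trunc_tendsto[OF g(1)] filterlim_real_sequentially)
  ultimately show ?thesis using LIMSEQ_unique by simp
qed

lemma sq_int_ft_trunc: "sq_int g \<Longrightarrow> sq_int (ft (trunc r g))"
  by (rule plancherel_bounded_support(1)[OF sq_int_trunc trunc_support])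

lemma fourier_L2_add: "fourier_L2 (u + v) = fourier_L2 u + fourier_L2 v"
proof -
  obtain g h where g: "sq_int g" "u = abs_L2 g" and h: "sq_int h" "v = abs_L2 h" by (metis L2_ex_sq_int)
  have s: "sq_int (\<lambda>x. g x + h x)" by (intro sq_int_add g h)
  have t: "ft (trunc r (\<lambda>x. g x + h x)) = (\<lambda>\<xi>. ft (trunc r g) \<xi> + ft (trunc r h) \<xi>)" for r
    using ft_add[OF integrable_trunc[OF g(1)] integrable_trunc[OF h(1)], of r r]
    by (simp add: fun_eq_iff trunc_def[abs_def] scaleR_add_right)
  have "(\<lambda>n. abs_L2 (ft (trunc (real n) g)) + abs_L2 (ft (trunc (real n) h))) \<longlonglongrightarrow> fourier_L2 u + fourier_L2 v"
    unfolding g(2) h(2) by (intro tendsto_add fourier_L2_tendsto_seq g h)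
  then have "(\<lambda>n. abs_L2 (ft (trunc (real n) (\<lambda>x. g x + h x)))) \<longlonglongrightarrow> fourier_L2 u + fourier_L2 v"
    by (simp add: t abs_L2_add sq_int_imp_square_integrable sq_int_ft_trunc g h)
  moreover have "(\<lambda>n. abs_L2 (ft (trunc (real n) (\<lambda>x. g x + h x)))) \<longlonglongrightarrow> fourier_L2 (u + v)"
    using fourier_L2_tendsto_seq[OF s] g h by (simp add: abs_L2_add sq_int_imp_square_integrable)
  ultimately show ?thesis using LIMSEQ_unique by blast
qed

lemma tendsto_mult_L2:
  assumes "bounded_borel m" "(X \<longlongrightarrow> u) F"
  shows "((\<lambda>n. mult_L2 m (X n)) \<longlongrightarrow> mult_L2 m u) F"
proof -
  obtain C where C: "m \<in> borel_measurable borel" "\<And>x. norm (m x) \<le> C"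
    using assms(1) by (auto simp: bounded_borel_def)
  have "bounded_linear (mult_L2 m)"
  proof (rule bounded_linear_intro)
    show "mult_L2 m (x + y) = mult_L2 m x + mult_L2 m y" for x y by (rule mult_L2_add[OF assms(1)])
    show "mult_L2 m (r *\<^sub>R x) = r *\<^sub>R mult_L2 m x" for r x
      by (rule L2_ex_sq_int[of x])
         (simp add: abs_L2_scaleR mult_L2_abs assms(1) sq_int_scaleR sq_int_imp_square_integrable sq_int_bounded_borel_mult)
    show "norm (mult_L2 m x) \<le> norm x * C" for x using norm_mult_L2_le[OF C] by (simp add: mult.commute)
  qed
  then show ?thesis using assms(2) by (rule bounded_linear.tendsto)
qed

lemma fourier_L2_cmult: "fourier_L2 (mult_L2 (\<lambda>_. c) u) = mult_L2 (\<lambda>_. c) (fourier_L2 u)"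
proof -
  obtain g where g: "sq_int g" "u = abs_L2 g" by (rule L2_ex_sq_int)
  have s: "sq_int (\<lambda>x. c * g x)" by (rule sq_int_bounded_borel_mult) (use g in auto)
  have t: "ft (trunc r (\<lambda>x. c * g x)) = (\<lambda>\<xi>. c * ft (trunc r g) \<xi>)" for r
    using ft_cmult[of c "trunc r g"] by (simp add: fun_eq_iff trunc_def[abs_def])
  have "(\<lambda>n. mult_L2 (\<lambda>_. c) (abs_L2 (ft (trunc (real n) g)))) \<longlonglongrightarrow> mult_L2 (\<lambda>_. c) (fourier_L2 u)"
    unfolding g(2) by (intro tendsto_mult_L2 fourier_L2_tendsto_seq g) simp
  then have "(\<lambda>n. abs_L2 (ft (trunc (real n) (\<lambda>x. c * g x)))) \<longlonglongrightarrow> mult_L2 (\<lambda>_. c) (fourier_L2 u)"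
    by (simp add: t mult_L2_abs sq_int_ft_trunc g)
  moreover have "(\<lambda>n. abs_L2 (ft (trunc (real n) (\<lambda>x. c * g x)))) \<longlonglongrightarrow> fourier_L2 (mult_L2 (\<lambda>_. c) u)"
    using fourier_L2_tendsto_seq[OF s] g by (simp add: mult_L2_abs)
  ultimately show ?thesis using LIMSEQ_unique by blast
qed

lemma inner_fourier_L2: "fourier_L2 u \<bullet> fourier_L2 v = u \<bullet> v"
proof -
  have "(norm (fourier_L2 u + fourier_L2 v))\<^sup>2 = (norm (u + v))\<^sup>2"
    by (metis fourier_L2_add norm_fourier_L2)
  then show ?thesis unfolding dot_norm by simp
qed

text \<open>Fubini, because the kernel \<open>cis (- (x \<bullet> \<xi>))\<close> is symmetric in
  \<open>x\<close> and \<xi>. The formula identifies the adjoint of the transform.\<close>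

lemma ft_multiplication_formula:
  assumes u: "integrable lborel u" and v: "integrable lborel v"
  shows "(LINT \<xi>|lborel. ft u \<xi> * v \<xi>) = (LINT x|lborel. u x * ft v x)"
proof -
  have [measurable]: "u \<in> borel_measurable borel" "v \<in> borel_measurable borel"
    using assms by (auto dest: borel_measurable_integrable)
  define H where "H x \<xi> = cis (- (x \<bullet> \<xi>)) * u x * v \<xi>" for x \<xi>
  have H: "integrable (lborel \<Otimes>\<^sub>M lborel) (\<lambda>(x, \<xi>). H x \<xi>)"
  proof (rule Bochner_Integration.integrable_bound[OF integrable_pair_product[OF u v]])
    show "(\<lambda>(x, \<xi>). H x \<xi>) \<in> borel_measurable (lborel \<Otimes>\<^sub>M lborel)"
      unfolding H_def[abs_def] by measurable
  qed (auto simp: H_def norm_mult)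
  have 1: "(LINT x|lborel. H x \<xi>) = (LINT x|lborel. cis (- (x \<bullet> \<xi>)) * u x) * v \<xi>" for \<xi>
    by (simp add: H_def)
  have 2: "(LINT \<xi>|lborel. H x \<xi>) = u x * (LINT \<xi>|lborel. cis (- (\<xi> \<bullet> x)) * v \<xi>)" for x
  proof -
    have "(LINT \<xi>|lborel. H x \<xi>) = (LINT \<xi>|lborel. u x * (cis (- (\<xi> \<bullet> x)) * v \<xi>))"
      unfolding H_def by (intro Bochner_Integration.integral_cong) (auto simp: mult_ac inner_commute)
    then show ?thesis by simp
  qed
  have "(LINT \<xi>|lborel. LINT x|lborel. H x \<xi>) = (LINT x|lborel. LINT \<xi>|lborel. H x \<xi>)"
    by (rule lborel_pair.Fubini_integral[OF H])
  then have eq: "(LINT \<xi>|lborel. (LINT x|lborel. cis (- (x \<bullet> \<xi>)) * u x) * v \<xi>)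
      = (LINT x|lborel. u x * (LINT \<xi>|lborel. cis (- (\<xi> \<bullet> x)) * v \<xi>))"
    unfolding 1 2 .
  define C where "C = complex_of_real ((2 * pi) powr (- real DIM('a) / 2))"
  have "(LINT \<xi>|lborel. ft u \<xi> * v \<xi>) = (LINT \<xi>|lborel. C * ((LINT x|lborel. cis (- (x \<bullet> \<xi>)) * u x) * v \<xi>))"
    unfolding ft_def C_def by (simp only: mult.assoc)
  also have "\<dots> = C * (LINT x|lborel. u x * (LINT \<xi>|lborel. cis (- (\<xi> \<bullet> x)) * v \<xi>))"
    unfolding integral_mult_right_zero eq ..
  also have "\<dots> = (LINT x|lborel. C * (u x * (LINT \<xi>|lborel. cis (- (\<xi> \<bullet> x)) * v \<xi>)))"
    unfolding integral_mult_right_zero ..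
  also have "\<dots> = (LINT x|lborel. u x * ft v x)"
    unfolding ft_def C_def by (intro Bochner_Integration.integral_cong) (auto simp only: mult_ac)
  finally show ?thesis .
qed

section \<open>Adjoint and inverse of the transform\<close>

lemma cnj_L2_add: "cnj_L2 (u + v) = cnj_L2 u + cnj_L2 v"
  by (rule L2_ex_sq_int[of u], rule L2_ex_sq_int[of v])
     (simp add: abs_L2_add cnj_L2_abs sq_int_add sq_int_cnj sq_int_imp_square_integrable)

text \<open>The transform is symmetric for the bilinear pairing, so its adjoint is its complex conjugate,
  again an isometry; an operator that is isometric together with its adjoint is bijective.\<close>

definition fourier_adj :: "('a::euclidean_space, complex) L2 \<Rightarrow> ('a, complex) L2" where
  "fourier_adj u = cnj_L2 (fourier_L2 (cnj_L2 u))"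

lemma fourier_adjoint: "fourier_L2 u \<bullet> v = u \<bullet> fourier_adj v"
proof -
  obtain g h where g: "sq_int g" "u = abs_L2 g" and h: "sq_int h" "cnj_L2 v = abs_L2 h" by (metis L2_ex_sq_int)
  have *: "abs_L2 (ft (trunc n g)) \<bullet> cnj_L2 (abs_L2 (trunc n h)) = abs_L2 (trunc n g) \<bullet> cnj_L2 (abs_L2 (ft (trunc n h)))" for n
  proof -
    note sq = sq_int_trunc[OF g(1), of n] sq_int_trunc[OF h(1), of n] sq_int_ft_trunc[OF g(1), of n] sq_int_ft_trunc[OF h(1), of n]
    have i: "integrable lborel (\<lambda>x. a x * b x)" if "sq_int a" "sq_int b" for a b :: "'a \<Rightarrow> complex"
    proof -
      have [measurable]: "a \<in> borel_measurable borel" "b \<in> borel_measurable borel"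
        using that by (auto dest: sq_int_measurable)
      have "(\<lambda>x. a x * b x) \<in> borel_measurable lborel" by measurable
      then show ?thesis
        using L2_Cauchy_Schwarz(1)[OF that] integrable_norm_iff[of "\<lambda>x. a x * b x" lborel]
        by (simp add: norm_mult)
    qed
    \<comment> \<open>The real inner product with a conjugate is the real part of the bilinear
      pairing, the form in which the multiplication formula applies.\<close>
    have in1: "abs_L2 a \<bullet> cnj_L2 (abs_L2 b) = Re (LINT x|lborel. a x * b x)" if "sq_int a" "sq_int b" for a b :: "'a \<Rightarrow> complex"
      using that i[OF that] by (simp add: cnj_L2_abs sq_int_inner sq_int_cnj inner_complex_def integral_Re[symmetric])
    show ?thesis
      unfolding in1[OF sq(3,2)] in1[OF sq(1,4)]
      using ft_multiplication_formula[OF integrable_trunc[OF g(1)] integrable_trunc[OF h(1)]] by simp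
  qed
  have c: "bounded_linear (cnj_L2 :: ('a, complex) L2 \<Rightarrow> ('a, complex) L2)"
  proof (rule bounded_linear_intro)
    show "cnj_L2 (x + y) = cnj_L2 x + cnj_L2 y" for x y :: "('a, complex) L2"
      by (rule cnj_L2_add)
    show "cnj_L2 (r *\<^sub>R x) = r *\<^sub>R cnj_L2 x" for r and x :: "('a, complex) L2"
      by (rule L2_ex_sq_int[of x])
         (simp add: abs_L2_scaleR cnj_L2_abs sq_int_scaleR sq_int_imp_square_integrable sq_int_cnj)
    show "norm (cnj_L2 x) \<le> norm x * 1" for x :: "('a, complex) L2" by simp
  qed
  have "(\<lambda>n. abs_L2 (ft (trunc (real n) g)) \<bullet> cnj_L2 (abs_L2 (trunc (real n) h))) \<longlonglongrightarrow> fourier_L2 u \<bullet> cnj_L2 (cnj_L2 v)"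
    unfolding g(2) h(2)
    by (intro tendsto_inner fourier_L2_tendsto_seq g bounded_linear.tendsto[OF c] trunc_tendsto[OF h(1)] filterlim_real_sequentially)
  moreover have "(\<lambda>n. abs_L2 (trunc (real n) g) \<bullet> cnj_L2 (abs_L2 (ft (trunc (real n) h)))) \<longlonglongrightarrow> u \<bullet> fourier_adj v"
    unfolding g(2) fourier_adj_def h(2)
    by (intro tendsto_inner fourier_L2_tendsto_seq h bounded_linear.tendsto[OF c] trunc_tendsto[OF g(1)] filterlim_real_sequentially)
  ultimately show ?thesis unfolding * using LIMSEQ_unique by simp
qed

lemma fourier_adj_fourier_L2: "fourier_adj (fourier_L2 v) = v"
proof -
  have "u \<bullet> (fourier_adj (fourier_L2 v) - v) = 0" for u
    by (simp add: inner_diff_right fourier_adjoint[symmetric] inner_fourier_L2)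
  from this[of "fourier_adj (fourier_L2 v) - v"] show ?thesis by simp
qed

text \<open>Complex conjugation exchanges the transform and its adjoint, so the left inverse
  property of \<open>fourier_adj\<close> at \<open>cnj_L2 v\<close> turns into the right inverse
  property at \<open>v\<close>. Surjectivity follows from this.\<close>

lemma fourier_L2_fourier_adj: "fourier_L2 (fourier_adj v) = v"
proof -
  have "cnj_L2 (fourier_adj (fourier_L2 (cnj_L2 v))) = v"
    by (simp add: fourier_adj_fourier_L2)
  then show ?thesis by (simp add: fourier_adj_def)
qed

lemma inv_fourier_L2: "inv fourier_L2 = fourier_adj"
  by (rule inv_equality) (auto simp: fourier_adj_fourier_L2 fourier_L2_fourier_adj)

section \<open>Multipliers as multiplication operators on the Fourier side\<close>

lemma fourier_L2_multiplier:
  "fourier_L2 (fourier_multiplier m u) = mult_L2 m (fourier_L2 u)"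
  by (simp add: fourier_multiplier_def inv_fourier_L2 fourier_L2_fourier_adj mult_L2_def)

lemma fourier_L2_inject: "fourier_L2 u = fourier_L2 v \<longleftrightarrow> u = v"
  by (metis fourier_adj_fourier_L2)

lemma fourier_multiplier_cmult:
  assumes "bounded_borel m"
  shows "fourier_multiplier m (mult_L2 (\<lambda>_. c) u) = mult_L2 (\<lambda>_. c) (fourier_multiplier m u)"
  by (subst fourier_L2_inject[symmetric])
     (simp add: fourier_L2_multiplier fourier_L2_cmult mult_L2_mult_L2 assms mult.commute)

lemma inner_fourier_multiplier:
  "fourier_multiplier m u \<bullet> v = mult_L2 m (fourier_L2 u) \<bullet> fourier_L2 v"
  by (subst inner_fourier_L2[symmetric]) (simp add: fourier_L2_multiplier)

lemma fourier_multiplier_self_adjoint: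
  assumes "bounded_borel (\<lambda>x. of_real (m x))"
  shows "fourier_multiplier (\<lambda>x. of_real (m x)) u \<bullet> v = u \<bullet> fourier_multiplier (\<lambda>x. of_real (m x)) v"
proof -
  have "fourier_multiplier (\<lambda>x. of_real (m x)) u \<bullet> v = fourier_L2 u \<bullet> mult_L2 (\<lambda>x. of_real (m x)) (fourier_L2 v)"
    unfolding inner_fourier_multiplier by (rule inner_mult_L2_real[OF assms])
  also have "\<dots> = u \<bullet> fourier_multiplier (\<lambda>x. of_real (m x)) v"
    by (simp add: inner_commute[of _ "mult_L2 _ _"] inner_commute[of u] inner_fourier_multiplier)
  finally show ?thesis .
qed

section \<open>Singular values and orthonormal systems\<close>

text \<open>Orthonormality refers to the real inner product; systems are indexed so that the
  \<open>i\<close>-th members of two systems can be paired.\<close>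

definition orthonormal_on :: "'i set \<Rightarrow> ('i \<Rightarrow> 'v::real_inner) \<Rightarrow> bool" where
  "orthonormal_on I e \<longleftrightarrow> (\<forall>i\<in>I. \<forall>j\<in>I. e i \<bullet> e j = (if i = j then 1 else 0))"

lemma norm_orthonormal_sum:
  assumes "finite I" "orthonormal_on I e"
  shows "(norm (\<Sum>i\<in>I. c i *\<^sub>R e i))\<^sup>2 = (\<Sum>i\<in>I. (c i)\<^sup>2)"
proof -
  have "(\<Sum>i\<in>I. c i *\<^sub>R e i) \<bullet> (\<Sum>j\<in>I. c j *\<^sub>R e j) = (\<Sum>i\<in>I. \<Sum>j\<in>I. c i * (c j * (if i = j then 1 else 0)))"
    unfolding inner_sum_left inner_sum_right
    using assms(2) by (intro sum.cong) (auto simp: orthonormal_on_def)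
  also have "\<dots> = (\<Sum>i\<in>I. (c i)\<^sup>2)"
    using assms(1) by (intro sum.cong) (simp_all add: power2_eq_square if_distrib cong: if_cong)
  finally show ?thesis by (simp add: power2_norm_eq_inner)
qed

text \<open>With \<open>w = \<Sum>i\<in>I. (A (e i) \<bullet> v) e i\<close>, the left-hand side is \<open>A w \<bullet> v\<close> and also
  equals \<open>norm w ^ 2\<close>; this avoids the adjoint of \<open>A\<close>.\<close>

lemma orthonormal_Bessel_operator:
  assumes I: "finite I" "orthonormal_on I e" and "linear A"
    and s: "\<And>x. norm (A x) \<le> s * norm x" and "0 \<le> s"
  shows "(\<Sum>i\<in>I. (A (e i) \<bullet> v)\<^sup>2) \<le> (s * norm v)\<^sup>2"
proof -
  define c where "c i = A (e i) \<bullet> v" for i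
  define w where "w = (\<Sum>i\<in>I. c i *\<^sub>R e i)"
  have nw: "(norm w)\<^sup>2 = (\<Sum>i\<in>I. (c i)\<^sup>2)"
    unfolding w_def by (rule norm_orthonormal_sum[OF I])
  have "A w = (\<Sum>i\<in>I. c i *\<^sub>R A (e i))"
    unfolding w_def by (simp add: linear_sum[OF \<open>linear A\<close>] linear_cmul[OF \<open>linear A\<close>])
  then have "A w \<bullet> v = (\<Sum>i\<in>I. (c i)\<^sup>2)"
    by (simp add: inner_sum_left c_def power2_eq_square)
  then have "(norm w)\<^sup>2 = A w \<bullet> v" using nw by simp
  also have "\<dots> \<le> norm (A w) * norm v" by (rule norm_cauchy_schwarz)
  also have "\<dots> \<le> s * norm w * norm v" using s by (intro mult_right_mono) auto
  finally have "norm w * norm w \<le> norm w * (s * norm v)" by (simp add: power2_eq_square mult_ac)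
  then have "norm w \<le> s * norm v"
    using \<open>0 \<le> s\<close> by (cases "norm w = 0") (auto dest: mult_left_le_imp_le)
  then have "(norm w)\<^sup>2 \<le> (s * norm v)\<^sup>2" by (intro power_mono) auto
  then show ?thesis using nw by (simp add: c_def)
qed

lemma orthonormal_basis_span:
  fixes S :: "'v::real_inner set"
  assumes "finite S"
  shows "\<exists>B. finite B \<and> card B \<le> card S \<and> orthonormal_on B id \<and> span S \<subseteq> span B"
proof -
  obtain C where C: "finite C" "card C \<le> card S" "span C = span S" "pairwise orthogonal C"
    using basis_orthogonal[OF assms] by blast
  define f :: "'v \<Rightarrow> 'v" where "f x = x /\<^sub>R norm x" for x
  \<comment> \<open>The orthogonal set \<open>C\<close> may contain the zero vector, which cannot be
    normalised and does not contribute to the span.\<close>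
  define B where "B = f ` (C - {0})"
  have "card B \<le> card (C - {0})" unfolding B_def using C(1) by (intro card_image_le) auto
  also have "\<dots> \<le> card C" using C(1) by (intro card_mono) auto
  finally have "card B \<le> card S" using C(2) by linarith
  moreover have "orthonormal_on B id"
    unfolding orthonormal_on_def B_def
  proof (intro ballI)
    fix x y assume "x \<in> f ` (C - {0})" "y \<in> f ` (C - {0})"
    then obtain a b where ab: "x = f a" "y = f b" "a \<in> C" "a \<noteq> 0" "b \<in> C" "b \<noteq> 0" by blast
    show "id x \<bullet> id y = (if x = y then 1 else 0)"
    proof (cases "a = b")
      case True
      then show ?thesis using ab by (simp add: f_def dot_square_norm power2_eq_square)
    next
      case False
      then have 0: "a \<bullet> b = 0" using C(4) ab by (auto simp: pairwise_def orthogonal_def)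
      then have xy: "x \<bullet> y = 0" using ab by (simp add: f_def)
      moreover have "x \<noteq> y"
      proof
        assume "x = y"
        with xy have "x = 0" by simp
        then show False using ab by (simp add: f_def)
      qed
      ultimately show ?thesis by simp
    qed
  qed
  moreover have "span S \<subseteq> span B"
  proof -
    have "x \<in> span B" if "x \<in> C" for x
    proof (cases "x = 0")
      case False
      then have "x = norm x *\<^sub>R f x" by (simp add: f_def)
      moreover have "f x \<in> span B" using that False by (intro span_base) (auto simp: B_def)
      ultimately show ?thesis by (metis span_scale)
    qed (simp add: span_zero)
    then have "span C \<subseteq> span B" by (intro span_minimal) auto
    then show ?thesis using C(3) by simp
  qed
  moreover have "finite B" using C(1) by (simp add: B_def)
  ultimately show ?thesis by blast
qed

lemma orthonormal_span_expand:
  assumes "finite B" "orthonormal_on B id" "y \<in> span B"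
  shows "y = (\<Sum>b\<in>B. (y \<bullet> b) *\<^sub>R b)"
proof -
  obtain u where u: "y = (\<Sum>b\<in>B. u b *\<^sub>R b)"
    using assms(1,3) by (auto simp: span_finite)
  have "y \<bullet> b = u b" if "b \<in> B" for b
  proof -
    have "y \<bullet> b = (\<Sum>x\<in>B. u x * (if x = b then 1 else 0))"
      unfolding u inner_sum_left using assms(2) that
      by (intro sum.cong) (auto simp: orthonormal_on_def)
    then show ?thesis using assms(1) that by (simp add: if_distrib cong: if_cong)
  qed
  then show ?thesis using u by simp
qed

text \<open>The trace norm is at most the rank times the operator norm, expressed through
  orthonormal systems. Expand \<open>A (e i)\<close> in an orthonormal basis \<open>B\<close> of a
  space containing the range. For each \<open>b\<close> the sum over \<open>i\<close> is bounded by
  Cauchy-Schwarz, and Bessel's inequality bounds the two factors by \<open>s\<close> and 1.\<close>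

lemma finite_rank_sum_bound:
  fixes A :: "'v::real_inner \<Rightarrow> 'v" and s :: real
  assumes "linear A" and s: "\<And>x. norm (A x) \<le> s * norm x" and "0 \<le> s"
    and S: "finite S" "range A \<subseteq> span S"
    and e: "finite I" "orthonormal_on I e" "orthonormal_on I g"
  shows "(\<Sum>i\<in>I. \<bar>A (e i) \<bullet> g i\<bar>) \<le> card S * s"
proof -
  obtain B where B: "finite B" "card B \<le> card S" "orthonormal_on B id" "span S \<subseteq> span B"
    using orthonormal_basis_span[OF S(1)] by blast
  have "\<bar>A (e i) \<bullet> g i\<bar> \<le> (\<Sum>b\<in>B. \<bar>A (e i) \<bullet> b\<bar> * \<bar>id (g i) \<bullet> b\<bar>)" for i
  proof -
    have "A (e i) = (\<Sum>b\<in>B. (A (e i) \<bullet> b) *\<^sub>R b)"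
      by (rule orthonormal_span_expand) (use B S in auto)
    then have "A (e i) \<bullet> g i = (\<Sum>b\<in>B. (A (e i) \<bullet> b) *\<^sub>R b) \<bullet> g i" by (rule arg_cong)
    also have "\<dots> = (\<Sum>b\<in>B. (A (e i) \<bullet> b) * (g i \<bullet> b))"
      unfolding inner_sum_left inner_scaleR_left by (simp only: inner_commute[of "g i"])
    finally have "A (e i) \<bullet> g i = (\<Sum>b\<in>B. (A (e i) \<bullet> b) * (g i \<bullet> b))" .
    then show ?thesis using sum_abs[of "\<lambda>b. (A (e i) \<bullet> b) * (g i \<bullet> b)" B] by (simp add: abs_mult)
  qed
  then have "(\<Sum>i\<in>I. \<bar>A (e i) \<bullet> g i\<bar>) \<le> (\<Sum>i\<in>I. \<Sum>b\<in>B. \<bar>A (e i) \<bullet> b\<bar> * \<bar>id (g i) \<bullet> b\<bar>)"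
    by (intro sum_mono)
  also have "\<dots> = (\<Sum>b\<in>B. \<Sum>i\<in>I. \<bar>A (e i) \<bullet> b\<bar> * \<bar>id (g i) \<bullet> b\<bar>)" by (rule sum.swap)
  also have "\<dots> \<le> (\<Sum>b\<in>B. s)"
  proof (rule sum_mono)
    fix b assume "b \<in> B"
    then have nb: "norm b = 1" using B(3) by (auto simp: orthonormal_on_def norm_eq_1)
    have "(\<Sum>i\<in>I. \<bar>A (e i) \<bullet> b\<bar> * \<bar>id (g i) \<bullet> b\<bar>) \<le> L2_set (\<lambda>i. A (e i) \<bullet> b) I * L2_set (\<lambda>i. id (g i) \<bullet> b) I"
      by (rule L2_set_mult_ineq)
    also have "\<dots> \<le> s * 1"
    proof (rule mult_mono)
      show "L2_set (\<lambda>i. A (e i) \<bullet> b) I \<le> s"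
        unfolding L2_set_def using orthonormal_Bessel_operator[OF e(1,2) \<open>linear A\<close> s \<open>0 \<le> s\<close>, of b] \<open>0 \<le> s\<close> nb
        by (intro real_le_lsqrt) auto
      show "L2_set (\<lambda>i. id (g i) \<bullet> b) I \<le> 1"
        unfolding L2_set_def using orthonormal_Bessel_operator[OF e(1,3) linear_id, of 1 b] nb
        by (intro real_le_lsqrt) auto
    qed (use \<open>0 \<le> s\<close> in \<open>auto simp: L2_set_nonneg\<close>)
    finally show "(\<Sum>i\<in>I. \<bar>A (e i) \<bullet> b\<bar> * \<bar>id (g i) \<bullet> b\<bar>) \<le> s" by simp
  qed
  also have "\<dots> \<le> card S * s" using B(2) \<open>0 \<le> s\<close> by (simp add: mult_right_mono)
  finally show ?thesis .
qed

section \<open>From complex rank to real spans\<close>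

lemma scaleR_eq_cscale: "a *\<^sub>R u = of_real a *\<^sub>C u"
proof (transfer fixing: a)
  fix f :: "'a \<Rightarrow> complex^'b" assume f: "square_integrable f \<and> square_integrable f \<and> (AE x in lebesgue. f x = f x)"
  have eq: "a *\<^sub>R f x = of_real a *s f x" for x
    by (simp add: vec_eq_iff) (simp add: scaleR_conv_of_real)
  then show "square_integrable (\<lambda>x. a *\<^sub>R f x) \<and> square_integrable (\<lambda>x. of_real a *s f x) \<and>
      (AE x in lebesgue. a *\<^sub>R f x = of_real a *s f x)"
    using f square_integrable_scaleR[of f a] by (simp add: eq)
qed

lemma cspan_subset_span: "cL2.span S \<subseteq> span (S \<union> (\<lambda>u. \<i> *\<^sub>C u) ` S)"
proof
  fix x assume "x \<in> cL2.span S"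
  then show "x \<in> span (S \<union> (\<lambda>u. \<i> *\<^sub>C u) ` S)" (is "x \<in> span ?T")
  proof (induction rule: cL2.span_induct_alt)
    case base
    show ?case by (rule span_zero)
  next
    case (step c x y)
    have "c *\<^sub>C x = (of_real (Re c) + of_real (Im c) * \<i>) *\<^sub>C x"
      by (simp add: complex_eq mult.commute)
    also have "\<dots> = Re c *\<^sub>R x + Im c *\<^sub>R (\<i> *\<^sub>C x)"
      by (simp only: cL2.scale_left_distrib scaleR_eq_cscale cL2.scale_scale)
    also have "\<dots> \<in> span ?T"
      using step(1) by (intro span_add span_scale span_base) auto
    finally show ?case using step by (intro span_add)
  qed
qed

text \<open>Rank is defined by complex spans, while \<open>finite_rank_sum_bound\<close> counts real
  dimensions. Adjoining \<open>\<i> *\<^sub>C u\<close> for each spanning vector \<open>u\<close>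
  costs the factor 2.\<close>

lemma rank_le_real_span:
  assumes "rank_le R t"
  shows "\<exists>S. finite S \<and> real (card S) \<le> 2 * t \<and> range R \<subseteq> span S"
proof -
  obtain S where S: "finite S" "real (card S) \<le> t" "range R \<subseteq> cL2.span S"
    using assms by (auto simp: rank_le_def)
  have "card (S \<union> (\<lambda>u. \<i> *\<^sub>C u) ` S) \<le> card S + card S"
    using S(1) by (metis (no_types, lifting) card_Un_le card_image_le add_left_mono order_trans)
  then have "real (card (S \<union> (\<lambda>u. \<i> *\<^sub>C u) ` S)) \<le> 2 * t" using S(2) by linarith
  then show ?thesis using S cspan_subset_span[of S] by (intro exI[of _ "S \<union> (\<lambda>u. \<i> *\<^sub>C u) ` S"]) auto
qed

lemma singular_value_approx:
  fixes T :: "('a::euclidean_space, complex^'b) L2 \<Rightarrow> ('a, complex^'b) L2"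
  assumes T: "bounded_clinear T" and "0 \<le> t" and "singular_value t T < \<eta>"
  shows "\<exists>R S. bounded_linear R \<and> finite S \<and> real (card S) \<le> 2 * t \<and> range R \<subseteq> span S \<and>
    (\<forall>u. norm (T u - R u) \<le> \<eta> * norm u)"
proof -
  \<comment> \<open>The zero operator has rank at most any \<open>t \<ge> 0\<close>, so the infimum
    runs over a nonempty set and the strict inequality yields a member below \<eta>.\<close>
  have "bounded_clinear (\<lambda>u::('a, complex^'b) L2. 0 :: ('a, complex^'b) L2)"
    by (simp add: bounded_clinear_def bounded_linear_zero)
  moreover have "rank_le (\<lambda>u::('a, complex^'b) L2. 0 :: ('a, complex^'b) L2) t"
    unfolding rank_le_def using \<open>0 \<le> t\<close> by (intro exI[of _ "{}"]) auto
  ultimately have ne: "{onorm (\<lambda>u. T u - R u) | R. bounded_clinear R \<and> rank_le R t} \<noteq> {}" by blast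
  from cInf_lessD[OF ne] assms(3) obtain R where R: "bounded_clinear R" "rank_le R t" "onorm (\<lambda>u. T u - R u) < \<eta>"
    unfolding singular_value_def by auto
  have bl: "bounded_linear R" "bounded_linear (\<lambda>u. T u - R u)"
    using T R by (auto simp: bounded_clinear_def intro: bounded_linear_sub)
  have "norm (T u - R u) \<le> \<eta> * norm u" for u
    using onorm[OF bl(2), of u] R(3) mult_right_mono[of "onorm (\<lambda>u. T u - R u)" \<eta> "norm u"] by simp
  then show ?thesis using rank_le_real_span[OF R(2)] bl(1) by blast
qed

text \<open>Telescope over approximants \<open>R j\<close> of rank \<open>O(2\<^sup>j)\<close>: the differences \<open>R (Suc j) - R j\<close> have rank
  \<open>O(2\<^sup>j)\<close> and norm \<open>O(\<eta> j)\<close> with \<open>\<eta> j = o(2\<^bsup>-j/d\<^esup>)\<close>, and the exponent \<open>1 - 1/d\<close> is positive.\<close>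

lemma sum_singular_values_estimate:
  fixes T :: "('a::euclidean_space, complex^'n) L2 \<Rightarrow> ('a, complex^'n) L2"
  assumes T: "bounded_clinear T" and d: "d \<ge> 2"
    and lim: "((\<lambda>t::real. t powr (1 / real d) * singular_value t T) \<longlongrightarrow> 0) at_top"
    and "\<delta> > 0"
  shows "\<exists>n0. \<forall>n\<ge>n0. \<forall>(I::'i set) e g. finite I \<longrightarrow> card I \<le> n \<longrightarrow> orthonormal_on I e \<longrightarrow> orthonormal_on I g \<longrightarrow>
    (\<Sum>i\<in>I. \<bar>T (e i) \<bullet> g i\<bar>) \<le> \<delta> * real n powr (1 - 1 / real d)"
proof -
  \<comment> \<open>Of the 51 shares, 48 pay for the telescoped sum, 2 for the remainder
    \<open>T - R m\<close>, and 1 for the constant \<open>K\<close> of the initial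
    approximant.\<close>
  define \<delta>' where "\<delta>' = \<delta> / 51"
  have \<delta>': "\<delta>' > 0" using \<open>\<delta> > 0\<close> by (simp add: \<delta>'_def)
  define \<alpha> where "\<alpha> = 1 / real d"
  have \<alpha>: "0 < \<alpha>" "\<alpha> \<le> 1 / 2" using d by (auto simp: \<alpha>_def field_simps)
  \<comment> \<open>\<open>q\<close> is the growth rate of rank times norm from one dyadic level to
    the next. As \<open>d \<ge> 2\<close> it is at least \<open>sqrt 2\<close>, and the bound
    \<open>4 / 3\<close> suffices to close the induction for \<open>main\<close>.\<close>
  define q where "q = 2 powr (1 - \<alpha>)"
  have q: "q \<ge> 4 / 3"
  proof -
    have "4 / 3 \<le> sqrt 2" by (rule real_le_rsqrt) (simp add: power2_eq_square)
    also have "sqrt 2 = 2 powr (1 / 2)" by (simp add: powr_half_sqrt)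
    also have "\<dots> \<le> q" unfolding q_def using \<alpha> by (intro powr_mono) auto
    finally show ?thesis .
  qed
  define \<eta> where "\<eta> j = \<delta>' * (2 ^ j) powr (- \<alpha>)" for j :: nat
  have \<eta>_pos: "\<eta> j > 0" for j using \<delta>' by (simp add: \<eta>_def)
  have q_pow: "q ^ j = 2 ^ j * (2 ^ j) powr (- \<alpha>)" for j :: nat
  proof -
    have "q ^ j = (2 powr (1 - \<alpha>)) powr real j" using q by (simp add: q_def powr_realpow)
    also have "\<dots> = (2 powr real j) powr (1 + - \<alpha>)" by (simp add: powr_powr mult.commute)
    also have "\<dots> = (2 powr real j) powr 1 * (2 powr real j) powr (- \<alpha>)" by (rule powr_add)
    finally show ?thesis by (simp add: powr_realpow)
  qed
  have \<eta>_q: "2 ^ j * \<eta> j = \<delta>' * q ^ j" for j by (simp add: \<eta>_def q_pow)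
  have \<eta>_Suc: "\<eta> j \<le> 2 * \<eta> (Suc j)" for j
  proof -
    have "(2::real) powr \<alpha> \<le> 2 powr 1" using \<alpha> by (intro powr_mono) auto
    moreover have "(2 ^ j) powr (- \<alpha>) = 2 powr \<alpha> * (2 ^ Suc j) powr (- \<alpha>)"
      by (simp add: powr_mult powr_minus)
    ultimately have "(2 ^ j) powr (- \<alpha>) \<le> 2 * (2 ^ Suc j) powr (- \<alpha>)"
      by (simp add: mult_right_mono)
    from mult_left_mono[OF this, of \<delta>'] show ?thesis using \<delta>' by (simp add: \<eta>_def)
  qed
  from order_tendstoD(2)[OF lim \<delta>'] obtain t0 where
    t0: "\<And>t. t \<ge> t0 \<Longrightarrow> t powr \<alpha> * singular_value t T < \<delta>'"
    unfolding eventually_at_top_linorder \<alpha>_def by blast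
  obtain j0 where j0: "t0 \<le> 2 ^ j0"
    using real_arch_pow[of 2 t0] by (auto intro: less_imp_le)
  have sv: "singular_value (2 ^ j) T < \<eta> j" if "j \<ge> j0" for j
  proof -
    have "(2::real) ^ j0 \<le> 2 ^ j" using that by (intro power_increasing) auto
    then have *: "(2 ^ j) powr \<alpha> * singular_value (2 ^ j) T < \<delta>'" using j0 by (intro t0) linarith
    have "singular_value (2 ^ j) T = (2 ^ j) powr (- \<alpha>) * ((2 ^ j) powr \<alpha> * singular_value (2 ^ j) T)"
      by (simp add: powr_minus)
    also have "\<dots> < (2 ^ j) powr (- \<alpha>) * \<delta>'"
      using * by (intro mult_strict_left_mono) auto
    finally show ?thesis by (simp add: \<eta>_def mult.commute)
  qed
  have "\<forall>j. \<exists>R S. j \<ge> j0 \<longrightarrow> bounded_linear R \<and> finite S \<and> real (card S) \<le> 2 * 2 ^ j \<and> range R \<subseteq> span S \<and>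
    (\<forall>u. norm (T u - R u) \<le> \<eta> j * norm u)"
    using singular_value_approx[OF T _ sv] by (meson zero_le_power zero_le_numeral)
  then obtain R S where RS: "\<And>j. j \<ge> j0 \<Longrightarrow> bounded_linear (R j)" "\<And>j. j \<ge> j0 \<Longrightarrow> finite (S j)"
    "\<And>j. j \<ge> j0 \<Longrightarrow> real (card (S j)) \<le> 2 * 2 ^ j" "\<And>j. j \<ge> j0 \<Longrightarrow> range (R j) \<subseteq> span (S j)"
    "\<And>j u. j \<ge> j0 \<Longrightarrow> norm (T u - R j u) \<le> \<eta> j * norm u"
    by metis
  \<comment> \<open>The initial operator \<open>R j0\<close> has fixed finite rank, so its
    contribution is bounded independently of the number of vectors; for large \<open>n\<close> it is
    absorbed by the growing power of \<open>n\<close>.\<close>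
  define K where "K = real (card (S j0)) * onorm (R j0)"
  \<comment> \<open>One step costs rank \<open>4 * 2 ^ Suc m\<close> times norm
    \<open>3 * \<eta> (Suc m)\<close>, that is \<open>12 * \<delta>' * q ^ Suc m\<close>. The
    earlier part is at most \<open>36 * \<delta>' * q ^ Suc m\<close> because
    \<open>48 \<le> 36 * q\<close>, so the constant 48 reproduces itself.\<close>
  have main: "(\<Sum>i\<in>I. \<bar>R m (e i) \<bullet> g i\<bar>) \<le> K + 48 * \<delta>' * q ^ m"
    if "m \<ge> j0" and I: "finite I" "orthonormal_on I e" "orthonormal_on I g" for m and I :: "'i set" and e g
    using \<open>m \<ge> j0\<close>
  proof (induction m rule: dec_induct)
    case base
    have bl: "bounded_linear (R j0)" using RS(1) by simp
    have "(\<Sum>i\<in>I. \<bar>R j0 (e i) \<bullet> g i\<bar>) \<le> K"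
      unfolding K_def
      by (rule finite_rank_sum_bound[OF bounded_linear.linear[OF bl] onorm[OF bl] onorm_pos_le[OF bl] RS(2,4) I]) auto
    moreover have "0 \<le> 48 * \<delta>' * q ^ j0" using \<delta>' q by simp
    ultimately show ?case by linarith
  next
    case (step m)
    define A where "A u = R (Suc m) u - R m u" for u
    have m: "m \<ge> j0" "Suc m \<ge> j0" using step by auto
    have bl: "bounded_linear A" unfolding A_def[abs_def] using RS(1) m by (intro bounded_linear_sub)
    have nA: "norm (A u) \<le> (3 * \<eta> (Suc m)) * norm u" for u
    proof -
      have "A u = (T u - R m u) - (T u - R (Suc m) u)" by (simp add: A_def)
      then have "norm (A u) \<le> norm (T u - R m u) + norm (T u - R (Suc m) u)" by (metis norm_triangle_ineq4)
      also have "\<dots> \<le> \<eta> m * norm u + \<eta> (Suc m) * norm u" using RS(5) m by (intro add_mono) auto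
      also have "\<dots> = (\<eta> m + \<eta> (Suc m)) * norm u" by (simp add: distrib_right)
      also have "\<dots> \<le> (3 * \<eta> (Suc m)) * norm u" using \<eta>_Suc[of m] by (intro mult_right_mono) auto
      finally show ?thesis .
    qed
    let ?S = "S (Suc m) \<union> S m"
    have "R (Suc m) u \<in> span ?S" "R m u \<in> span ?S" for u
      using RS(4)[OF m(1)] RS(4)[OF m(2)] span_mono[of "S m" ?S] span_mono[of "S (Suc m)" ?S] by auto
    then have ran: "range A \<subseteq> span ?S" by (auto simp: A_def intro: span_diff)
    have "(\<Sum>i\<in>I. \<bar>A (e i) \<bullet> g i\<bar>) \<le> real (card ?S) * (3 * \<eta> (Suc m))"
      by (rule finite_rank_sum_bound[OF bounded_linear.linear[OF bl] nA _ _ ran I])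
         (use RS(2) m \<eta>_pos[of "Suc m"] in auto)
    also have "\<dots> \<le> (4 * 2 ^ Suc m) * (3 * \<eta> (Suc m))"
    proof (rule mult_right_mono)
      have "real (card ?S) \<le> real (card (S (Suc m))) + real (card (S m))"
        using card_Un_le[of "S (Suc m)" "S m"] by linarith
      also have "\<dots> \<le> 2 * 2 ^ Suc m + 2 * 2 ^ m" by (rule add_mono[OF RS(3)[OF m(2)] RS(3)[OF m(1)]])
      finally show "real (card ?S) \<le> 4 * 2 ^ Suc m" by simp
    qed (use \<eta>_pos[of "Suc m"] in auto)
    also have "\<dots> = 12 * (2 ^ Suc m * \<eta> (Suc m))" by simp
    also have "\<dots> = 12 * \<delta>' * q ^ Suc m" unfolding \<eta>_q by simp
    finally have A: "(\<Sum>i\<in>I. \<bar>A (e i) \<bullet> g i\<bar>) \<le> 12 * \<delta>' * q ^ Suc m" .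
    have "\<bar>R (Suc m) (e i) \<bullet> g i\<bar> \<le> \<bar>R m (e i) \<bullet> g i\<bar> + \<bar>A (e i) \<bullet> g i\<bar>" for i
      by (simp add: A_def inner_diff_left)
    then have "(\<Sum>i\<in>I. \<bar>R (Suc m) (e i) \<bullet> g i\<bar>) \<le> (\<Sum>i\<in>I. \<bar>R m (e i) \<bullet> g i\<bar>) + (\<Sum>i\<in>I. \<bar>A (e i) \<bullet> g i\<bar>)"
      unfolding sum.distrib[symmetric] by (intro sum_mono)
    also have "\<dots> \<le> K + 48 * \<delta>' * q ^ m + 12 * \<delta>' * q ^ Suc m" using A step by linarith
    also have "48 * \<delta>' * q ^ m \<le> 36 * \<delta>' * q ^ Suc m"
    proof -
      have "48 * (\<delta>' * q ^ m) \<le> (36 * q) * (\<delta>' * q ^ m)" using q \<delta>' by (intro mult_right_mono) auto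
      then show ?thesis by (simp add: mult_ac)
    qed
    finally show ?case by simp
  qed
  have ev: "eventually (\<lambda>n::nat. K \<le> \<delta>' * real n powr (1 - \<alpha>)) sequentially"
  proof -
    have "filterlim (\<lambda>n::nat. real n powr (1 - \<alpha>)) at_top sequentially"
      using \<alpha> by real_asymp
    then have "eventually (\<lambda>n::nat. K / \<delta>' \<le> real n powr (1 - \<alpha>)) sequentially"
      by (simp add: filterlim_at_top)
    then show ?thesis using \<delta>' by (simp add: pos_divide_le_eq mult.commute)
  qed
  then obtain n1 where n1: "\<And>n. n \<ge> n1 \<Longrightarrow> K \<le> \<delta>' * real n powr (1 - \<alpha>)"
    by (auto simp: eventually_sequentially)
  have fin: "(\<Sum>i\<in>I. \<bar>T (e i) \<bullet> g i\<bar>) \<le> \<delta> * real n powr (1 - 1 / real d)"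
    if n: "n \<ge> max n1 (2 ^ j0)" and I: "finite I" "card I \<le> n" "orthonormal_on I e" "orthonormal_on I g"
    for n and I :: "'i set" and e g
  proof -
    have "n > 0" using n by (metis max.boundedE not_gr_zero power_not_zero zero_neq_numeral le_zero_eq)
    \<comment> \<open>The dyadic level just below \<open>n\<close>: the rank of \<open>R m\<close>
      is then comparable to \<open>n\<close>, and the error \<open>T - R m\<close> contributes at
      most \<open>card I * \<eta> m \<le> 2 * 2 ^ m * \<eta> m\<close>.\<close>
    obtain m where m: "2 ^ m \<le> n" "n < 2 ^ Suc m"
      using ex_power_ivl1[of 2 n] \<open>n > 0\<close> by auto
    have "m \<ge> j0"
    proof (rule ccontr)
      assume "\<not> m \<ge> j0"
      then have "(2::nat) ^ Suc m \<le> 2 ^ j0" by (intro power_increasing) auto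
      then show False using m n by linarith
    qed
    have mr: "2 ^ m \<le> real n" "real n \<le> 2 * 2 ^ m"
      using m by (metis of_nat_le_iff of_nat_numeral of_nat_power, metis less_imp_le of_nat_le_iff of_nat_mult of_nat_numeral of_nat_power power_Suc)
    have qn: "q ^ m \<le> real n powr (1 - \<alpha>)"
    proof -
      have "q ^ m = (2 ^ m) powr (1 - \<alpha>)"
        unfolding q_pow by (simp add: powr_diff powr_minus field_simps)
      also have "\<dots> \<le> real n powr (1 - \<alpha>)" using mr \<alpha> by (intro powr_mono2) auto
      finally show ?thesis .
    qed
    have ne: "norm (e i) = 1" "norm (g i) = 1" if "i \<in> I" for i
      using I(3,4) that by (auto simp: orthonormal_on_def norm_eq_1)
    have "\<bar>T (e i) \<bullet> g i\<bar> \<le> \<bar>R m (e i) \<bullet> g i\<bar> + \<eta> m" if "i \<in> I" for i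
    proof -
      have "\<bar>(T (e i) - R m (e i)) \<bullet> g i\<bar> \<le> norm (T (e i) - R m (e i)) * norm (g i)"
        by (rule Cauchy_Schwarz_ineq2)
      also have "\<dots> \<le> \<eta> m" using RS(5)[OF \<open>m \<ge> j0\<close>, of "e i"] ne[OF that] by simp
      finally show ?thesis by (simp add: inner_diff_left)
    qed
    then have "(\<Sum>i\<in>I. \<bar>T (e i) \<bullet> g i\<bar>) \<le> (\<Sum>i\<in>I. \<bar>R m (e i) \<bullet> g i\<bar> + \<eta> m)" by (intro sum_mono)
    also have "\<dots> = (\<Sum>i\<in>I. \<bar>R m (e i) \<bullet> g i\<bar>) + card I * \<eta> m" by (simp add: sum.distrib)
    also have "\<dots> \<le> (K + 48 * \<delta>' * q ^ m) + (2 * 2 ^ m) * \<eta> m"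
    proof (intro add_mono main[OF \<open>m \<ge> j0\<close> I(1,3,4)] mult_right_mono)
      show "real (card I) \<le> 2 * 2 ^ m" using I(2) mr(2) by linarith
    qed (use \<eta>_pos[of m] in auto)
    also have "\<dots> = K + 50 * (\<delta>' * q ^ m)" using \<eta>_q[of m] by simp
    also have "\<dots> \<le> \<delta>' * real n powr (1 - \<alpha>) + 50 * (\<delta>' * real n powr (1 - \<alpha>))"
      using n1[of n] n qn \<delta>' by (intro add_mono mult_left_mono) auto
    also have "\<dots> = \<delta> * real n powr (1 - 1 / real d)" by (simp add: \<delta>'_def \<alpha>_def)
    finally show ?thesis .
  qed
  then show ?thesis by blast
qed

section \<open>Riesz transforms\<close>

lemma integral_exp_half_line:
  assumes "r > 0"
  shows "has_bochner_integral lborel (\<lambda>s. indicator {0..} s * exp (- s\<^sup>2 * r\<^sup>2)) (sqrt pi / (2 * r))"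
proof -
  have "has_bochner_integral lborel (\<lambda>x. indicator {0..} (0 + r * x) *\<^sub>R exp (- (0 + r * x)\<^sup>2)) ((sqrt pi / 2) /\<^sub>R \<bar>r\<bar>)"
    using gaussian_moment_0 assms
    by (subst lborel_has_bochner_integral_real_affine_iff[symmetric]) auto
  moreover have "indicator {0..} (0 + r * x) *\<^sub>R exp (- (0 + r * x)\<^sup>2) = indicator {0..} x * exp (- x\<^sup>2 * r\<^sup>2)" for x
    using assms by (auto simp: indicator_def zero_le_mult_iff power_mult_distrib mult.commute)
  ultimately show ?thesis using assms by (simp add: field_simps)
qed

definition riesz_symbol :: "'a::euclidean_space \<Rightarrow> 'a \<Rightarrow> real" where
  "riesz_symbol c \<xi> = (c \<bullet> \<xi>) / norm \<xi>"

lemma abs_riesz_symbol_le: "\<bar>riesz_symbol c \<xi>\<bar> \<le> norm c"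
  unfolding riesz_symbol_def using Cauchy_Schwarz_ineq2[of c \<xi>]
  by (cases "\<xi> = 0") (auto simp: divide_le_eq)

lemma borel_measurable_riesz_symbol [measurable]: "riesz_symbol c \<in> borel_measurable borel"
  unfolding riesz_symbol_def[abs_def] by measurable

lemma bounded_borel_riesz_symbol: "bounded_borel (\<lambda>\<xi>. of_real (riesz_symbol c \<xi>))"
  unfolding bounded_borel_def using abs_riesz_symbol_le[of c] by (auto intro!: exI[of _ "norm c"])

definition riesz :: "'a::euclidean_space \<Rightarrow> ('a, complex) L2 \<Rightarrow> ('a, complex) L2" where
  "riesz c = fourier_multiplier (\<lambda>\<xi>. of_real (riesz_symbol c \<xi>))"

lemma riesz_inner:
  assumes u: "sq_int u" "\<And>x. u x \<noteq> 0 \<Longrightarrow> norm x \<le> R" and v: "sq_int v" "\<And>x. v x \<noteq> 0 \<Longrightarrow> norm x \<le> R'"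
  shows "riesz c (abs_L2 u) \<bullet> abs_L2 v = (LINT \<xi>|lborel. riesz_symbol c \<xi> * (ft u \<xi> \<bullet> ft v \<xi>))"
proof -
  note sq = plancherel_bounded_support(1)[OF u] plancherel_bounded_support(1)[OF v]
  have Fu: "fourier_L2 (abs_L2 u) = abs_L2 (ft u)" by (rule fourier_L2_bounded_support[OF u])
  have Fv: "fourier_L2 (abs_L2 v) = abs_L2 (ft v)" by (rule fourier_L2_bounded_support[OF v])
  have "riesz c (abs_L2 u) \<bullet> abs_L2 v = abs_L2 (\<lambda>\<xi>. of_real (riesz_symbol c \<xi>) * ft u \<xi>) \<bullet> abs_L2 (ft v)"
    unfolding riesz_def inner_fourier_multiplier Fu Fv
    by (simp add: mult_L2_abs bounded_borel_riesz_symbol sq)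
  also have "\<dots> = (LINT \<xi>|lborel. (of_real (riesz_symbol c \<xi>) * ft u \<xi>) \<bullet> ft v \<xi>)"
    by (intro sq_int_inner sq_int_bounded_borel_mult bounded_borel_riesz_symbol sq)
  also have "\<dots> = (LINT \<xi>|lborel. riesz_symbol c \<xi> * (ft u \<xi> \<bullet> ft v \<xi>))"
    by (intro Bochner_Integration.integral_cong) (auto simp: inner_complex_def algebra_simps)
  finally show ?thesis .
qed

lemma riesz_self_adjoint: "riesz c u \<bullet> v = u \<bullet> riesz c v"
  unfolding riesz_def by (rule fourier_multiplier_self_adjoint[OF bounded_borel_riesz_symbol])

lemma riesz_cmult: "riesz c (mult_L2 (\<lambda>_. z) u) = mult_L2 (\<lambda>_. z) (riesz c u)"
  unfolding riesz_def by (rule fourier_multiplier_cmult[OF bounded_borel_riesz_symbol])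

text \<open>The kernel \<open>(c \<bullet> z) * heat t z\<close> at \<open>z = x - y\<close> is, up
  to the factor \<open>- 2 * t\<close>, the derivative of the heat kernel in direction
  \<open>c\<close>. Its sign is that of \<open>c \<bullet> (x - y)\<close>, from which all lower
  bounds derive.\<close>

definition heat_form :: "'a::euclidean_space \<Rightarrow> ('a \<Rightarrow> real) \<Rightarrow> ('a \<Rightarrow> real) \<Rightarrow> real \<Rightarrow> real" where
  "heat_form c u v t = (LINT p|(lborel \<Otimes>\<^sub>M lborel). u (fst p) * v (snd p) * ((c \<bullet> (fst p - snd p)) * heat t (fst p - snd p)))"

text \<open>\<open>ft_weighted\<close> with the Gaussian times \<open>c \<bullet> \<xi>\<close>,
  whose transform is the Gaussian moment. That moment carries the factor \<open>- \<i>\<close>, so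
  for real \<open>u\<close> and \<open>v\<close> the whole integral is imaginary and nothing is lost
  by taking the imaginary part.\<close>

lemma gaussian_weighted_form:
  fixes u v :: "'a::euclidean_space \<Rightarrow> real"
  defines "u' \<equiv> \<lambda>x. complex_of_real (u x)" and "v' \<equiv> \<lambda>x. complex_of_real (v x)"
  assumes u: "integrable lborel u" and v: "integrable lborel v" and t: "t > 0"
  shows "(LINT \<xi>|lborel. (c \<bullet> \<xi>) * exp (- t * (norm \<xi>)\<^sup>2) * Im (ft u' \<xi> * cnj (ft v' \<xi>)))
    = - ((2 * pi) powr (- real DIM('a)) / (2 * t)) * heat_form c u v t"
proof -
  have u': "integrable lborel u'" and v': "integrable lborel v'" using u v by (simp_all add: u'_def v'_def)
  have [measurable]: "u' \<in> borel_measurable borel" "v' \<in> borel_measurable borel"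
    using u' v' by (auto dest: borel_measurable_integrable)
  define g where "g \<xi> = complex_of_real ((c \<bullet> \<xi>) * exp (- t * (norm \<xi>)\<^sup>2))" for \<xi>
  have g: "integrable lborel g"
    using gaussian_fourier_moment(1)[OF t, of c 0] by (simp add: g_def[abs_def])
  have W: "(LINT \<xi>|lborel. g \<xi> * (ft u' \<xi> * cnj (ft v' \<xi>)))
    = of_real ((2 * pi) powr (- real DIM('a))) * (LINT p|(lborel \<Otimes>\<^sub>M lborel).
        u' (fst p) * cnj (v' (snd p)) * (- \<i> * of_real ((c \<bullet> (fst p - snd p)) / (2 * t) * heat t (fst p - snd p))))"
    using ft_weighted[OF u' v' g] unfolding g_def gaussian_fourier_moment(2)[OF t] .
  also have "(LINT p|(lborel \<Otimes>\<^sub>M lborel). u' (fst p) * cnj (v' (snd p)) * (- \<i> * of_real ((c \<bullet> (fst p - snd p)) / (2 * t) * heat t (fst p - snd p))))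
    = (LINT p|(lborel \<Otimes>\<^sub>M lborel). (- \<i> * of_real (1 / (2 * t))) * of_real (u (fst p) * v (snd p) * ((c \<bullet> (fst p - snd p)) * heat t (fst p - snd p))))"
    by (intro Bochner_Integration.integral_cong) (auto simp: u'_def v'_def)
  also have "\<dots> = (- \<i> * of_real (1 / (2 * t))) * of_real (heat_form c u v t)"
    unfolding integral_mult_right_zero integral_complex_of_real heat_form_def ..
  finally have eq: "(LINT \<xi>|lborel. g \<xi> * (ft u' \<xi> * cnj (ft v' \<xi>)))
    = - \<i> * of_real ((2 * pi) powr (- real DIM('a)) / (2 * t) * heat_form c u v t)" by simp
  have int: "integrable lborel (\<lambda>\<xi>. g \<xi> * (ft u' \<xi> * cnj (ft v' \<xi>)))"
  proof (rule Bochner_Integration.integrable_bound)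
    define B where "B w = (2 * pi) powr (- real DIM('a) / 2) * (LINT x|lborel. norm (w x))" for w :: "'a \<Rightarrow> complex"
    have B: "norm (ft w \<xi>) \<le> B w" if "integrable lborel w" for w \<xi> unfolding B_def by (rule ft_bounded[OF that])
    show "integrable lborel (\<lambda>\<xi>. g \<xi> * of_real (B u' * B v'))" using g by simp
    show "(\<lambda>\<xi>. g \<xi> * (ft u' \<xi> * cnj (ft v' \<xi>))) \<in> borel_measurable lborel"
      using borel_measurable_integrable[OF g] by measurable
    have "norm (ft u' \<xi>) * norm (ft v' \<xi>) \<le> B u' * B v'" for \<xi>
      using B[OF u', of \<xi>] B[OF v', of \<xi>] by (intro mult_mono) (auto intro: order_trans[OF norm_ge_zero])
    then show "AE \<xi> in lborel. norm (g \<xi> * (ft u' \<xi> * cnj (ft v' \<xi>))) \<le> norm (g \<xi> * of_real (B u' * B v'))"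
      unfolding norm_mult norm_of_real complex_mod_cnj
      by (intro AE_I2 mult_left_mono) (auto intro: order_trans[OF _ abs_ge_self] simp: abs_mult[symmetric])
  qed
  have "(LINT \<xi>|lborel. (c \<bullet> \<xi>) * exp (- t * (norm \<xi>)\<^sup>2) * Im (ft u' \<xi> * cnj (ft v' \<xi>)))
    = (LINT \<xi>|lborel. Im (g \<xi> * (ft u' \<xi> * cnj (ft v' \<xi>))))"
    by (intro Bochner_Integration.integral_cong) (auto simp: g_def)
  also have "\<dots> = Im (LINT \<xi>|lborel. g \<xi> * (ft u' \<xi> * cnj (ft v' \<xi>)))" by (rule integral_Im[OF int])
  finally show ?thesis unfolding eq by simp
qed

text \<open>The subordination formula \<open>1 / r = 2 / sqrt pi * (\<integral> s \<ge> 0. exp (- s\<^sup>2 r\<^sup>2))\<close> replaces the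
  explicit kernel of the Riesz transforms.\<close>

lemma riesz_heat_lower_bound:
  fixes u v :: "'a::euclidean_space \<Rightarrow> real"
  assumes u: "sq_int u" "\<And>x. u x \<noteq> 0 \<Longrightarrow> norm x \<le> R" and v: "sq_int v" "\<And>x. v x \<noteq> 0 \<Longrightarrow> norm x \<le> R'"
    and nn: "\<And>t. t > 0 \<Longrightarrow> 0 \<le> heat_form c u v t"
    and lb: "\<And>t. 1 \<le> t \<Longrightarrow> t \<le> 4 \<Longrightarrow> m \<le> heat_form c u v t" and m: "0 \<le> m"
  shows "(2 * pi) powr (- real DIM('a)) / (4 * sqrt pi) * m
    \<le> - (riesz c (abs_L2 (\<lambda>x. of_real (u x))) \<bullet> abs_L2 (\<lambda>x. \<i> * of_real (v x)))"
proof -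
  define u' where "u' = (\<lambda>x. complex_of_real (u x))"
  define v' where "v' = (\<lambda>x. complex_of_real (v x))"
  have u': "sq_int u'" "\<And>x. u' x \<noteq> 0 \<Longrightarrow> norm x \<le> R" using u by (auto simp: u'_def sq_int_def)
  have v': "sq_int v'" "\<And>x. v' x \<noteq> 0 \<Longrightarrow> norm x \<le> R'" using v by (auto simp: v'_def sq_int_def)
  have iv': "sq_int (\<lambda>x. \<i> * v' x)" by (rule sq_int_bounded_borel_mult[OF bounded_borel_const v'(1)])
  have iv'': "\<And>x. \<i> * v' x \<noteq> 0 \<Longrightarrow> norm x \<le> R'" using v'(2) by simp
  have iu: "integrable lborel u" and jv: "integrable lborel v"
    using sq_int_bounded_support_integrable u v by blast+
  define p where "p \<xi> = Im (ft u' \<xi> * cnj (ft v' \<xi>))" for \<xi>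
  have [measurable]: "u' \<in> borel_measurable borel" "v' \<in> borel_measurable borel"
    using u'(1) v'(1) by (auto dest: sq_int_measurable)
  have [measurable]: "(\<lambda>z. Im z) \<in> borel_measurable borel"
    by (intro borel_measurable_continuous_onI continuous_intros)
  have pm [measurable]: "p \<in> borel_measurable borel" unfolding p_def[abs_def] by measurable
  have p: "integrable lborel p"
  proof (rule Bochner_Integration.integrable_bound)
    show "integrable lborel (\<lambda>\<xi>. norm (ft u' \<xi>) * norm (ft v' \<xi>))"
      by (rule L2_Cauchy_Schwarz(1)[OF plancherel_bounded_support(1)[OF u'] plancherel_bounded_support(1)[OF v']])
    show "AE \<xi> in lborel. norm (p \<xi>) \<le> norm (norm (ft u' \<xi>) * norm (ft v' \<xi>))"
    proof (rule AE_I2)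
      fix \<xi>
      have "norm (p \<xi>) \<le> norm (ft u' \<xi> * cnj (ft v' \<xi>))" unfolding p_def real_norm_def by (rule abs_Im_le_cmod)
      then show "norm (p \<xi>) \<le> norm (norm (ft u' \<xi>) * norm (ft v' \<xi>))" by (simp add: norm_mult)
    qed
  qed simp
  have RI: "riesz c (abs_L2 u') \<bullet> abs_L2 (\<lambda>x. \<i> * v' x)
      = (LINT \<xi>|lborel. riesz_symbol c \<xi> * (ft u' \<xi> \<bullet> ft (\<lambda>x. \<i> * v' x) \<xi>))"
    by (rule riesz_inner[OF u' iv' iv''])
  have P: "riesz c (abs_L2 u') \<bullet> abs_L2 (\<lambda>x. \<i> * v' x) = (LINT \<xi>|lborel. riesz_symbol c \<xi> * p \<xi>)"
    unfolding RI
    by (intro Bochner_Integration.integral_cong) (auto simp: ft_cmult p_def inner_complex_def algebra_simps)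
  \<comment> \<open>The half-line Gaussian whose integral over \<open>s\<close> is
    \<open>sqrt pi / (2 * norm \<xi>)\<close>. The square of \<open>s\<close> is the heat time
    \<open>t\<close>.\<close>
  define h where "h s \<xi> = (indicator {0..} s * exp (- s\<^sup>2 * (norm \<xi>)\<^sup>2) :: real)" for s and \<xi> :: 'a
  define H where "H \<xi> s = (c \<bullet> \<xi>) * p \<xi> * h s \<xi>" for \<xi> s
  have hI: "integrable lborel (\<lambda>s. h s \<xi>)" "(LINT s|lborel. h s \<xi>) = sqrt pi / (2 * norm \<xi>)" if "\<xi> \<noteq> 0" for \<xi>
    using integral_exp_half_line[of "norm \<xi>"] that by (auto simp: h_def has_bochner_integral_iff)
  have H_int: "(LINT s|lborel. H \<xi> s) = sqrt pi / 2 * (riesz_symbol c \<xi> * p \<xi>)" for \<xi>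
    by (cases "\<xi> = 0") (simp_all add: H_def hI riesz_symbol_def)
  have H: "integrable (lborel \<Otimes>\<^sub>M lborel) (\<lambda>(\<xi>, s). H \<xi> s)"
  proof (rule lborel_pair.Fubini_integrable)
    show "(\<lambda>(\<xi>, s). H \<xi> s) \<in> borel_measurable (lborel \<Otimes>\<^sub>M lborel)"
      unfolding H_def h_def by measurable
    have "(LINT s|lborel. norm (H \<xi> s)) = sqrt pi / 2 * \<bar>riesz_symbol c \<xi> * p \<xi>\<bar>" for \<xi>
    proof -
      have "norm (H \<xi> s) = \<bar>(c \<bullet> \<xi>) * p \<xi>\<bar> * h s \<xi>" for s by (simp add: H_def abs_mult h_def)
      then show ?thesis by (cases "\<xi> = 0") (simp_all add: hI riesz_symbol_def abs_mult)
    qed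
    moreover have "integrable lborel (\<lambda>\<xi>. sqrt pi / 2 * \<bar>riesz_symbol c \<xi> * p \<xi>\<bar>)"
    proof (rule Bochner_Integration.integrable_bound)
      show "integrable lborel (\<lambda>\<xi>. (sqrt pi / 2 * norm c) * p \<xi>)" using p by simp
      show "AE \<xi> in lborel. norm (sqrt pi / 2 * \<bar>riesz_symbol c \<xi> * p \<xi>\<bar>) \<le> norm ((sqrt pi / 2 * norm c) * p \<xi>)"
        using abs_riesz_symbol_le[of c] by (intro AE_I2) (simp add: abs_mult mult_right_mono)
    qed measurable
    ultimately show "integrable lborel (\<lambda>\<xi>. LINT s|lborel. norm (case (\<xi>, s) of (\<xi>, s) \<Rightarrow> H \<xi> s))"
      by (simp only: prod.case)
    show "AE \<xi> in lborel. integrable lborel (\<lambda>s. case (\<xi>, s) of (\<xi>, s) \<Rightarrow> H \<xi> s)"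
    proof (rule AE_I2)
      fix \<xi> :: 'a
      show "integrable lborel (\<lambda>s. case (\<xi>, s) of (\<xi>, s) \<Rightarrow> H \<xi> s)"
        by (cases "\<xi> = 0") (simp_all add: H_def hI)
    qed
  qed
  define C where "C = (2 * pi) powr (- real DIM('a))"
  have C: "C > 0" by (simp add: C_def)
  have inner: "(LINT \<xi>|lborel. H \<xi> s) = - (C / (2 * s\<^sup>2)) * heat_form c u v (s\<^sup>2)" if "s > 0" for s
  proof -
    have "(LINT \<xi>|lborel. H \<xi> s) = (LINT \<xi>|lborel. (c \<bullet> \<xi>) * exp (- s\<^sup>2 * (norm \<xi>)\<^sup>2) * p \<xi>)"
      using that by (intro Bochner_Integration.integral_cong) (auto simp: H_def h_def)
    then show ?thesis
      using gaussian_weighted_form[OF iu jv, of "s\<^sup>2" c] that by (simp add: p_def u'_def v'_def C_def)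
  qed
  have H0: "H \<xi> s = 0" if "s < 0" for s \<xi> using that by (simp add: H_def h_def)
  \<comment> \<open>The window from 1 to 2 for \<open>s\<close> corresponds to
    \<open>1 \<le> t \<le> 4\<close>, where the lower bound \<open>m\<close> is available and
    \<open>1 / (2 * s\<^sup>2) \<ge> 1 / 8\<close>. Elsewhere only the nonnegativity of the form
    enters; the single value \<open>s = 0\<close> is negligible.\<close>
  have low: "indicator {1..2} s * (C / 8 * m) \<le> - (LINT \<xi>|lborel. H \<xi> s)" if "s \<noteq> 0" for s :: real
  proof (cases "s < 0")
    case True
    then show ?thesis by (simp add: H0)
  next
    case False
    then have s: "s > 0" using that by simp
    show ?thesis
    proof (cases "s \<in> {1..2}")
      case True
      then have s2: "1 \<le> s\<^sup>2" "s\<^sup>2 \<le> 4"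
        using power_mono[of 1 s 2] power_mono[of s 2 2] by auto
      have "C / 8 * m \<le> (C / (2 * s\<^sup>2)) * heat_form c u v (s\<^sup>2)"
      proof (rule mult_mono)
        show "C / 8 \<le> C / (2 * s\<^sup>2)" using s2 C by (intro divide_left_mono) auto
        show "m \<le> heat_form c u v (s\<^sup>2)" using s2 by (rule lb)
      qed (use C m s in auto)
      then show ?thesis unfolding inner[OF s] using True by simp
    next
      case False
      have "0 \<le> (C / (2 * s\<^sup>2)) * heat_form c u v (s\<^sup>2)" using nn[of "s\<^sup>2"] s C by simp
      then show ?thesis unfolding inner[OF s] using False by simp
    qed
  qed
  have "(LINT s::real|lborel. indicator {1..2} s * (C / 8 * m)) \<le> (LINT s|lborel. - (LINT \<xi>|lborel. H \<xi> s))"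
  proof (rule integral_mono_AE)
    show "integrable lborel (\<lambda>s::real. indicator {1..2} s * (C / 8 * m))"
      by (intro integrable_mult_left integrable_real_indicator) auto
    show "integrable lborel (\<lambda>s. - (LINT \<xi>|lborel. H \<xi> s))"
      using lborel_pair.integrable_snd[OF H] by simp
    show "AE s in lborel. indicator {1..2} s * (C / 8 * m) \<le> - (LINT \<xi>|lborel. H \<xi> s)"
      using AE_lborel_singleton[of 0] by eventually_elim (rule low)
  qed
  moreover have "(LINT s::real|lborel. indicator {1..2} s * (C / 8 * m)) = C / 8 * m" by simp
  moreover have "(LINT s|lborel. - (LINT \<xi>|lborel. H \<xi> s)) = - (LINT \<xi>|lborel. LINT s|lborel. H \<xi> s)"
    using lborel_pair.Fubini_integral[OF H] by simp
  moreover have "(LINT \<xi>|lborel. LINT s|lborel. H \<xi> s) = sqrt pi / 2 * (LINT \<xi>|lborel. riesz_symbol c \<xi> * p \<xi>)"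
    unfolding H_int by simp
  ultimately have "C / 8 * m \<le> sqrt pi / 2 * (- (LINT \<xi>|lborel. riesz_symbol c \<xi> * p \<xi>))" by simp
  then have "C / (4 * sqrt pi) * m \<le> - (LINT \<xi>|lborel. riesz_symbol c \<xi> * p \<xi>)"
    by (simp add: field_simps)
  then show ?thesis unfolding P[symmetric] C_def u'_def v'_def .
qed

text \<open>A Borel, square-integrable representative chosen once for each class. Unlike
  \<open>rep_L2\<close>, which is only Lebesgue measurable, it can be used directly in integrals
  over \<open>lborel\<close>.\<close>

definition brep :: "('a::euclidean_space, 'b::euclidean_space) L2 \<Rightarrow> 'a \<Rightarrow> 'b" where
  "brep u = (SOME g. sq_int g \<and> abs_L2 g = u)"

lemma sq_int_brep: "sq_int (brep u)" and abs_brep [simp]: "abs_L2 (brep u) = u"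
proof -
  have "\<exists>g. sq_int g \<and> abs_L2 g = u" by (metis L2_ex_sq_int)
  from someI_ex[OF this] show "sq_int (brep u)" "abs_L2 (brep u) = u" by (auto simp: brep_def)
qed

lemma borel_measurable_brep [measurable]: "brep u \<in> borel_measurable borel"
  using sq_int_brep by (rule sq_int_measurable)

lemma AE_brep: "AE x in lborel. rep_L2 u x = brep u x"
  using rep_abs_sq_int[OF sq_int_brep[of u]] by simp

lemma sq_int_of_real: "sq_int v \<Longrightarrow> sq_int (\<lambda>x. complex_of_real (v x))"
  by (auto simp: sq_int_def)

lemma sq_int_times_i: "sq_int v \<Longrightarrow> sq_int (\<lambda>x. \<i> * v x)"
  by (rule sq_int_bounded_borel_mult[OF bounded_borel_const])

lemma inner_imag:
  assumes v: "sq_int v"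
  shows "w \<bullet> abs_L2 (\<lambda>x. \<i> * complex_of_real (v x)) = (LINT x|lborel. v x * Im (brep w x))"
    and "integrable lborel (\<lambda>x. v x * Im (brep w x))"
proof -
  have iv: "sq_int (\<lambda>x. \<i> * complex_of_real (v x))" by (intro sq_int_times_i sq_int_of_real v)
  have eq: "brep w x \<bullet> (\<i> * complex_of_real (v x)) = v x * Im (brep w x)" for x
    by (simp add: inner_complex_def)
  show "w \<bullet> abs_L2 (\<lambda>x. \<i> * complex_of_real (v x)) = (LINT x|lborel. v x * Im (brep w x))"
    using sq_int_inner(1)[OF sq_int_brep[of w] iv] by (simp add: eq)
  show "integrable lborel (\<lambda>x. v x * Im (brep w x))"
    using sq_int_inner(2)[OF sq_int_brep[of w] iv] by (simp add: eq)
qed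

section \<open>Lower bounds for Riesz transforms of indicators\<close>

lemma heat_ge:
  fixes z :: "'a::euclidean_space"
  assumes "1 \<le> t" "t \<le> 4" "norm z \<le> r"
  shows "sqrt (pi / 4) ^ DIM('a) * exp (- r\<^sup>2 / 4) \<le> heat t z"
  unfolding heat_def
proof (rule mult_mono)
  show "sqrt (pi / 4) ^ DIM('a) \<le> sqrt (pi / t) ^ DIM('a)"
    using assms by (intro power_mono real_sqrt_le_mono divide_left_mono) auto
  have "(norm z)\<^sup>2 \<le> r\<^sup>2" using assms by (intro power_mono) auto
  moreover have "(norm z)\<^sup>2 / (4 * t) \<le> (norm z)\<^sup>2 / 4" using assms by (intro divide_left_mono) auto
  ultimately show "exp (- r\<^sup>2 / 4) \<le> exp (- (norm z)\<^sup>2 / (4 * t))" by simp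
qed (use assms in auto)

lemma heat_form_integrable:
  fixes u v :: "'a::euclidean_space \<Rightarrow> real"
  assumes u: "integrable lborel u" "\<And>x. u x \<noteq> 0 \<Longrightarrow> norm x \<le> R"
    and v: "integrable lborel v" "\<And>x. v x \<noteq> 0 \<Longrightarrow> norm x \<le> R'" and t: "t > 0"
  shows "integrable (lborel \<Otimes>\<^sub>M lborel) (\<lambda>p. u (fst p) * v (snd p) * ((c \<bullet> (fst p - snd p)) * heat t (fst p - snd p)))"
proof (rule Bochner_Integration.integrable_bound)
  have [measurable]: "u \<in> borel_measurable borel" "v \<in> borel_measurable borel"
    using u v by (auto dest: borel_measurable_integrable)
  show "(\<lambda>p. u (fst p) * v (snd p) * ((c \<bullet> (fst p - snd p)) * heat t (fst p - snd p))) \<in> borel_measurable (lborel \<Otimes>\<^sub>M lborel)"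
    unfolding heat_def by measurable
  define K where "K = norm c * (R + R') * sqrt (pi / t) ^ DIM('a)"
  show "integrable (lborel \<Otimes>\<^sub>M lborel) (\<lambda>p. K * (case p of (x, y) \<Rightarrow> norm (u x) * norm (v y)))"
    by (intro integrable_mult_right integrable_pair_product u v)
  show "AE p in lborel \<Otimes>\<^sub>M lborel. norm (u (fst p) * v (snd p) * ((c \<bullet> (fst p - snd p)) * heat t (fst p - snd p)))
      \<le> norm (K * (case p of (x, y) \<Rightarrow> norm (u x) * norm (v y)))"
  proof (rule AE_I2)
    fix p :: "'a \<times> 'a"
    obtain x y where p: "p = (x, y)" by (cases p)
    show "norm (u (fst p) * v (snd p) * ((c \<bullet> (fst p - snd p)) * heat t (fst p - snd p)))
      \<le> norm (K * (case p of (x, y) \<Rightarrow> norm (u x) * norm (v y)))"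
    proof (cases "u x = 0 \<or> v y = 0")
      case False
      then have "norm x \<le> R" "norm y \<le> R'" using u v by auto
      then have xy: "norm (x - y) \<le> R + R'" using norm_triangle_ineq4[of x y] by linarith
      have "\<bar>c \<bullet> (x - y)\<bar> \<le> norm c * norm (x - y)" by (rule Cauchy_Schwarz_ineq2)
      also have "\<dots> \<le> norm c * (R + R')" using xy by (intro mult_left_mono) auto
      finally have 1: "\<bar>c \<bullet> (x - y)\<bar> \<le> norm c * (R + R')" .
      have 2: "heat t (x - y) \<le> sqrt (pi / t) ^ DIM('a)"
        unfolding heat_def using t by (intro mult_left_le) auto
      have "\<bar>c \<bullet> (x - y)\<bar> * heat t (x - y) \<le> K"
        unfolding K_def using 1 2 t by (intro mult_mono) (auto simp: heat_nonneg intro: order_trans[OF abs_ge_zero])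
      then have "(\<bar>u x\<bar> * \<bar>v y\<bar>) * (\<bar>c \<bullet> (x - y)\<bar> * heat t (x - y)) \<le> (\<bar>u x\<bar> * \<bar>v y\<bar>) * \<bar>K\<bar>"
        by (intro mult_left_mono) auto
      then show ?thesis using t by (simp add: p abs_mult heat_nonneg mult_ac)
    qed (auto simp: p)
  qed
qed

lemma sq_int_indicator:
  assumes "A \<in> sets borel" "\<And>x. x \<in> A \<Longrightarrow> norm x \<le> R"
  shows "sq_int (indicator A :: 'a::euclidean_space \<Rightarrow> real)" "sq_int (indicator A :: 'a \<Rightarrow> complex)"
  by (rule sq_int_bounded_support[where C=1 and r=R];
      use assms in \<open>auto simp: indicator_def split: if_splits\<close>)+

lemma integral_indicator_pair:
  assumes "integrable lborel (u :: 'a::euclidean_space \<Rightarrow> real)" "integrable lborel (v :: 'a \<Rightarrow> real)"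
  shows "integrable (lborel \<Otimes>\<^sub>M lborel) (\<lambda>p. u (fst p) * v (snd p))"
    "(LINT p|(lborel \<Otimes>\<^sub>M lborel). u (fst p) * v (snd p)) = (LINT x|lborel. u x) * (LINT y|lborel. v y)"
proof -
  have [measurable]: "u \<in> borel_measurable borel" "v \<in> borel_measurable borel"
    using assms by (auto dest: borel_measurable_integrable)
  show i: "integrable (lborel \<Otimes>\<^sub>M lborel) (\<lambda>p. u (fst p) * v (snd p))"
    by (rule Bochner_Integration.integrable_bound[OF integrable_pair_product[OF assms]])
       (auto simp: abs_mult)
  then show "(LINT p|(lborel \<Otimes>\<^sub>M lborel). u (fst p) * v (snd p)) = (LINT x|lborel. u x) * (LINT y|lborel. v y)"
    using lborel_pair.integral_fst[of "\<lambda>x y. u x * v y"] by (simp add: case_prod_unfold)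
qed

text \<open>A displacement by 3 against two unit radii leaves
  \<open>b \<bullet> (x - y) \<ge> 3 - 2\<close> and \<open>norm (x - y) \<le> 3 + 2\<close>, hence
  a uniformly positive heat kernel. The mean of \<open>- Im\<close> of the transform over every
  Borel set \<open>E\<close> of positive measure inside the ball is therefore at least \<delta>, and
  this forces the pointwise bound.\<close>

lemma riesz_indicator_lower_bound:
  fixes b x0 :: "'a::euclidean_space"
  assumes b: "b \<in> Basis" and A: "A \<in> sets borel" "A \<subseteq> ball (x0 + 3 *\<^sub>R b) 1" "measure lborel A > 0"
  shows "\<exists>\<delta>>0. AE y in lborel. y \<in> ball x0 1 \<longrightarrow> \<delta> \<le> norm (brep (riesz b (abs_L2 (indicator A))) y)"
proof -
  define R where "R = norm x0 + 5"
  have nA: "norm x \<le> R" if "x \<in> A" for x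
  proof -
    have "dist (x0 + 3 *\<^sub>R b) x < 1" using A(2) that by auto
    moreover have "norm (x0 + 3 *\<^sub>R b) \<le> norm x0 + 3" using norm_triangle_ineq[of x0 "3 *\<^sub>R b"] b by simp
    ultimately show ?thesis
      using norm_triangle_sub[of x "x0 + 3 *\<^sub>R b"] unfolding R_def dist_norm by (simp add: norm_minus_commute)
  qed
  have nQ: "norm y \<le> R" if "y \<in> ball x0 1" for y
    using that norm_triangle_sub[of y x0] unfolding R_def by (simp add: dist_norm norm_minus_commute)
  have bxy: "1 \<le> b \<bullet> (x - y)" "norm (x - y) \<le> 5" if "x \<in> A" "y \<in> ball x0 1" for x y
  proof -
    define h where "h = x - (x0 + 3 *\<^sub>R b)"
    define k where "k = x0 - y"
    have "norm h < 1" using A(2) that unfolding h_def by (auto simp: dist_norm norm_minus_commute)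
    have "norm k < 1" using that unfolding k_def by (auto simp: dist_norm)
    have e: "x - y = 3 *\<^sub>R b + (h + k)" by (simp add: h_def k_def)
    have nhk: "norm (h + k) \<le> 2" using norm_triangle_ineq[of h k] \<open>norm h < 1\<close> \<open>norm k < 1\<close> by linarith
    have "b \<bullet> (x - y) = 3 + b \<bullet> (h + k)" unfolding e inner_add_right[of b "3 *\<^sub>R b"] using b by simp
    moreover have "\<bar>b \<bullet> (h + k)\<bar> \<le> 2" using Cauchy_Schwarz_ineq2[of b "h + k"] b nhk by simp
    ultimately show "1 \<le> b \<bullet> (x - y)" by linarith
    show "norm (x - y) \<le> 5" unfolding e using norm_triangle_ineq[of "3 *\<^sub>R b" "h + k"] b nhk by simp
  qed
  define h0 where "h0 = sqrt (pi / 4) ^ DIM('a) * exp (- 5\<^sup>2 / 4)"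
  have h0: "h0 > 0" by (simp add: h0_def)
  define \<kappa> where "\<kappa> = (2 * pi) powr (- real DIM('a)) / (4 * sqrt pi)"
  have \<kappa>: "\<kappa> > 0" by (simp add: \<kappa>_def)
  define \<delta> where "\<delta> = \<kappa> * (h0 * measure lborel A)"
  have \<delta>: "\<delta> > 0" using \<kappa> h0 A by (simp add: \<delta>_def)
  define w where "w = riesz b (abs_L2 (indicator A))"
  have fin: "emeasure lborel E < \<infinity>" if "E \<subseteq> cball 0 R" for E :: "'a set"
    using emeasure_bounded_finite[OF bounded_subset[OF bounded_cball that]] .
  have ii: "integrable lborel (indicator E :: 'a \<Rightarrow> real)" if "E \<in> sets borel" "E \<subseteq> cball 0 R" for E
    using that fin by (intro integrable_real_indicator) auto
  have iA: "integrable lborel (indicator A :: 'a \<Rightarrow> real)" using nA A by (intro ii) auto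
  have key: "\<delta> * measure lborel E \<le> - (LINT x|lborel. indicator E x * Im (brep w x))"
    if E: "E \<in> sets borel" "E \<subseteq> ball x0 1" for E
  proof -
    have nE: "norm y \<le> R" if "y \<in> E" for y using nQ E that by auto
    have iE: "integrable lborel (indicator E :: 'a \<Rightarrow> real)" using nE E by (intro ii) auto
    have pos: "0 \<le> indicator A (fst p) * indicator E (snd p) * ((b \<bullet> (fst p - snd p)) * heat t (fst p - snd p))" if "t > 0" for p :: "'a \<times> 'a" and t
      using bxy(1)[of "fst p" "snd p"] E that heat_nonneg[of t "fst p - snd p"] by (auto simp: indicator_def)
    have "\<kappa> * (h0 * (measure lborel A * measure lborel E))
      \<le> - (riesz b (abs_L2 (\<lambda>x. of_real (indicator A x))) \<bullet> abs_L2 (\<lambda>x. \<i> * of_real (indicator E x)))"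
      unfolding \<kappa>_def
    proof (rule riesz_heat_lower_bound[where R=R and R'=R])
      show "sq_int (indicator A :: 'a \<Rightarrow> real)" "sq_int (indicator E :: 'a \<Rightarrow> real)"
        using sq_int_indicator(1)[OF A(1) nA] sq_int_indicator(1)[OF E(1) nE] by auto
      show "0 \<le> heat_form b (indicator A) (indicator E) t" if "t > 0" for t
        unfolding heat_form_def using pos[OF that] by (intro Bochner_Integration.integral_nonneg)
      show "h0 * (measure lborel A * measure lborel E) \<le> heat_form b (indicator A) (indicator E) t" if t: "1 \<le> t" "t \<le> 4" for t
      proof -
        have "h0 * (measure lborel A * measure lborel E) = (LINT p|(lborel \<Otimes>\<^sub>M lborel). h0 * (indicator A (fst p) * indicator E (snd p)))"
          using integral_indicator_pair(2)[OF iA iE] by simp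
        also have "\<dots> \<le> heat_form b (indicator A) (indicator E) t"
          unfolding heat_form_def
        proof (rule integral_mono)
          show "integrable (lborel \<Otimes>\<^sub>M lborel) (\<lambda>p. h0 * (indicator A (fst p) * indicator E (snd p)))"
            using integral_indicator_pair(1)[OF iA iE] by simp
          have supp: "norm x \<le> R" if "(indicator A x :: real) \<noteq> 0" for x
            using that nA by (auto simp: indicator_def split: if_splits)
          have supp': "norm x \<le> R" if "(indicator E x :: real) \<noteq> 0" for x
            using that nE by (auto simp: indicator_def split: if_splits)
          show "integrable (lborel \<Otimes>\<^sub>M lborel) (\<lambda>p. indicator A (fst p) * indicator E (snd p) * ((b \<bullet> (fst p - snd p)) * heat t (fst p - snd p)))"
            by (rule heat_form_integrable[OF iA supp iE supp']) (use t in linarith)+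
          fix p :: "'a \<times> 'a"
          have "h0 \<le> 1 * heat t (fst p - snd p)" if "fst p \<in> A" "snd p \<in> E"
            using heat_ge[OF t bxy(2)[of "fst p" "snd p"]] that E by (auto simp: h0_def)
          also have "1 * heat t (fst p - snd p) \<le> (b \<bullet> (fst p - snd p)) * heat t (fst p - snd p)" if "fst p \<in> A" "snd p \<in> E"
            using bxy(1)[of "fst p" "snd p"] that E t by (intro mult_right_mono heat_nonneg) auto
          finally show "h0 * (indicator A (fst p) * indicator E (snd p))
              \<le> indicator A (fst p) * indicator E (snd p) * ((b \<bullet> (fst p - snd p)) * heat t (fst p - snd p))"
            by (auto simp: indicator_def)
        qed
        finally show ?thesis .
      qed
      show "0 \<le> h0 * (measure lborel A * measure lborel E)" using h0 by simp
    qed (use nA nE in \<open>auto simp: indicator_def split: if_splits\<close>)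
    then show ?thesis
      using inner_imag(1)[OF sq_int_indicator(1)[OF E(1) nE], of w]
      by (simp add: \<delta>_def w_def of_real_indicator mult_ac)
  qed
  \<comment> \<open>The set where the pointwise bound fails is itself an admissible test set. The
    bound \<open>key\<close> for it makes the integral of a nonnegative function nonpositive, so
    \<open>E\<close> is null.\<close>
  define E where "E = {y \<in> ball x0 1. - Im (brep w y) < \<delta>}"
  have [measurable]: "(\<lambda>z. Im z) \<in> borel_measurable borel"
    by (intro borel_measurable_continuous_onI continuous_intros)
  have E: "E \<in> sets borel" "E \<subseteq> ball x0 1"
    unfolding E_def by auto
  have nE: "norm y \<le> R" if "y \<in> E" for y using nQ E that by auto
  have iE: "integrable lborel (indicator E :: 'a \<Rightarrow> real)" using nE E by (intro ii) auto
  note II = inner_imag(2)[OF sq_int_indicator(1)[OF E(1) nE], of w]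
  have int: "integrable lborel (\<lambda>y. indicator E y * \<delta> - (- (indicator E y * Im (brep w y))))"
    using iE II by simp
  have "(LINT y|lborel. indicator E y * \<delta> - (- (indicator E y * Im (brep w y)))) \<le> 0"
    using key[OF E] iE II by (simp add: mult.commute)
  moreover have nn: "0 \<le> indicator E y * \<delta> - (- (indicator E y * Im (brep w y)))" for y
    by (auto simp: indicator_def E_def)
  moreover have "0 \<le> (LINT y|lborel. indicator E y * \<delta> - (- (indicator E y * Im (brep w y))))"
    by (rule Bochner_Integration.integral_nonneg) (rule nn)
  ultimately have "(LINT y|lborel. indicator E y * \<delta> - (- (indicator E y * Im (brep w y)))) = 0"
    by linarith
  then have "AE y in lborel. indicator E y * \<delta> - (- (indicator E y * Im (brep w y))) = 0"
    using integral_nonneg_eq_0_iff_AE[OF int] nn by simp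
  then have "AE y in lborel. y \<in> ball x0 1 \<longrightarrow> \<delta> \<le> norm (brep w y)"
  proof eventually_elim
    case (elim y)
    then have "y \<notin> E" by (auto simp: E_def)
    then show ?case using abs_Im_le_cmod[of "brep w y"] by (auto simp: E_def)
  qed
  then show ?thesis using \<delta> unfolding w_def by blast
qed

text \<open>Half-open, so that its integer translates are disjoint and cover the whole
  space.\<close>

definition unit_cube :: "'a::euclidean_space set" where
  "unit_cube = {x. \<forall>b\<in>Basis. 0 \<le> x \<bullet> b \<and> x \<bullet> b < 1}"

lemma unit_cube_borel [measurable]: "unit_cube \<in> sets borel"
  unfolding unit_cube_def by measurable

lemma norm_unit_cube: "x \<in> unit_cube \<Longrightarrow> norm x \<le> DIM('a)" for x :: "'a::euclidean_space"
proof -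
  assume "x \<in> unit_cube"
  then have "(\<Sum>b\<in>Basis. \<bar>x \<bullet> b\<bar>) \<le> (\<Sum>b\<in>(Basis::'a set). 1)"
    by (intro sum_mono) (auto simp: unit_cube_def)
  then show ?thesis using norm_le_l1[of x] by simp
qed

lemma unit_cube_box: "box 0 One \<subseteq> unit_cube" "unit_cube \<subseteq> cbox 0 One"
  by (auto simp: unit_cube_def mem_box less_imp_le)

lemma integrable_unit_cube: "integrable lborel (indicator unit_cube :: 'a::euclidean_space \<Rightarrow> real)"
  using emeasure_bounded_finite[OF bounded_subset[OF bounded_cbox unit_cube_box(2)]]
  by (intro integrable_real_indicator) auto

text \<open>Up to sign the moment is the Riesz pairing of the indicator with
  \<open>v y = - (c \<bullet> y)\<close> on the cube. Symmetrising the heat form in the two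
  variables replaces \<open>- (c \<bullet> y) * (c \<bullet> (x - y))\<close> by half of
  \<open>(c \<bullet> (x - y))^2\<close>, which is nonnegative and does not vanish
  identically.\<close>

lemma riesz_unit_cube_moment_pos:
  fixes c :: "'a::euclidean_space"
  assumes "c \<noteq> 0"
  shows "0 < (LINT y|lborel. (c \<bullet> y) * (indicator unit_cube y * Im (brep (riesz c (abs_L2 (indicator unit_cube))) y)))"
proof -
  let ?Q = "unit_cube :: 'a set"
  define D where "D = real DIM('a)"
  define \<phi> where "\<phi> = (indicator ?Q :: 'a \<Rightarrow> real)"
  define v where "v y = - (c \<bullet> y) * \<phi> y" for y
  have \<phi>_supp: "norm x \<le> D" if "\<phi> x \<noteq> 0" for x
    using that norm_unit_cube by (auto simp: \<phi>_def D_def indicator_def split: if_splits)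
  then have v_supp: "norm x \<le> D" if "v x \<noteq> 0" for x using that by (auto simp: v_def)
  have [measurable]: "\<phi> \<in> borel_measurable borel" unfolding \<phi>_def by measurable
  have \<phi>: "sq_int \<phi>" unfolding \<phi>_def by (rule sq_int_indicator(1)[OF unit_cube_borel norm_unit_cube])
  have i\<phi>: "integrable lborel \<phi>" unfolding \<phi>_def by (rule integrable_unit_cube)
  have v: "sq_int v"
  proof (rule sq_int_bounded_support[where C="norm c * D" and r=D])
    show "v \<in> borel_measurable borel" unfolding v_def[abs_def] by measurable
    show "norm (v x) \<le> norm c * D" for x
    proof (cases "\<phi> x = 0")
      case False
      then have "norm x \<le> D" by (rule \<phi>_supp)
      then have "norm c * norm x \<le> norm c * D" by (intro mult_left_mono) auto
      then show ?thesis using False Cauchy_Schwarz_ineq2[of c x] by (auto simp: v_def \<phi>_def indicator_def split: if_splits)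
    qed (simp add: v_def D_def)
  qed (rule v_supp)
  have iv: "integrable lborel v" by (rule sq_int_bounded_support_integrable[OF v v_supp])
  define S where "S t p = \<phi> (fst p) * \<phi> (snd p) * ((c \<bullet> (fst p - snd p))\<^sup>2 * heat t (fst p - snd p))" for t and p :: "'a \<times> 'a"
  have S: "integrable (lborel \<Otimes>\<^sub>M lborel) (S t)" "heat_form c \<phi> v t = (LINT p|(lborel \<Otimes>\<^sub>M lborel). S t p) / 2" if t: "t > 0" for t
  proof -
    define G where "G p = \<phi> (fst p) * v (snd p) * ((c \<bullet> (fst p - snd p)) * heat t (fst p - snd p))" for p
    have G: "integrable (lborel \<Otimes>\<^sub>M lborel) G"
      unfolding G_def[abs_def] by (rule heat_form_integrable[OF i\<phi> \<phi>_supp iv v_supp t])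
    have Gm: "G \<in> borel_measurable (lborel \<Otimes>\<^sub>M lborel)" using G by (rule borel_measurable_integrable)
    have G': "integrable (lborel \<Otimes>\<^sub>M lborel) (\<lambda>(x, y). G (y, x))" "(LINT p|(lborel \<Otimes>\<^sub>M lborel). (case p of (x, y) \<Rightarrow> G (y, x))) = (LINT p|(lborel \<Otimes>\<^sub>M lborel). G p)"
      using lborel_pair.integrable_product_swap[OF G] lborel_pair.integral_product_swap[OF Gm] by auto
    have "S t p = G p + (case p of (x, y) \<Rightarrow> G (y, x))" for p
    proof -
      obtain x y where p: "p = (x, y)" by (cases p)
      have "heat t (y - x) = heat t (x - y)" by (simp add: heat_def norm_minus_commute)
      then show ?thesis
        by (simp add: p S_def G_def v_def power2_eq_square inner_diff_right algebra_simps)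
    qed
    then have Seq: "S t = (\<lambda>p. G p + (case p of (x, y) \<Rightarrow> G (y, x)))" by (rule ext)
    show "integrable (lborel \<Otimes>\<^sub>M lborel) (S t)" unfolding Seq by (intro Bochner_Integration.integrable_add G G')
    have "(LINT p|(lborel \<Otimes>\<^sub>M lborel). S t p) = (LINT p|(lborel \<Otimes>\<^sub>M lborel). G p) + (LINT p|(lborel \<Otimes>\<^sub>M lborel). G p)"
      unfolding Seq by (subst Bochner_Integration.integral_add[OF G G'(1)]) (simp only: G'(2))
    then show "heat_form c \<phi> v t = (LINT p|(lborel \<Otimes>\<^sub>M lborel). S t p) / 2"
      unfolding heat_form_def G_def by simp
  qed
  define q where "q p = \<phi> (fst p) * \<phi> (snd p) * (c \<bullet> (fst p - snd p))\<^sup>2" for p :: "'a \<times> 'a"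
  define h0 where "h0 = sqrt (pi / 4) ^ DIM('a) * exp (- (2 * D)\<^sup>2 / 4)"
  have h0: "h0 > 0" by (simp add: h0_def)
  have q_nn: "0 \<le> q p" for p by (simp add: q_def \<phi>_def)
  have q_le: "h0 * q p \<le> S t p" if t: "1 \<le> t" "t \<le> 4" for t p
  proof (cases "\<phi> (fst p) = 0 \<or> \<phi> (snd p) = 0")
    case False
    then have "norm (fst p) \<le> D" "norm (snd p) \<le> D" using \<phi>_supp by auto
    then have "norm (fst p - snd p) \<le> 2 * D" using norm_triangle_ineq4[of "fst p" "snd p"] by linarith
    then have "h0 \<le> heat t (fst p - snd p)" unfolding h0_def by (rule heat_ge[OF t])
    then have "q p * h0 \<le> q p * heat t (fst p - snd p)" using q_nn by (intro mult_left_mono)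
    then show ?thesis by (simp add: q_def S_def mult_ac)
  qed (auto simp: q_def S_def)
  have qi: "integrable (lborel \<Otimes>\<^sub>M lborel) q"
  proof (rule Bochner_Integration.integrable_bound)
    show "integrable (lborel \<Otimes>\<^sub>M lborel) (\<lambda>p. (1 / h0) * S 1 p)" using S(1)[of 1] by simp
    show "q \<in> borel_measurable (lborel \<Otimes>\<^sub>M lborel)" unfolding q_def[abs_def] by measurable
    show "AE p in lborel \<Otimes>\<^sub>M lborel. norm (q p) \<le> norm ((1 / h0) * S 1 p)"
    proof (rule AE_I2)
      fix p
      have "q p \<le> (1 / h0) * S 1 p" using q_le[of 1 p] h0 by (simp add: field_simps)
      then show "norm (q p) \<le> norm ((1 / h0) * S 1 p)"
        using q_nn[of p] abs_ge_self[of "(1 / h0) * S 1 p"] unfolding real_norm_def by linarith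
    qed
  qed
  define K where "K = (LINT p|(lborel \<Otimes>\<^sub>M lborel). q p)"
  \<comment> \<open>If \<open>K\<close> were zero, \<open>q\<close> would vanish almost everywhere.
    It is positive on the open set \<open>U\<close>, which contains the pair formed by the centre of
    the cube and a point slightly displaced along \<open>c\<close>.\<close>
  have "K \<noteq> 0"
  proof
    assume "K = 0"
    then have "AE p in lborel \<Otimes>\<^sub>M lborel. q p = 0"
      using integral_nonneg_eq_0_iff_AE[OF qi] q_nn by (simp add: K_def)
    then have AE: "AE p in lborel. q p = 0" unfolding lborel_prod .
    define U where "U = {p :: 'a \<times> 'a. fst p \<in> box 0 One \<and> snd p \<in> box 0 One \<and> c \<bullet> (fst p - snd p) \<noteq> 0}"
    have "open U"
    proof -
      have "U = (box 0 One \<times> box 0 One) \<inter> {p. c \<bullet> (fst p - snd p) \<noteq> 0}" by (auto simp: U_def)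
      moreover have "open {p :: 'a \<times> 'a. c \<bullet> (fst p - snd p) \<noteq> 0}"
        by (intro open_Collect_neq continuous_intros)
      ultimately show ?thesis by (auto intro!: open_Int open_Times open_box)
    qed
    moreover have "U \<noteq> {}"
    proof -
      define z :: 'a where "z = (1/2) *\<^sub>R One"
      have z: "z \<in> box 0 One" by (simp add: z_def mem_box)
      then obtain e where e: "e > 0" "ball z e \<subseteq> box 0 One" using open_box open_contains_ball by blast
      define x where "x = z + (e / (2 * norm c)) *\<^sub>R c"
      have "dist z x = e / 2" using \<open>c \<noteq> 0\<close> e by (simp add: x_def dist_norm)
      then have "x \<in> box 0 One" using e by (intro subsetD[OF e(2)]) auto
      moreover have "c \<bullet> (x - z) \<noteq> 0" using \<open>c \<noteq> 0\<close> e by (simp add: x_def)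
      ultimately have "(x, z) \<in> U" using z by (simp add: U_def)
      then show ?thesis by blast
    qed
    ultimately have "\<not> negligible U" by (rule open_not_negligible)
    moreover have "AE p in lborel. p \<notin> U"
      using AE by eventually_elim (use unit_cube_box(1) in \<open>auto simp: q_def U_def \<phi>_def indicator_def split: if_splits\<close>)
    then have "AE p in lebesgue. p \<notin> U" by (rule AE_completion)
    then have "negligible U"
      using \<open>open U\<close> by (simp add: negligible_iff_null_sets AE_iff_null_sets)
    ultimately show False by simp
  qed
  moreover have "K \<ge> 0" unfolding K_def using q_nn by (intro Bochner_Integration.integral_nonneg)
  ultimately have K: "K > 0" by simp
  have "0 < (2 * pi) powr (- real DIM('a)) / (4 * sqrt pi) * (h0 * K / 2)" using K h0 by simp
  also have "\<dots> \<le> - (riesz c (abs_L2 (\<lambda>x. of_real (\<phi> x))) \<bullet> abs_L2 (\<lambda>x. \<i> * of_real (v x)))"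
  proof (rule riesz_heat_lower_bound[OF \<phi> \<phi>_supp v v_supp])
    show "0 \<le> heat_form c \<phi> v t" if "t > 0" for t
    proof -
      have "0 \<le> S t p" for p
        unfolding S_def \<phi>_def using that by (intro mult_nonneg_nonneg heat_nonneg) auto
      then have "0 \<le> (LINT p|(lborel \<Otimes>\<^sub>M lborel). S t p)" by (rule Bochner_Integration.integral_nonneg)
      then show ?thesis unfolding S(2)[OF that] by simp
    qed
    show "h0 * K / 2 \<le> heat_form c \<phi> v t" if t: "1 \<le> t" "t \<le> 4" for t
    proof -
      have "t > 0" using t by simp
      have "h0 * K = (LINT p|(lborel \<Otimes>\<^sub>M lborel). h0 * q p)" by (simp add: K_def)
      also have "\<dots> \<le> (LINT p|(lborel \<Otimes>\<^sub>M lborel). S t p)"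
        using qi S(1)[OF \<open>t > 0\<close>] q_le[OF t] by (intro integral_mono) auto
      finally show ?thesis unfolding S(2)[OF \<open>t > 0\<close>] by simp
    qed
    show "0 \<le> h0 * K / 2" using h0 K by simp
  qed
  also have "abs_L2 (\<lambda>x. complex_of_real (\<phi> x)) = abs_L2 (indicator unit_cube)"
    by (simp add: \<phi>_def of_real_indicator)
  also have "- (riesz c (abs_L2 (indicator unit_cube)) \<bullet> abs_L2 (\<lambda>x. \<i> * complex_of_real (v x)))
     = (LINT x|lborel. - (v x * Im (brep (riesz c (abs_L2 (indicator unit_cube))) x)))"
    unfolding inner_imag(1)[OF v] by simp
  also have "\<dots> = (LINT y|lborel. (c \<bullet> y) * (indicator unit_cube y * Im (brep (riesz c (abs_L2 (indicator unit_cube))) y)))"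
    by (intro Bochner_Integration.integral_cong) (simp_all add: v_def \<phi>_def)
  finally show ?thesis .
qed

section \<open>The quantum derivative on locally bounded pieces\<close>

lemma borel_measurable_smult_const:
  fixes v :: "complex^'n"
  assumes [measurable]: "g \<in> borel_measurable M"
  shows "(\<lambda>x. g x *s v) \<in> borel_measurable M"
proof -
  have "continuous_on UNIV (\<lambda>c. c *s v)"
    unfolding vector_scalar_mult_def by (intro continuous_intros)
  then show ?thesis using assms by (rule borel_measurable_continuous_on)
qed

lemma sq_int_smult_const:
  fixes v :: "complex^'n"
  assumes "sq_int g"
  shows "sq_int (\<lambda>x. g x *s v)"
proof (rule sq_int_bound[OF assms, where C="norm v"])
  show "(\<lambda>x. g x *s v) \<in> borel_measurable borel"
    using sq_int_measurable[OF assms] by (rule borel_measurable_smult_const)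
qed (simp add: norm_vector_smult_complex mult.commute)

text \<open>On an elementary tensor every component is a constant multiple of the scalar function
  \<open>g\<close>. A multiplier commutes with complex constants, so it acts on \<open>g\<close>
  alone and the matrix acts on \<open>v\<close> alone.\<close>

lemma tensor_op_multiplier:
  fixes v :: "complex^'n" and A :: "complex^'n^'n" and g :: "'a::euclidean_space \<Rightarrow> complex"
  assumes m: "bounded_borel m" and g: "sq_int g"
  shows "tensor_op A (fourier_multiplier m) (abs_L2 (\<lambda>x. g x *s v))
    = abs_L2 (\<lambda>x. brep (fourier_multiplier m (abs_L2 g)) x *s (A *v v))"
proof -
  let ?B = "fourier_multiplier m"
  define \<beta> where "\<beta> = brep (?B (abs_L2 g))"
  have \<beta>: "sq_int \<beta>" "abs_L2 \<beta> = ?B (abs_L2 g)" by (simp_all add: \<beta>_def sq_int_brep)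
  have 1: "abs_L2 (\<lambda>y. rep_L2 (abs_L2 (\<lambda>x. g x *s v)) y $ k) = mult_L2 (\<lambda>_. v $ k) (abs_L2 g)" for k
  proof -
    have "abs_L2 (\<lambda>y. rep_L2 (abs_L2 (\<lambda>x. g x *s v)) y $ k) = abs_L2 (\<lambda>x. v $ k * g x)"
    proof (rule abs_L2_cong_sq_int)
      show "sq_int (\<lambda>x. v $ k * g x)" by (rule sq_int_bounded_borel_mult[OF bounded_borel_const g])
      show "AE x in lebesgue. rep_L2 (abs_L2 (\<lambda>x. g x *s v)) x $ k = v $ k * g x"
        using rep_abs_L2[OF sq_int_imp_square_integrable[OF sq_int_smult_const[OF g]], of v]
        by eventually_elim (simp add: mult.commute)
    qed
    then show ?thesis by (simp add: mult_L2_abs g)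
  qed
  have 2: "?B (abs_L2 (\<lambda>y. rep_L2 (abs_L2 (\<lambda>x. g x *s v)) y $ k)) = abs_L2 (\<lambda>x. v $ k * \<beta> x)" for k
    unfolding 1 fourier_multiplier_cmult[OF m] \<beta>(2)[symmetric]
    by (rule mult_L2_abs[OF bounded_borel_const \<beta>(1)])
  have "AE x in lebesgue. rep_L2 (abs_L2 (\<lambda>x. v $ k * \<beta> x)) x = v $ k * \<beta> x" for k
    by (intro rep_abs_L2 sq_int_imp_square_integrable sq_int_bounded_borel_mult bounded_borel_const \<beta>)
  then have "AE x in lebesgue. \<forall>k. rep_L2 (abs_L2 (\<lambda>x. v $ k * \<beta> x)) x = v $ k * \<beta> x"
    by (rule eventually_all_finite)
  then have AE: "AE x in lebesgue. A *v (\<chi> k. rep_L2 (?B (abs_L2 (\<lambda>y. rep_L2 (abs_L2 (\<lambda>x. g x *s v)) y $ k))) x)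
      = \<beta> x *s (A *v v)"
    unfolding 2
  proof eventually_elim
    case (elim x)
    then show ?case
      by (simp add: vec_eq_iff matrix_vector_mult_def sum_distrib_left mult_ac)
  qed
  show ?thesis
    unfolding tensor_op_def \<beta>_def[symmetric]
    by (rule abs_L2_cong_sq_int[OF sq_int_smult_const[OF \<beta>(1)] AE])
qed

lemma sq_int_sum: "finite I \<Longrightarrow> (\<And>i. i \<in> I \<Longrightarrow> sq_int (h i)) \<Longrightarrow> sq_int (\<lambda>x. \<Sum>i\<in>I. h i x)"
  by (induction I rule: finite_induct) (simp_all add: sq_int_add)

lemma abs_L2_zero: "abs_L2 (\<lambda>x. 0) = 0"
  by (simp add: zero_L2_def)

lemma abs_L2_sum:
  assumes "finite I" "\<And>i. i \<in> I \<Longrightarrow> sq_int (h i)"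
  shows "(\<Sum>i\<in>I. abs_L2 (h i)) = abs_L2 (\<lambda>x. \<Sum>i\<in>I. h i x)"
  using assms
proof (induction I rule: finite_induct)
  case (insert i I)
  then have "abs_L2 (h i) + abs_L2 (\<lambda>x. \<Sum>i\<in>I. h i x) = abs_L2 (\<lambda>x. h i x + (\<Sum>i\<in>I. h i x))"
    by (intro abs_L2_add sq_int_imp_square_integrable sq_int_sum) auto
  then show ?case using insert by simp
qed (simp add: abs_L2_zero)

abbreviation riesz_axis :: "'d::finite \<Rightarrow> (real^'d, complex) L2 \<Rightarrow> (real^'d, complex) L2" where
  "riesz_axis j \<equiv> riesz (axis j 1)"

lemma AE_sgn_dirac:
  fixes \<gamma> :: "'d::finite \<Rightarrow> complex^'n^'n" and g :: "real^'d \<Rightarrow> complex"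
  assumes g: "sq_int g"
  shows "AE x in lborel. rep_L2 (sgn_dirac \<gamma> (abs_L2 (\<lambda>x. g x *s v))) x
    = (\<Sum>j\<in>UNIV. brep (riesz_axis j (abs_L2 g)) x *s (\<gamma> j *v v))"
proof -
  have "of_real (\<xi> $ j / norm \<xi>) = (of_real (riesz_symbol (axis j 1) \<xi>) :: complex)" for j and \<xi> :: "real^'d"
    by (simp add: riesz_symbol_def inner_axis')
  then have "tensor_op (\<gamma> j) (fourier_multiplier (\<lambda>\<xi>. of_real (\<xi> $ j / norm \<xi>))) (abs_L2 (\<lambda>x. g x *s v))
      = abs_L2 (\<lambda>x. brep (riesz_axis j (abs_L2 g)) x *s (\<gamma> j *v v))" for j
    unfolding riesz_def by (simp only: tensor_op_multiplier[OF bounded_borel_riesz_symbol g])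
  then have "sgn_dirac \<gamma> (abs_L2 (\<lambda>x. g x *s v)) = (\<Sum>j\<in>UNIV. abs_L2 (\<lambda>x. brep (riesz_axis j (abs_L2 g)) x *s (\<gamma> j *v v)))"
    unfolding sgn_dirac_def by (intro sum.cong) simp_all
  also have "\<dots> = abs_L2 (\<lambda>x. \<Sum>j\<in>UNIV. brep (riesz_axis j (abs_L2 g)) x *s (\<gamma> j *v v))"
    by (intro abs_L2_sum sq_int_smult_const sq_int_brep) simp
  finally show ?thesis
    by (simp only:) (intro rep_abs_sq_int sq_int_sum sq_int_smult_const sq_int_brep finite)
qed

text \<open>Take the trace of the anticommutation relation and use that
  \<open>\<gamma> j ** \<gamma> l\<close> and \<open>\<gamma> l ** \<gamma> j\<close> have the same
  trace. The sum on the left is that trace, written by columns.\<close>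

lemma trace_gamma:
  fixes \<gamma> :: "'d::finite \<Rightarrow> complex^'n^'n"
  assumes "gamma_matrices \<gamma>"
  shows "(\<Sum>p\<in>UNIV. (\<gamma> j *v (\<gamma> l *v axis p 1)) $ p) = (if j = l then of_nat CARD('n) else 0)"
proof -
  have "trace (\<gamma> j ** \<gamma> l + \<gamma> l ** \<gamma> j) = trace (mat (if j = l then 2 else 0) :: complex^'n^'n)"
    using assms by (simp only: gamma_matrices_def)
  then have "2 * trace (\<gamma> j ** \<gamma> l) = of_nat CARD('n) * (if j = l then 2 else 0)"
    using trace_mul_sym[of "\<gamma> j" "\<gamma> l"] unfolding trace_add by (simp add: trace_def mat_def)
  then have "trace (\<gamma> j ** \<gamma> l) = (if j = l then of_nat CARD('n) else 0)"
    by (simp split: if_splits)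
  moreover have "(\<Sum>p\<in>UNIV. (\<gamma> j *v (\<gamma> l *v axis p 1)) $ p) = trace (\<gamma> j ** \<gamma> l)"
    unfolding trace_def matrix_vector_mul_assoc
    by (intro sum.cong refl) (simp add: matrix_vector_mult_def axis_def if_distrib cong: if_cong)
  ultimately show ?thesis by simp
qed

text \<open>Feeding in \<open>\<gamma> l *v axis p 1\<close>, reading off component \<open>p\<close>
  and summing over \<open>p\<close> leaves, by \<open>trace_gamma\<close>, only the summand
  \<open>j = l\<close> of the Dirac sign. What remains is \<open>\<i> * N\<close> times the scalar
  commutator of the Riesz transform with \<open>f0\<close>, applied to \<open>g\<close>. The
  assumption on \<open>f0 * g\<close> makes the first term of the commutator an honest element of
  L2.\<close>

lemma quantum_derivative_trace:
  fixes \<gamma> :: "'d::finite \<Rightarrow> complex^'n^'n" and g f0 :: "real^'d \<Rightarrow> complex"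
  assumes \<gamma>: "gamma_matrices \<gamma>" and T: "is_quantum_derivative \<gamma> f T"
    and f0: "AE x in lebesgue. f x = f0 x"
    and g: "g \<in> borel_measurable borel" "\<And>x. norm (g x) \<le> C" "\<And>x. g x \<noteq> 0 \<Longrightarrow> norm x \<le> R"
    and fg: "sq_int (\<lambda>x. f0 x * g x)"
  shows "AE x in lborel. (\<Sum>p\<in>UNIV. brep (T (abs_L2 (\<lambda>x. g x *s (\<gamma> l *v axis p 1)))) x $ p)
    = \<i> * of_nat CARD('n) * (brep (riesz_axis l (abs_L2 (\<lambda>x. f0 x * g x))) x - f0 x * brep (riesz_axis l (abs_L2 g)) x)"
proof -
  define e where "e p = \<gamma> l *v axis p 1" for p
  have sg: "sq_int g" by (rule sq_int_bounded_support[OF g])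
  have "AE x in lborel. brep (T (abs_L2 (\<lambda>x. g x *s e p))) x =
      \<i> *s ((\<Sum>j\<in>UNIV. brep (riesz_axis j (abs_L2 (\<lambda>x. f0 x * g x))) x *s (\<gamma> j *v e p))
        - f0 x *s (\<Sum>j\<in>UNIV. brep (riesz_axis j (abs_L2 g)) x *s (\<gamma> j *v e p)))" for p
  proof -
    let ?g = "\<lambda>x. g x *s e p"
    have 1: "?g \<in> borel_measurable lebesgue"
      by (rule measurable_completion) (use borel_measurable_smult_const[OF g(1)] in simp)
    have 2: "bounded (range ?g)"
      unfolding bounded_iff using g(2)
      by (intro exI[of _ "C * norm (e p)"]) (auto simp: norm_vector_smult_complex intro!: mult_right_mono)
    have 3: "compact (closure {x. ?g x \<noteq> 0})"
    proof -
      have "{x. ?g x \<noteq> 0} \<subseteq> cball 0 R" using g(3) by (auto simp: vec_eq_iff)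
      then show ?thesis using bounded_subset[OF bounded_cball] by (simp add: compact_closure)
    qed
    have eq: "abs_L2 (\<lambda>y. f y *s ?g y) = abs_L2 (\<lambda>y. (f0 y * g y) *s e p)"
    proof (rule abs_L2_cong_sq_int[OF sq_int_smult_const[OF fg]])
      show "AE x in lebesgue. f x *s ?g x = (f0 x * g x) *s e p"
        using f0 by eventually_elim (simp add: vector_smult_assoc)
    qed
    have "AE x in lebesgue. rep_L2 (T (abs_L2 ?g)) x =
        \<i> *s (rep_L2 (sgn_dirac \<gamma> (abs_L2 (\<lambda>y. (f0 y * g y) *s e p))) x - f x *s rep_L2 (sgn_dirac \<gamma> (abs_L2 ?g)) x)"
      using T 1 2 3 unfolding is_quantum_derivative_def eq[symmetric] by blast
    then have "AE x in lborel. rep_L2 (T (abs_L2 ?g)) x =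
        \<i> *s (rep_L2 (sgn_dirac \<gamma> (abs_L2 (\<lambda>y. (f0 y * g y) *s e p))) x - f x *s rep_L2 (sgn_dirac \<gamma> (abs_L2 ?g)) x)"
      by (simp only: AE_completion_iff)
    moreover have "AE x in lborel. f x = f0 x" using f0 by (simp only: AE_completion_iff)
    moreover note AE_brep[of "T (abs_L2 ?g)"] AE_sgn_dirac[OF fg, of \<gamma> "e p"] AE_sgn_dirac[OF sg, of \<gamma> "e p"]
    ultimately show ?thesis by eventually_elim simp
  qed
  then have "AE x in lborel. \<forall>p. brep (T (abs_L2 (\<lambda>x. g x *s e p))) x =
      \<i> *s ((\<Sum>j\<in>UNIV. brep (riesz_axis j (abs_L2 (\<lambda>x. f0 x * g x))) x *s (\<gamma> j *v e p))
        - f0 x *s (\<Sum>j\<in>UNIV. brep (riesz_axis j (abs_L2 g)) x *s (\<gamma> j *v e p)))"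
    by (rule eventually_all_finite)
  then show ?thesis unfolding e_def[symmetric]
  proof eventually_elim
    case (elim x)
    define a where "a j = brep (riesz_axis j (abs_L2 (\<lambda>x. f0 x * g x))) x - f0 x * brep (riesz_axis j (abs_L2 g)) x" for j
    have "brep (T (abs_L2 (\<lambda>x. g x *s e p))) x $ p = \<i> * (\<Sum>j\<in>UNIV. a j * (\<gamma> j *v e p) $ p)" for p
    proof -
      have comp: "(\<i> *s (X - f0 x *s Y)) $ p = \<i> * (X $ p - f0 x * Y $ p)" for X Y :: "complex^'n"
        by (simp add: right_diff_distrib)
      have "brep (T (abs_L2 (\<lambda>x. g x *s e p))) x $ p
        = \<i> * ((\<Sum>j\<in>UNIV. brep (riesz_axis j (abs_L2 (\<lambda>x. f0 x * g x))) x * (\<gamma> j *v e p) $ p)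
          - f0 x * (\<Sum>j\<in>UNIV. brep (riesz_axis j (abs_L2 g)) x * (\<gamma> j *v e p) $ p))"
        unfolding elim[rule_format, of p] comp by (simp only: sum_component vector_smult_component)
      also have "\<dots> = \<i> * (\<Sum>j\<in>UNIV. a j * (\<gamma> j *v e p) $ p)"
        by (simp add: a_def left_diff_distrib sum_subtractf sum_distrib_left mult.assoc)
      finally show ?thesis .
    qed
    then have "(\<Sum>p\<in>UNIV. brep (T (abs_L2 (\<lambda>x. g x *s e p))) x $ p) = \<i> * (\<Sum>p\<in>UNIV. \<Sum>j\<in>UNIV. a j * (\<gamma> j *v e p) $ p)"
      by (simp add: sum_distrib_left)
    also have "(\<Sum>p\<in>UNIV. \<Sum>j\<in>UNIV. a j * (\<gamma> j *v e p) $ p) = (\<Sum>j\<in>UNIV. a j * (\<Sum>p\<in>UNIV. (\<gamma> j *v e p) $ p))"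
      unfolding sum_distrib_left by (rule sum.swap)
    also have "\<dots> = a l * of_nat CARD('n)"
      unfolding e_def trace_gamma[OF \<gamma>] by (simp add: if_distrib cong: if_cong)
    finally show ?case by (simp add: a_def mult_ac)
  qed
qed

text \<open>A set \<open>A\<close> on which \<open>f0\<close> is bounded is chosen in a ball displaced from \<open>x0\<close> along \<open>b\<close>, so that
  \<open>b \<bullet> (x - y)\<close> has constant sign for \<open>x\<close> near \<open>x0\<close> and \<open>y \<in> A\<close>; there is no cancellation in the
  Riesz transform of its indicator.\<close>

lemma quantum_derivative_L2_loc_ball:
  fixes \<gamma> :: "'d::finite \<Rightarrow> complex^'n^'n" and f0 :: "real^'d \<Rightarrow> complex"
  assumes \<gamma>: "gamma_matrices \<gamma>" and T: "is_quantum_derivative \<gamma> f T"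
    and f0: "AE x in lebesgue. f x = f0 x" and f0m [measurable]: "f0 \<in> borel_measurable borel"
  shows "sq_int (\<lambda>x. indicator (ball x0 1) x *\<^sub>R f0 x)"
proof -
  obtain l :: 'd where True by blast
  define b :: "real^'d" where "b = axis l 1"
  have b: "b \<in> Basis" by (simp add: b_def axis_in_Basis_iff)
  define A where "A n = {x \<in> ball (x0 + 3 *\<^sub>R b) 1. norm (f0 x) \<le> real n}" for n :: nat
  have A_sets: "A n \<in> sets borel" for n unfolding A_def by measurable
  \<comment> \<open>The sets \<open>A n\<close> exhaust a ball of positive measure, so they cannot
    all be null. Only such a piece, on which \<open>f0\<close> is bounded, is available as a test
    set at this stage.\<close>
  have "\<exists>n. measure lborel (A n) > 0"
  proof (rule ccontr)
    assume "\<not> (\<exists>n. measure lborel (A n) > 0)"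
    then have m0: "measure lborel (A n) = 0" for n using zero_less_measure_iff by blast
    have "emeasure lborel (A n) < \<infinity>" for n
      by (rule emeasure_bounded_finite[OF bounded_subset[OF bounded_ball]]) (auto simp: A_def)
    then have "A n \<in> null_sets lborel" for n
      using m0[of n] A_sets[of n] by (intro null_setsI) (auto simp: emeasure_eq_ennreal_measure less_top)
    then have "(\<Union>n. A n) \<in> null_sets lborel" by (rule null_sets_UN)
    moreover have "(\<Union>n. A n) = ball (x0 + 3 *\<^sub>R b) 1"
      using real_arch_simple by (auto simp: A_def)
    ultimately have "ball (x0 + 3 *\<^sub>R b) 1 \<in> null_sets lborel" by simp
    then have "negligible (ball (x0 + 3 *\<^sub>R b) 1)"
      by (simp add: negligible_iff_null_sets null_sets_completionI)
    then show False using open_not_negligible[OF open_ball, of "x0 + 3 *\<^sub>R b" 1] by auto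
  qed
  then obtain n where n: "measure lborel (A n) > 0" by blast
  define g :: "real^'d \<Rightarrow> complex" where "g = indicator (A n)"
  have gm [measurable]: "g \<in> borel_measurable borel" unfolding g_def using A_sets[of n] by measurable
  have g1: "norm (g x) \<le> 1" for x by (simp add: g_def indicator_def)
  define R where "R = norm (x0 + 3 *\<^sub>R b) + 1"
  have suppA: "norm x \<le> R" if "x \<in> A n" for x
    using that norm_triangle_sub[of x "x0 + 3 *\<^sub>R b"] by (auto simp: A_def R_def dist_norm norm_minus_commute)
  have supp: "norm x \<le> R" if "g x \<noteq> 0" for x
    using that suppA by (auto simp: g_def indicator_def split: if_splits)
  have fg: "sq_int (\<lambda>x. f0 x * g x)"
  proof (rule sq_int_bounded_support[where C="real n" and r=R])
    show "norm (f0 x * g x) \<le> real n" for x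
      by (auto simp: g_def indicator_def A_def)
  qed (use supp in auto)
  define N where "N = (of_nat CARD('n) :: complex)"
  have N: "N \<noteq> 0" by (simp add: N_def)
  define r where "r = brep (riesz_axis l (abs_L2 g))"
  define s where "s = brep (riesz_axis l (abs_L2 (\<lambda>x. f0 x * g x)))"
  define t where "t x = (\<Sum>p\<in>UNIV. brep (T (abs_L2 (\<lambda>x. g x *s (\<gamma> l *v axis p 1)))) x $ p)" for x
  have t: "sq_int t"
    unfolding t_def[abs_def]
  proof (intro sq_int_sum finite)
    fix p
    let ?h = "brep (T (abs_L2 (\<lambda>x. g x *s (\<gamma> l *v axis p 1))))"
    show "sq_int (\<lambda>x. ?h x $ p)"
    proof (rule sq_int_bound[OF sq_int_brep, where C=1])
      have "continuous_on UNIV (\<lambda>v::complex^'n. v $ p)" by (intro continuous_intros)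
      then show "(\<lambda>x. ?h x $ p) \<in> borel_measurable borel"
        using borel_measurable_brep by (rule borel_measurable_continuous_on)
      show "AE x in lborel. norm (?h x $ p) \<le> 1 * norm (?h x)"
        using Finite_Cartesian_Product.norm_nth_le by auto
    qed
  qed
  have "AE x in lborel. t x = \<i> * N * (s x - f0 x * r x)"
    unfolding t_def N_def s_def r_def
    by (rule quantum_derivative_trace[OF \<gamma> T f0 gm g1 supp fg])
  then have AE: "AE x in lborel. s x - (1 / (\<i> * N)) * t x = f0 x * r x"
    by eventually_elim (use N in \<open>simp add: field_simps\<close>)
  have sq: "sq_int (\<lambda>x. s x - (1 / (\<i> * N)) * t x)"
    by (intro sq_int_diff sq_int_bounded_borel_mult bounded_borel_const t) (simp add: s_def sq_int_brep)
  have fr: "sq_int (\<lambda>x. f0 x * r x)"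
    by (rule sq_int_AE_imp[OF sq _ AE]) (simp add: r_def)
  obtain \<delta> where \<delta>: "\<delta> > 0" "AE y in lborel. y \<in> ball x0 1 \<longrightarrow> \<delta> \<le> norm (r y)"
  proof -
    have sub: "A n \<subseteq> ball (x0 + 3 *\<^sub>R b) 1" by (auto simp: A_def)
    show thesis
      using riesz_indicator_lower_bound[OF b A_sets[of n] sub n] that unfolding r_def g_def b_def by blast
  qed
  show ?thesis
  proof (rule sq_int_bound[OF fr, where C="1 / \<delta>"])
    show "(\<lambda>x. indicator (ball x0 1) x *\<^sub>R f0 x) \<in> borel_measurable borel"
      by (intro borel_measurable_scaleR borel_measurable_indicator f0m) simp
    show "AE x in lborel. norm (indicator (ball x0 1) x *\<^sub>R f0 x) \<le> 1 / \<delta> * norm (f0 x * r x)"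
      using \<delta>(2)
    proof eventually_elim
      case (elim x)
      show ?case
      proof (cases "x \<in> ball x0 1")
        case True
        then have "norm (f0 x) * \<delta> \<le> norm (f0 x) * norm (r x)" using elim by (intro mult_left_mono) auto
        then show ?thesis using True \<delta>(1) by (simp add: norm_mult field_simps)
      qed (use \<delta>(1) in simp)
    qed
  qed
qed

lemma quantum_derivative_L2_loc:
  fixes \<gamma> :: "'d::finite \<Rightarrow> complex^'n^'n" and f0 :: "real^'d \<Rightarrow> complex"
  assumes \<gamma>: "gamma_matrices \<gamma>" and T: "is_quantum_derivative \<gamma> f T"
    and f0: "AE x in lebesgue. f x = f0 x" and f0m [measurable]: "f0 \<in> borel_measurable borel"
  shows "sq_int (\<lambda>x. indicator (cball 0 R) x *\<^sub>R f0 x)"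
proof -
  note ball = quantum_derivative_L2_loc_ball[OF assms]
  have "compact (cball (0::real^'d) R)" by simp
  moreover have "cball (0::real^'d) R \<subseteq> (\<Union>x\<in>UNIV. ball x 1)"
  proof
    fix x :: "real^'d"
    show "x \<in> (\<Union>x\<in>UNIV. ball x 1)" by (rule UN_I[where a=x]) auto
  qed
  ultimately obtain F :: "(real^'d) set" where F: "finite F" "cball 0 R \<subseteq> (\<Union>x\<in>F. ball x 1)"
    using compactE_image[of "cball (0::real^'d) R" UNIV "\<lambda>x. ball x 1"] by (metis open_ball)
  have s: "sq_int (\<lambda>x. \<Sum>y\<in>F. norm (indicator (ball y 1) x *\<^sub>R f0 x))"
    by (intro sq_int_sum F(1) sq_int_norm_fun ball)
  show ?thesis
  proof (rule sq_int_bound[OF s, where C=1])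
    show "(\<lambda>x. indicator (cball 0 R) x *\<^sub>R f0 x) \<in> borel_measurable borel"
      by (intro borel_measurable_scaleR borel_measurable_indicator f0m) simp
    show "AE x in lborel. norm (indicator (cball 0 R) x *\<^sub>R f0 x)
        \<le> 1 * norm (\<Sum>y\<in>F. norm (indicator (ball y 1) x *\<^sub>R f0 x))"
    proof (rule AE_I2)
      fix x :: "real^'d"
      show "norm (indicator (cball 0 R) x *\<^sub>R f0 x) \<le> 1 * norm (\<Sum>y\<in>F. norm (indicator (ball y 1) x *\<^sub>R f0 x))"
      proof (cases "x \<in> cball 0 R")
        case True
        then obtain y where y: "y \<in> F" "x \<in> ball y 1" using F(2) by blast
        have "norm (indicator (cball 0 R) x *\<^sub>R f0 x) = norm (indicator (ball y 1) x *\<^sub>R f0 x)"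
          using True y by simp
        also have "\<dots> \<le> (\<Sum>y\<in>F. norm (indicator (ball y 1) x *\<^sub>R f0 x))"
          using F(1) y(1) by (intro member_le_sum) auto
        finally show ?thesis by simp
      qed simp
    qed
  qed
qed

text \<open>Self-adjointness moves the Riesz transform from \<open>f0 * indicator Q\<close> to the
  indicator, so one term of the commutator is paired with \<open>r\<close> and the other with
  \<open>cnj r\<close>. Their difference is \<open>2 * \<i> * Im r\<close>, and with the prefactor
  \<open>- \<i> * N\<close> this becomes the real weight \<open>2 * N * Im r\<close>.\<close>

lemma quantum_derivative_pairing:
  fixes \<gamma> :: "'d::finite \<Rightarrow> complex^'n^'n" and f0 :: "real^'d \<Rightarrow> complex" and Q :: "(real^'d) set"
  assumes \<gamma>: "gamma_matrices \<gamma>" and T: "is_quantum_derivative \<gamma> f T"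
    and f0: "AE x in lebesgue. f x = f0 x" and f0m [measurable]: "f0 \<in> borel_measurable borel"
    and Q [measurable]: "Q \<in> sets borel" "\<And>x. x \<in> Q \<Longrightarrow> norm x \<le> R"
  shows "(\<Sum>p\<in>UNIV. T (abs_L2 (\<lambda>x. indicator Q x *s (\<gamma> l *v axis p 1))) \<bullet> abs_L2 (\<lambda>x. (z * indicator Q x) *s axis p 1))
    = 2 * real CARD('n) * (LINT x|lborel. (indicator Q x * Re (cnj z * f0 x)) * Im (brep (riesz_axis l (abs_L2 (indicator Q))) x))"
proof -
  let ?g = "indicator Q :: real^'d \<Rightarrow> complex"
  define N where "N = (of_nat CARD('n) :: complex)"
  have g1: "norm (?g x) \<le> 1" for x by (simp add: indicator_def)
  have gs: "norm x \<le> R" if "?g x \<noteq> 0" for x using that Q(2) by (auto simp: indicator_def split: if_splits)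
  have gm [measurable]: "?g \<in> borel_measurable borel" by measurable
  have sg: "sq_int ?g" by (rule sq_int_bounded_support[OF gm g1 gs])
  have "sq_int (\<lambda>x. ?g x * (indicator (cball 0 R) x *\<^sub>R f0 x))"
    by (rule sq_int_mult_bounded[OF quantum_derivative_L2_loc[OF \<gamma> T f0 f0m] gm g1])
  moreover have "(\<lambda>x. ?g x * (indicator (cball 0 R) x *\<^sub>R f0 x)) = (\<lambda>x. f0 x * ?g x)"
    using Q(2) by (force simp: indicator_def)
  ultimately have fg: "sq_int (\<lambda>x. f0 x * ?g x)" by simp
  define r where "r = brep (riesz_axis l (abs_L2 ?g))"
  define s where "s = brep (riesz_axis l (abs_L2 (\<lambda>x. f0 x * ?g x)))"
  have r: "sq_int r" "abs_L2 r = riesz_axis l (abs_L2 ?g)" by (simp_all add: r_def sq_int_brep)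
  have s: "sq_int s" "abs_L2 s = riesz_axis l (abs_L2 (\<lambda>x. f0 x * ?g x))" by (simp_all add: s_def sq_int_brep)
  define h where "h p = brep (T (abs_L2 (\<lambda>x. ?g x *s (\<gamma> l *v axis p 1))))" for p
  have hT: "T (abs_L2 (\<lambda>x. ?g x *s (\<gamma> l *v axis p 1))) = abs_L2 (h p)" for p by (simp add: h_def)
  have sh: "sq_int (h p)" for p by (simp add: h_def sq_int_brep)
  have zg: "sq_int (\<lambda>x. z * ?g x)" by (rule sq_int_bounded_borel_mult[OF bounded_borel_const sg])
  have inner_axis_complex: "w \<bullet> (c *s axis p 1) = w $ p \<bullet> c" for w :: "complex^'n" and c p
  proof -
    have "c *s axis p (1::complex) = axis p c" by (auto simp: vec_eq_iff axis_def)
    then show ?thesis by (simp add: inner_axis)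
  qed
  note SI = sq_int_inner[OF sh sq_int_smult_const[OF zg]]
  have "(\<Sum>p\<in>UNIV. T (abs_L2 (\<lambda>x. indicator Q x *s (\<gamma> l *v axis p 1))) \<bullet> abs_L2 (\<lambda>x. (z * indicator Q x) *s axis p 1))
      = (\<Sum>p\<in>UNIV. LINT x|lborel. h p x $ p \<bullet> (z * ?g x))"
    unfolding hT SI(1) inner_axis_complex ..
  also have "\<dots> = (LINT x|lborel. (\<Sum>p\<in>UNIV. h p x $ p \<bullet> (z * ?g x)))"
    by (rule Bochner_Integration.integral_sum[symmetric]) (use SI(2)[of _ "axis _ 1"] in \<open>simp only: inner_axis_complex\<close>)
  \<comment> \<open>The constants and the conjugate of \<open>r\<close> are shifted to the second
    argument of the real inner product, which prepares the first term for the adjoint.\<close>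
  also have "\<dots> = (LINT x|lborel. s x \<bullet> (- \<i> * N * z * ?g x) - (f0 x * ?g x) \<bullet> (- \<i> * N * z * cnj (r x)))"
  proof (rule integral_cong_AE)
    have hm [measurable]: "(\<lambda>x. h p x $ p) \<in> borel_measurable borel" for p
    proof -
      have "continuous_on UNIV (\<lambda>v::complex^'n. v $ p)" by (intro continuous_intros)
      then show ?thesis unfolding h_def using borel_measurable_brep by (rule borel_measurable_continuous_on)
    qed
    show "(\<lambda>x. \<Sum>p\<in>UNIV. h p x $ p \<bullet> (z * ?g x)) \<in> borel_measurable lborel" by measurable
    have [measurable]: "r \<in> borel_measurable borel" "s \<in> borel_measurable borel"
      using r s by (auto dest: sq_int_measurable)
    show "(\<lambda>x. s x \<bullet> (- \<i> * N * z * ?g x) - (f0 x * ?g x) \<bullet> (- \<i> * N * z * cnj (r x))) \<in> borel_measurable lborel" by measurable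
    have "AE x in lborel. (\<Sum>p\<in>UNIV. h p x $ p) = \<i> * N * (s x - f0 x * r x)"
      unfolding h_def N_def s_def r_def by (rule quantum_derivative_trace[OF \<gamma> T f0 gm g1 gs fg])
    then show "AE x in lborel. (\<Sum>p\<in>UNIV. h p x $ p \<bullet> (z * ?g x)) = s x \<bullet> (- \<i> * N * z * ?g x) - (f0 x * ?g x) \<bullet> (- \<i> * N * z * cnj (r x))"
    proof eventually_elim
      case (elim x)
      have "(\<Sum>p\<in>UNIV. h p x $ p \<bullet> (z * ?g x)) = (\<i> * N * (s x - f0 x * r x)) \<bullet> (z * ?g x)"
        unfolding inner_sum_left[symmetric] elim ..
      also have "\<dots> = s x \<bullet> (- \<i> * N * z * ?g x) - (f0 x * ?g x) \<bullet> (- \<i> * N * z * cnj (r x))"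
        by (simp add: inner_complex_def N_def indicator_def algebra_simps)
      finally show ?case .
    qed
  qed
  also have "\<dots> = (LINT x|lborel. s x \<bullet> (- \<i> * N * z * ?g x)) - (LINT x|lborel. (f0 x * ?g x) \<bullet> (- \<i> * N * z * cnj (r x)))"
  proof (rule Bochner_Integration.integral_diff)
    show "integrable lborel (\<lambda>x. s x \<bullet> (- \<i> * N * z * ?g x))"
      by (intro sq_int_inner s sq_int_bounded_borel_mult bounded_borel_const sg)
    show "integrable lborel (\<lambda>x. (f0 x * ?g x) \<bullet> (- \<i> * N * z * cnj (r x)))"
      by (intro sq_int_inner fg sq_int_bounded_borel_mult bounded_borel_const sq_int_cnj r)
  qed
  also have "(LINT x|lborel. s x \<bullet> (- \<i> * N * z * ?g x)) = (LINT x|lborel. (f0 x * ?g x) \<bullet> (- \<i> * N * z * r x))"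
  proof -
    have "(LINT x|lborel. s x \<bullet> (- \<i> * N * z * ?g x)) = abs_L2 s \<bullet> abs_L2 (\<lambda>x. - \<i> * N * z * ?g x)"
      by (intro sq_int_inner(1)[symmetric] s sq_int_bounded_borel_mult bounded_borel_const sg)
    also have "abs_L2 (\<lambda>x. - \<i> * N * z * ?g x) = mult_L2 (\<lambda>_. - \<i> * N * z) (abs_L2 ?g)"
      by (subst mult_L2_abs) (auto simp: sg)
    also have "abs_L2 s \<bullet> \<dots> = abs_L2 (\<lambda>x. f0 x * ?g x) \<bullet> mult_L2 (\<lambda>_. - \<i> * N * z) (abs_L2 r)"
      unfolding s(2) r(2) riesz_self_adjoint riesz_cmult ..
    also have "mult_L2 (\<lambda>_. - \<i> * N * z) (abs_L2 r) = abs_L2 (\<lambda>x. - \<i> * N * z * r x)"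
      by (subst mult_L2_abs) (auto simp: r)
    also have "abs_L2 (\<lambda>x. f0 x * ?g x) \<bullet> \<dots> = (LINT x|lborel. (f0 x * ?g x) \<bullet> (- \<i> * N * z * r x))"
      by (intro sq_int_inner(1) fg sq_int_bounded_borel_mult bounded_borel_const r)
    finally show ?thesis .
  qed
  also have "(LINT x|lborel. (f0 x * ?g x) \<bullet> (- \<i> * N * z * r x)) - (LINT x|lborel. (f0 x * ?g x) \<bullet> (- \<i> * N * z * cnj (r x)))
     = (LINT x|lborel. (f0 x * ?g x) \<bullet> (- \<i> * N * z * r x) - (f0 x * ?g x) \<bullet> (- \<i> * N * z * cnj (r x)))"
    by (intro Bochner_Integration.integral_diff[symmetric] sq_int_inner fg sq_int_bounded_borel_mult bounded_borel_const sq_int_cnj r)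
  also have "\<dots> = (LINT x|lborel. 2 * real CARD('n) * ((indicator Q x * Re (cnj z * f0 x)) * Im (r x)))"
    by (intro Bochner_Integration.integral_cong)
       (auto simp: inner_complex_def N_def indicator_def algebra_simps)
  finally show ?thesis by (simp add: r_def)
qed

section \<open>Weak gradients\<close>

definition locally_integrable :: "('a::euclidean_space \<Rightarrow> real) \<Rightarrow> bool" where
  "locally_integrable h \<longleftrightarrow> h \<in> borel_measurable borel \<and> (\<forall>R. integrable lborel (\<lambda>x. indicator (cball 0 R) x * h x))"

lemma measurable_pred_cball [measurable]: "Measurable.pred borel (\<lambda>x::'a::euclidean_space. x \<in> cball a r)"
  by (simp add: pred_def)

lemma locally_integrable_mult:
  assumes h: "locally_integrable h" and w [measurable]: "w \<in> borel_measurable borel"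
    and b: "\<And>x. \<bar>w x\<bar> \<le> C" and s: "\<And>x. w x \<noteq> 0 \<Longrightarrow> norm x \<le> R"
  shows "integrable lborel (\<lambda>x. h x * w x)"
proof (rule Bochner_Integration.integrable_bound)
  have [measurable]: "h \<in> borel_measurable borel" using h by (simp add: locally_integrable_def)
  show "integrable lborel (\<lambda>x. C * (indicator (cball 0 R) x * h x))"
    using h by (simp add: locally_integrable_def)
  show "(\<lambda>x. h x * w x) \<in> borel_measurable lborel" by measurable
  show "AE x in lborel. norm (h x * w x) \<le> norm (C * (indicator (cball 0 R) x * h x))"
  proof (rule AE_I2)
    fix x
    show "norm (h x * w x) \<le> norm (C * (indicator (cball 0 R) x * h x))"
    proof (cases "w x = 0")
      case False
      then have "norm x \<le> R" by (rule s)
      moreover have "\<bar>w x\<bar> * \<bar>h x\<bar> \<le> \<bar>C\<bar> * \<bar>h x\<bar>" using b[of x] by (intro mult_right_mono) auto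
      ultimately show ?thesis by (simp add: abs_mult mult.commute)
    qed simp
  qed
qed

text \<open>The Lipschitz constant \<open>L\<close> dominates all difference quotients, so
  differentiability is enough to pass to the limit under the integral. This class contains simple
  rational bumps.\<close>

definition test_function :: "('a::euclidean_space \<Rightarrow> real) \<Rightarrow> ('a \<Rightarrow> 'a \<Rightarrow> real) \<Rightarrow> real \<Rightarrow> real \<Rightarrow> bool" where
  "test_function \<phi> \<phi>' L R \<longleftrightarrow> (\<forall>x. (\<phi> has_derivative \<phi>' x) (at x)) \<and> (\<forall>x y. \<bar>\<phi> x - \<phi> y\<bar> \<le> L * norm (x - y))
    \<and> (\<forall>x. \<phi> x \<noteq> 0 \<longrightarrow> norm x \<le> R) \<and> 0 \<le> R"

lemma test_function_measurable [measurable_dest]: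
  assumes "test_function \<phi> \<phi>' L R"
  shows "\<phi> \<in> borel_measurable borel"
  using assms unfolding test_function_def
  by (intro borel_measurable_continuous_onI continuous_at_imp_continuous_on) (auto intro: has_derivative_continuous)

lemma test_function_L_nonneg:
  assumes "test_function \<phi> \<phi>' L R"
  shows "0 \<le> L"
proof -
  obtain b :: 'a where b: "b \<in> Basis" using nonempty_Basis by blast
  have "\<bar>\<phi> b - \<phi> 0\<bar> \<le> L * norm (b - 0)" using assms unfolding test_function_def by blast
  then show ?thesis using b by simp
qed

text \<open>A point of norm \<open>R + 1\<close> lies outside the support and within distance
  \<open>2 * R + 1\<close> of every point of it; the Lipschitz bound between the two does the
  rest.\<close>

lemma test_function_bounded:
  assumes "test_function \<phi> \<phi>' L R"
  shows "\<bar>\<phi> x\<bar> \<le> L * (2 * R + 1)"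
proof -
  note T = assms[unfolded test_function_def]
  have L: "0 \<le> L" by (rule test_function_L_nonneg[OF assms])
  obtain b :: 'a where b: "b \<in> Basis" using nonempty_Basis by blast
  define y where "y = (R + 1) *\<^sub>R b"
  have ny: "norm y = R + 1" using b T by (simp add: y_def)
  then have y: "\<phi> y = 0" using T by force
  show ?thesis
  proof (cases "\<phi> x = 0")
    case False
    then have "norm x \<le> R" using T by blast
    then have "norm (x - y) \<le> 2 * R + 1" using ny norm_triangle_ineq4[of x y] by linarith
    then have "L * norm (x - y) \<le> L * (2 * R + 1)" using L by (intro mult_left_mono)
    moreover have "\<bar>\<phi> x - \<phi> y\<bar> \<le> L * norm (x - y)" using T by blast
    ultimately show ?thesis using y by simp
  next
    case True
    then show ?thesis using L T by simp
  qed
qed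

lemma test_function_translate:
  assumes "test_function \<phi> \<phi>' L R"
  shows "test_function (\<lambda>x. \<phi> (x - v)) (\<lambda>x. \<phi>' (x - v)) L (R + norm v)"
  unfolding test_function_def
proof (intro conjI allI impI)
  note T = assms[unfolded test_function_def]
  fix x y
  have "(\<phi> has_derivative \<phi>' (x - v)) (at (x - v))" using T by blast
  moreover have "((\<lambda>x. x - v) has_derivative (\<lambda>h. h)) (at x)" by (auto intro!: derivative_eq_intros)
  ultimately show "((\<lambda>x. \<phi> (x - v)) has_derivative \<phi>' (x - v)) (at x)"
    using has_derivative_compose[of "\<lambda>x. x - v" "\<lambda>h. h" x UNIV \<phi> "\<phi>' (x - v)"] by simp
  have "\<bar>\<phi> (x - v) - \<phi> (y - v)\<bar> \<le> L * norm ((x - v) - (y - v))" using T by blast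
  then show "\<bar>\<phi> (x - v) - \<phi> (y - v)\<bar> \<le> L * norm (x - y)" by simp
  show "norm x \<le> R + norm v" if "\<phi> (x - v) \<noteq> 0"
  proof -
    have "norm (x - v) \<le> R" using T that by blast
    then show ?thesis using norm_triangle_sub[of x v] by simp
  qed
  show "0 \<le> R + norm v" using T by simp
qed

text \<open>Dominated convergence, with dominating function \<open>L * norm y\<close> times the
  absolute value of \<open>h\<close> on the ball enlarged by \<open>norm y\<close>. The minus sign
  reflects the shift by \<open>- k n *\<^sub>R y\<close>. The bound that holds for every
  \<open>n\<close> allows a further limit under an integral over \<open>y\<close>.\<close>

lemma test_function_difference_quotient:
  assumes h: "locally_integrable h" and T: "test_function \<phi> \<phi>' L R"
    and k: "k \<longlonglongrightarrow> 0" "\<And>n. k n \<noteq> 0" "\<And>n. \<bar>k n\<bar> \<le> 1"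
  shows "(\<lambda>n. LINT x|lborel. h x * ((\<phi> (x - k n *\<^sub>R y) - \<phi> x) / k n)) \<longlonglongrightarrow> - (LINT x|lborel. h x * \<phi>' x y)"
    and "\<bar>LINT x|lborel. h x * ((\<phi> (x - k n *\<^sub>R y) - \<phi> x) / k n)\<bar>
      \<le> L * norm y * (LINT x|lborel. indicator (cball 0 (R + norm y)) x * \<bar>h x\<bar>)"
    and "integrable lborel (\<lambda>x. h x * \<phi>' x y)"
proof -
  note T' = T[unfolded test_function_def]
  have [measurable]: "h \<in> borel_measurable borel" using h by (simp add: locally_integrable_def)
  have [measurable]: "\<phi> \<in> borel_measurable borel" using T by (rule test_function_measurable)
  have L: "0 \<le> L" by (rule test_function_L_nonneg[OF T])
  let ?q = "\<lambda>n x. (\<phi> (x - k n *\<^sub>R y) - \<phi> x) / k n"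
  have lim: "(\<lambda>n. ?q n x) \<longlonglongrightarrow> - \<phi>' x y" for x
  proof -
    have d: "(\<phi> has_derivative \<phi>' x) (at x)" using T' by blast
    have g: "((\<lambda>t. x - t *\<^sub>R y) has_derivative (\<lambda>t. - (t *\<^sub>R y))) (at 0)"
      by (auto intro!: derivative_eq_intros)
    have "((\<lambda>t. \<phi> (x - t *\<^sub>R y)) has_derivative (\<lambda>t. \<phi>' x (- (t *\<^sub>R y)))) (at 0)"
      using has_derivative_compose[OF g, of \<phi> "\<phi>' x"] d by simp
    moreover have "linear (\<phi>' x)" using d by (rule has_derivative_linear)
    then have "\<phi>' x (- (t *\<^sub>R y)) = (- \<phi>' x y) * t" for t
      by (simp add: linear_neg linear_cmul)
    then have "(\<lambda>t. \<phi>' x (- (t *\<^sub>R y))) = (*) (- \<phi>' x y)" by (rule ext)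
    ultimately have "((\<lambda>t. \<phi> (x - t *\<^sub>R y)) has_field_derivative (- \<phi>' x y)) (at 0)"
      by (simp only: has_field_derivative_def)
    then have "((\<lambda>t. (\<phi> (x - t *\<^sub>R y) - \<phi> x) / t) \<longlongrightarrow> - \<phi>' x y) (at 0)"
      by (simp add: has_field_derivative_iff)
    moreover have "filterlim k (at 0) sequentially"
      using k by (auto simp: filterlim_at)
    ultimately show ?thesis by (rule filterlim_compose)
  qed
  have bd: "norm (h x * ?q n x) \<le> L * norm y * (indicator (cball 0 (R + norm y)) x * \<bar>h x\<bar>)" for n x
  proof (cases "norm x \<le> R + norm y")
    case True
    have "\<bar>\<phi> (x - k n *\<^sub>R y) - \<phi> x\<bar> \<le> L * norm ((x - k n *\<^sub>R y) - x)" using T' by blast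
    also have "\<dots> = L * norm y * \<bar>k n\<bar>" by simp
    finally have "\<bar>?q n x\<bar> \<le> L * norm y" using k(2)[of n] by (simp add: divide_le_eq)
    from mult_right_mono[OF this abs_ge_zero[of "h x"]] True show ?thesis by (simp add: abs_mult mult_ac)
  next
    case False
    have "norm x \<le> norm (x - k n *\<^sub>R y) + \<bar>k n\<bar> * norm y" using norm_triangle_sub[of x "k n *\<^sub>R y"] by simp
    moreover have "\<bar>k n\<bar> * norm y \<le> 1 * norm y" using k(3) by (intro mult_right_mono) auto
    ultimately have "R < norm (x - k n *\<^sub>R y)" using False by linarith
    moreover have "R < norm x" using False norm_ge_zero[of y] by linarith
    moreover have supp: "\<phi> z = 0" if "R < norm z" for z
      by (rule ccontr) (use T' that in \<open>meson not_le\<close>)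
    ultimately have "\<phi> (x - k n *\<^sub>R y) = 0" "\<phi> x = 0" by blast+
    then show ?thesis using L by simp
  qed
  have dom: "integrable lborel (\<lambda>x. L * norm y * (indicator (cball 0 (R + norm y)) x * \<bar>h x\<bar>))"
  proof -
    have "integrable lborel (\<lambda>x. norm (indicator (cball 0 (R + norm y)) x * h x))"
      using h by (intro integrable_norm) (simp add: locally_integrable_def)
    then show ?thesis by (simp add: abs_mult)
  qed
  have lim': "(\<lambda>n. h x * ?q n x) \<longlonglongrightarrow> - (h x * \<phi>' x y)" for x
    using tendsto_mult_left[OF lim, of "h x"] by simp
  have qm: "(\<lambda>x. h x * ?q n x) \<in> borel_measurable lborel" for n by measurable
  \<comment> \<open>The definition of a test function contains no measurability of the derivative;
    it is inherited here as a pointwise limit of measurable difference quotients.\<close>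
  have m: "(\<lambda>x. - (h x * \<phi>' x y)) \<in> borel_measurable lborel"
    by (rule borel_measurable_LIMSEQ_real[OF lim' qm])
  have "(\<lambda>n. LINT x|lborel. h x * ?q n x) \<longlonglongrightarrow> (LINT x|lborel. - (h x * \<phi>' x y))"
    by (rule integral_dominated_convergence[OF m qm dom]) (use lim' bd in auto)
  then show "(\<lambda>n. LINT x|lborel. h x * ?q n x) \<longlonglongrightarrow> - (LINT x|lborel. h x * \<phi>' x y)" by simp
  have "integrable lborel (\<lambda>x. - (h x * \<phi>' x y))"
    by (rule integrable_dominated_convergence[where s="\<lambda>n x. h x * ?q n x", OF m qm dom]) (use lim' bd in auto)
  then show "integrable lborel (\<lambda>x. h x * \<phi>' x y)" by simp
  have "\<bar>LINT x|lborel. h x * ?q n x\<bar> \<le> (LINT x|lborel. norm (h x * ?q n x))"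
    using integral_norm_bound[of lborel "\<lambda>x. h x * ?q n x"] by simp
  also have "\<dots> \<le> (LINT x|lborel. L * norm y * (indicator (cball 0 (R + norm y)) x * \<bar>h x\<bar>))"
  proof (rule integral_mono[OF _ dom bd])
    show "integrable lborel (\<lambda>x. norm (h x * ?q n x))"
      by (rule Bochner_Integration.integrable_bound[OF dom]) (use bd qm in \<open>auto intro: order_trans[OF _ abs_ge_self]\<close>)
  qed
  finally show "\<bar>LINT x|lborel. h x * ?q n x\<bar> \<le> L * norm y * (LINT x|lborel. indicator (cball 0 (R + norm y)) x * \<bar>h x\<bar>)"
    by simp
qed

text \<open>Test the local means against \<open>\<phi>\<close> and move the increments \<open>y / n\<close> onto \<open>\<phi>\<close>: since \<open>\<rho>\<close> has
  mean zero, only difference quotients of \<open>\<phi>\<close> remain.\<close>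

lemma weak_derivative_moment_zero:
  fixes h \<rho> :: "'a::euclidean_space \<Rightarrow> real"
  assumes h: "locally_integrable h" and T: "test_function \<phi> \<phi>' L R"
    and \<rho>: "integrable lborel \<rho>" "\<And>y. \<rho> y \<noteq> 0 \<Longrightarrow> norm y \<le> D" "(LINT y|lborel. \<rho> y) = 0"
    and lim: "\<And>M. (\<lambda>n. real (Suc n) * (LINT a|lborel. indicator (cball 0 M) a *
        \<bar>LINT y|lborel. h (a + (1 / real (Suc n)) *\<^sub>R y) * \<rho> y\<bar>)) \<longlonglongrightarrow> 0"
  shows "(LINT y|lborel. \<rho> y * (LINT x|lborel. h x * \<phi>' x y)) = 0"
proof -
  note T' = T[unfolded test_function_def]
  have [measurable]: "h \<in> borel_measurable borel" using h by (simp add: locally_integrable_def)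
  have [measurable]: "\<phi> \<in> borel_measurable borel" using T by (rule test_function_measurable)
  have [measurable]: "\<rho> \<in> borel_measurable borel" using \<rho>(1) by auto
  have L: "0 \<le> L" by (rule test_function_L_nonneg[OF T])
  have D: "0 \<le> D \<or> (\<forall>y. \<rho> y = 0)" using \<rho>(2) norm_ge_zero order_trans by blast
  define k where "k n = 1 / real (Suc n)" for n
  have k: "k \<longlonglongrightarrow> 0" "\<And>n. k n \<noteq> 0" "\<And>n. \<bar>k n\<bar> \<le> 1" "\<And>n. k n > 0"
    using LIMSEQ_inverse_real_of_nat by (auto simp: k_def[abs_def] inverse_eq_divide)
  define B where "B = L * (2 * R + 1)"
  have B: "\<bar>\<phi> x\<bar> \<le> B" for x unfolding B_def by (rule test_function_bounded[OF T])
  have B0: "0 \<le> B" using B[of 0] by linarith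
  define G where "G n a = (LINT y|lborel. h (a + k n *\<^sub>R y) * \<rho> y)" for n a
  define Ih where "Ih r = (LINT x|lborel. indicator (cball 0 r) x * \<bar>h x\<bar>)" for r
  have ih: "integrable lborel (\<lambda>x. indicator (cball 0 r) x * \<bar>h x\<bar>)" for r
  proof -
    have "integrable lborel (\<lambda>x. norm (indicator (cball 0 r) x * h x))"
      using h by (intro integrable_norm) (simp add: locally_integrable_def)
    then show ?thesis by (simp add: abs_mult)
  qed
  have shift_norm: "norm (a + k n *\<^sub>R y) \<le> r + D" if "norm a \<le> r" "norm y \<le> D" for n a y r
  proof -
    have "norm (k n *\<^sub>R y) \<le> 1 * norm y" unfolding norm_scaleR using k(3) by (intro mult_right_mono) auto
    then show ?thesis using norm_triangle_ineq[of a "k n *\<^sub>R y"] that by linarith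
  qed
  have shift_int: "(LINT a|lborel. f (a + w)) = (LINT a|lborel. f a)" "integrable lborel (\<lambda>a. f (a + w)) \<longleftrightarrow> integrable lborel f"
    if "f \<in> borel_measurable borel" for f :: "'a \<Rightarrow> real" and w
    using lborel_affine_integral[OF that, of 1 w] by (simp_all add: add.commute)
  \<comment> \<open>The weight \<open>w\<close> is general because two choices are needed: the
    indicator of a ball, which gives local integrability of \<open>G n\<close>, and \<phi>, which
    permits the exchange of integrals in \<open>eq\<close>.\<close>
  have joint: "integrable (lborel \<Otimes>\<^sub>M lborel) (\<lambda>(y, a). w a * (h (a + k n *\<^sub>R y) * \<rho> y))"
    if w: "w \<in> borel_measurable borel" "\<And>a. \<bar>w a\<bar> \<le> C" "\<And>a. w a \<noteq> 0 \<Longrightarrow> norm a \<le> M" for w :: "'a \<Rightarrow> real" and C M n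
  proof (rule lborel_pair.Fubini_integrable)
    have C: "0 \<le> C" using w(2)[of 0] by linarith
    note [measurable] = w(1)
    show m: "(\<lambda>(y, a). w a * (h (a + k n *\<^sub>R y) * \<rho> y)) \<in> borel_measurable (lborel \<Otimes>\<^sub>M lborel)"
      by measurable
    have *: "integrable lborel (\<lambda>a. w a * (h (a + k n *\<^sub>R y) * \<rho> y))"
      "(LINT a|lborel. norm (w a * (h (a + k n *\<^sub>R y) * \<rho> y))) \<le> C * Ih (M + D) * \<bar>\<rho> y\<bar>" for y
    proof -
      define f where "f x = (indicator (cball 0 (M + D)) x * \<bar>h x\<bar>) * (C * \<bar>\<rho> y\<bar>)" for x
      have fm: "f \<in> borel_measurable borel" unfolding f_def by measurable
      have fi: "integrable lborel f" unfolding f_def[abs_def] using ih by simp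
      have le: "norm (w a * (h (a + k n *\<^sub>R y) * \<rho> y)) \<le> f (a + k n *\<^sub>R y)" for a
      proof (cases "w a = 0 \<or> \<rho> y = 0")
        case False
        then have "norm (a + k n *\<^sub>R y) \<le> M + D" using w(3) \<rho>(2) by (intro shift_norm) auto
        moreover have "\<bar>w a\<bar> * (\<bar>h (a + k n *\<^sub>R y)\<bar> * \<bar>\<rho> y\<bar>) \<le> C * (\<bar>h (a + k n *\<^sub>R y)\<bar> * \<bar>\<rho> y\<bar>)"
          using w(2) by (intro mult_right_mono) auto
        ultimately show ?thesis by (simp add: f_def abs_mult mult_ac)
      qed (use C in \<open>auto simp: f_def\<close>)
      have fsi: "integrable lborel (\<lambda>a. f (a + k n *\<^sub>R y))" using shift_int(2)[OF fm] fi by simp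
      show i: "integrable lborel (\<lambda>a. w a * (h (a + k n *\<^sub>R y) * \<rho> y))"
        by (rule Bochner_Integration.integrable_bound[OF fsi])
           (use le in \<open>auto intro: order_trans[OF _ abs_ge_self]\<close>)
      have "(LINT a|lborel. norm (w a * (h (a + k n *\<^sub>R y) * \<rho> y))) \<le> (LINT a|lborel. f (a + k n *\<^sub>R y))"
        by (rule integral_mono[OF integrable_norm[OF i] fsi le])
      also have "\<dots> = C * Ih (M + D) * \<bar>\<rho> y\<bar>"
        unfolding shift_int(1)[OF fm] by (simp add: f_def[abs_def] Ih_def)
      finally show "(LINT a|lborel. norm (w a * (h (a + k n *\<^sub>R y) * \<rho> y))) \<le> C * Ih (M + D) * \<bar>\<rho> y\<bar>" .
    qed
    show "integrable lborel (\<lambda>y. LINT a|lborel. norm (case (y, a) of (y, a) \<Rightarrow> w a * (h (a + k n *\<^sub>R y) * \<rho> y)))"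
    proof (rule Bochner_Integration.integrable_bound)
      show "integrable lborel (\<lambda>y. C * Ih (M + D) * \<rho> y)" using \<rho>(1) by simp
      show "(\<lambda>y. LINT a|lborel. norm (case (y, a) of (y, a) \<Rightarrow> w a * (h (a + k n *\<^sub>R y) * \<rho> y))) \<in> borel_measurable lborel"
        using m by measurable
      show "AE y in lborel. norm (LINT a|lborel. norm (case (y, a) of (y, a) \<Rightarrow> w a * (h (a + k n *\<^sub>R y) * \<rho> y))) \<le> norm (C * Ih (M + D) * \<rho> y)"
      proof (rule AE_I2)
        fix y
        have "0 \<le> Ih (M + D)" unfolding Ih_def by (intro Bochner_Integration.integral_nonneg) auto
        then have "norm (C * Ih (M + D) * \<rho> y) = C * Ih (M + D) * \<bar>\<rho> y\<bar>" using C by (simp add: abs_mult)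
        then show "norm (LINT a|lborel. norm (case (y, a) of (y, a) \<Rightarrow> w a * (h (a + k n *\<^sub>R y) * \<rho> y))) \<le> norm (C * Ih (M + D) * \<rho> y)"
          using *(2)[of y] Bochner_Integration.integral_nonneg[of lborel "\<lambda>a. norm (w a * (h (a + k n *\<^sub>R y) * \<rho> y))"]
          by (simp only: prod.case real_norm_def abs_of_nonneg norm_ge_zero abs_ge_zero)
      qed
    qed
    show "AE y in lborel. integrable lborel (\<lambda>a. case (y, a) of (y, a) \<Rightarrow> w a * (h (a + k n *\<^sub>R y) * \<rho> y))"
      using *(1) by simp
  qed
  have Gint: "integrable lborel (\<lambda>a. indicator (cball 0 M) a * G n a)" for n M
  proof -
    have "integrable (lborel \<Otimes>\<^sub>M lborel) (\<lambda>(y, a). indicator (cball 0 M) a * (h (a + k n *\<^sub>R y) * \<rho> y))"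
      by (rule joint[of "indicator (cball 0 M)" 1 M n]) (auto simp: indicator_def)
    from lborel_pair.integrable_snd[OF this] show ?thesis unfolding G_def by simp
  qed
  have Gm: "G n \<in> borel_measurable borel" for n unfolding G_def[abs_def] by measurable
  have small: "(\<lambda>n. real (Suc n) * (LINT a|lborel. \<phi> a * G n a)) \<longlonglongrightarrow> 0"
  proof (rule Lim_null_comparison)
    show "eventually (\<lambda>n. norm (real (Suc n) * (LINT a|lborel. \<phi> a * G n a))
        \<le> B * (real (Suc n) * (LINT a|lborel. indicator (cball 0 R) a * \<bar>G n a\<bar>))) sequentially"
    proof (intro always_eventually allI)
      fix n
      have i: "integrable lborel (\<lambda>a. indicator (cball 0 R) a * \<bar>G n a\<bar>)"
        using integrable_norm[OF Gint[of R n]] by (simp add: abs_mult)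
      have le: "norm (\<phi> a * G n a) \<le> B * (indicator (cball 0 R) a * \<bar>G n a\<bar>)" for a
      proof (cases "\<phi> a = 0")
        case False
        then have "norm a \<le> R" using T' by blast
        then show ?thesis using mult_right_mono[OF B[of a] abs_ge_zero[of "G n a"]] by (simp add: abs_mult)
      qed (use B0 in simp)
      have "norm (LINT a|lborel. \<phi> a * G n a) \<le> (LINT a|lborel. norm (\<phi> a * G n a))" by (rule integral_norm_bound)
      also have "\<dots> \<le> (LINT a|lborel. B * (indicator (cball 0 R) a * \<bar>G n a\<bar>))"
      proof (rule integral_mono[OF _ _ le])
        show "integrable lborel (\<lambda>a. B * (indicator (cball 0 R) a * \<bar>G n a\<bar>))" using i by simp
        then show "integrable lborel (\<lambda>a. norm (\<phi> a * G n a))"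
          by (rule Bochner_Integration.integrable_bound)
             (use le Gm[of n] in \<open>auto intro: order_trans[OF _ abs_ge_self]\<close>)
      qed
      also have "\<dots> = B * (LINT a|lborel. indicator (cball 0 R) a * \<bar>G n a\<bar>)" by simp
      finally have "norm (LINT a|lborel. \<phi> a * G n a) \<le> B * (LINT a|lborel. indicator (cball 0 R) a * \<bar>G n a\<bar>)" .
      then have le': "real (Suc n) * norm (LINT a|lborel. \<phi> a * G n a)
          \<le> real (Suc n) * (B * (LINT a|lborel. indicator (cball 0 R) a * \<bar>G n a\<bar>))"
        by (rule mult_left_mono) simp
      have "norm (real (Suc n) * (LINT a|lborel. \<phi> a * G n a)) = real (Suc n) * norm (LINT a|lborel. \<phi> a * G n a)"
        by (simp only: real_norm_def abs_mult abs_of_nat)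
      also note le'
      also have "real (Suc n) * (B * (LINT a|lborel. indicator (cball 0 R) a * \<bar>G n a\<bar>))
          = B * (real (Suc n) * (LINT a|lborel. indicator (cball 0 R) a * \<bar>G n a\<bar>))"
        by (rule mult.left_commute)
      finally show "norm (real (Suc n) * (LINT a|lborel. \<phi> a * G n a))
        \<le> B * (real (Suc n) * (LINT a|lborel. indicator (cball 0 R) a * \<bar>G n a\<bar>))" .
    qed
    show "(\<lambda>n. B * (real (Suc n) * (LINT a|lborel. indicator (cball 0 R) a * \<bar>G n a\<bar>))) \<longlonglongrightarrow> 0"
      using tendsto_mult_left[OF lim[of R], of B] unfolding G_def k_def by simp
  qed
  define q where "q n y = (LINT x|lborel. h x * ((\<phi> (x - k n *\<^sub>R y) - \<phi> x) / k n))" for n y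
  have h\<phi>: "integrable lborel (\<lambda>x. h x * \<phi> (x - w))" for w
    by (rule locally_integrable_mult[OF h, where C=B and R="R + norm w"])
       (use B test_function_translate[OF T, of w] in \<open>auto simp: test_function_def\<close>)
  have eq: "real (Suc n) * (LINT a|lborel. \<phi> a * G n a) = (LINT y|lborel. \<rho> y * q n y)" for n
  proof -
    define I0 where "I0 = (LINT x|lborel. h x * \<phi> x)"
    have J: "integrable (lborel \<Otimes>\<^sub>M lborel) (\<lambda>(y, a). \<phi> a * (h (a + k n *\<^sub>R y) * \<rho> y))"
      by (rule joint[of \<phi> B R n]) (use B T' in auto)
    have inner: "(LINT a|lborel. \<phi> a * (h (a + k n *\<^sub>R y) * \<rho> y)) = \<rho> y * (LINT x|lborel. h x * \<phi> (x - k n *\<^sub>R y))" for y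
    proof -
      have "(LINT x|lborel. h x * \<phi> (x - k n *\<^sub>R y)) = (LINT a|lborel. h (a + k n *\<^sub>R y) * \<phi> ((a + k n *\<^sub>R y) - k n *\<^sub>R y))"
        by (rule shift_int(1)[symmetric]) measurable
      also have "\<rho> y * \<dots> = (LINT a|lborel. \<phi> a * (h (a + k n *\<^sub>R y) * \<rho> y))"
        by (subst integral_mult_right_zero[symmetric]) (simp add: mult_ac)
      finally show ?thesis ..
    qed
    have i1: "integrable lborel (\<lambda>y. \<rho> y * (LINT x|lborel. h x * \<phi> (x - k n *\<^sub>R y)))"
      using lborel_pair.integrable_fst[OF J] unfolding inner .
    have "(LINT a|lborel. \<phi> a * G n a) = (LINT a|lborel. LINT y|lborel. \<phi> a * (h (a + k n *\<^sub>R y) * \<rho> y))"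
      unfolding G_def by simp
    also have "\<dots> = (LINT y|lborel. LINT a|lborel. \<phi> a * (h (a + k n *\<^sub>R y) * \<rho> y))"
      by (rule lborel_pair.Fubini_integral[OF J])
    also have "\<dots> = (LINT y|lborel. \<rho> y * (LINT x|lborel. h x * \<phi> (x - k n *\<^sub>R y))) - (LINT y|lborel. \<rho> y) * I0"
      unfolding inner \<rho>(3) by simp
    also have "\<dots> = (LINT y|lborel. \<rho> y * (LINT x|lborel. h x * \<phi> (x - k n *\<^sub>R y)) - \<rho> y * I0)"
      using i1 \<rho>(1) by simp
    also have "real (Suc n) * \<dots> = (LINT y|lborel. \<rho> y * q n y)"
    proof (subst integral_mult_right_zero[symmetric], intro Bochner_Integration.integral_cong refl)
      fix y
      have "q n y = (LINT x|lborel. (h x * \<phi> (x - k n *\<^sub>R y) - h x * \<phi> x) / k n)"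
        unfolding q_def by (intro Bochner_Integration.integral_cong) (auto simp: right_diff_distrib)
      also have "\<dots> = ((LINT x|lborel. h x * \<phi> (x - k n *\<^sub>R y)) - I0) / k n"
        using h\<phi>[of "k n *\<^sub>R y"] h\<phi>[of 0] by (simp add: I0_def)
      finally have q: "q n y = ((LINT x|lborel. h x * \<phi> (x - k n *\<^sub>R y)) - I0) / k n" .
      have arith: "real (Suc n) * (r * J - r * I0) = r * ((J - I0) / k n)" for r J
        by (simp add: k_def algebra_simps)
      show "real (Suc n) * (\<rho> y * (LINT x|lborel. h x * \<phi> (x - k n *\<^sub>R y)) - \<rho> y * I0) = \<rho> y * q n y"
        unfolding q by (rule arith)
    qed
    finally show ?thesis .
  qed
  define dq where "dq y = (LINT x|lborel. h x * \<phi>' x y)" for y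
  note Q = test_function_difference_quotient[OF h T k(1-3), folded q_def dq_def]
  have [measurable]: "q n \<in> borel_measurable borel" for n unfolding q_def[abs_def] by measurable
  have [measurable]: "dq \<in> borel_measurable borel"
  proof -
    have "(\<lambda>y. - dq y) \<in> borel_measurable borel"
      by (rule borel_measurable_LIMSEQ_real[OF Q(1)]) measurable
    then show ?thesis by simp
  qed
  have "(\<lambda>n. LINT y|lborel. \<rho> y * q n y) \<longlonglongrightarrow> (LINT y|lborel. \<rho> y * (- dq y))"
  proof (rule integral_dominated_convergence)
    show "integrable lborel (\<lambda>y. norm (\<rho> y) * (L * D * Ih (R + D)))" using \<rho>(1) by simp
    show "AE y in lborel. (\<lambda>n. \<rho> y * q n y) \<longlonglongrightarrow> \<rho> y * - dq y"
      by (intro AE_I2 tendsto_mult_left Q(1))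
    show "AE y in lborel. norm (\<rho> y * q n y) \<le> norm (\<rho> y) * (L * D * Ih (R + D))" for n
    proof (rule AE_I2)
      fix y
      show "norm (\<rho> y * q n y) \<le> norm (\<rho> y) * (L * D * Ih (R + D))"
      proof (cases "\<rho> y = 0")
        case False
        then have y: "norm y \<le> D" by (rule \<rho>(2))
        have "\<bar>q n y\<bar> \<le> L * norm y * Ih (R + norm y)" using Q(2) by (simp add: Ih_def)
        also have "\<dots> \<le> L * D * Ih (R + D)"
        proof (rule mult_mono)
          show "L * norm y \<le> L * D" using L y by (intro mult_left_mono)
          show "Ih (R + norm y) \<le> Ih (R + D)"
            unfolding Ih_def by (rule integral_mono[OF ih ih]) (use y in \<open>auto simp: indicator_def\<close>)
          show "0 \<le> L * D" using L y norm_ge_zero[of y] by (intro mult_nonneg_nonneg) linarith+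
          show "0 \<le> Ih (R + norm y)" unfolding Ih_def by (intro Bochner_Integration.integral_nonneg) auto
        qed
        finally show ?thesis unfolding real_norm_def abs_mult by (intro mult_left_mono) auto
      qed simp
    qed
  qed measurable
  then have "(LINT y|lborel. \<rho> y * (- dq y)) = 0"
    using small unfolding eq by (rule LIMSEQ_unique)
  then show ?thesis unfolding dq_def[symmetric] by simp
qed

text \<open>Along the line \<open>t *\<^sub>R v\<close> the integral has, at each \<open>t\<close>,
  minus the weak directional derivative tested against a translate of \<phi> as its derivative. A
  translate is again a test function, so this derivative is zero and the integral is constant in
  \<open>t\<close>.\<close>

lemma test_function_translation_invariant:
  fixes h :: "'a::euclidean_space \<Rightarrow> real"
  assumes h: "locally_integrable h"
    and zero: "\<And>\<phi> \<phi>' L R y. test_function \<phi> \<phi>' L R \<Longrightarrow> (LINT x|lborel. h x * \<phi>' x y) = 0"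
    and T: "test_function \<phi> \<phi>' L R"
  shows "(LINT x|lborel. h x * \<phi> (x - v)) = (LINT x|lborel. h x * \<phi> x)"
proof -
  define \<Psi> where "\<Psi> t = (LINT x|lborel. h x * \<phi> (x - t *\<^sub>R v))" for t
  have i: "integrable lborel (\<lambda>x. h x * \<phi> (x - w))" for w
  proof (rule locally_integrable_mult[OF h])
    note T1 = test_function_translate[OF T, of w]
    show "(\<lambda>x. \<phi> (x - w)) \<in> borel_measurable borel" using T1 by (rule test_function_measurable)
    show "\<bar>\<phi> (x - w)\<bar> \<le> L * (2 * (R + norm w) + 1)" for x using test_function_bounded[OF T1] .
    show "norm x \<le> R + norm w" if "\<phi> (x - w) \<noteq> 0" for x
      using T1 that unfolding test_function_def by blast
  qed
  have "DERIV \<Psi> t :> 0" for t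
    unfolding DERIV_def tendsto_at_iff_sequentially
  proof (intro allI impI)
    fix X :: "nat \<Rightarrow> real" assume X: "\<forall>i. X i \<in> UNIV - {0}" "X \<longlonglongrightarrow> 0"
    obtain N where N: "\<And>n. n \<ge> N \<Longrightarrow> norm (X n - 0) < 1" using LIMSEQ_D[OF X(2), of 1] by auto
    define k where "k n = X (n + N)" for n
    have k: "k \<longlonglongrightarrow> 0" unfolding k_def using X(2) by (rule LIMSEQ_ignore_initial_segment)
    have k': "k n \<noteq> 0" "\<bar>k n\<bar> \<le> 1" for n
      using X(1) N[of "n + N"] by (auto simp: k_def less_imp_le)
    note Tt = test_function_translate[OF T, of "t *\<^sub>R v"]
    have q: "(\<Psi> (t + k n) - \<Psi> t) / k n = (LINT x|lborel. h x * ((\<phi> ((x - k n *\<^sub>R v) - t *\<^sub>R v) - \<phi> (x - t *\<^sub>R v)) / k n))" for n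
    proof -
      have "(LINT x|lborel. h x * ((\<phi> ((x - k n *\<^sub>R v) - t *\<^sub>R v) - \<phi> (x - t *\<^sub>R v)) / k n))
        = (LINT x|lborel. (h x * \<phi> (x - (t + k n) *\<^sub>R v) - h x * \<phi> (x - t *\<^sub>R v)) / k n)"
        by (intro Bochner_Integration.integral_cong) (auto simp: algebra_simps)
      also have "\<dots> = (\<Psi> (t + k n) - \<Psi> t) / k n"
        using i by (simp add: \<Psi>_def)
      finally show ?thesis ..
    qed
    have "(\<lambda>n. (\<Psi> (t + k n) - \<Psi> t) / k n) \<longlonglongrightarrow> - 0"
      using test_function_difference_quotient(1)[OF h Tt k k', of v] unfolding q zero[OF Tt] .
    then have "(\<lambda>n. (\<Psi> (t + X (n + N)) - \<Psi> t) / X (n + N)) \<longlonglongrightarrow> 0" by (simp add: k_def)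
    from LIMSEQ_offset[of "\<lambda>n. (\<Psi> (t + X n) - \<Psi> t) / X n", OF this]
    show "((\<lambda>h. (\<Psi> (t + h) - \<Psi> t) / h) \<circ> X) \<longlonglongrightarrow> 0" by (simp add: o_def)
  qed
  then have "\<Psi> 1 = \<Psi> 0" by (intro DERIV_isconst_all) auto
  then show ?thesis by (simp add: \<Psi>_def)
qed

text \<open>A rational step: zero on the negative half-line, differentiable at 0 thanks to the
  square, 1-Lipschitz, and tending to 1 at infinity. Its dilates converge to the indicator of the
  positive half-line.\<close>

definition smooth_step :: "real \<Rightarrow> real" where
  "smooth_step t = (max 0 t)\<^sup>2 / (1 + (max 0 t)\<^sup>2)"

lemma smooth_step_bounds: "0 \<le> smooth_step t" "smooth_step t \<le> 1"
proof -
  have "0 < 1 + (max 0 t)\<^sup>2" by (rule add_pos_nonneg) auto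
  then show "0 \<le> smooth_step t" "smooth_step t \<le> 1" by (simp_all add: smooth_step_def)
qed

lemma smooth_step_Lipschitz: "\<bar>smooth_step a - smooth_step b\<bar> \<le> \<bar>a - b\<bar>"
proof -
  define p where "p = max 0 a"
  define q where "q = max 0 b"
  have pq: "0 \<le> p" "0 \<le> q" "\<bar>p - q\<bar> \<le> \<bar>a - b\<bar>" by (auto simp: p_def q_def)
  have p: "1 + p\<^sup>2 > 0" "1 + q\<^sup>2 > 0" by (auto intro: add_pos_nonneg)
  \<comment> \<open>The difference of the two sides is the sum of squares displayed in the next
    line.\<close>
  have "p + q \<le> (1 + p\<^sup>2) * (1 + q\<^sup>2)"
  proof -
    have "0 \<le> (p - 1/2)\<^sup>2 + (q - 1/2)\<^sup>2 + (p * q)\<^sup>2 + 1/2" by (intro add_nonneg_nonneg) auto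
    then show ?thesis by (simp add: power2_eq_square algebra_simps)
  qed
  then have le: "(p + q) / ((1 + p\<^sup>2) * (1 + q\<^sup>2)) \<le> 1" using p by (simp add: divide_le_eq)
  have "smooth_step a - smooth_step b = (p - q) * ((p + q) / ((1 + p\<^sup>2) * (1 + q\<^sup>2)))"
    unfolding smooth_step_def p_def[symmetric] q_def[symmetric]
    using p by (simp add: diff_frac_eq) (simp add: power2_eq_square algebra_simps)
  then have "\<bar>smooth_step a - smooth_step b\<bar> = \<bar>p - q\<bar> * ((p + q) / ((1 + p\<^sup>2) * (1 + q\<^sup>2)))"
    using pq p by (simp add: abs_mult)
  also have "\<dots> \<le> \<bar>p - q\<bar> * 1" using le by (intro mult_left_mono) auto
  finally show ?thesis using pq by simp
qed

lemma smooth_step_differentiable: "smooth_step differentiable (at t)"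
proof -
  have d: "((\<lambda>t. (max 0 t)\<^sup>2) has_field_derivative 2 * max 0 t) (at t)" for t :: real
  proof (cases t "0 :: real" rule: linorder_cases)
    case less
    have "((\<lambda>t. 0) has_field_derivative 2 * max 0 t) (at t)" using less by simp
    then show ?thesis
      by (rule has_field_derivative_transform_within_open[where S="{..<0}"]) (use less in auto)
  next
    case greater
    have "((\<lambda>t. t\<^sup>2) has_field_derivative 2 * max 0 t) (at t)"
      using greater by (auto intro!: derivative_eq_intros)
    then show ?thesis
      by (rule has_field_derivative_transform_within_open[where S="{0<..}"]) (use greater in auto)
  next
    case equal
    have "((\<lambda>h. (max 0 h)\<^sup>2 / h) \<longlongrightarrow> 0) (at (0::real))"
    proof (rule Lim_null_comparison)
      show "eventually (\<lambda>h. norm ((max 0 h)\<^sup>2 / h) \<le> \<bar>h\<bar>) (at (0::real))"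
        by (intro always_eventually) (auto simp: max_def power2_eq_square)
      show "((\<lambda>h::real. \<bar>h\<bar>) \<longlongrightarrow> 0) (at 0)" by (auto intro!: tendsto_eq_intros)
    qed
    then show ?thesis using equal by (simp add: has_field_derivative_iff)
  qed
  have "1 + (max 0 t)\<^sup>2 \<noteq> 0" by (metis add_pos_nonneg less_irrefl zero_le_power2 zero_less_one)
  from DERIV_divide[OF d DERIV_add[OF DERIV_const d] this]
  have "\<exists>D. (smooth_step has_field_derivative D) (at t)"
    unfolding smooth_step_def[abs_def] by blast
  then show ?thesis by (simp add: real_differentiable_def)
qed

text \<open>The bound 1 makes the class closed under products, with Lipschitz constants adding up,
  so finite products over the coordinates stay inside.\<close>

definition smooth_bounded :: "('a::euclidean_space \<Rightarrow> real) \<Rightarrow> bool" where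
  "smooth_bounded w \<longleftrightarrow> (\<forall>x. w differentiable (at x)) \<and> (\<exists>L\<ge>0. \<forall>x y. \<bar>w x - w y\<bar> \<le> L * norm (x - y)) \<and> (\<forall>x. \<bar>w x\<bar> \<le> 1)"

lemma smooth_bounded_mult:
  assumes "smooth_bounded v" "smooth_bounded w"
  shows "smooth_bounded (\<lambda>x. v x * w x)"
proof -
  obtain L1 L2 where L: "L1 \<ge> 0" "L2 \<ge> 0" "\<And>x y. \<bar>v x - v y\<bar> \<le> L1 * norm (x - y)" "\<And>x y. \<bar>w x - w y\<bar> \<le> L2 * norm (x - y)"
    using assms unfolding smooth_bounded_def by blast
  have b: "\<bar>v x\<bar> \<le> 1" "\<bar>w x\<bar> \<le> 1" for x using assms unfolding smooth_bounded_def by auto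
  have "\<bar>v x * w x - v y * w y\<bar> \<le> (L1 + L2) * norm (x - y)" for x y
  proof -
    have "v x * w x - v y * w y = v x * (w x - w y) + (v x - v y) * w y" by (simp add: algebra_simps)
    then have "\<bar>v x * w x - v y * w y\<bar> \<le> \<bar>v x\<bar> * \<bar>w x - w y\<bar> + \<bar>v x - v y\<bar> * \<bar>w y\<bar>"
      using abs_triangle_ineq[of "v x * (w x - w y)" "(v x - v y) * w y"] by (simp add: abs_mult)
    also have "\<dots> \<le> 1 * (L2 * norm (x - y)) + (L1 * norm (x - y)) * 1"
      using L b by (intro add_mono mult_mono) auto
    finally show ?thesis by (simp add: algebra_simps)
  qed
  moreover have "\<bar>v x * w x\<bar> \<le> 1" for x
    using mult_mono[OF b(1) b(2), of x x] by (simp add: abs_mult)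
  moreover have "(\<lambda>x. v x * w x) differentiable (at x)" for x
    using assms unfolding smooth_bounded_def by (intro differentiable_mult) auto
  ultimately show ?thesis
    unfolding smooth_bounded_def using L by (intro conjI allI exI[of _ "L1 + L2"]) auto
qed

lemma smooth_bounded_prod:
  "finite I \<Longrightarrow> (\<And>i. i \<in> I \<Longrightarrow> smooth_bounded (w i)) \<Longrightarrow> smooth_bounded (\<lambda>x. \<Prod>i\<in>I. w i x)"
proof (induction I rule: finite_induct)
  case empty
  show ?case by (auto simp: smooth_bounded_def intro!: exI[of _ 0])
qed (simp add: smooth_bounded_mult)

lemma smooth_bounded_step:
  fixes b :: "'a::euclidean_space"
  shows "smooth_bounded (\<lambda>x. smooth_step (x \<bullet> b + c))"
  unfolding smooth_bounded_def
proof (intro conjI allI exI[of _ "norm b"])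
  fix x y :: 'a
  have "(\<lambda>x. x \<bullet> b + c) differentiable (at x)" by (simp add: differentiable_def) (auto intro!: derivative_eq_intros exI)
  from differentiable_chain_at[OF this smooth_step_differentiable]
  show "(\<lambda>x. smooth_step (x \<bullet> b + c)) differentiable (at x)" by (simp add: o_def)
  have "\<bar>smooth_step (x \<bullet> b + c) - smooth_step (y \<bullet> b + c)\<bar> \<le> \<bar>(x \<bullet> b + c) - (y \<bullet> b + c)\<bar>"
    by (rule smooth_step_Lipschitz)
  also have "\<dots> = \<bar>(x - y) \<bullet> b\<bar>" by (simp add: inner_diff_left)
  also have "\<dots> \<le> norm b * norm (x - y)" using Cauchy_Schwarz_ineq2[of "x - y" b] by (simp add: mult.commute)
  finally show "\<bar>smooth_step (x \<bullet> b + c) - smooth_step (y \<bullet> b + c)\<bar> \<le> norm b * norm (x - y)" .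
  show "\<bar>smooth_step (x \<bullet> b + c)\<bar> \<le> 1" using smooth_step_bounds[of "x \<bullet> b + c"] by simp
qed simp

section \<open>Bumps that converge to indicators of boxes\<close>

definition box_bump :: "'a::euclidean_space \<Rightarrow> 'a \<Rightarrow> nat \<Rightarrow> 'a \<Rightarrow> real" where
  "box_bump l u n x = (\<Prod>b\<in>Basis. smooth_step (real n * (x \<bullet> b - l \<bullet> b)) * smooth_step (real n * (u \<bullet> b - x \<bullet> b)))"

lemma smooth_step_nonpos: "t \<le> 0 \<Longrightarrow> smooth_step t = 0"
  by (simp add: smooth_step_def max_def)

lemma box_bump_support: "x \<notin> box l u \<Longrightarrow> box_bump l u n x = 0"
proof -
  assume "x \<notin> box l u"
  then obtain b where b: "b \<in> Basis" "\<not> (l \<bullet> b < x \<bullet> b \<and> x \<bullet> b < u \<bullet> b)" by (auto simp: mem_box)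
  then have "real n * (x \<bullet> b - l \<bullet> b) \<le> 0 \<or> real n * (u \<bullet> b - x \<bullet> b) \<le> 0"
    by (auto simp: mult_le_0_iff)
  then have "smooth_step (real n * (x \<bullet> b - l \<bullet> b)) * smooth_step (real n * (u \<bullet> b - x \<bullet> b)) = 0"
    using smooth_step_nonpos by auto
  then show ?thesis unfolding box_bump_def using b(1) by (intro prod_zero) auto
qed

lemma box_bump_bounds: "0 \<le> box_bump l u n x" "box_bump l u n x \<le> 1"
  unfolding box_bump_def
  by (auto intro!: prod_nonneg prod_le_1 mult_le_one smooth_step_bounds mult_nonneg_nonneg)

lemma smooth_step_tendsto:
  assumes "t > 0"
  shows "(\<lambda>n. smooth_step (real n * t)) \<longlonglongrightarrow> 1"
proof -
  have "(\<lambda>n. (real n * t)\<^sup>2 / (1 + (real n * t)\<^sup>2)) \<longlonglongrightarrow> 1"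
    using assms by real_asymp
  moreover have "smooth_step (real n * t) = (real n * t)\<^sup>2 / (1 + (real n * t)\<^sup>2)" for n
    using assms by (simp add: smooth_step_def)
  ultimately show ?thesis by simp
qed

lemma box_bump_tendsto: "(\<lambda>n. box_bump l u n x) \<longlonglongrightarrow> indicator (box l u) x"
proof (cases "x \<in> box l u")
  case True
  then have "(\<lambda>n. box_bump l u n x) \<longlonglongrightarrow> (\<Prod>b\<in>(Basis :: 'a set). 1 * 1)"
    unfolding box_bump_def by (intro tendsto_prod tendsto_mult smooth_step_tendsto) (auto simp: mem_box)
  then show ?thesis using True by simp
qed (simp add: box_bump_support)

lemma box_bump_test_function: "\<exists>\<phi>' L R. test_function (box_bump l u n) \<phi>' L R"
proof -
  have "smooth_bounded (\<lambda>x. smooth_step (real n * (x \<bullet> b - l \<bullet> b)) * smooth_step (real n * (u \<bullet> b - x \<bullet> b)))" for b :: 'a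
  proof (rule smooth_bounded_mult)
    show "smooth_bounded (\<lambda>x. smooth_step (real n * (x \<bullet> b - l \<bullet> b)))"
      using smooth_bounded_step[of "real n *\<^sub>R b" "- real n * (l \<bullet> b)"] by (simp add: algebra_simps)
    show "smooth_bounded (\<lambda>x. smooth_step (real n * (u \<bullet> b - x \<bullet> b)))"
      using smooth_bounded_step[of "- real n *\<^sub>R b" "real n * (u \<bullet> b)"] by (simp add: algebra_simps)
  qed
  then have sb: "smooth_bounded (box_bump l u n)"
    unfolding box_bump_def[abs_def] by (intro smooth_bounded_prod) auto
  obtain R where R: "\<forall>x\<in>box l u. norm x \<le> R" using bounded_box[of l u] by (auto simp: bounded_iff)
  obtain L where L: "\<And>x y. \<bar>box_bump l u n x - box_bump l u n y\<bar> \<le> L * norm (x - y)"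
    using sb unfolding smooth_bounded_def by blast
  have "test_function (box_bump l u n) (\<lambda>x. frechet_derivative (box_bump l u n) (at x)) L (max 0 R)"
    unfolding test_function_def
  proof (intro conjI allI impI)
    show "(box_bump l u n has_derivative frechet_derivative (box_bump l u n) (at x)) (at x)" for x
      using sb unfolding smooth_bounded_def by (simp add: frechet_derivative_works)
    show "norm x \<le> max 0 R" if "box_bump l u n x \<noteq> 0" for x
      using box_bump_support[of x l u n] R that by (force simp: le_max_iff_disj)
  qed (use L in auto)
  then show ?thesis by blast
qed

text \<open>Open boxes form a generating system of the Borel sets that is stable under intersection,
  so the integral over every Borel set vanishes, in particular over the sets where the function is
  positive and where it is negative. Restriction to a large box \<open>B\<close> first makes the
  function integrable, which the steps for complements and countable unions require.\<close>

lemma AE_zero_of_box_integrals: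
  fixes k :: "'a::euclidean_space \<Rightarrow> real"
  assumes k: "locally_integrable k" and box: "\<And>l u. (LINT x|lborel. k x * indicator (box l u) x) = 0"
  shows "AE x in lborel. k x = 0"
proof -
  have [measurable]: "k \<in> borel_measurable borel" using k by (simp add: locally_integrable_def)
  have "AE x in lborel. x \<in> box (- real n *\<^sub>R One) (real n *\<^sub>R One) \<longrightarrow> k x = 0" for n
  proof -
    define B where "B = box (- real n *\<^sub>R One) (real n *\<^sub>R One :: 'a)"
    obtain R where R: "\<forall>x\<in>B. norm x \<le> R" using bounded_box unfolding bounded_iff B_def by blast
    define m where "m x = k x * indicator B x" for x
    have [measurable]: "B \<in> sets borel" by (simp add: B_def)
    have m: "integrable lborel m" unfolding m_def[abs_def]
      by (rule locally_integrable_mult[OF k, where C=1 and R=R])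
         (use R in \<open>auto simp: indicator_def split: if_splits\<close>)
    have [measurable]: "m \<in> borel_measurable borel" using m by auto
    have si: "set_integrable lborel A m" if "A \<in> sets borel" for A
      using m that unfolding set_integrable_def by (intro integrable_mult_indicator) auto
    have P: "(LINT x:A|lborel. m x) = 0" if "A \<in> sets borel" for A
    proof -
      have A: "A \<in> sigma_sets UNIV (range (\<lambda>(a, b). box a b :: 'a set))"
        using that by (subst (asm) borel_eq_box) (simp add: sets_measure_of)
      have stable: "Int_stable (range (\<lambda>(a, b). box a b :: 'a set))"
        by (auto simp: Int_stable_def box_Int_box)
      have Pow: "range (\<lambda>(a, b). box a b :: 'a set) \<subseteq> Pow UNIV" by simp
      from stable Pow A show ?thesis
      proof (induction rule: sigma_sets_induct_disjoint)
        case (basic A)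
        then obtain a b where A: "A = box a b" by auto
        have "(LINT x:A|lborel. m x) = (LINT x|lborel. k x * indicator (A \<inter> B) x)"
          unfolding set_lebesgue_integral_def m_def
          by (intro Bochner_Integration.integral_cong) (auto simp: indicator_def)
        also have "A \<inter> B = box (\<Sum>i\<in>Basis. max (a \<bullet> i) ((- real n *\<^sub>R One) \<bullet> i) *\<^sub>R i) (\<Sum>i\<in>Basis. min (b \<bullet> i) ((real n *\<^sub>R One) \<bullet> i) *\<^sub>R i)"
          unfolding A B_def by (rule box_Int_box)
        finally show ?case using box by simp
      next
        case empty
        show ?case by (simp add: set_lebesgue_integral_def)
      next
        case (compl A)
        have "A \<in> sets borel" using compl(1) by (subst borel_eq_box) (simp add: sets_measure_of)
        have "(LINT x:UNIV - A|lborel. m x) = (LINT x|lborel. m x - indicator A x *\<^sub>R m x)"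
          unfolding set_lebesgue_integral_def
          by (intro Bochner_Integration.integral_cong) (auto simp: indicator_def)
        also have "\<dots> = (LINT x|lborel. m x) - (LINT x:A|lborel. m x)"
          using si[OF \<open>A \<in> sets borel\<close>] m unfolding set_lebesgue_integral_def set_integrable_def by simp
        also have "(LINT x|lborel. m x) = 0" using box unfolding m_def B_def by simp
        finally show ?case using compl by simp
      next
        case (union A)
        have A: "A i \<in> sets borel" for i
          using union(2) by (subst borel_eq_box) (auto simp: sets_measure_of)
        have "(LINT x:(\<Union>i. A i)|lborel. m x) = (\<Sum>i. (LINT x:A i|lborel. m x))"
          by (rule lebesgue_integral_countable_add)
             (use A union(1) si[of "\<Union>i. A i"] in \<open>auto simp: disjoint_family_on_def\<close>)
        then show ?case using union(3) by simp
      qed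
    qed
    have 1: "AE x in lborel. m x \<le> 0"
    proof -
      have S: "{x. m x > 0} \<in> sets borel" by measurable
      have "(LINT x|lborel. indicator {x. m x > 0} x *\<^sub>R m x) = 0"
        using P[OF S] unfolding set_lebesgue_integral_def .
      then have "AE x in lborel. indicator {x. m x > 0} x *\<^sub>R m x = 0"
        using si[OF S] unfolding set_integrable_def
        by (subst (asm) integral_nonneg_eq_0_iff_AE) (auto simp: indicator_def)
      then show ?thesis by eventually_elim (auto simp: indicator_def split: if_splits)
    qed
    have 2: "AE x in lborel. 0 \<le> m x"
    proof -
      have S: "{x. m x < 0} \<in> sets borel" by measurable
      have "(LINT x|lborel. - (indicator {x. m x < 0} x *\<^sub>R m x)) = 0"
        using P[OF S] unfolding set_lebesgue_integral_def by simp
      then have "AE x in lborel. - (indicator {x. m x < 0} x *\<^sub>R m x) = 0"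
        using si[OF S] unfolding set_integrable_def
        by (subst (asm) integral_nonneg_eq_0_iff_AE) (auto simp: indicator_def)
      then show ?thesis by eventually_elim (auto simp: indicator_def split: if_splits)
    qed
    from 1 2 show ?thesis unfolding B_def[symmetric]
      by eventually_elim (auto simp: m_def)
  qed
  then have "AE x in lborel. \<forall>n. x \<in> box (- real n *\<^sub>R One) (real n *\<^sub>R One) \<longrightarrow> k x = 0"
    by (subst AE_all_countable) (rule allI)
  then show ?thesis
  proof eventually_elim
    case (elim x)
    obtain n :: nat where n: "norm x < real n" using reals_Archimedean2 by blast
    have "- real n < x \<bullet> b" "x \<bullet> b < real n" if "b \<in> Basis" for b
      using Basis_le_norm[OF that, of x] n by linarith+
    then have "x \<in> box (- real n *\<^sub>R One) (real n *\<^sub>R One)"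
      by (simp add: mem_box)
    then show ?case using elim by blast
  qed
qed

lemma not_AE_lborel_False: "\<not> (AE x in (lborel :: 'a::euclidean_space measure). False)"
proof
  assume "AE x in (lborel :: 'a measure). False"
  then obtain N where N: "{x \<in> space (lborel :: 'a measure). \<not> False} \<subseteq> N" "emeasure lborel N = 0" "N \<in> sets lborel"
    by (rule AE_E)
  then have "N = UNIV" by auto
  then show False using N(2) by (simp add: emeasure_lborel_UNIV)
qed

text \<open>Pairings with test functions are translation invariant; bumps approximating boxes then
  show \<open>h (x + v) = h x\<close> for almost every \<open>x\<close>, for each fixed
  \<open>v\<close>. By Fubini there is one point \<open>x0\<close> with
  \<open>h (x0 + v) = h x0\<close> for almost every \<open>v\<close>, and translation of the measure
  by \<open>x0\<close> finishes.\<close>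

lemma constant_of_weak_gradient_zero:
  fixes h :: "'a::euclidean_space \<Rightarrow> real"
  assumes h: "locally_integrable h"
    and zero: "\<And>\<phi> \<phi>' L R y. test_function \<phi> \<phi>' L R \<Longrightarrow> (LINT x|lborel. h x * \<phi>' x y) = 0"
  shows "\<exists>c. AE x in lborel. h x = c"
proof -
  have [measurable]: "h \<in> borel_measurable borel" using h by (simp add: locally_integrable_def)
  have inv: "AE x in lborel. h (x + v) = h x" for v
  proof -
    define k where "k x = h (x + v) - h x" for x
    have hv: "locally_integrable (\<lambda>x. h (x + v))"
      unfolding locally_integrable_def
    proof (intro conjI allI)
      fix R
      define f where "f y = h y * indicator (cball v R) y" for y
      have fm: "f \<in> borel_measurable borel" unfolding f_def by measurable
      have "integrable lborel f"
        unfolding f_def[abs_def]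
      proof (rule locally_integrable_mult[OF h, where C=1 and R="norm v + R"])
        show "norm x \<le> norm v + R" if "indicator (cball v R) x \<noteq> (0::real)" for x
        proof -
          have "dist v x \<le> R" using that by (auto simp: indicator_def split: if_splits)
          then show ?thesis using norm_triangle_sub[of x v] by (simp add: dist_norm norm_minus_commute)
        qed
      qed (auto simp: indicator_def)
      then have "integrable lborel (\<lambda>x. f (v + 1 *\<^sub>R x))" using lborel_affine_integral(2)[OF fm, of 1 v] by simp
      moreover have "f (v + 1 *\<^sub>R x) = indicator (cball 0 R) x * h (x + v)" for x
        by (simp add: f_def indicator_def dist_norm add.commute)
      ultimately show "integrable lborel (\<lambda>x. indicator (cball 0 R) x * h (x + v))" by simp
    qed measurable
    have k: "locally_integrable k"
      using h hv unfolding locally_integrable_def k_def by (auto simp: right_diff_distrib)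
    have "AE x in lborel. k x = 0"
    proof (rule AE_zero_of_box_integrals[OF k])
      fix l u :: 'a
      obtain R where R: "\<forall>x\<in>box l u. norm x \<le> R" using bounded_box unfolding bounded_iff by blast
      have bm: "box_bump l u n \<in> borel_measurable borel" for n
        using box_bump_test_function[of l u n] test_function_measurable by blast
      have bint: "integrable lborel (\<lambda>x. g x * box_bump l u n x)" if "locally_integrable g" for g n
      proof (rule locally_integrable_mult[OF that bm, where C=1 and R=R])
        show "\<bar>box_bump l u n x\<bar> \<le> 1" for x using box_bump_bounds[of l u n x] by simp
        show "norm x \<le> R" if "box_bump l u n x \<noteq> 0" for x using box_bump_support[of x l u n] R that by blast
      qed
      have z: "(LINT x|lborel. k x * box_bump l u n x) = 0" for n
      proof -
        obtain \<phi>' L R where T: "test_function (box_bump l u n) \<phi>' L R" using box_bump_test_function by blast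
        define f where "f x = h x * box_bump l u n (x - v)" for x
        have fm: "f \<in> borel_measurable borel"
        proof -
          note [measurable] = bm[of n]
          show ?thesis unfolding f_def by measurable
        qed
        have "(LINT x|lborel. h (x + v) * box_bump l u n x) = (LINT x|lborel. f (v + 1 *\<^sub>R x))"
          by (simp add: f_def add.commute)
        also have "\<dots> = (LINT x|lborel. f x)" using lborel_affine_integral(1)[OF fm, of 1 v] by simp
        also have "\<dots> = (LINT x|lborel. h x * box_bump l u n x)"
          unfolding f_def by (rule test_function_translation_invariant[OF h _ T]) (rule zero)
        finally show ?thesis
          unfolding k_def left_diff_distrib using bint[OF hv, of n] bint[OF h, of n] by simp
      qed
      have km: "k \<in> borel_measurable borel" using k by (simp add: locally_integrable_def)
      have "(\<lambda>n. LINT x|lborel. k x * box_bump l u n x) \<longlonglongrightarrow> (LINT x|lborel. k x * indicator (box l u) x)"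
      proof (rule integral_dominated_convergence)
        show "integrable lborel (\<lambda>x. norm (k x * indicator (box l u) x))"
          by (intro integrable_norm locally_integrable_mult[OF k, where C=1 and R=R])
             (use R in \<open>auto simp: indicator_def split: if_splits\<close>)
        show "AE x in lborel. (\<lambda>n. k x * box_bump l u n x) \<longlonglongrightarrow> k x * indicator (box l u) x"
          by (intro AE_I2 tendsto_mult_left box_bump_tendsto)
        show "AE x in lborel. norm (k x * box_bump l u n x) \<le> norm (k x * indicator (box l u) x)" for n
        proof (rule AE_I2)
          fix x
          show "norm (k x * box_bump l u n x) \<le> norm (k x * indicator (box l u) x)"
            using box_bump_bounds[of l u n x] box_bump_support[of x l u n]
            by (cases "x \<in> box l u") (auto simp: abs_mult mult_left_le)
        qed
        show "(\<lambda>x. k x * box_bump l u n x) \<in> borel_measurable lborel" for n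
          using bm[of n] km by simp
        show "(\<lambda>x. k x * indicator (box l u) x) \<in> borel_measurable lborel"
          using km by simp
      qed
      then show "(LINT x|lborel. k x * indicator (box l u) x) = 0"
        unfolding z by (simp add: LIMSEQ_const_iff)
    qed
    then show ?thesis by (simp add: k_def)
  qed
  have "AE v in lborel. AE x in lborel. h (x + v) = h x" using inv by simp
  then have "AE x in lborel. AE v in lborel. h (x + v) = h x"
    by (subst lborel_pair.AE_commute) measurable
  then obtain x0 where x0: "AE v in lborel. h (x0 + v) = h x0"
    using not_AE_lborel_False[where 'a='a] by (metis (no_types, lifting) eventually_mono)
  have "AE y in distr lborel borel ((+) x0). h y = h x0"
    using x0 by (subst AE_distr_iff) auto
  then show ?thesis unfolding lborel_distr_plus by blast
qed

section \<open>The kernel of the unit cube\<close>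

definition rescale :: "'a::euclidean_space \<Rightarrow> real \<Rightarrow> ('a \<Rightarrow> 'b) \<Rightarrow> 'a \<Rightarrow> 'b" where
  "rescale a \<epsilon> u x = u ((1 / \<epsilon>) *\<^sub>R (x - a))"

lemma rescale_affine: "\<epsilon> \<noteq> 0 \<Longrightarrow> rescale a \<epsilon> u (a + \<epsilon> *\<^sub>R y) = u y"
  by (simp add: rescale_def)

lemma borel_measurable_rescale:
  assumes "u \<in> borel_measurable borel"
  shows "rescale a \<epsilon> u \<in> borel_measurable borel"
proof -
  have "(\<lambda>x. (1 / \<epsilon>) *\<^sub>R (x - a)) \<in> borel \<rightarrow>\<^sub>M borel" by measurable
  from measurable_compose[OF this assms] show ?thesis by (simp add: rescale_def[abs_def])
qed

lemma sq_int_rescale: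
  assumes "\<epsilon> \<noteq> 0" "u \<in> borel_measurable borel"
  shows "sq_int (rescale a \<epsilon> u) \<longleftrightarrow> sq_int u"
proof -
  have m: "rescale a \<epsilon> u \<in> borel_measurable borel" by (rule borel_measurable_rescale[OF assms(2)])
  then have "(\<lambda>x. (norm (rescale a \<epsilon> u x))\<^sup>2) \<in> borel_measurable borel" by measurable
  from lborel_affine_integral(2)[OF this assms(1), of a] show ?thesis
    using m assms by (simp add: sq_int_def rescale_affine)
qed

lemma rescale_support:
  assumes "\<epsilon> > 0" "\<And>x. u x \<noteq> 0 \<Longrightarrow> norm x \<le> R" "rescale a \<epsilon> u x \<noteq> 0"
  shows "norm x \<le> norm a + \<epsilon> * R"
proof -
  have "norm ((1 / \<epsilon>) *\<^sub>R (x - a)) \<le> R" using assms unfolding rescale_def by blast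
  then have "norm (x - a) \<le> \<epsilon> * R" using assms(1) by (simp add: divide_le_eq mult.commute)
  then show ?thesis using norm_triangle_sub[of x a] by linarith
qed

lemma ft_rescale:
  fixes u :: "'a::euclidean_space \<Rightarrow> complex"
  assumes \<epsilon>: "\<epsilon> > 0" and [measurable]: "u \<in> borel_measurable borel"
  shows "ft (rescale a \<epsilon> u) \<xi> = of_real (\<epsilon> ^ DIM('a)) * (cis (- (a \<bullet> \<xi>)) * ft u (\<epsilon> *\<^sub>R \<xi>))"
proof -
  define f where "f x = cis (- (x \<bullet> \<xi>)) * rescale a \<epsilon> u x" for x
  have [measurable]: "rescale a \<epsilon> u \<in> borel_measurable borel" by (rule borel_measurable_rescale) measurable
  have fm: "f \<in> borel_measurable borel" unfolding f_def by measurable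
  have "(LINT x|lborel. f x) = (\<epsilon> ^ DIM('a)) *\<^sub>R (LINT x|lborel. f (a + \<epsilon> *\<^sub>R x))"
    using lborel_affine_integral(1)[OF fm, of \<epsilon> a] \<epsilon> by simp
  also have "(LINT x|lborel. f (a + \<epsilon> *\<^sub>R x)) = (LINT x|lborel. cis (- (a \<bullet> \<xi>)) * (cis (- (x \<bullet> (\<epsilon> *\<^sub>R \<xi>))) * u x))"
    using \<epsilon> by (intro Bochner_Integration.integral_cong)
      (simp_all add: f_def rescale_affine inner_add_left cis_mult mult.assoc[symmetric])
  also have "\<dots> = cis (- (a \<bullet> \<xi>)) * (LINT x|lborel. cis (- (x \<bullet> (\<epsilon> *\<^sub>R \<xi>))) * u x)" by simp
  finally show ?thesis unfolding ft_def f_def by (simp add: scaleR_conv_of_real mult_ac)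
qed

lemma riesz_symbol_scale: "\<epsilon> > 0 \<Longrightarrow> riesz_symbol c (\<epsilon> *\<^sub>R \<xi>) = riesz_symbol c \<xi>"
  by (simp add: riesz_symbol_def)

text \<open>The translation only multiplies both transforms by the same phase, which cancels in the
  pairing. The two transforms contribute \<open>\<epsilon>\<close> to the power
  \<open>2 * DIM('a)\<close>, the substitution in the frequency removes one half of it, and the
  symbol is invariant under dilation.\<close>

lemma riesz_rescale:
  fixes u v :: "'a::euclidean_space \<Rightarrow> complex"
  assumes \<epsilon>: "\<epsilon> > 0" and u: "sq_int u" "\<And>x. u x \<noteq> 0 \<Longrightarrow> norm x \<le> R" and v: "sq_int v" "\<And>x. v x \<noteq> 0 \<Longrightarrow> norm x \<le> R"
  shows "riesz c (abs_L2 (rescale a \<epsilon> u)) \<bullet> abs_L2 (rescale a \<epsilon> v) = \<epsilon> ^ DIM('a) * (riesz c (abs_L2 u) \<bullet> abs_L2 v)"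
proof -
  note um [measurable] = sq_int_measurable[OF u(1)] and vm [measurable] = sq_int_measurable[OF v(1)]
  have su: "sq_int (rescale a \<epsilon> u)" and sv: "sq_int (rescale a \<epsilon> v)"
    using sq_int_rescale u(1) v(1) um vm \<epsilon> by (metis less_irrefl)+
  define D where "D = \<epsilon> ^ DIM('a)"
  have D: "D > 0" using \<epsilon> by (simp add: D_def)
  define f where "f \<xi> = riesz_symbol c \<xi> * (ft u \<xi> \<bullet> ft v \<xi>)" for \<xi>
  have fm: "f \<in> borel_measurable borel" unfolding f_def[abs_def] by measurable
  have "riesz c (abs_L2 (rescale a \<epsilon> u)) \<bullet> abs_L2 (rescale a \<epsilon> v)
      = (LINT \<xi>|lborel. riesz_symbol c \<xi> * (ft (rescale a \<epsilon> u) \<xi> \<bullet> ft (rescale a \<epsilon> v) \<xi>))"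
  proof (rule riesz_inner[OF su _ sv])
    show "norm x \<le> norm a + \<epsilon> * R" if "rescale a \<epsilon> u x \<noteq> 0" for x
      using rescale_support[OF \<epsilon> _ that, of R] u(2) by blast
    show "norm x \<le> norm a + \<epsilon> * R" if "rescale a \<epsilon> v x \<noteq> 0" for x
      using rescale_support[OF \<epsilon> _ that, of R] v(2) by blast
  qed
  also have "\<dots> = (LINT \<xi>|lborel. D\<^sup>2 * f (0 + \<epsilon> *\<^sub>R \<xi>))"
  proof (intro Bochner_Integration.integral_cong refl)
    fix \<xi> :: 'a
    have "(q * z) \<bullet> (q * w) = (norm q)\<^sup>2 * (z \<bullet> w)" for q z w :: complex
      by (simp add: inner_complex_def cmod_power2) (simp add: power2_eq_square algebra_simps)
    from this[of "of_real D * cis _"]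
    have r: "(of_real D * (cis t * z)) \<bullet> (of_real D * (cis t * w)) = D\<^sup>2 * (z \<bullet> w)" for t and z w :: complex
      by (simp add: norm_mult mult.assoc)
    show "riesz_symbol c \<xi> * (ft (rescale a \<epsilon> u) \<xi> \<bullet> ft (rescale a \<epsilon> v) \<xi>) = D\<^sup>2 * f (0 + \<epsilon> *\<^sub>R \<xi>)"
      unfolding ft_rescale[OF \<epsilon> um] ft_rescale[OF \<epsilon> vm] D_def[symmetric] r
      by (simp add: f_def riesz_symbol_scale[OF \<epsilon>])
  qed
  also have "\<dots> = D\<^sup>2 * (LINT \<xi>|lborel. f (0 + \<epsilon> *\<^sub>R \<xi>))" by simp
  also have "(LINT \<xi>|lborel. f \<xi>) = D * (LINT \<xi>|lborel. f (0 + \<epsilon> *\<^sub>R \<xi>))"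
    using lborel_affine_integral(1)[OF fm, of \<epsilon> 0] \<epsilon> by (simp add: D_def)
  then have "D\<^sup>2 * (LINT \<xi>|lborel. f (0 + \<epsilon> *\<^sub>R \<xi>)) = D * (LINT \<xi>|lborel. f \<xi>)"
    by (simp add: power2_eq_square)
  also have "(LINT \<xi>|lborel. f \<xi>) = riesz c (abs_L2 u) \<bullet> abs_L2 v"
    unfolding f_def by (rule riesz_inner[OF u v, symmetric])
  finally show ?thesis by (simp add: D_def)
qed

text \<open>The symbol is linear in \<open>c\<close>. This passes from the coordinate directions,
  where information on \<open>f\<close> is available, to an arbitrary direction, where positivity of
  the moment is used.\<close>

lemma riesz_linear_symbol: "riesz c u \<bullet> v = (\<Sum>b\<in>Basis. (c \<bullet> b) * (riesz b u \<bullet> v))"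
  for c :: "'a::euclidean_space"
proof -
  obtain g k where g: "sq_int g" "fourier_L2 u = abs_L2 g" and k: "sq_int k" "fourier_L2 v = abs_L2 k"
    by (metis L2_ex_sq_int)
  have s: "sq_int (\<lambda>\<xi>. of_real (riesz_symbol b \<xi>) * g \<xi>)" for b
    by (rule sq_int_bounded_borel_mult[OF bounded_borel_riesz_symbol g(1)])
  have eq: "(of_real r * z) \<bullet> w = r * (z \<bullet> w)" for r and z w :: complex by (simp add: inner_complex_def algebra_simps)
  have R: "riesz b u \<bullet> v = (LINT \<xi>|lborel. riesz_symbol b \<xi> * (g \<xi> \<bullet> k \<xi>))"
      "integrable lborel (\<lambda>\<xi>. riesz_symbol b \<xi> * (g \<xi> \<bullet> k \<xi>))" for b
    using sq_int_inner[OF s[of b] k(1)] unfolding eq riesz_def inner_fourier_multiplier g(2) k(2)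
    by (simp_all add: mult_L2_abs bounded_borel_riesz_symbol g(1))
  have sym: "riesz_symbol c \<xi> = (\<Sum>b\<in>Basis. (c \<bullet> b) * riesz_symbol b \<xi>)" for \<xi> :: 'a
    unfolding riesz_symbol_def by (subst euclidean_inner) (simp add: sum_divide_distrib inner_commute)
  have "riesz c u \<bullet> v = (LINT \<xi>|lborel. (\<Sum>b\<in>Basis. (c \<bullet> b) * (riesz_symbol b \<xi> * (g \<xi> \<bullet> k \<xi>))))"
    unfolding R(1) sym by (simp add: sum_distrib_right mult.assoc)
  also have "\<dots> = (\<Sum>b\<in>Basis. (c \<bullet> b) * (riesz b u \<bullet> v))"
    unfolding R(1) by (subst Bochner_Integration.integral_sum) (auto intro: integrable_mult_right R(2))
  finally show ?thesis .
qed

text \<open>The fixed kernel against which the local means are taken, called \<rho> in the section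
  on weak gradients, for an arbitrary direction \<open>c\<close>.\<close>

definition cube_kernel :: "'a::euclidean_space \<Rightarrow> 'a \<Rightarrow> real" where
  "cube_kernel c y = indicator unit_cube y * Im (brep (riesz c (abs_L2 (indicator unit_cube))) y)"

text \<open>The mean is the pairing of the Riesz transform of the indicator with \<open>\<i>\<close>
  times the indicator. On the Fourier side the symbol is real and a number is orthogonal to its
  multiple by \<open>\<i>\<close> for the real inner product, so the integrand vanishes
  pointwise.\<close>

lemma cube_kernel_props:
  fixes c :: "'a::euclidean_space"
  shows "integrable lborel (cube_kernel c)" "cube_kernel c y \<noteq> 0 \<Longrightarrow> norm y \<le> DIM('a)" "(LINT y|lborel. cube_kernel c y) = 0"
proof -
  have s: "sq_int (indicator unit_cube :: 'a \<Rightarrow> real)" "sq_int (indicator unit_cube :: 'a \<Rightarrow> complex)"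
    by (rule sq_int_indicator[OF unit_cube_borel norm_unit_cube]; assumption)+
  note I = inner_imag[OF s(1), of "riesz c (abs_L2 (indicator unit_cube))"]
  show "integrable lborel (cube_kernel c)" using I(2) by (simp add: cube_kernel_def[abs_def])
  show "cube_kernel c y \<noteq> 0 \<Longrightarrow> norm y \<le> DIM('a)"
    using norm_unit_cube[of y] by (auto simp: cube_kernel_def indicator_def split: if_splits)
  have supp: "(indicator unit_cube x :: complex) \<noteq> 0 \<Longrightarrow> norm x \<le> DIM('a)"
    "\<i> * complex_of_real (indicator unit_cube x) \<noteq> 0 \<Longrightarrow> norm x \<le> DIM('a)" for x :: 'a
    using norm_unit_cube[of x] by (auto simp: indicator_def split: if_splits)
  have isq: "sq_int (\<lambda>x::'a. \<i> * complex_of_real (indicator unit_cube x))"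
    by (intro sq_int_times_i sq_int_of_real s)
  have "ft (\<lambda>x::'a. \<i> * complex_of_real (indicator unit_cube x)) \<xi> = \<i> * ft (indicator unit_cube) \<xi>" for \<xi>
    unfolding ft_cmult of_real_indicator ..
  then have "ft (indicator unit_cube) \<xi> \<bullet> ft (\<lambda>x::'a. \<i> * complex_of_real (indicator unit_cube x)) \<xi> = 0" for \<xi>
    by (simp add: inner_complex_def)
  then have "riesz c (abs_L2 (indicator unit_cube)) \<bullet> abs_L2 (\<lambda>x. \<i> * complex_of_real (indicator unit_cube x)) = 0"
    using riesz_inner[OF s(2) supp(1) isq supp(2)] by simp
  then show "(LINT y|lborel. cube_kernel c y) = 0" using I(1) by (simp add: cube_kernel_def)
qed

text \<open>The restriction of \<open>h\<close> to the small cube is pulled back to a function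
  \<open>V\<close> on the unit cube, and \<open>riesz_rescale\<close> is applied to the indicator
  and \<open>\<i> * V\<close>. Local square integrability of \<open>h\<close> makes \<open>V\<close>
  an admissible argument.\<close>

lemma cube_integral_rescale:
  fixes h :: "'a::euclidean_space \<Rightarrow> real"
  assumes h: "\<And>R. sq_int (\<lambda>x. indicator (cball 0 R) x *\<^sub>R h x)" and hm [measurable]: "h \<in> borel_measurable borel" and \<epsilon>: "\<epsilon> > 0"
  shows "(LINT x|lborel. (rescale a \<epsilon> (indicator unit_cube) x * h x) * Im (brep (riesz c (abs_L2 (rescale a \<epsilon> (indicator unit_cube)))) x))
    = \<epsilon> ^ DIM('a) * (LINT y|lborel. h (a + \<epsilon> *\<^sub>R y) * cube_kernel c y)"
proof -
  define V where "V y = indicator unit_cube y * h (a + \<epsilon> *\<^sub>R y)" for y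
  have Vm [measurable]: "V \<in> borel_measurable borel" unfolding V_def by measurable
  have V: "rescale a \<epsilon> V = (\<lambda>x. rescale a \<epsilon> (indicator unit_cube) x * h x)"
    using \<epsilon> by (simp add: V_def rescale_def fun_eq_iff)
  let ?D = "real DIM('a)"
  have supp: "norm x \<le> ?D" if "(indicator unit_cube x :: complex) \<noteq> 0" for x :: 'a
    using that norm_unit_cube[of x] by (auto simp: indicator_def split: if_splits)
  have supp': "norm x \<le> ?D" if "(indicator unit_cube x :: real) \<noteq> 0" for x :: 'a
    using that norm_unit_cube[of x] by (auto simp: indicator_def split: if_splits)
  have Vsupp: "norm x \<le> ?D" if "\<i> * complex_of_real (V x) \<noteq> 0" for x
    using that norm_unit_cube[of x] by (auto simp: V_def indicator_def split: if_splits)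
  have s: "sq_int (indicator unit_cube :: 'a \<Rightarrow> real)" "sq_int (indicator unit_cube :: 'a \<Rightarrow> complex)"
    by (rule sq_int_indicator[OF unit_cube_borel norm_unit_cube]; assumption)+
  have "sq_int (rescale a \<epsilon> V)"
  proof (rule sq_int_bound[OF h[of "norm a + \<epsilon> * ?D"], where C=1])
    show "rescale a \<epsilon> V \<in> borel_measurable borel" by (rule borel_measurable_rescale[OF Vm])
    show "AE x in lborel. norm (rescale a \<epsilon> V x) \<le> 1 * norm (indicator (cball 0 (norm a + \<epsilon> * ?D)) x *\<^sub>R h x)"
    proof (rule AE_I2)
      fix x
      show "norm (rescale a \<epsilon> V x) \<le> 1 * norm (indicator (cball 0 (norm a + \<epsilon> * ?D)) x *\<^sub>R h x)"
      proof (cases "rescale a \<epsilon> (indicator unit_cube) x = (0::real)")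
        case False
        have "norm x \<le> norm a + \<epsilon> * ?D" using rescale_support[OF \<epsilon> _ False, of ?D] supp' by blast
        moreover have "\<bar>rescale a \<epsilon> (indicator unit_cube) x\<bar> \<le> (1::real)" by (simp add: rescale_def indicator_def)
        ultimately show ?thesis unfolding V
          using mult_right_mono[of "\<bar>rescale a \<epsilon> (indicator unit_cube) x\<bar>" 1 "\<bar>h x\<bar>"] by (simp add: abs_mult)
      qed (simp add: V)
    qed
  qed
  then have sV: "sq_int (rescale a \<epsilon> V)" "sq_int V"
    using sq_int_rescale[OF _ Vm, of \<epsilon> a] \<epsilon> by auto
  have iV: "sq_int (\<lambda>y. \<i> * complex_of_real (V y))" by (intro sq_int_times_i sq_int_of_real sV)
  let ?u = "abs_L2 (rescale a \<epsilon> (indicator unit_cube))" and ?w = "abs_L2 (indicator unit_cube)"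
  have "(LINT x|lborel. (rescale a \<epsilon> (indicator unit_cube) x * h x) * Im (brep (riesz c ?u) x))
      = riesz c ?u \<bullet> abs_L2 (\<lambda>x. \<i> * complex_of_real (rescale a \<epsilon> V x))"
    using inner_imag(1)[OF sV(1), of "riesz c ?u"] unfolding V by simp
  also have "(\<lambda>x. \<i> * complex_of_real (rescale a \<epsilon> V x)) = rescale a \<epsilon> (\<lambda>y. \<i> * complex_of_real (V y))"
    by (simp add: rescale_def fun_eq_iff)
  also have "riesz c ?u \<bullet> abs_L2 \<dots> = \<epsilon> ^ DIM('a) * (riesz c ?w \<bullet> abs_L2 (\<lambda>y. \<i> * complex_of_real (V y)))"
    by (rule riesz_rescale[OF \<epsilon> s(2) supp iV Vsupp])
  also have "riesz c ?w \<bullet> abs_L2 (\<lambda>y. \<i> * complex_of_real (V y)) = (LINT y|lborel. V y * Im (brep (riesz c ?w) y))"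
    by (rule inner_imag(1)[OF sV(2)])
  also have "\<dots> = (LINT y|lborel. h (a + \<epsilon> *\<^sub>R y) * cube_kernel c y)"
    by (intro Bochner_Integration.integral_cong) (auto simp: V_def cube_kernel_def)
  finally show ?thesis .
qed

text \<open>If \<open>w\<close> annihilates the first moments of all coordinate kernels, then by
  linearity in the direction it also annihilates the moment of the kernel for \<open>w\<close>
  itself, which is positive unless \<open>w = 0\<close>.\<close>

lemma cube_kernel_moment_injective:
  fixes w :: "'a::euclidean_space"
  assumes "\<And>b. b \<in> Basis \<Longrightarrow> (LINT y|lborel. cube_kernel b y * (w \<bullet> y)) = 0"
  shows "w = 0"
proof (rule ccontr)
  assume "w \<noteq> 0"
  define v where "v y = (w \<bullet> y) * indicator unit_cube y" for y
  have v: "sq_int v"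
  proof (rule sq_int_bounded_support[where C="norm w * DIM('a)" and r="DIM('a)"])
    show "v \<in> borel_measurable borel" unfolding v_def[abs_def] by measurable
    show "norm (v x) \<le> norm w * DIM('a)" for x
    proof (cases "x \<in> unit_cube")
      case True
      then have "norm w * norm x \<le> norm w * DIM('a)" using norm_unit_cube[of x] by (intro mult_left_mono) auto
      then show ?thesis using True Cauchy_Schwarz_ineq2[of w x] by (simp add: v_def)
    qed (simp add: v_def)
    show "v x \<noteq> 0 \<Longrightarrow> norm x \<le> DIM('a)" for x
      using norm_unit_cube[of x] by (auto simp: v_def indicator_def split: if_splits)
  qed
  have eq: "riesz c (abs_L2 (indicator unit_cube)) \<bullet> abs_L2 (\<lambda>x. \<i> * complex_of_real (v x)) = (LINT y|lborel. cube_kernel c y * (w \<bullet> y))" for c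
    unfolding inner_imag(1)[OF v]
    by (intro Bochner_Integration.integral_cong) (auto simp: v_def cube_kernel_def)
  have "(LINT y|lborel. cube_kernel w y * (w \<bullet> y)) = 0"
    unfolding eq[symmetric] riesz_linear_symbol[of w] using assms by (simp add: eq)
  then show False
    using riesz_unit_cube_moment_pos[OF \<open>w \<noteq> 0\<close>] by (simp add: cube_kernel_def mult_ac)
qed

text \<open>For a fixed test function the weak derivative is linear in the direction, hence given by
  a vector \<open>w\<close>. The limits say that \<open>w\<close> is orthogonal to the first moment
  of each coordinate kernel, and these moments leave only \<open>w = 0\<close>.\<close>

lemma constant_of_cube_means:
  fixes h :: "'a::euclidean_space \<Rightarrow> real"
  assumes h: "locally_integrable h"
    and lim: "\<And>b M. b \<in> Basis \<Longrightarrow> (\<lambda>n. real (Suc n) * (LINT a|lborel. indicator (cball 0 M) a *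
        \<bar>LINT y|lborel. h (a + (1 / real (Suc n)) *\<^sub>R y) * cube_kernel b y\<bar>)) \<longlonglongrightarrow> 0"
  shows "\<exists>c. AE x in lborel. h x = c"
proof (rule constant_of_weak_gradient_zero[OF h])
  fix \<phi> :: "'a \<Rightarrow> real" and \<phi>' L R y
  assume T: "test_function \<phi> \<phi>' L R"
  define dq where "dq y = (LINT x|lborel. h x * \<phi>' x y)" for y
  have int: "integrable lborel (\<lambda>x. h x * \<phi>' x y)" for y
    by (rule test_function_difference_quotient(3)[OF h T LIMSEQ_inverse_real_of_nat])
       (auto simp: inverse_le_1_iff)
  define w where "w = (\<Sum>b\<in>Basis. dq b *\<^sub>R b)"
  have lin: "linear (\<phi>' x)" for x using T unfolding test_function_def by (blast intro: has_derivative_linear)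
  have dq: "dq y = w \<bullet> y" for y
  proof -
    have "\<phi>' x y = (\<Sum>b\<in>Basis. (y \<bullet> b) * \<phi>' x b)" for x
    proof -
      have "\<phi>' x y = \<phi>' x (\<Sum>b\<in>Basis. (y \<bullet> b) *\<^sub>R b)" by (simp add: euclidean_representation)
      then show ?thesis by (simp add: linear_sum[OF lin] linear_cmul[OF lin])
    qed
    then have "dq y = (LINT x|lborel. (\<Sum>b\<in>Basis. (y \<bullet> b) * (h x * \<phi>' x b)))"
      unfolding dq_def by (simp add: sum_distrib_left mult_ac)
    also have "\<dots> = (\<Sum>b\<in>Basis. (y \<bullet> b) * dq b)"
      unfolding dq_def by (subst Bochner_Integration.integral_sum) (auto intro: integrable_mult_right int)
    also have "\<dots> = w \<bullet> y"
      unfolding w_def inner_sum_left inner_scaleR_left by (simp only: mult.commute inner_commute[of y])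
    finally show ?thesis .
  qed
  have "w = 0"
  proof (rule cube_kernel_moment_injective)
    fix b :: 'a assume b: "b \<in> Basis"
    show "(LINT y|lborel. cube_kernel b y * (w \<bullet> y)) = 0"
      using weak_derivative_moment_zero[OF h T cube_kernel_props(1-3) lim[OF b]]
      unfolding dq_def[symmetric] dq by simp
  qed
  then show "(LINT x|lborel. h x * \<phi>' x y) = 0" using dq[of y] by (simp add: dq_def)
qed

section \<open>Lattices of cubes\<close>

lemma unit_cube_vec: "x \<in> unit_cube \<longleftrightarrow> (\<forall>i. 0 \<le> x $ i \<and> x $ i < 1)" for x :: "real^'d"
proof
  assume "x \<in> unit_cube"
  then have "0 \<le> x \<bullet> axis i 1 \<and> x \<bullet> axis i 1 < 1" for i
    unfolding unit_cube_def by (simp add: axis_in_Basis_iff)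
  then show "\<forall>i. 0 \<le> x $ i \<and> x $ i < 1" by (simp add: inner_axis)
next
  assume *: "\<forall>i. 0 \<le> x $ i \<and> x $ i < 1"
  show "x \<in> unit_cube"
    unfolding unit_cube_def
  proof (intro CollectI ballI)
    fix b :: "real^'d" assume "b \<in> Basis"
    then obtain i where "b = axis i 1" by (auto simp: Basis_vec_def)
    then show "0 \<le> x \<bullet> b \<and> x \<bullet> b < 1" using * by (simp add: inner_axis)
  qed
qed

lemma integral_unit_cube: "(LINT x::'a::euclidean_space|lborel. indicator unit_cube x) = (1 :: real)"
proof -
  have "emeasure lborel (box 0 One :: 'a set) = 1" "emeasure lborel (cbox 0 One :: 'a set) = 1"
    by (simp_all add: emeasure_lborel_box_eq emeasure_lborel_cbox_eq)
  moreover have "emeasure lborel (box 0 One :: 'a set) \<le> emeasure lborel (unit_cube :: 'a set)"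
      "emeasure lborel (unit_cube :: 'a set) \<le> emeasure lborel (cbox 0 One :: 'a set)"
    by (intro emeasure_mono unit_cube_box; simp)+
  ultimately have "emeasure lborel (unit_cube :: 'a set) = 1" by (metis antisym)
  then show ?thesis by (simp add: measure_def)
qed

text \<open>The offset \<theta> is measured in units of the mesh, so averaging over translates of
  the lattice is integration of \<theta> over the unit cube, whatever \<open>n\<close> is.\<close>

definition grid_point :: "nat \<Rightarrow> real^'d \<Rightarrow> ('d \<Rightarrow> int) \<Rightarrow> real^'d" where
  "grid_point n \<theta> k = (1 / real n) *\<^sub>R ((\<chi> i. of_int (k i)) + \<theta>)"

definition grid :: "nat \<Rightarrow> ('d::finite \<Rightarrow> int) set" where
  "grid N = PiE UNIV (\<lambda>_. {- int N..<int N})"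

lemma finite_grid: "finite (grid N :: ('d::finite \<Rightarrow> int) set)"
  unfolding grid_def by (intro finite_PiE) auto

lemma card_grid: "card (grid N :: ('d::finite \<Rightarrow> int) set) = (2 * N) ^ CARD('d)"
  unfolding grid_def by (simp add: card_PiE nat_mult_distrib power_mult_distrib)

definition grid_cube :: "nat \<Rightarrow> real^'d \<Rightarrow> ('d::finite \<Rightarrow> int) \<Rightarrow> (real^'d) set" where
  "grid_cube n \<theta> k = {x. real n *\<^sub>R (x - grid_point n \<theta> k) \<in> unit_cube}"

text \<open>The index of the cube that contains a point is given by floors. Uniqueness of the floor
  makes the cubes disjoint, as \<open>orthonormal_grid\<close> needs; its existence makes them cover
  space, as \<open>integral_le_grid_sum\<close> needs.\<close>

lemma grid_cube_iff:
  assumes "n > 0"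
  shows "x \<in> grid_cube n \<theta> k \<longleftrightarrow> (\<forall>i. k i = \<lfloor>real n * x $ i - \<theta> $ i\<rfloor>)"
proof -
  have "real n *\<^sub>R (x - grid_point n \<theta> k) $ i = real n * x $ i - \<theta> $ i - of_int (k i)" for i
    using assms by (simp add: grid_point_def algebra_simps)
  then have "x \<in> grid_cube n \<theta> k \<longleftrightarrow> (\<forall>i. of_int (k i) \<le> real n * x $ i - \<theta> $ i \<and> real n * x $ i - \<theta> $ i < of_int (k i) + 1)"
    unfolding grid_cube_def unit_cube_vec by (auto simp: algebra_simps)
  then show ?thesis by (metis floor_eq_iff)
qed

lemma indicator_grid_cube:
  assumes "n > 0"
  shows "rescale (grid_point n \<theta> k) (1 / real n) (indicator unit_cube) = indicator (grid_cube n \<theta> k)"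
  using assms by (simp add: rescale_def grid_cube_def fun_eq_iff indicator_def)

lemma grid_cube_borel: "grid_cube n \<theta> k \<in> sets borel"
proof -
  have "(\<lambda>x. real n *\<^sub>R (x - grid_point n \<theta> k)) \<in> borel \<rightarrow>\<^sub>M borel" by measurable
  from measurable_sets[OF this unit_cube_borel] show ?thesis
    by (simp add: grid_cube_def vimage_def)
qed

lemma grid_cube_bounded:
  fixes \<theta> :: "real^'d"
  assumes "n > 0" "x \<in> grid_cube n \<theta> k"
  shows "norm x \<le> norm (grid_point n \<theta> k) + real DIM(real^'d)"
proof -
  have "norm (real n *\<^sub>R (x - grid_point n \<theta> k)) \<le> real DIM(real^'d)"
    using assms(2) norm_unit_cube unfolding grid_cube_def by blast
  moreover have "1 * norm (x - grid_point n \<theta> k) \<le> real n * norm (x - grid_point n \<theta> k)"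
    using assms(1) by (intro mult_right_mono) auto
  ultimately have "norm (x - grid_point n \<theta> k) \<le> real DIM(real^'d)" by simp
  then show ?thesis using norm_triangle_sub[of x "grid_point n \<theta> k"] by linarith
qed

lemma integral_grid_cube:
  fixes \<theta> :: "real^'d"
  assumes n: "n > 0"
  shows "(LINT x|lborel. indicator (grid_cube n \<theta> k) x) = (1 / real n) ^ CARD('d)"
    "integrable lborel (indicator (grid_cube n \<theta> k) :: real^'d \<Rightarrow> real)"
proof -
  have m: "(indicator (grid_cube n \<theta> k) :: real^'d \<Rightarrow> real) \<in> borel_measurable borel"
    using grid_cube_borel by (rule borel_measurable_indicator)
  have e: "(1 / real n :: real) \<noteq> 0" using n by simp
  have eq: "indicator (grid_cube n \<theta> k) (grid_point n \<theta> k + (1 / real n) *\<^sub>R x) = (indicator unit_cube x :: real)" for x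
    using rescale_affine[OF e, of "grid_point n \<theta> k" "indicator unit_cube" x] by (simp add: indicator_grid_cube[OF n])
  show "(LINT x|lborel. indicator (grid_cube n \<theta> k) x) = (1 / real n) ^ CARD('d)"
    unfolding lborel_affine_integral(1)[OF m e, of "grid_point n \<theta> k"] eq integral_unit_cube by simp
  show "integrable lborel (indicator (grid_cube n \<theta> k) :: real^'d \<Rightarrow> real)"
    using lborel_affine_integral(2)[OF m e, of "grid_point n \<theta> k"] integrable_unit_cube[where 'a="real^'d"] by (simp add: eq)
qed

lemma orthonormal_grid:
  fixes \<theta> :: "real^'d" and v :: "complex^'n"
  assumes n: "n > 0" and v: "norm v = 1" and z: "norm z = 1"
  shows "orthonormal_on K (\<lambda>k. abs_L2 (\<lambda>x. (of_real (sqrt (real n ^ CARD('d))) * (z * indicator (grid_cube n \<theta> k) x)) *s v))"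
  unfolding orthonormal_on_def
proof (intro ballI)
  fix j k :: "'d \<Rightarrow> int"
  define s where "s = sqrt (real n ^ CARD('d))"
  define c where "c k x = of_real s * (z * indicator (grid_cube n \<theta> k) x)" for k and x :: "real^'d"
  have sq: "sq_int (\<lambda>x. c k x *s v)" for k
  proof (intro sq_int_smult_const)
    have "sq_int (indicator (grid_cube n \<theta> k) :: real^'d \<Rightarrow> complex)"
      by (rule sq_int_indicator(2)[OF grid_cube_borel grid_cube_bounded[OF n]])
    then show "sq_int (c k)" unfolding c_def[abs_def]
      by (intro sq_int_bounded_borel_mult bounded_borel_const)
  qed
  have vv: "(a *s v) \<bullet> (b *s v) = a \<bullet> b" for a b :: complex
  proof -
    have *: "(norm (a *s v + b *s v))\<^sup>2 = (norm (a + b))\<^sup>2"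
      unfolding vector_sadd_rdistrib[symmetric] norm_vector_smult_complex using v by simp
    show ?thesis unfolding dot_norm * norm_vector_smult_complex using v by simp
  qed
  have zz: "z \<bullet> z = 1" using z by (simp add: dot_square_norm)
  have "c j x \<bullet> c k x = (if j = k then s\<^sup>2 * indicator (grid_cube n \<theta> k) x else 0)" for x
  proof (cases "x \<in> grid_cube n \<theta> j \<and> x \<in> grid_cube n \<theta> k")
    case True
    then have "j = k" using grid_cube_iff[OF n, of x \<theta>] by (simp add: fun_eq_iff)
    moreover have "(of_real s * z) \<bullet> (of_real s * z) = s\<^sup>2 * (z \<bullet> z)" by (simp add: inner_complex_def power2_eq_square algebra_simps)
    ultimately show ?thesis using True zz by (simp add: c_def)
  qed (auto simp: c_def indicator_def)
  then have "abs_L2 (\<lambda>x. c j x *s v) \<bullet> abs_L2 (\<lambda>x. c k x *s v) = (LINT x|lborel. (if j = k then s\<^sup>2 * indicator (grid_cube n \<theta> k) x else 0))"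
    unfolding sq_int_inner(1)[OF sq sq] vv by simp
  also have "\<dots> = (if j = k then 1 else 0)"
  proof -
    have "(LINT x|lborel. s\<^sup>2 * indicator (grid_cube n \<theta> k) x) = s\<^sup>2 * (1 / real n) ^ CARD('d)"
      by (simp only: integral_mult_right_zero integral_grid_cube(1)[OF n])
    also have "\<dots> = 1" using n by (simp add: s_def power_one_over)
    finally show ?thesis by simp
  qed
  finally show "abs_L2 (\<lambda>x. (of_real (sqrt (real n ^ CARD('d))) * (z * indicator (grid_cube n \<theta> j) x)) *s v) \<bullet>
      abs_L2 (\<lambda>x. (of_real (sqrt (real n ^ CARD('d))) * (z * indicator (grid_cube n \<theta> k) x)) *s v) = (if j = k then 1 else 0)"
    by (simp add: c_def s_def)
qed

text \<open>A Hermitian matrix with square 1 is unitary: the squared norm of its column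
  \<open>p\<close> is the diagonal entry \<open>p\<close> of its square.\<close>

lemma norm_gamma_axis:
  fixes \<gamma> :: "'d::finite \<Rightarrow> complex^'n^'n"
  assumes "gamma_matrices \<gamma>"
  shows "norm (\<gamma> l *v axis p 1) = 1"
proof -
  have herm: "\<gamma> l $ a $ b = cnj (\<gamma> l $ b $ a)" for a b
  proof -
    have "(\<chi> k m. cnj (\<gamma> l $ m $ k)) = \<gamma> l" using assms by (simp add: gamma_matrices_def)
    then have "(\<chi> k m. cnj (\<gamma> l $ m $ k)) $ a $ b = \<gamma> l $ a $ b" by (rule arg_cong)
    then show ?thesis by simp
  qed
  have "\<gamma> l ** \<gamma> l + \<gamma> l ** \<gamma> l = mat 2"
    using assms unfolding gamma_matrices_def by (metis (full_types))
  then have "(\<gamma> l ** \<gamma> l + \<gamma> l ** \<gamma> l) $ p $ p = mat 2 $ p $ p" by simp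
  then have "2 * (\<gamma> l ** \<gamma> l) $ p $ p = 2" by (simp add: mat_def)
  then have sq: "(\<gamma> l ** \<gamma> l) $ p $ p = 1" by simp
  have comp: "(\<gamma> l *v axis p 1) $ q = \<gamma> l $ q $ p" for q
    by (simp add: matrix_vector_mult_def axis_def if_distrib cong: if_cong)
  have "complex_of_real ((norm (\<gamma> l *v axis p 1))\<^sup>2) = (\<Sum>q\<in>UNIV. of_real ((norm (\<gamma> l $ q $ p))\<^sup>2))"
    unfolding norm_vec_def L2_set_def comp by (simp add: sum_nonneg)
  also have "\<dots> = (\<Sum>q\<in>UNIV. \<gamma> l $ p $ q * \<gamma> l $ q $ p)"
    unfolding complex_norm_square using herm[of p] by (simp add: mult.commute)
  also have "\<dots> = 1" using sq by (simp add: matrix_matrix_mult_def)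
  finally have "complex_of_real ((norm (\<gamma> l *v axis p 1))\<^sup>2) = of_real 1" by simp
  then have "(norm (\<gamma> l *v axis p 1))\<^sup>2 = 1" unfolding of_real_eq_iff .
  then have "norm (\<gamma> l *v axis p 1) = 1 \<or> norm (\<gamma> l *v axis p 1) = - 1" by (simp only: power2_eq_1_iff)
  then show ?thesis using norm_ge_zero[of "\<gamma> l *v axis p 1"] by linarith
qed

text \<open>The two normalising factors \<open>sqrt (real n ^ CARD('d))\<close> multiply to
  \<open>n^d\<close> and cancel the \<open>n^(-d)\<close> of the rescaled cube, so each local mean
  is a trace of pairings divided by \<open>2 * N\<close>. The trace uses \<open>N\<close> pairs of
  orthonormal systems, each costing at most \<open>B\<close>, and \<open>N\<close> drops
  out.\<close>

lemma grid_mean_sum: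
  fixes \<gamma> :: "'d::finite \<Rightarrow> complex^'n^'n" and f0 :: "real^'d \<Rightarrow> complex"
  assumes \<gamma>: "gamma_matrices \<gamma>" and T: "is_quantum_derivative \<gamma> f T"
    and f0: "AE x in lebesgue. f x = f0 x" and f0m [measurable]: "f0 \<in> borel_measurable borel"
    and n: "n > 0" and z: "norm z = 1" and K: "finite (K :: ('d \<Rightarrow> int) set)"
    and bound: "\<And>e g. orthonormal_on K e \<Longrightarrow> orthonormal_on K g \<Longrightarrow> (\<Sum>k\<in>K. \<bar>T (e k) \<bullet> g k\<bar>) \<le> B"
  shows "2 * (\<Sum>k\<in>K. \<bar>LINT y|lborel. Re (cnj z * f0 (grid_point n \<theta> k + (1 / real n) *\<^sub>R y)) * cube_kernel (axis l 1) y\<bar>) \<le> B"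
proof -
  define G where "G k = (LINT y|lborel. Re (cnj z * f0 (grid_point n \<theta> k + (1 / real n) *\<^sub>R y)) * cube_kernel (axis l 1) y)" for k
  define N where "N = real CARD('n)"
  have N: "N > 0" by (simp add: N_def)
  define s where "s = sqrt (real n ^ CARD('d))"
  have s2: "s * s = real n ^ CARD('d)" by (simp add: s_def)
  define e where "e p k = abs_L2 (\<lambda>x. (of_real s * (1 * indicator (grid_cube n \<theta> k) x)) *s (\<gamma> l *v axis p 1))" for p k
  define g where "g p k = abs_L2 (\<lambda>x. (of_real s * (z * indicator (grid_cube n \<theta> k) x)) *s axis p (1::complex) :: complex^'n)" for p k
  have eo: "orthonormal_on K (e p)" for p
    unfolding e_def s_def by (rule orthonormal_grid[OF n norm_gamma_axis[OF \<gamma>]]) simp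
  have go: "orthonormal_on K (g p)" for p
    unfolding g_def s_def by (rule orthonormal_grid[OF n _ z]) simp
  have bl: "bounded_linear T" using T by (simp add: is_quantum_derivative_def bounded_clinear_def)
  have key: "(\<Sum>p\<in>UNIV. T (e p k) \<bullet> g p k) = 2 * N * G k" for k
  proof -
    let ?Q = "grid_cube n \<theta> k"
    have sQ: "sq_int (indicator ?Q :: real^'d \<Rightarrow> complex)"
      by (rule sq_int_indicator(2)[OF grid_cube_borel grid_cube_bounded[OF n]])
    have scale: "abs_L2 (\<lambda>x. (of_real s * c x) *s v) = s *\<^sub>R abs_L2 (\<lambda>x. c x *s v)"
      if "sq_int c" for c :: "real^'d \<Rightarrow> complex" and v :: "complex^'n"
    proof -
      have "s *\<^sub>R abs_L2 (\<lambda>x. c x *s v) = abs_L2 (\<lambda>x. s *\<^sub>R (c x *s v))"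
        by (intro abs_L2_scaleR sq_int_imp_square_integrable sq_int_smult_const that)
      also have "(\<lambda>x. s *\<^sub>R (c x *s v)) = (\<lambda>x. (of_real s * c x) *s v)"
        by (simp add: fun_eq_iff vec_eq_iff) (simp add: scaleR_conv_of_real)
      finally show ?thesis ..
    qed
    have c1: "sq_int (\<lambda>x. 1 * indicator ?Q x :: complex)" and c2: "sq_int (\<lambda>x. z * indicator ?Q x)"
      by (intro sq_int_bounded_borel_mult bounded_borel_const sQ)+
    have "T (e p k) \<bullet> g p k = real n ^ CARD('d) * (T (abs_L2 (\<lambda>x. indicator ?Q x *s (\<gamma> l *v axis p 1))) \<bullet> abs_L2 (\<lambda>x. (z * indicator ?Q x) *s axis p 1))" for p
      unfolding e_def g_def scale[OF c1] scale[OF c2] s2[symmetric]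
      by (simp add: linear_cmul[OF bounded_linear.linear[OF bl]])
    then have "(\<Sum>p\<in>UNIV. T (e p k) \<bullet> g p k) = real n ^ CARD('d) *
        (\<Sum>p\<in>UNIV. T (abs_L2 (\<lambda>x. indicator ?Q x *s (\<gamma> l *v axis p 1))) \<bullet> abs_L2 (\<lambda>x. (z * indicator ?Q x) *s axis p 1))"
      by (simp add: sum_distrib_left)
    also have "(\<Sum>p\<in>UNIV. T (abs_L2 (\<lambda>x. indicator ?Q x *s (\<gamma> l *v axis p 1))) \<bullet> abs_L2 (\<lambda>x. (z * indicator ?Q x) *s axis p 1))
        = 2 * N * (LINT x|lborel. (indicator ?Q x * Re (cnj z * f0 x)) * Im (brep (riesz_axis l (abs_L2 (indicator ?Q))) x))"
      unfolding N_def by (rule quantum_derivative_pairing[OF \<gamma> T f0 f0m grid_cube_borel grid_cube_bounded[OF n]])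
    also have "(LINT x|lborel. (indicator ?Q x * Re (cnj z * f0 x)) * Im (brep (riesz_axis l (abs_L2 (indicator ?Q))) x))
        = (1 / real n) ^ CARD('d) * G k"
    proof -
      have hm: "(\<lambda>x. Re (cnj z * f0 x)) \<in> borel_measurable borel" by measurable
      have h: "sq_int (\<lambda>x. indicator (cball 0 R) x *\<^sub>R Re (cnj z * f0 x))" for R
      proof (rule sq_int_bound[OF quantum_derivative_L2_loc[OF \<gamma> T f0 f0m, of R], where C=1])
        show "(\<lambda>x. indicator (cball 0 R) x *\<^sub>R Re (cnj z * f0 x)) \<in> borel_measurable borel"
          using hm by (intro borel_measurable_scaleR borel_measurable_indicator) auto
        show "AE x in lborel. norm (indicator (cball 0 R) x *\<^sub>R Re (cnj z * f0 x)) \<le> 1 * norm (indicator (cball 0 R) x *\<^sub>R f0 x)"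
        proof (rule AE_I2)
          fix x
          have "\<bar>Re (cnj z * f0 x)\<bar> \<le> norm (cnj z * f0 x)" by (rule abs_Re_le_cmod)
          also have "\<dots> = norm (f0 x)" using z by (simp add: norm_mult)
          finally show "norm (indicator (cball 0 R) x *\<^sub>R Re (cnj z * f0 x)) \<le> 1 * norm (indicator (cball 0 R) x *\<^sub>R f0 x)"
            by (cases "x \<in> cball 0 R") simp_all
        qed
      qed
      have "1 / real n > 0" using n by simp
      from cube_integral_rescale[OF h hm this, of "grid_point n \<theta> k" "axis l 1"]
      show ?thesis by (simp add: indicator_grid_cube[OF n] G_def)
    qed
    finally show ?thesis using n by (simp add: power_one_over)
  qed
  have "2 * N * (\<Sum>k\<in>K. \<bar>G k\<bar>) = (\<Sum>k\<in>K. \<bar>\<Sum>p\<in>UNIV. T (e p k) \<bullet> g p k\<bar>)"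
    unfolding key using N by (simp add: abs_mult sum_distrib_left)
  also have "\<dots> \<le> (\<Sum>k\<in>K. \<Sum>p\<in>UNIV. \<bar>T (e p k) \<bullet> g p k\<bar>)" by (intro sum_mono sum_abs)
  also have "\<dots> = (\<Sum>p\<in>UNIV. \<Sum>k\<in>K. \<bar>T (e p k) \<bullet> g p k\<bar>)" by (rule sum.swap)
  also have "\<dots> \<le> (\<Sum>p\<in>(UNIV::'n set). B)" by (intro sum_mono bound eo go)
  also have "\<dots> = N * B" by (simp add: N_def)
  finally have "N * (2 * (\<Sum>k\<in>K. \<bar>G k\<bar>)) \<le> N * B" by (simp add: mult_ac)
  then show ?thesis using N unfolding G_def by (simp add: mult_le_cancel_left_pos)
qed

section \<open>Averaging over translates of the lattice\<close>

lemma nn_integral_affine: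
  fixes f :: "'a::euclidean_space \<Rightarrow> ennreal"
  assumes [measurable]: "f \<in> borel_measurable borel" and c: "c > 0"
  shows "(\<integral>\<^sup>+x. f x \<partial>lborel) = ennreal (c ^ DIM('a)) * (\<integral>\<^sup>+x. f (t + c *\<^sub>R x) \<partial>lborel)"
proof -
  have "(\<lambda>x::'a. t + c *\<^sub>R x) \<in> lborel \<rightarrow>\<^sub>M borel" by measurable
  then show ?thesis
    using c by (subst lborel_affine[of c t]) (simp_all add: nn_integral_density nn_integral_distr nn_integral_cmult)
qed

text \<open>The ball is covered by the cubes of the unshifted lattice, since \<open>R < M\<close>.
  Each cube is parametrised by the offset \<theta> in the unit cube with Jacobian
  \<open>n^(-d)\<close>, so the sum over cubes of integrals becomes the average over \<theta> of the
  sums that are bounded by \<open>B\<close>.\<close>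

lemma integral_le_grid_sum:
  fixes G :: "real^'d \<Rightarrow> real"
  assumes [measurable]: "G \<in> borel_measurable borel" and n: "n > 0" and M: "R < real M" and B: "0 \<le> B"
    and bound: "\<And>\<theta>. (\<Sum>k\<in>grid (M * n). \<bar>G (grid_point n \<theta> k)\<bar>) \<le> B"
  shows "(LINT a|lborel. indicator (cball 0 R) a * \<bar>G a\<bar>) \<le> (1 / real n) ^ CARD('d) * B"
proof (rule integral_real_bounded)
  show "0 \<le> (1 / real n) ^ CARD('d) * B" using B by simp
  let ?K = "grid (M * n) :: ('d \<Rightarrow> int) set"
  have cover: "ennreal (indicator (cball 0 R) a * \<bar>G a\<bar>) \<le> (\<Sum>k\<in>?K. indicator (grid_cube n 0 k) a * ennreal \<bar>G a\<bar>)" for a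
  proof (cases "a \<in> cball 0 R")
    case True
    define k where "k i = \<lfloor>real n * a $ i - 0 $ i\<rfloor>" for i
    have "a \<in> grid_cube n 0 k" by (simp add: grid_cube_iff[OF n] k_def)
    moreover have "k \<in> ?K"
    proof -
      have "\<bar>a $ i\<bar> < real M" for i
        using component_le_norm_cart[of a i] True M by simp
      then have "\<bar>real n * a $ i\<bar> < real n * real M" for i using n by (simp add: abs_mult)
      then have "- real (M * n) \<le> real n * a $ i" "real n * a $ i < real (M * n)" for i
        by (metis abs_less_iff less_imp_le minus_less_iff mult.commute of_nat_mult,
            metis abs_less_iff mult.commute of_nat_mult)
      then have "- int (M * n) \<le> k i \<and> k i < int (M * n)" for i
        unfolding k_def by (simp add: le_floor_iff floor_less_iff)
      then show ?thesis by (simp add: grid_def PiE_UNIV_domain)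
    qed
    ultimately have "indicator (grid_cube n 0 k) a * ennreal \<bar>G a\<bar> = ennreal (indicator (cball 0 R) a * \<bar>G a\<bar>)"
      using True by simp
    moreover have "indicator (grid_cube n 0 k) a * ennreal \<bar>G a\<bar> \<le> (\<Sum>k\<in>?K. indicator (grid_cube n 0 k) a * ennreal \<bar>G a\<bar>)"
      using \<open>k \<in> ?K\<close> by (intro member_le_sum finite_grid) auto
    ultimately show ?thesis by simp
  qed simp
  have e: "1 / real n > 0" using n by simp
  note [measurable] = grid_cube_borel unit_cube_borel
  have one: "(\<integral>\<^sup>+a. indicator (grid_cube n 0 k) a * ennreal \<bar>G a\<bar> \<partial>lborel)
      = ennreal ((1 / real n) ^ CARD('d)) * (\<integral>\<^sup>+\<theta>. indicator unit_cube \<theta> * ennreal \<bar>G (grid_point n \<theta> k)\<bar> \<partial>lborel)" for k :: "'d \<Rightarrow> int"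
  proof -
    have pt: "grid_point n 0 k + (1 / real n) *\<^sub>R \<theta> = grid_point n \<theta> k" for \<theta>
      by (simp add: grid_point_def scaleR_add_right)
    have ind: "indicator (grid_cube n 0 k) (grid_point n 0 k + (1 / real n) *\<^sub>R \<theta>) = (indicator unit_cube \<theta> :: ennreal)" for \<theta>
      using n by (simp add: grid_cube_def indicator_def)
    have m: "(\<lambda>a. indicator (grid_cube n 0 k) a * ennreal \<bar>G a\<bar>) \<in> borel_measurable borel" by measurable
    show ?thesis
      using nn_integral_affine[OF m e, of "grid_point n 0 k"] unfolding ind unfolding pt by simp
  qed
  have gm [measurable]: "(\<lambda>\<theta>. grid_point n \<theta> k) \<in> borel \<rightarrow>\<^sub>M borel" for k :: "'d \<Rightarrow> int"
    unfolding grid_point_def by measurable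
  have "(\<integral>\<^sup>+a. ennreal (indicator (cball 0 R) a * \<bar>G a\<bar>) \<partial>lborel)
      \<le> (\<integral>\<^sup>+a. (\<Sum>k\<in>?K. indicator (grid_cube n 0 k) a * ennreal \<bar>G a\<bar>) \<partial>lborel)"
    by (intro nn_integral_mono cover)
  also have "\<dots> = (\<Sum>k\<in>?K. \<integral>\<^sup>+a. indicator (grid_cube n 0 k) a * ennreal \<bar>G a\<bar> \<partial>lborel)"
    by (rule nn_integral_sum) measurable
  also have "\<dots> = ennreal ((1 / real n) ^ CARD('d)) * (\<Sum>k\<in>?K. \<integral>\<^sup>+\<theta>. indicator unit_cube \<theta> * ennreal \<bar>G (grid_point n \<theta> k)\<bar> \<partial>lborel)"
    unfolding one by (simp add: sum_distrib_left)
  also have "(\<Sum>k\<in>?K. \<integral>\<^sup>+\<theta>. indicator unit_cube \<theta> * ennreal \<bar>G (grid_point n \<theta> k)\<bar> \<partial>lborel)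
      = (\<integral>\<^sup>+\<theta>. (\<Sum>k\<in>?K. indicator unit_cube \<theta> * ennreal \<bar>G (grid_point n \<theta> k)\<bar>) \<partial>lborel)"
    by (rule nn_integral_sum[symmetric]) measurable
  also have "\<dots> \<le> (\<integral>\<^sup>+\<theta>. indicator (unit_cube :: (real^'d) set) \<theta> * ennreal B \<partial>lborel)"
  proof (rule nn_integral_mono)
    fix \<theta> :: "real^'d"
    have "(\<Sum>k\<in>?K. indicator unit_cube \<theta> * ennreal \<bar>G (grid_point n \<theta> k)\<bar>)
        = indicator unit_cube \<theta> * ennreal (\<Sum>k\<in>?K. \<bar>G (grid_point n \<theta> k)\<bar>)"
      by (simp add: sum_distrib_left[symmetric] sum_ennreal)
    also have "\<dots> \<le> indicator unit_cube \<theta> * ennreal B"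
      by (intro mult_left_mono ennreal_leI bound) simp
    finally show "(\<Sum>k\<in>?K. indicator unit_cube \<theta> * ennreal \<bar>G (grid_point n \<theta> k)\<bar>) \<le> indicator unit_cube \<theta> * ennreal B" .
  qed
  also have "\<dots> = ennreal B"
  proof -
    have "emeasure lborel (unit_cube :: (real^'d) set) = 1"
    proof -
      have "(\<integral>\<^sup>+(x::real^'d). ennreal (indicator unit_cube x) \<partial>lborel) = ennreal 1"
        using nn_integral_eq_integral[OF integrable_unit_cube[where 'a="real^'d"]] unfolding integral_unit_cube by simp
      then show ?thesis by (simp add: ennreal_indicator)
    qed
    then show ?thesis by (simp add: nn_integral_multc)
  qed
  finally have "(\<integral>\<^sup>+a. ennreal (indicator (cball 0 R) a * \<bar>G a\<bar>) \<partial>lborel) \<le> ennreal ((1 / real n) ^ CARD('d)) * ennreal B"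
    by (simp add: mult_left_mono)
  then show "(\<integral>\<^sup>+a. ennreal (indicator (cball 0 R) a * \<bar>G a\<bar>) \<partial>lborel) \<le> ennreal ((1 / real n) ^ CARD('d) * B)"
    using B by (simp add: ennreal_mult)
qed

text \<open>With \<open>m = 2 * M * n\<close> there are \<open>m ^ d\<close> cubes, and the exponent
  \<open>1 - 1 / d\<close> of the singular value estimate turns this number into
  \<open>m ^ (d - 1)\<close>. Multiplied by \<open>n\<close> and by the Jacobian
  \<open>n^(-d)\<close>, it leaves a constant times the arbitrary \<delta>.\<close>

lemma constant_of_quantum_derivative_decay:
  fixes \<gamma> :: "'d::finite \<Rightarrow> complex^'n^'n" and f0 :: "real^'d \<Rightarrow> complex"
  assumes d: "CARD('d) \<ge> 2" and \<gamma>: "gamma_matrices \<gamma>" and T: "is_quantum_derivative \<gamma> f T"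
    and decay: "((\<lambda>t::real. t powr (1 / real CARD('d)) * singular_value t T) \<longlongrightarrow> 0) at_top"
    and f0: "AE x in lebesgue. f x = f0 x" and f0m [measurable]: "f0 \<in> borel_measurable borel" and z: "norm z = 1"
  shows "\<exists>c. AE x in lborel. Re (cnj z * f0 x) = c"
proof (rule constant_of_cube_means)
  define h where "h x = Re (cnj z * f0 x)" for x
  have hm [measurable]: "h \<in> borel_measurable borel" unfolding h_def by measurable
  have bT: "bounded_clinear T" using T by (simp add: is_quantum_derivative_def)
  show "locally_integrable (\<lambda>x. Re (cnj z * f0 x))"
    unfolding locally_integrable_def
  proof (intro conjI allI)
    fix R
    have i: "integrable lborel (\<lambda>x. indicator (cball 0 R) x *\<^sub>R f0 x)"
      by (rule sq_int_bounded_support_integrable[OF quantum_derivative_L2_loc[OF \<gamma> T f0 f0m], of _ R])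
         (auto simp: indicator_def split: if_splits)
    have "integrable lborel (\<lambda>x. Re (cnj z * (indicator (cball 0 R) x *\<^sub>R f0 x)))"
      by (intro integrable_Re integrable_mult_right i)
    moreover have "Re (cnj z * (indicator (cball 0 R) x *\<^sub>R f0 x)) = indicator (cball 0 R) x * Re (cnj z * f0 x)" for x
      by (simp add: indicator_def)
    ultimately show "integrable lborel (\<lambda>x. indicator (cball 0 R) x * Re (cnj z * f0 x))" by simp
  qed measurable
  fix b :: "real^'d" and R :: real
  assume "b \<in> Basis"
  then obtain l where b: "b = axis l 1" by (auto simp: Basis_vec_def)
  obtain M :: nat where M: "max R 0 < real M" using reals_Archimedean2 by blast
  then have M0: "M > 0" and MR: "R < real M" by auto
  define d where "d = CARD('d)"
  have d2: "d \<ge> 2" using \<open>CARD('d) \<ge> 2\<close> by (simp add: d_def)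
  define G where "G n a = (LINT y|lborel. h (a + (1 / real n) *\<^sub>R y) * cube_kernel b y)" for n :: nat and a
  have km [measurable]: "cube_kernel b \<in> borel_measurable borel" using cube_kernel_props(1)[of b] by auto
  have Gm: "G n \<in> borel_measurable borel" for n unfolding G_def[abs_def] by measurable
  have "(\<lambda>n. real (Suc n) * (LINT a|lborel. indicator (cball 0 R) a * \<bar>G (Suc n) a\<bar>)) \<longlonglongrightarrow> 0"
  proof (rule LIMSEQ_I)
    fix r :: real assume r: "r > 0"
    \<comment> \<open>Chosen so that
      \<open>\<delta> * real m ^ (d - 1) = r * real n ^ (d - 1)\<close> for
      \<open>\<delta> = r / C\<close>; the factor 2 in \<open>grid_mean_sum\<close> then leaves
      \<open>r / 2\<close>, strictly below \<open>r\<close>.\<close>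
    define C where "C = (2 * real M) ^ (d - 1)"
    have C: "C > 0" using M0 by (simp add: C_def)
    define \<delta> where "\<delta> = r / C"
    have \<delta>: "\<delta> > 0" using r C by (simp add: \<delta>_def)
    obtain n0 where n0: "\<And>n (I::('d \<Rightarrow> int) set) e g. n \<ge> n0 \<Longrightarrow> finite I \<Longrightarrow> card I \<le> n \<Longrightarrow> orthonormal_on I e \<Longrightarrow> orthonormal_on I g \<Longrightarrow>
        (\<Sum>i\<in>I. \<bar>T (e i) \<bullet> g i\<bar>) \<le> \<delta> * real n powr (1 - 1 / real d)"
      using sum_singular_values_estimate[OF bT d2 decay[folded d_def] \<delta>, where 'i="'d \<Rightarrow> int"] by blast
    have "real n * (LINT a|lborel. indicator (cball 0 R) a * \<bar>G n a\<bar>) < r" if n: "n > 0" "n \<ge> n0" for n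
    proof -
      define m where "m = 2 * (M * n)"
      have "1 * n \<le> (2 * M) * n" using M0 by (intro mult_le_mono1) simp
      then have "n \<le> m" by (simp add: m_def)
      then have m: "m \<ge> 1" "m \<ge> n0" using n by linarith+
      then have md: "m ^ d \<ge> n0" using d2 self_le_power[of m d] by linarith
      have pw: "real (m ^ d) powr (1 - 1 / real d) = real m ^ (d - 1)"
      proof -
        have "real (m ^ d) powr (1 - 1 / real d) = (real m powr real d) powr (1 - 1 / real d)"
          using m(1) by (simp add: powr_realpow)
        also have "\<dots> = real m powr (real d - 1)"
        proof -
          have "real d * (1 - 1 / real d) = real d - 1" using d2 by (simp add: right_diff_distrib)
          then show ?thesis by (simp only: powr_powr)
        qed
        also have "real d - 1 = real (d - 1)" using d2 by (simp add: of_nat_diff)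
        finally show ?thesis using m(1) by (simp add: powr_realpow)
      qed
      define B where "B = \<delta> * real m ^ (d - 1)"
      have B: "B > 0" using \<delta> m by (simp add: B_def)
      have "2 * (\<Sum>k\<in>grid (M * n). \<bar>G n (grid_point n \<theta> k)\<bar>) \<le> B" for \<theta>
        unfolding G_def h_def b
      proof (rule grid_mean_sum[OF \<gamma> T f0 f0m n(1) z finite_grid])
        fix e g :: "('d \<Rightarrow> int) \<Rightarrow> (real^'d, complex^'n) L2"
        assume "orthonormal_on (grid (M * n)) e" "orthonormal_on (grid (M * n)) g"
        then show "(\<Sum>k\<in>grid (M * n). \<bar>T (e k) \<bullet> g k\<bar>) \<le> B"
          using n0[OF md finite_grid[of "M * n"], of e g] unfolding B_def pw[symmetric]
          by (simp only: card_grid m_def d_def mult.assoc order_refl)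
      qed
      then have "(LINT a|lborel. indicator (cball 0 R) a * \<bar>G n a\<bar>) \<le> (1 / real n) ^ CARD('d) * (B / 2)"
        by (intro integral_le_grid_sum[OF Gm n(1) MR]) (use B in \<open>auto simp: field_simps\<close>)
      then have "real n * (LINT a|lborel. indicator (cball 0 R) a * \<bar>G n a\<bar>) \<le> real n * ((1 / real n) ^ CARD('d) * (B / 2))"
        by (intro mult_left_mono) auto
      also have "real n * ((1 / real n) ^ CARD('d) * (B / 2)) = r / 2"
      proof -
        have ds: "d = Suc (d - 1)" using d2 by simp
        have p: "(1 / real n) ^ d = (1 / real n) * (1 / real n) ^ (d - 1)" by (subst ds) simp
        have "real m ^ (d - 1) = C * real n ^ (d - 1)"
          unfolding m_def C_def by (simp add: power_mult_distrib mult_ac)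
        then have "B = r * real n ^ (d - 1)" using C by (simp add: B_def \<delta>_def)
        then show ?thesis unfolding d_def[symmetric] p using n(1) by (simp add: power_one_over)
      qed
      finally show ?thesis using r by simp
    qed
    then have "norm (real (Suc n) * (LINT a|lborel. indicator (cball 0 R) a * \<bar>G (Suc n) a\<bar>) - 0) < r" if "n \<ge> n0" for n
    proof -
      have "0 \<le> real (Suc n) * (LINT a|lborel. indicator (cball 0 R) a * \<bar>G (Suc n) a\<bar>)"
        by (intro mult_nonneg_nonneg Bochner_Integration.integral_nonneg) auto
      moreover have "real (Suc n) * (LINT a|lborel. indicator (cball 0 R) a * \<bar>G (Suc n) a\<bar>) < r"
        using \<open>\<And>n. n > 0 \<Longrightarrow> n \<ge> n0 \<Longrightarrow> _\<close>[of "Suc n"] that by simp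
      ultimately show ?thesis by (simp only: diff_zero real_norm_def abs_of_nonneg)
    qed
    then show "\<exists>no. \<forall>n\<ge>no. norm (real (Suc n) * (LINT a|lborel. indicator (cball 0 R) a * \<bar>G (Suc n) a\<bar>) - 0) < r" by blast
  qed
  then show "(\<lambda>n. real (Suc n) * (LINT a|lborel. indicator (cball 0 R) a *
        \<bar>LINT y|lborel. Re (cnj z * f0 (a + (1 / real (Suc n)) *\<^sub>R y)) * cube_kernel b y\<bar>)) \<longlonglongrightarrow> 0"
    unfolding G_def h_def .
qed

text \<open>Integrability on balls gives measurability of the restrictions, and these converge
  pointwise to \<open>f\<close>.\<close>

lemma BMO_measurable:
  fixes f :: "'a::euclidean_space \<Rightarrow> complex"
  assumes "f \<in> BMO"
  shows "f \<in> borel_measurable lebesgue"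
proof (rule borel_measurable_LIMSEQ_metric)
  show "(\<lambda>x. indicator (cball 0 (real n)) x *\<^sub>R f x) \<in> borel_measurable lebesgue" for n
  proof -
    have "f absolutely_integrable_on cball 0 (real n)" using assms by (simp add: BMO_def)
    then show ?thesis unfolding set_integrable_def by (rule borel_measurable_integrable)
  qed
  fix x :: 'a
  obtain n0 where "norm x \<le> real n0" using real_arch_simple by blast
  then have "indicator (cball 0 (real n)) x *\<^sub>R f x = f x" if "n \<ge> n0" for n
    using that by simp
  then show "(\<lambda>n. indicator (cball 0 (real n)) x *\<^sub>R f x) \<longlonglongrightarrow> f x"
    by (intro tendsto_eventually) (auto simp: eventually_sequentially)
qed

theorem corollary1p3:
  fixes \<gamma> :: "'d::finite \<Rightarrow> complex^'n^'n"
    and f :: "real^'d \<Rightarrow> complex"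
    and df :: "(real^'d, complex^'n) L2 \<Rightarrow> (real^'d, complex^'n) L2"
  assumes "CARD('d) \<ge> 2"
    and "CARD('n) = 2 ^ (CARD('d) div 2)"
    and "gamma_matrices \<gamma>"
    and "f \<in> BMO"
    and "is_quantum_derivative \<gamma> f df"
    and "((\<lambda>t::real. t powr (1 / real CARD('d)) * singular_value t df) \<longlongrightarrow> 0) at_top"
  shows "\<exists>c. AE x in lebesgue. f x = c"
proof -
  obtain f0 where f0: "f0 \<in> borel_measurable borel" "AE x in lebesgue. f x = f0 x"
    using lebesgue_measurable_ex_borel[OF BMO_measurable[OF assms(4)]] by blast
  note C = constant_of_quantum_derivative_decay[OF assms(1,3,5,6) f0(2,1)]
  \<comment> \<open>The choice \<open>z = 1\<close> gives the real part of \<open>f0\<close>; in the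
    next line \<open>z = \<i>\<close> gives the imaginary part, as
    \<open>Re (cnj \<i> * w) = Im w\<close>.\<close>
  obtain a where a: "AE x in lborel. Re (cnj 1 * f0 x) = a" using C[of 1] by auto
  obtain b where b: "AE x in lborel. Re (cnj \<i> * f0 x) = b" using C[of \<i>] by auto
  have "AE x in lborel. f0 x = Complex a b"
    using a b by eventually_elim (simp add: complex_eq_iff)
  then have "AE x in lebesgue. f0 x = Complex a b" by (rule AE_completion)
  with f0(2) have "AE x in lebesgue. f x = Complex a b" by eventually_elim simp
  then show ?thesis by blast
qed

end
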